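(* Let $2<p\le n$, let $\mathcal{M}\subset\mathbb{R}^n$ be an $n$-dimensional domain, and let $\{\iota^\varepsilon\}_{\varepsilon>0}$ be a family of immersions $\iota^\varepsilon:\mathcal{M}\to\mathbb{R}^{n+k}$ that is uniformly bounded in $L^{p,n-p}_{2,w,\mathrm{loc}}$. Assume the following conditions: (1) for any compact subset $\mathcal{K}\Subset\mathcal{M}$ there are constants $0<c\le C<\infty$ (depending possibly on $\mathcal{K}$) such that for almost every $x\in\mathcal{K}$ (and every $\varepsilon>0$) one has $$c\le\big\{\text{eigenvalues of the matrix } g^\varepsilon(x):=d\iota^\varepsilon(x)\otimes d\iota^\varepsilon(x)\big\}\le C;$$ (2) for each $j\in\{1,2,\dots,n\}$ and $\varepsilon>0$, the first derivative $\partial_j\iota^\varepsilon$ lies in $L^{p,n-p}_{1,w,\mathrm{loc}}\cap L^\infty_{\mathrm{loc}}$. Then, modulo subsequences, $\{\iota^\varepsilon\}$ converges weakly in $L^{p,n-p}_{2,w,\mathrm{loc}}$ to an immersion $\overline\iota$, whose induced metric $\overline\iota^{\#}\delta$ is a (weak) limiting point of $g^\varepsilon$ in $L^{p,n-p}_{1,w,\mathrm{loc}}$, and whose extrinsic geometry (i.e., second fundamental form and normal connection) is a (weak) limiting point of that of $\iota^\varepsilon$ in $L^{p,n-p}_{w,\mathrm{loc}}$.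
   Context: $\delta$ is the Euclidean metric and $\overline\iota^{\#}\delta$ its pullback. The matrix $g^\varepsilon=d\iota^\varepsilon\otimes d\iota^\varepsilon$ is the induced metric, with entries $g^\varepsilon_{ij}=\partial_i\iota^\varepsilon\cdot\partial_j\iota^\varepsilon$. An immersion is understood in the almost-everywhere sense: the differential is one-to-one almost everywhere. **Weak Morrey spaces.** For a bounded smooth domain $U\subset\mathbb{R}^n$, $1\le p<\infty$ and $0\le\lambda\le n$, let $L^p_w$ denote the weak $L^p$-space. The weak Morrey space $L^{p,\lambda}_w(U)$ consists of $f\in L^p_w(U)$ with $$\|f\|_{L^{p,\lambda}_w(U)}:=\sup_{x\in U,\,0<r\le\operatorname{diam}(U)}r^{-\lambda/p}\|f\|_{L^p_w(B_r(x)\cap U)}<\infty .$$ Inductively, $f\in L^{p,\lambda}_{\ell,w}(U)$ means $\nabla f\in L^{p,\lambda}_{\ell-1,w}(U)$ for $\ell=1,2,\dots$, with $L^{p,\lambda}_{0,w}=L^{p,\lambda}_w$. The subscript "loc" means that the property holds on every open subset $V\Subset\mathcal{M}$. **Extrinsic geometry.** The extrinsic geometry of an immersion is the pair formed by its second fundamental form and its normal connection $\nabla^\perp$, the orthogonal projection of the Levi-Civita connection of $\mathbb{R}^{n+k}$ to the normal directions of the image. Their regularity and convergence refer to their components/connection coefficients in local orthonormal frames $\{\partial_i\}$ of the tangent bundle and $\{\eta_\alpha\}$ of the normal bundle, namely $\langle\mathrm{II}(\partial_i,\partial_j),\eta_\alpha\rangle$ and $\langle\nabla^\perp_{\partial_j}\eta_\alpha,\eta_\beta\rangle$.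 *)

theory Defs
  imports "HOL-Analysis.Analysis"
begin

section \<open>Weak derivatives\<close>

definition partial :: "'n \<Rightarrow> (real^'n \<Rightarrow> real) \<Rightarrow> real^'n \<Rightarrow> real" where
  "partial i \<phi> x = frechet_derivative \<phi> (at x) (axis i 1)"

primrec Ck :: "nat \<Rightarrow> (real^'n \<Rightarrow> real) \<Rightarrow> bool" where
  "Ck 0 \<phi> \<longleftrightarrow> continuous_on UNIV \<phi>"
| "Ck (Suc l) \<phi> \<longleftrightarrow> (\<forall>x. \<phi> differentiable (at x)) \<and> (\<forall>i. Ck l (partial i \<phi>))"

definition test_function :: "(real^'n) set \<Rightarrow> (real^'n \<Rightarrow> real) \<Rightarrow> bool" where
  "test_function U \<phi> \<longleftrightarrow>
     (\<forall>l. Ck l \<phi>) \<and> compact (closure {x. \<phi> x \<noteq> 0}) \<and> closure {x. \<phi> x \<noteq> 0} \<subseteq> U"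

definition locally_integrable :: "(real^'n) set \<Rightarrow> (real^'n \<Rightarrow> 'b::euclidean_space) \<Rightarrow> bool" where
  "locally_integrable U f \<longleftrightarrow> (\<forall>K. compact K \<and> K \<subseteq> U \<longrightarrow> set_integrable lebesgue K f)"

definition has_weak_partial ::
    "(real^'n) set \<Rightarrow> 'n \<Rightarrow> (real^'n \<Rightarrow> 'b::euclidean_space) \<Rightarrow> (real^'n \<Rightarrow> 'b) \<Rightarrow> bool" where
  "has_weak_partial U i f g \<longleftrightarrow> locally_integrable U f \<and> locally_integrable U g \<and>
     (\<forall>\<phi>. test_function U \<phi> \<longrightarrow>
        (LINT x:U|lebesgue. partial i \<phi> x *\<^sub>R f x) = - (LINT x:U|lebesgue. \<phi> x *\<^sub>R g x))"

definition weakly_differentiable :: "(real^'n) set \<Rightarrow> (real^'n \<Rightarrow> 'b::euclidean_space) \<Rightarrow> bool" where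
  "weakly_differentiable U f \<longleftrightarrow> (\<forall>i. \<exists>g. has_weak_partial U i f g)"

text \<open>
  Weak partial derivatives are unique only up to null sets of \<open>U\<close>, and \<open>weak_partial\<close> chooses
  one representative.  Everything below depends on it only almost everywhere in \<open>U\<close>.
\<close>
definition weak_partial ::
    "(real^'n) set \<Rightarrow> 'n \<Rightarrow> (real^'n \<Rightarrow> 'b::euclidean_space) \<Rightarrow> real^'n \<Rightarrow> 'b" where
  "weak_partial U i f = (SOME g. has_weak_partial U i f g)"


section \<open>Weak Morrey spaces\<close>

text \<open>
  The weak \<open>L\<^sup>p\<close> quasi-norm \<open>sup\<^bsub>t>0\<^esub> t |{|f| > t}|\<^bsup>1/p\<^esup>\<close>, written as the least admissible
  constant in the weak-type inequality so that no root of an infinite measure is needed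
  (\<open>Inf {} = \<infinity>\<close>).
\<close>
definition weak_Lp_norm :: "real \<Rightarrow> (real^'n) set \<Rightarrow> (real^'n \<Rightarrow> 'b::euclidean_space) \<Rightarrow> ennreal" where
  "weak_Lp_norm p S f = Inf {ennreal C |C. 0 \<le> C \<and>
     (\<forall>t>0. emeasure lebesgue {x \<in> S. t < norm (f x)} \<le> ennreal ((C / t) powr p))}"

definition weak_Morrey_norm ::
    "real \<Rightarrow> real \<Rightarrow> (real^'n) set \<Rightarrow> (real^'n \<Rightarrow> 'b::euclidean_space) \<Rightarrow> ennreal" where
  "weak_Morrey_norm p la U f =
     (SUP x\<in>U. SUP r\<in>{0<..diameter U}.
        ennreal (r powr (- (la / p))) * weak_Lp_norm p (ball x r \<inter> U) f)"

definition weak_Morrey ::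
    "real \<Rightarrow> real \<Rightarrow> (real^'n) set \<Rightarrow> (real^'n \<Rightarrow> 'b::euclidean_space) set" where
  "weak_Morrey p la U = {f. f \<in> borel_measurable (lebesgue_on U) \<and>
     weak_Lp_norm p U f < \<infinity> \<and> weak_Morrey_norm p la U f < \<infinity>}"

text \<open>
  \<open>weak_Morrey_Sobolev p la l U\<close> is the space \<open>L\<^bsup>p,la\<^esup>\<^bsub>l,w\<^esub>(U)\<close>.
\<close>
primrec weak_Morrey_Sobolev ::
    "real \<Rightarrow> real \<Rightarrow> nat \<Rightarrow> (real^'n) set \<Rightarrow> (real^'n \<Rightarrow> 'b::euclidean_space) \<Rightarrow> bool" where
  "weak_Morrey_Sobolev p la 0 U f \<longleftrightarrow> f \<in> weak_Morrey p la U"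
| "weak_Morrey_Sobolev p la (Suc l) U f \<longleftrightarrow>
     weakly_differentiable U f \<and> (\<forall>i. weak_Morrey_Sobolev p la l U (weak_partial U i f))"

text \<open>
  Membership constrains only the derivatives of top order.  The norm below also counts the lower
  orders: the top-order seminorm vanishes on polynomials of lower degree and hence does not
  control, for instance, a family of translations.
\<close>
primrec weak_Morrey_Sobolev_norm ::
    "real \<Rightarrow> real \<Rightarrow> nat \<Rightarrow> (real^'n) set \<Rightarrow> (real^'n \<Rightarrow> 'b::euclidean_space) \<Rightarrow> ennreal" where
  "weak_Morrey_Sobolev_norm p la 0 U f = weak_Morrey_norm p la U f"
| "weak_Morrey_Sobolev_norm p la (Suc l) U f = weak_Morrey_norm p la U f +
     (\<Sum>i\<in>UNIV. weak_Morrey_Sobolev_norm p la l U (weak_partial U i f))"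

definition open_compactly_in :: "(real^'n) set \<Rightarrow> (real^'n) set \<Rightarrow> bool" where
  "open_compactly_in V M \<longleftrightarrow> open V \<and> compact (closure V) \<and> closure V \<subseteq> M"

definition weak_Morrey_Sobolev_loc ::
    "real \<Rightarrow> real \<Rightarrow> nat \<Rightarrow> (real^'n) set \<Rightarrow> (real^'n \<Rightarrow> 'b::euclidean_space) \<Rightarrow> bool" where
  "weak_Morrey_Sobolev_loc p la l M f \<longleftrightarrow>
     (\<forall>V. open_compactly_in V M \<longrightarrow> weak_Morrey_Sobolev p la l V f)"

definition Linfty_loc :: "(real^'n) set \<Rightarrow> (real^'n \<Rightarrow> 'b::euclidean_space) \<Rightarrow> bool" where
  "Linfty_loc M f \<longleftrightarrow> (\<forall>V. open_compactly_in V M \<longrightarrow>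
     f \<in> borel_measurable (lebesgue_on V) \<and> (\<exists>B. AE x in lebesgue_on V. norm (f x) \<le> B))"

definition unif_bounded_loc ::
    "real \<Rightarrow> real \<Rightarrow> nat \<Rightarrow> (real^'n) set \<Rightarrow> 'i set \<Rightarrow> ('i \<Rightarrow> real^'n \<Rightarrow> 'b::euclidean_space) \<Rightarrow> bool"
  where
  "unif_bounded_loc p la l M I F \<longleftrightarrow> (\<forall>V. open_compactly_in V M \<longrightarrow>
     (\<forall>i\<in>I. weak_Morrey_Sobolev p la l V (F i)) \<and>
     (\<exists>C. \<forall>i\<in>I. weak_Morrey_Sobolev_norm p la l V (F i) \<le> ennreal C))"


section \<open>Weak convergence\<close>

text \<open>
  Weak convergence in the non-reflexive space \<open>L\<^bsup>p,la\<^esup>\<^sub>w(U)\<close> is understood in the weak-star sense: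
  bounded in norm and convergent against the predual.  The predual of weak \<open>L\<^sup>p\<close> is the Lorentz
  space \<open>L\<^bsup>p',1\<^esup>\<close>, \<open>1/p + 1/p' = 1\<close>, with norm proportional to
  \<open>\<integral>\<^sub>0\<^bsup>\<infinity>\<^esup> |{|\<phi>| > t}|\<^bsup>1/p'\<^esup> dt\<close>.  For bounded \<open>U\<close> it is dense in the (block space) predual of
  \<open>L\<^bsup>p,la\<^esup>\<^sub>w(U)\<close>, so it detects weak-star convergence of norm-bounded sequences.
  \<open>Lorentz_dual p U\<close> is only used for sets \<open>U\<close> of finite measure.
\<close>
definition Lorentz_dual :: "real \<Rightarrow> (real^'n) set \<Rightarrow> (real^'n \<Rightarrow> real) set" where
  "Lorentz_dual p U = {\<phi>. \<phi> \<in> borel_measurable (lebesgue_on U) \<and>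
     (\<integral>\<^sup>+t\<in>{0<..}. ennreal (measure lebesgue {x \<in> U. t < \<bar>\<phi> x\<bar>} powr (1 - 1 / p)) \<partial>lborel) < \<infinity>}"

definition weak_conv_Morrey ::
    "real \<Rightarrow> real \<Rightarrow> (real^'n) set \<Rightarrow> (nat \<Rightarrow> real^'n \<Rightarrow> 'b::euclidean_space) \<Rightarrow>
     (real^'n \<Rightarrow> 'b) \<Rightarrow> bool" where
  "weak_conv_Morrey p la U F f \<longleftrightarrow>
     f \<in> weak_Morrey p la U \<and> (\<forall>m. F m \<in> weak_Morrey p la U) \<and>
     (\<exists>C. \<forall>m. weak_Morrey_norm p la U (F m) \<le> ennreal C) \<and>
     (\<forall>\<phi>\<in>Lorentz_dual p U.
        (\<lambda>m. LINT x:U|lebesgue. \<phi> x *\<^sub>R F m x) \<longlonglongrightarrow> (LINT x:U|lebesgue. \<phi> x *\<^sub>R f x))"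

primrec weak_conv ::
    "real \<Rightarrow> real \<Rightarrow> nat \<Rightarrow> (real^'n) set \<Rightarrow> (nat \<Rightarrow> real^'n \<Rightarrow> 'b::euclidean_space) \<Rightarrow>
     (real^'n \<Rightarrow> 'b) \<Rightarrow> bool" where
  "weak_conv p la 0 U F f \<longleftrightarrow> weak_conv_Morrey p la U F f"
| "weak_conv p la (Suc l) U F f \<longleftrightarrow> weak_conv_Morrey p la U F f \<and>
     weakly_differentiable U f \<and> (\<forall>m. weakly_differentiable U (F m)) \<and>
     (\<forall>i. weak_conv p la l U (\<lambda>m. weak_partial U i (F m)) (weak_partial U i f))"

definition weak_conv_loc ::
    "real \<Rightarrow> real \<Rightarrow> nat \<Rightarrow> (real^'n) set \<Rightarrow> (nat \<Rightarrow> real^'n \<Rightarrow> 'b::euclidean_space) \<Rightarrow>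
     (real^'n \<Rightarrow> 'b) \<Rightarrow> bool" where
  "weak_conv_loc p la l M F f \<longleftrightarrow> (\<forall>V. open_compactly_in V M \<longrightarrow> weak_conv p la l V F f)"


section \<open>Immersions and their geometry\<close>

definition weak_differential ::
    "(real^'n) set \<Rightarrow> (real^'n \<Rightarrow> real^'m) \<Rightarrow> real^'n \<Rightarrow> real^'n \<Rightarrow> real^'m" where
  "weak_differential U f x h = (\<Sum>i\<in>UNIV. (h $ i) *\<^sub>R weak_partial U i f x)"

definition ae_immersion :: "(real^'n) set \<Rightarrow> (real^'n \<Rightarrow> real^'m) \<Rightarrow> bool" where
  "ae_immersion U f \<longleftrightarrow> weakly_differentiable U f \<and>
     (AE x in lebesgue_on U. inj (weak_differential U f x))"

definition induced_metric ::
    "(real^'n) set \<Rightarrow> (real^'n \<Rightarrow> real^'m) \<Rightarrow> real^'n \<Rightarrow> real^'n^'n" where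
  "induced_metric U f x = (\<chi> i j. weak_partial U i f x \<bullet> weak_partial U j f x)"

definition eigenvalues :: "real^'n^'n \<Rightarrow> real set" where
  "eigenvalues A = {\<mu>. \<exists>v. v \<noteq> 0 \<and> A *v v = \<mu> *\<^sub>R v}"

definition normal_space ::
    "(real^'n) set \<Rightarrow> (real^'n \<Rightarrow> real^'m) \<Rightarrow> real^'n \<Rightarrow> (real^'m) set" where
  "normal_space U f x = orthogonal_comp (range (weak_differential U f x))"

definition orth_proj :: "(real^'m) set \<Rightarrow> real^'m \<Rightarrow> real^'m" where
  "orth_proj S v = (THE w. w \<in> S \<and> v - w \<in> orthogonal_comp S)"

text \<open>
  \<open>II(\<partial>\<^sub>i,\<partial>\<^sub>j)\<close>, as a normal vector field: the normal part of the flat derivative of \<open>\<partial>\<^sub>j f\<close> in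
  direction \<open>\<partial>\<^sub>i f\<close>.
\<close>
definition second_fundamental_form ::
    "(real^'n) set \<Rightarrow> (real^'n \<Rightarrow> real^'m) \<Rightarrow> 'n \<Rightarrow> 'n \<Rightarrow> real^'n \<Rightarrow> real^'m" where
  "second_fundamental_form U f i j x =
     orth_proj (normal_space U f x) (weak_partial U i (weak_partial U j f) x)"

text \<open>\<open>\<nabla>\<^sup>\<bottom>\<eta>\<close> in direction \<open>\<partial>\<^sub>j\<close>, for a normal vector field \<open>\<eta>\<close>.\<close>
definition normal_connection ::
    "(real^'n) set \<Rightarrow> (real^'n \<Rightarrow> real^'m) \<Rightarrow> 'n \<Rightarrow> (real^'n \<Rightarrow> real^'m) \<Rightarrow> real^'n \<Rightarrow> real^'m" where
  "normal_connection U f j \<eta> x = orth_proj (normal_space U f x) (weak_partial U j \<eta> x)"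

definition orthonormal_normal_frame ::
    "nat \<Rightarrow> (real^'n) set \<Rightarrow> (real^'n \<Rightarrow> real^'m) \<Rightarrow> (nat \<Rightarrow> real^'n \<Rightarrow> real^'m) \<Rightarrow> bool" where
  "orthonormal_normal_frame k U f \<eta> \<longleftrightarrow> (AE x in lebesgue_on U.
     (\<forall>\<alpha><k. \<eta> \<alpha> x \<in> normal_space U f x) \<and>
     (\<forall>\<alpha><k. \<forall>\<beta><k. \<eta> \<alpha> x \<bullet> \<eta> \<beta> x = (if \<alpha> = \<beta> then 1 else 0)))"

text \<open>
  The normal parts of the constant vectors \<open>e\<^sub>a\<close>.  They span the normal space almost everywhere, so
  the covariant derivatives of these globally defined sections determine the normal connection
  even where no local orthonormal frame of Sobolev regularity exists.
\<close>
definition normal_generator ::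
    "(real^'n) set \<Rightarrow> (real^'n \<Rightarrow> real^'m) \<Rightarrow> 'm \<Rightarrow> real^'n \<Rightarrow> real^'m" where
  "normal_generator U f a x = orth_proj (normal_space U f x) (axis a 1)"

text \<open>
  \<open>f\<close> carries the weak limit in \<open>L\<^bsup>p,la\<^esup>\<^bsub>w,loc\<^esub>\<close> of the extrinsic geometries of the \<open>F m\<close>, seen as
  vector-valued objects without reference to a normal frame.
\<close>
definition extrinsic_conv ::
    "real \<Rightarrow> real \<Rightarrow> (real^'n) set \<Rightarrow> (nat \<Rightarrow> real^'n \<Rightarrow> real^'m) \<Rightarrow> (real^'n \<Rightarrow> real^'m) \<Rightarrow> bool" where
  "extrinsic_conv p la U F f \<longleftrightarrow>
     (\<forall>i j. weak_conv_loc p la 0 U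
        (\<lambda>m. second_fundamental_form U (F m) i j) (second_fundamental_form U f i j)) \<and>
     (\<forall>a. weak_conv_loc p la 1 U
        (\<lambda>m. normal_generator U (F m) a) (normal_generator U f a)) \<and>
     (\<forall>j a. weak_conv_loc p la 0 U
        (\<lambda>m. normal_connection U (F m) j (normal_generator U (F m) a))
        (normal_connection U f j (normal_generator U f a)))"

text \<open>
  The same in components: \<open>\<langle>II(\<partial>\<^sub>i,\<partial>\<^sub>j),\<eta>\<^sub>\<alpha>\<rangle>\<close> and \<open>\<langle>\<nabla>\<^sup>\<bottom>\<^sub>j \<eta>\<^sub>\<alpha>,\<eta>\<^sub>\<beta>\<rangle>\<close> for frames \<open>H m\<close> of the normal bundle
  of \<open>F m\<close> and \<open>\<eta>\<close> of that of \<open>f\<close>.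
\<close>
definition extrinsic_conv_in_frames ::
    "real \<Rightarrow> real \<Rightarrow> nat \<Rightarrow> (real^'n) set \<Rightarrow>
     (nat \<Rightarrow> real^'n \<Rightarrow> real^'m) \<Rightarrow> (nat \<Rightarrow> nat \<Rightarrow> real^'n \<Rightarrow> real^'m) \<Rightarrow>
     (real^'n \<Rightarrow> real^'m) \<Rightarrow> (nat \<Rightarrow> real^'n \<Rightarrow> real^'m) \<Rightarrow> bool" where
  "extrinsic_conv_in_frames p la k U F H f \<eta> \<longleftrightarrow>
     (\<forall>i j. \<forall>\<alpha><k. weak_conv_loc p la 0 U
        (\<lambda>m x. second_fundamental_form U (F m) i j x \<bullet> H m \<alpha> x)
        (\<lambda>x. second_fundamental_form U f i j x \<bullet> \<eta> \<alpha> x)) \<and>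
     (\<forall>j. \<forall>\<alpha><k. \<forall>\<beta><k. weak_conv_loc p la 0 U
        (\<lambda>m x. normal_connection U (F m) j (H m \<alpha>) x \<bullet> H m \<beta> x)
        (\<lambda>x. normal_connection U f j (\<eta> \<alpha>) x \<bullet> \<eta> \<beta> x))"

end

theory Submission
 imports Defs "HOL-Library.Diagonal_Subsequence"
begin

text \<open>
  Since \<open>p > 2\<close>, weak \<open>L\<^sup>p\<close> bounds are local \<open>L\<^sup>2\<close> bounds, so the maps, their first and their second
  derivatives subconverge weakly in local \<open>L\<^sup>2\<close>, and weak Morrey bounds pass to such limits.  By
  Rellich's theorem the Jacobians converge strongly in local \<open>L\<^sup>1\<close>; the eigenvalue bounds confine them
  to a closed set of injective matrices of bounded norm, which also contains the limit.  On this set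
  the metric and the normal projection are \<open>C\<^sup>1\<^sup>,\<^sup>1\<close> functions of the Jacobian.  The second fundamental
  form, the derivatives of the metric and the normal connection are therefore products of a bounded,
  strongly convergent factor and a weakly convergent one, and converge weakly to the product of the
  limits.
\<close>

text \<open>The admissible Jacobians form a closed set that is not convex (it is stable under
  \<open>A |-> - A\<close> but excludes 0), so mollifying a Jacobian may leave it. The chain rule is
  therefore proved with difference quotients, which evaluate the nonlinear function only at values
  of the Jacobian itself. Square integrability of the second derivatives pays twice: it controls the
  quadratic remainder in the chain rule, and it allows a weakly convergent factor to be multiplied
  by one that is bounded but converges only in L^1. The Morrey exponent n - p is the one for which
  every bounded function on a bounded open set has a finite Morrey bound, since a ball of radius r
  has volume proportional to r^n = r^(n-p) r^p; hence metric and projection need only sup bounds at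
  order zero. A normal frame is not determined by its immersion, so frames given along the sequence
  require a further subsequence, whereas the frame-free statement uses projections of constant
  vectors.\<close>

notation scaleR (infixr "*R" 75)

section \<open>Smooth bump functions\<close>

text \<open>The derivative is existentially quantified, so that closure under sums, products and
  affine substitution is shown by exhibiting a formula for it.\<close>

primrec Dk :: "nat => (real => real) => bool" where
 "Dk 0 h \<longleftrightarrow> continuous_on UNIV h"
| "Dk (Suc l) h \<longleftrightarrow> (\<exists>h'. (\<forall>x. (h has_real_derivative h' x) (at x)) & Dk l h')"

lemma Dk_continuous: "Dk l h ==> continuous_on UNIV h"
 by (cases l) (auto intro!: continuous_at_imp_continuous_on dest: DERIV_isCont)

lemma Dk_lower: "Dk (Suc l) h ==> Dk l h"
proof (induction l arbitrary: h)
 case 0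
 then show ?case using Dk_continuous by (metis Dk.simps(1))
qed auto

lemma Dk_const: "Dk l (%x. c)"
proof (induction l arbitrary: c)
 case (Suc l)
 then show ?case by (auto intro!: exI[of _ "%x. 0"])
qed auto

lemma Dk_add: "Dk l f ==> Dk l g ==> Dk l (%x. f x + g x)"
proof (induction l arbitrary: f g)
 case (Suc l)
 then obtain f' g' where "\<forall>x. (f has_real_derivative f' x) (at x)" "Dk l f'"
  "\<forall>x. (g has_real_derivative g' x) (at x)" "Dk l g'" by auto
 with Suc.IH show ?case
  by (auto intro!: exI[of _ "%x. f' x + g' x"] derivative_eq_intros)
qed (auto intro: continuous_on_add)

lemma Dk_mult: "Dk l f ==> Dk l g ==> Dk l (%x. f x * g x)"
proof (induction l arbitrary: f g)
 case (Suc l)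
 then obtain f' g' where *: "\<forall>x. (f has_real_derivative f' x) (at x)" "Dk l f'"
  "\<forall>x. (g has_real_derivative g' x) (at x)" "Dk l g'" by auto
 have "Dk l (%x. f' x * g x + g' x * f x)"
  using * Suc.IH Suc.prems Dk_lower by (intro Dk_add Suc.IH) blast+
 with * show ?case
  by (auto intro!: exI[of _ "%x. f' x * g x + g' x * f x"] DERIV_mult)
qed (auto intro: continuous_on_mult)

lemma Dk_affine: "Dk l f ==> Dk l (%x. f (a + b * x))"
proof (induction l arbitrary: f)
 case 0
 then have "continuous_on UNIV f" by simp
 then have "continuous_on UNIV (%x. f (a + b * x))"
  by (rule continuous_on_compose2) (auto intro: continuous_intros)
 then show ?case by simp
next
 case (Suc l)
 then obtain f' where *: "\<forall>x. (f has_real_derivative f' x) (at x)" "Dk l f'" by auto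
 have "((%x. f (a + b * x)) has_real_derivative f' (a + b * x) * b) (at x)" for x
  by (rule DERIV_chain2[of f]) (use * in \<open>auto intro!: derivative_eq_intros\<close>)
 moreover have "Dk l (%x. f' (a + b * x) * b)"
  by (intro Dk_mult Dk_const Suc.IH *)
 ultimately show ?case
  unfolding Dk.simps by (intro exI[of _ "%x. f' (a + b * x) * b"] conjI allI)
qed

section \<open>The flat function exp(-1/s) and one-dimensional bumps\<close>

text \<open>The polynomial parameter closes the family under differentiation: every derivative of
  exp(-1/s) is again a polynomial in 1/s times exp(-1/s).\<close>

definition flat :: "real poly => real => real" where
 "flat q s = (if s > 0 then poly q (1 / s) * exp (- (1 / s)) else 0)"

lemma poly_times_exp_minus_tendsto_0:
 "((%x. poly q x * exp (- x)) \<longlongrightarrow> (0::real)) at_top"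
proof -
 have "((%x. \<Sum>i\<le>degree q. coeff q i * (x ^ i / exp x)) \<longlongrightarrow> (\<Sum>i\<le>degree q. coeff q i * 0)) at_top"
  by (intro tendsto_sum tendsto_mult tendsto_const tendsto_power_div_exp_0)
 then show ?thesis
  by (simp add: poly_altdef exp_minus field_simps sum_divide_distrib)
qed

text \<open>With x = 1/s, differentiation in s is -x^2 d/dx, which sends q(x) exp(-x) to x^2 (q -
  q')(x) exp(-x); \<open>[:0, 0, 1:]\<close> is x^2. Only s = 0 requires a limit.\<close>

lemma flat_deriv:
 "(flat q has_real_derivative flat ([:0, 0, 1:] * (q - pderiv q)) s) (at s)"
proof -
 consider "s > 0" | "s < 0" | "s = 0" by linarith
 then show ?thesis
 proof cases
  case 1
  have "((%s. poly q (1 / s) * exp (- (1 / s))) has_real_derivative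
    flat ([:0, 0, 1:] * (q - pderiv q)) s) (at s)"
   using 1 by (auto intro!: derivative_eq_intros poly_DERIV[THEN DERIV_chain2]
    simp: flat_def field_simps power2_eq_square)
  then show ?thesis
   by (rule has_field_derivative_transform_within_open[of _ _ _ "{0<..}"])
    (use 1 in \<open>auto simp: flat_def\<close>)
 next
  case 2
  have "((%s. 0) has_real_derivative flat ([:0, 0, 1:] * (q - pderiv q)) s) (at s)"
   using 2 by (auto simp: flat_def)
  then show ?thesis
   by (rule has_field_derivative_transform_within_open[of _ _ _ "{..<0}"])
    (use 2 in \<open>auto simp: flat_def\<close>)
 next
  case 3
  have "((%h. flat q h / h) \<longlongrightarrow> 0) (at_right 0)"
  proof (rule Lim_transform_eventually)
   \<comment> \<open>Dividing by h multiplies the polynomial in 1/h by its variable, hence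
     \<open>pCons 0 q\<close>.\<close>
   show "((%h::real. poly (pCons 0 q) (inverse h) * exp (- inverse h)) \<longlongrightarrow> 0) (at_right 0)"
    by (rule filterlim_compose[OF poly_times_exp_minus_tendsto_0 filterlim_inverse_at_top_right])
   show "\<forall>\<^sub>F h in at_right 0. poly (pCons 0 q) (inverse h) * exp (- inverse h) = flat q h / h"
    unfolding eventually_at_right_field by (auto intro!: exI[of _ 1] simp: flat_def field_simps)
  qed
  moreover have "((%h. flat q h / h) \<longlongrightarrow> 0) (at_left 0)"
  proof (rule Lim_transform_eventually)
   show "\<forall>\<^sub>F h in at_left 0. (%h. 0) h = flat q h / h"
    unfolding eventually_at_left_field by (auto intro!: exI[of _ "-1"] simp: flat_def)
  qed auto
  ultimately have "((%h. flat q h / h) \<longlongrightarrow> 0) (at 0)"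
   by (rule filterlim_split_at_real[rotated])
  then show ?thesis using 3 by (simp add: DERIV_def flat_def)
 qed
qed

lemma Dk_flat: "Dk l (flat q)"
proof (induction l arbitrary: q)
 case 0
 then show ?case using flat_deriv[of q] DERIV_isCont
  by (auto intro!: continuous_at_imp_continuous_on)
next
 case (Suc l)
 then show ?case using flat_deriv[of q] by (auto intro!: exI[of _ "flat ([:0, 0, 1:] * (q - pderiv q))"])
qed

text \<open>The factor m steepens both flanks without enlarging the support: as m grows, the values
  stay in [0, 1] and tend to the indicator of the open interval from alpha to beta.\<close>

definition bump :: "real => real => real => real => real" where
 "bump m alpha beta y = flat 1 (m * (y - alpha)) * flat 1 (m * (beta - y))"

lemma flat1_bounds: "0 <= flat 1 s" "flat 1 s <= 1"
 by (auto simp: flat_def)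

lemma bump_bounds: "0 <= bump m alpha beta y" "bump m alpha beta y <= 1"
 using flat1_bounds by (auto simp: bump_def intro!: mult_le_one)

lemma bump_outside: "m > 0 ==> y <= alpha \<or> beta <= y ==> bump m alpha beta y = 0"
 by (auto simp: bump_def flat_def zero_less_mult_iff)

lemma Dk_bump: "Dk l (bump m alpha beta)"
proof -
 have "Dk l (%y. flat 1 ((- m * alpha) + m * y) * flat 1 ((m * beta) + (- m) * y))"
  by (intro Dk_mult Dk_affine Dk_flat)
 then show ?thesis by (simp add: bump_def[abs_def] algebra_simps)
qed

lemma flat1_tendsto: "(%k. flat 1 (real (Suc k) * s)) \<longlonglongrightarrow> indicator {0<..} s"
proof (cases "s > 0")
 case True
 have "(%k. exp (- (1 / s * (1 / real (Suc k))))) \<longlonglongrightarrow> exp (- (1 / s * 0))"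
  by (intro tendsto_intros LIMSEQ_Suc[OF lim_const_over_n])
 moreover have "flat 1 (real (Suc k) * s) = exp (- (1 / s * (1 / real (Suc k))))" for k
  using True by (simp add: flat_def zero_less_mult_iff del: of_nat_Suc)
 ultimately show ?thesis using True by simp
next
 case False
 then have "flat 1 (real (Suc k) * s) = 0" for k
  by (auto simp: flat_def zero_less_mult_iff)
 then show ?thesis using False by simp
qed

lemma bump_tendsto: "(%k. bump (real (Suc k)) alpha beta y) \<longlonglongrightarrow> indicator {alpha<..<beta} y"
proof -
 have "indicator {alpha<..<beta} y = indicator {0<..} (y - alpha) * (indicator {0<..} (beta - y) :: real)"
  by (auto simp: indicator_def)
 then show ?thesis
  unfolding bump_def by (simp only:) (intro tendsto_mult flat1_tendsto)
qed

section \<open>Tensor products of one-dimensional bumps as test functions\<close>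

definition tensor :: "('n => real => real) => real^'n => real" where
 "tensor h x = (\<Prod>j\<in>UNIV. h j (x $ j))"

lemma tensor_split: "tensor h x = h i (x $ i) * (\<Prod>j\<in>UNIV - {i}. h j (x $ j))"
 unfolding tensor_def by (rule prod.remove) auto

lemma tensor_deriv:
 fixes h :: "'n::finite => real => real"
 assumes "!!j y. (h j has_real_derivative h' j y) (at y)"
 shows "tensor h differentiable (at x)"
  and "partial i (tensor h) x = tensor (h(i := h' i)) x"
proof -
 have D: "((%x. h j (x $ j)) has_derivative (%y. h' j (x $ j) * (y $ j))) (at x)" for j
  using has_derivative_compose[OF bounded_linear_imp_has_derivative[OF bounded_linear_vec_nth, of j]
   assms[of j, unfolded has_field_derivative_def, of "x $ j"]] by simp
 have *: "(tensor h has_derivative (%y. \<Sum>j\<in>UNIV. (h' j (x $ j) * (y $ j)) * (\<Prod>l\<in>UNIV - {j}. h l (x $ l)))) (at x)"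
  unfolding tensor_def[abs_def] by (rule has_derivative_prod[OF D])
 then show "tensor h differentiable (at x)" by (auto simp: differentiable_def)
 have "partial i (tensor h) x = (\<Sum>j\<in>UNIV. (h' j (x $ j) * (axis i 1 $ j)) * (\<Prod>l\<in>UNIV - {j}. h l (x $ l)))"
  unfolding partial_def frechet_derivative_at[OF *, symmetric] ..
 also have "... = (\<Sum>j\<in>UNIV. if j = i then h' i (x $ i) * (\<Prod>l\<in>UNIV - {i}. h l (x $ l)) else 0)"
  by (rule sum.cong) (auto simp: axis_def)
 also have "... = tensor (h(i := h' i)) x"
  by (simp add: tensor_split[where i = i])
 finally show "partial i (tensor h) x = tensor (h(i := h' i)) x" .
qed

lemma Ck_tensor:
 fixes h :: "'n::finite => real => real"
 shows "(!!j. Dk l (h j)) ==> Ck l (tensor h)"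
proof (induction l arbitrary: h)
 case 0
 then have c: "continuous_on UNIV (h j)" for j by simp
 have "continuous_on UNIV (%x::real^'n. h j (x $ j))" for j
  by (rule continuous_on_compose2[OF c]) (auto intro: continuous_on_component)
 then show ?case by (auto simp: tensor_def[abs_def] intro!: continuous_on_prod)
next
 case (Suc l)
 then have "\<exists>g. (\<forall>x. (h j has_real_derivative g x) (at x)) & Dk l g" for j by simp
 then obtain h' where h': "!!j x. (h j has_real_derivative h' j x) (at x)" "!!j. Dk l (h' j)" by metis
 have "partial i (tensor h) = tensor (h(i := h' i))" for i
  using tensor_deriv(2)[of h h', OF h'(1)] by auto
 moreover have "Ck l (tensor (h(i := h' i)))" for i
  by (rule Suc.IH) (use h'(2) Dk_lower[OF Suc.prems] in auto)
 ultimately show ?case using tensor_deriv(1)[of h h', OF h'(1)] by auto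
qed

lemma test_function_tensor:
 fixes h :: "'n::finite => real => real"
 assumes "!!j l. Dk l (h j)" "!!j y. y < a $ j \<or> b $ j < y ==> h j y = 0" "cbox a b \<subseteq> U"
 shows "test_function U (tensor h)"
proof -
 have "{x. tensor h x ~= 0} \<subseteq> cbox a b"
 proof
  fix x assume "x \<in> {x. tensor h x ~= 0}"
  then have "h j (x $ j) ~= 0" for j by (auto simp: tensor_def)
  then show "x \<in> cbox a b" using assms(2) by (auto simp: mem_box_cart) (meson not_le)+
 qed
 then have *: "closure {x. tensor h x ~= 0} \<subseteq> cbox a b" by (rule closure_minimal) auto
 moreover have "compact (closure {x. tensor h x ~= 0})"
  using compact_Int_closed[OF compact_cbox[of a b] closed_closure[of "{x. tensor h x ~= 0}"]] *
  by (simp add: Int_absorb1 inf.absorb2)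
 ultimately show ?thesis
  using assms by (auto simp: test_function_def intro: Ck_tensor)
qed

definition boxbump :: "nat => real^'n => real^'n => real^'n => real" where
 "boxbump k a b = tensor (%j. bump (real (Suc k)) (a $ j) (b $ j))"

lemma boxbump_bounds: "0 <= boxbump k a b x" "boxbump k a b x <= 1"
 by (auto simp: boxbump_def tensor_def bump_bounds intro!: prod_nonneg prod_le_1)

lemma test_function_boxbump:
 "cbox a b \<subseteq> U ==> test_function U (boxbump k a b)"
 unfolding boxbump_def
 by (rule test_function_tensor) (auto simp: Dk_bump bump_outside)

lemma boxbump_tendsto: "(%k. boxbump k a b x) \<longlonglongrightarrow> indicator (box a b) x"
proof -
 have "(%k. boxbump k a b x) \<longlonglongrightarrow> (\<Prod>j\<in>UNIV. indicator {a $ j<..<b $ j} (x $ j))"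
  unfolding boxbump_def tensor_def by (intro tendsto_prod bump_tendsto)
 also have "(\<Prod>j\<in>UNIV. indicator {a $ j<..<b $ j} (x $ j)) = (indicator (box a b) x :: real)"
  by (auto simp: indicator_def mem_box_cart)
 finally show ?thesis .
qed

lemma boxbump_continuous: "continuous_on UNIV (boxbump k a b)"
 using test_function_boxbump[of a b UNIV k] unfolding test_function_def by (metis Ck.simps(1) subset_UNIV)

lemma boxbump_outside: "x \<notin> box a b ==> boxbump k a b x = 0"
proof -
 assume "x \<notin> box a b"
 then obtain j where "x $ j <= a $ j \<or> b $ j <= x $ j"
  by (auto simp: mem_box_cart not_less)
 then have "bump (real (Suc k)) (a $ j) (b $ j) (x $ j) = 0" by (intro bump_outside) auto
 then show ?thesis by (auto simp: boxbump_def tensor_def intro!: prod_zero)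
qed

text \<open>Averaging a bump over a segment of length t in direction i gives a test function whose
  partial derivative is a finite difference of bumps. Testing a weak derivative with it yields the
  fundamental theorem of calculus along coordinate lines. Only the i-th tensor factor
  changes.\<close>

lemma shifted_boxbump:
 fixes a b :: "real^'n"
 assumes t: "t > 0" and U: "cbox a (b + t *R axis i 1) \<subseteq> U"
 obtains Phi where "test_function U Phi"
  "!!x. partial i Phi x = boxbump k a b x - boxbump k a b (x - t *R axis i 1)"
  "!!x. Phi x = (\<integral>s. boxbump k a b (x - s *R axis i 1) * indicator {0..t} s \<partial>lborel)"
proof -
 define h where "h = (%j. bump (real (Suc k)) (a $ j) (b $ j))"
 have cont: "isCont (h j) y" for j y
  using Dk_continuous[OF Dk_bump] by (auto simp: h_def continuous_on_eq_continuous_at)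
 obtain H where H0: "!!y. (H has_vector_derivative h i y) (at y)"
  using einterval_antiderivative[of "-\<infinity>" "\<infinity>" "h i"] cont by auto
 then have H: "(H has_real_derivative h i y) (at y)" for y
  by (simp add: has_real_derivative_iff_has_vector_derivative)
 \<comment> \<open>The primitive \<open>H\<close> has no compact support in general, but this
   difference is the integral of the bump over a window of length t and vanishes as soon as the
   window misses the support.\<close>
 define G where "G = (%y. H y - H (y - t))"
 have G: "(G has_real_derivative h i y - h i (y - t)) (at y)" for y
  unfolding G_def
  by (auto intro!: derivative_eq_intros H DERIV_chain2[OF H])
 have Gint: "G y = (\<integral>s. h i (y - s) * indicator {0..t} s \<partial>lborel)" for y
 proof -
  have "(\<integral>s. h i (y - s) * indicator {0..t} s \<partial>lborel) = (- H (y - t)) - (- H (y - 0))"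
   by (rule integral_FTC_Icc_real)
    (use t in \<open>auto intro!: derivative_eq_intros DERIV_chain2[OF H] continuous_intros isCont_o2[OF _ cont]\<close>)
  then show ?thesis by (simp add: G_def)
 qed
 define g where "g = h(i := G)"
 have Dkh: "Dk l (h j)" for l j by (simp add: h_def Dk_bump)
 have DkG: "Dk l (%y. h i y - h i (y - t))" for l
  using Dk_add[OF Dkh Dk_mult[OF Dk_const[of _ "-1"] Dk_affine[OF Dkh, of _ _ "-t" 1]], of l i]
  by simp
 have "Dk l (g j)" for l j
 proof (cases "j = i")
  case True
  have "Dk (Suc l) G"
   unfolding Dk.simps using G DkG by (intro exI[of _ "%y. h i y - h i (y - t)"] conjI allI)
  then show ?thesis using True Dk_lower by (simp add: g_def)
 next
  case False then show ?thesis by (simp add: g_def Dkh)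
 qed
 moreover have "g j y = 0" if "y < a $ j \<or> (b + t *R axis i 1) $ j < y" for j y
 proof (cases "j = i")
  case True
  have z: "(%s. h i (y - s) * indicator {0..t} s) = (%s. 0)"
   using that True t by (auto simp: h_def indicator_def fun_eq_iff intro!: bump_outside)
  show ?thesis using True unfolding g_def by (simp add: Gint z)
 next
  case False
  then show ?thesis using that by (auto simp: g_def h_def axis_def intro!: bump_outside)
 qed
 ultimately have 1: "test_function U (tensor g)"
  using U by (intro test_function_tensor) auto
 have "\<exists>h'. \<forall>y. (h j has_real_derivative h' y) (at y)" for j
  using Dkh[of "Suc 0" j] by auto
 then obtain h' where h': "!!j y. (h j has_real_derivative h' j y) (at y)" by metis
 have "partial i (tensor g) x = tensor (g(i := (h'(i := %y. h i y - h i (y - t))) i)) x" for x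
  by (rule tensor_deriv(2)) (use h' G in \<open>auto simp: g_def\<close>)
 moreover have S: "tensor h (x - s *R axis i 1) = h i (x $ i - s) * (\<Prod>j\<in>UNIV - {i}. h j (x $ j))" for x s
  by (auto simp: tensor_split[where i = i] axis_def intro!: prod.cong)
 ultimately have P: "partial i (tensor g) x = tensor h x - tensor h (x - t *R axis i 1)" for x
  unfolding S by (simp add: tensor_split[where i = i] g_def left_diff_distrib)
 have "tensor g x = (\<integral>s. tensor h (x - s *R axis i 1) * indicator {0..t} s \<partial>lborel)" for x
 proof -
  have "tensor g x = (\<integral>s. h i (x $ i - s) * indicator {0..t} s \<partial>lborel) * (\<Prod>j\<in>UNIV - {i}. h j (x $ j))"
   by (simp add: tensor_split[where i = i] g_def Gint)
  also have "... = (\<integral>s. (h i (x $ i - s) * indicator {0..t} s) * (\<Prod>j\<in>UNIV - {i}. h j (x $ j)) \<partial>lborel)"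
   by (rule integral_mult_left_zero[symmetric])
  also have "... = (\<integral>s. tensor h (x - s *R axis i 1) * indicator {0..t} s \<partial>lborel)"
   by (simp add: S mult_ac)
  finally show ?thesis .
 qed
 with P that[OF 1] show ?thesis by (simp add: boxbump_def h_def)
qed

section \<open>Testing against bounded functions\<close>

text \<open>Convergence is tested against bounded measurable functions rather than smooth ones: this
  class contains indicators and is stable under bounded measurable factors, which is what limits of
  Morrey bounds and limits of products require.\<close>

definition wtest :: "(real^'n) set => (real^'n => real) => bool" where
 "wtest U psi \<longleftrightarrow> psi \<in> borel_measurable lebesgue & (\<exists>B. \<forall>x. \<bar>psi x\<bar> <= B) \<and>
  (\<exists>K. compact K & K \<subseteq> U & (\<forall>x. x \<notin> K --> psi x = 0))"

lemma wtest_outside: "wtest U psi ==> x \<notin> U ==> psi x = 0"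
 unfolding wtest_def by blast

lemma wtest_integrable:
 assumes "wtest U psi" "locally_integrable U f"
 shows "integrable lebesgue (%x. psi x *R f x)"
proof -
 obtain B K where B: "!!x. \<bar>psi x\<bar> <= B" and K: "compact K" "K \<subseteq> U" "!!x. x \<notin> K ==> psi x = 0"
  and [measurable]: "psi \<in> borel_measurable lebesgue"
  using assms(1) by (auto simp: wtest_def)
 have *: "integrable lebesgue (%x. indicator K x *R f x)"
  using assms(2) K by (auto simp: locally_integrable_def set_integrable_def)
 have "integrable lebesgue (%x. psi x *R (indicator K x *R f x))"
 proof (rule Bochner_Integration.integrable_bound[OF integrable_scaleR_right[of B, OF *]])
  show "AE x in lebesgue. norm (psi x *R (indicator K x *R f x)) <= norm (B *R (indicator K x *R f x))"
   using order_trans[OF B abs_ge_self] by (auto simp: abs_mult intro!: AE_I2 mult_right_mono)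
 qed (use borel_measurable_integrable[OF *] in measurable)
 moreover have "psi x *R (indicator K x *R f x) = psi x *R f x" for x
  using K(3) by (cases "x \<in> K") auto
 ultimately show ?thesis by (simp only:)
qed

lemma wtest_set_integral:
 "(!!x. x \<notin> U ==> psi x = 0) ==> (LINT x:U|lebesgue. psi x *R f x) = (LINT x|lebesgue. psi x *R f x)"
 unfolding set_lebesgue_integral_def
 by (rule Bochner_Integration.integral_cong) (auto simp: indicator_def)

lemma continuous_compact_support_bounded:
 fixes f :: "'a::topological_space => real"
 assumes "continuous_on UNIV f" "compact K" "!!x. x \<notin> K ==> f x = 0"
 shows "\<exists>B. \<forall>x. \<bar>f x\<bar> <= B"
proof -
 have "bounded (f ` K)"
  using assms by (intro compact_imp_bounded compact_continuous_image continuous_on_subset[OF assms(1)]) auto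
 then obtain B where "!!x. x \<in> K ==> \<bar>f x\<bar> <= B" by (auto simp: bounded_iff)
 then have "\<bar>f x\<bar> <= max B 0" for x using assms(3)[of x] by (cases "x \<in> K") (auto intro: max.coboundedI1)
 then show ?thesis by blast
qed

lemma continuous_compact_support_wtest:
 fixes f :: "real^'n => real"
 assumes "continuous_on UNIV f" "compact K" "!!x. x \<notin> K ==> f x = 0" "K \<subseteq> U"
 shows "wtest U f"
 using continuous_compact_support_bounded[OF assms(1-3)] assms
 by (auto simp: wtest_def intro!: measurable_completion borel_measurable_continuous_onI)

lemma test_function_support:
 assumes "test_function U phi"
 obtains K where "compact K" "K \<subseteq> U" "!!x. x \<notin> K ==> phi x = 0"
  "!!x i. x \<notin> K ==> partial i phi x = 0" "continuous_on UNIV phi"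
  "!!i. continuous_on UNIV (partial i phi)" "!!x. phi differentiable (at x)"
proof
 let ?K = "closure {x. phi x ~= 0}"
 show "compact ?K" "?K \<subseteq> U" using assms by (auto simp: test_function_def)
 show 0: "phi x = 0" if "x \<notin> ?K" for x using that closure_subset[of "{x. phi x ~= 0}"] by auto
 have C: "Ck 0 phi" "Ck (Suc 0) phi" using assms by (auto simp: test_function_def simp del: Ck.simps)
 then show "continuous_on UNIV phi" "!!i. continuous_on UNIV (partial i phi)" "!!x. phi differentiable (at x)"
  by auto
 show "partial i phi x = 0" if "x \<notin> ?K" for x i
 proof -
  have "(phi has_derivative (%h. 0)) (at x)"
  proof (rule has_derivative_transform_within_open[of "%x. 0" _ _ _ "- ?K"])
   show "0 = phi y" if "y \<in> - ?K" for y using 0[of y] that by simp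
  qed (use that in \<open>auto intro: open_Compl\<close>)
  then have "(%h. 0) = frechet_derivative phi (at x)" by (rule frechet_derivative_at)
  from fun_cong[OF this, of "axis i 1"] show ?thesis by (simp add: partial_def)
 qed
qed

lemma
 assumes "test_function U phi"
 shows test_function_wtest: "wtest U phi" and test_function_partial_wtest: "wtest U (partial i phi)"
proof -
 obtain K where K: "compact K" "K \<subseteq> U" "!!x. x \<notin> K ==> phi x = 0"
  "!!x i. x \<notin> K ==> partial i phi x = 0" "continuous_on UNIV phi"
  "!!i. continuous_on UNIV (partial i phi)"
  using test_function_support[OF assms] by metis
 show "wtest U phi" "wtest U (partial i phi)"
  using continuous_compact_support_wtest[OF K(5,1,3,2)] continuous_compact_support_wtest[OF K(6,1,4,2)]
  by blast+
qed

text \<open>Test functions of \<open>U\<close> and their derivatives vanish off \<open>U\<close>, so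
  the integrals can be taken over the whole space. In this form, shrinking \<open>U\<close> merely
  shrinks the families of test functions and compact sets.\<close>

lemma has_weak_partial_iff:
 "has_weak_partial U i f g \<longleftrightarrow> locally_integrable U f & locally_integrable U g \<and>
  (\<forall>phi. test_function U phi -->
    (LINT x|lebesgue. partial i phi x *R f x) = - (LINT x|lebesgue. phi x *R g x))"
proof -
 have "(LINT x:U|lebesgue. partial i phi x *R f x) = (LINT x|lebesgue. partial i phi x *R f x)"
  "(LINT x:U|lebesgue. phi x *R g x) = (LINT x|lebesgue. phi x *R g x)"
  if "test_function U phi" for phi
  using that
  by (auto intro!: wtest_set_integral dest: test_function_wtest test_function_partial_wtest wtest_outside)
 then show ?thesis by (auto simp: has_weak_partial_def)
qed

lemma locally_integrable_mono: "V \<subseteq> U ==> locally_integrable U f ==> locally_integrable V f"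
 unfolding locally_integrable_def by blast

lemma locally_integrable_cong:
 assumes "AE x in lebesgue. x \<in> U --> f x = g x" "locally_integrable U f"
 shows "locally_integrable U g"
 unfolding locally_integrable_def set_integrable_def
proof safe
 fix K assume K: "compact K" "K \<subseteq> U"
 have *: "integrable lebesgue (%x. indicator K x *R f x)"
  using assms(2) K by (auto simp: locally_integrable_def set_integrable_def)
 have "AE x in lebesgue. indicator K x *R f x = indicator K x *R g x"
  using assms(1) by eventually_elim (use K in \<open>auto simp: indicator_def\<close>)
 from integrable_cong_AE_imp[OF * borel_measurable_AE[OF borel_measurable_integrable[OF *] this] this]
 show "integrable lebesgue (%x. indicator K x *R g x)" .
qed

lemma wtest_integral_cong:
 assumes "AE x in lebesgue. x \<in> U --> f x = g x" "locally_integrable U f" "wtest U psi"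
 shows "(LINT x|lebesgue. psi x *R f x) = (LINT x|lebesgue. psi x *R g x)"
proof (rule integral_cong_AE)
 show "(%x. psi x *R f x) \<in> borel_measurable lebesgue" "(%x. psi x *R g x) \<in> borel_measurable lebesgue"
  using wtest_integrable[OF assms(3)] assms(2) locally_integrable_cong[OF assms(1,2)]
  by (auto intro: borel_measurable_integrable)
 show "AE x in lebesgue. psi x *R f x = psi x *R g x"
  using assms(1) by eventually_elim (use wtest_outside[OF assms(3)] in auto)
qed

lemma has_weak_partial_cong:
 assumes "AE x in lebesgue. x \<in> U --> f x = f' x" "AE x in lebesgue. x \<in> U --> g x = g' x"
  "has_weak_partial U i f g"
 shows "has_weak_partial U i f' g'"
proof -
 have li: "locally_integrable U f" "locally_integrable U g"
  using assms(3) by (auto simp: has_weak_partial_iff)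
 show ?thesis
  unfolding has_weak_partial_iff
 proof (intro conjI allI impI)
  show "locally_integrable U f'" "locally_integrable U g'"
   by (rule locally_integrable_cong[OF assms(1) li(1)], rule locally_integrable_cong[OF assms(2) li(2)])
  fix phi assume phi: "test_function U phi"
  then have "(LINT x|lebesgue. partial i phi x *R f x) = - (LINT x|lebesgue. phi x *R g x)"
   using assms(3) by (auto simp: has_weak_partial_iff)
  then show "(LINT x|lebesgue. partial i phi x *R f' x) = - (LINT x|lebesgue. phi x *R g' x)"
   using wtest_integral_cong[OF assms(1) li(1) test_function_partial_wtest[OF phi]]
    wtest_integral_cong[OF assms(2) li(2) test_function_wtest[OF phi]] by simp
 qed
qed

lemma AE_imp_sym: "AE x in M. P x --> f x = g x ==> AE x in M. P x --> g x = f x"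
 by (erule eventually_mono) auto

text \<open>The first conclusion is an equality of functions, not just almost everywhere on
  \<open>U\<close>: \<open>f\<close> and \<open>f'\<close> have the same weak derivatives, so
  \<open>SOME\<close> picks the same representative for both.\<close>

lemma weak_partial_cong:
 assumes "AE x in lebesgue. x \<in> U --> f x = f' x"
 shows "weak_partial U i f = weak_partial U i f'" "weakly_differentiable U f = weakly_differentiable U f'"
proof -
 have *: "has_weak_partial U j f = has_weak_partial U j f'" for j
  using has_weak_partial_cong[OF assms, of g g j for g] has_weak_partial_cong[OF AE_imp_sym[OF assms], of g g j for g]
  by fastforce
 show "weak_partial U i f = weak_partial U i f'" by (simp add: weak_partial_def *)
 show "weakly_differentiable U f = weakly_differentiable U f'" by (simp add: weakly_differentiable_def *)
qed

lemma has_weak_partial_weak_partial_ex: "has_weak_partial U i f g ==> has_weak_partial U i f (weak_partial U i f)"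
 unfolding weak_partial_def by (metis someI_ex)

lemma has_weak_partial_weak_partial:
 "weakly_differentiable U f ==> has_weak_partial U i f (weak_partial U i f)"
 unfolding weakly_differentiable_def weak_partial_def by (metis someI_ex)

lemma test_function_mono: "V \<subseteq> U ==> test_function V phi ==> test_function U phi"
 unfolding test_function_def by auto

lemma has_weak_partial_mono: "V \<subseteq> U ==> has_weak_partial U i f g ==> has_weak_partial V i f g"
 unfolding has_weak_partial_iff by (meson locally_integrable_mono test_function_mono)

section \<open>Exhaustion by relatively compact sets and localisation\<close>

lemma compact_between:
 fixes K :: "(real^'n) set"
 assumes "open U" "compact K" "K \<subseteq> U"
 obtains V where "open_compactly_in V U" "K \<subseteq> V"
proof -
 obtain C where C: "!!n. compact (C n)" "!!n. C n \<subseteq> U" "!!n. C n \<subseteq> interior (C (Suc n))"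
  "!!K. compact K ==> K \<subseteq> U ==> \<exists>N::nat. \<forall>n\<ge>N. K \<subseteq> C n"
  using open_Union_compact_subsets[OF assms(1)] by metis
 obtain N where "K \<subseteq> C N" using C(4)[OF assms(2,3)] by auto
 then have "K \<subseteq> interior (C (Suc N))" using C(3) by blast
 moreover have "closure (interior (C (Suc N))) \<subseteq> C (Suc N)"
  by (intro closure_minimal interior_subset compact_imp_closed C)
 then have "open_compactly_in (interior (C (Suc N))) U"
  using C(1)[of "Suc N"] C(2)[of "Suc N"] unfolding open_compactly_in_def
  by (auto intro: compact_closure[THEN iffD2] bounded_subset[OF compact_imp_bounded] interior_subset)
 ultimately show ?thesis using that by blast
qed

lemma open_exhaustion:
 fixes U :: "(real^'n) set"
 assumes "open U"
 obtains V :: "nat => (real^'n) set" where "!!n. open_compactly_in (V n) U" "!!n. V n \<subseteq> V (Suc n)"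
  "(\<Union>n. V n) = U" "!!K. compact K ==> K \<subseteq> U ==> \<exists>n. K \<subseteq> V n"
proof -
 obtain C where C: "!!n. compact (C n)" "!!n. C n \<subseteq> U" "!!n. C n \<subseteq> interior (C (Suc n))"
  "\<Union>(range C) = U"
  "!!K. compact K ==> K \<subseteq> U ==> \<exists>N::nat. \<forall>n\<ge>N. K \<subseteq> C n"
  using open_Union_compact_subsets[OF assms(1)] by metis
 let ?V = "%n. interior (C n)"
 have cl: "closure (?V n) \<subseteq> C n" for n
  by (intro closure_minimal interior_subset compact_imp_closed C)
 have 1: "open_compactly_in (?V n) U" for n
  using C(1)[of n] C(2)[of n] cl unfolding open_compactly_in_def
  by (auto intro: compact_closure[THEN iffD2] bounded_subset[OF compact_imp_bounded] interior_subset)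
 have 2: "\<exists>n. K \<subseteq> ?V n" if "compact K" "K \<subseteq> U" for K
  using C(5)[OF that] C(3) by blast
 have 3: "(\<Union>n. ?V n) = U"
 proof
  show "(\<Union>n. ?V n) \<subseteq> U" using C(2) interior_subset by blast
  show "U \<subseteq> (\<Union>n. ?V n)" using C(3,4) by blast
 qed
 have 4: "?V n \<subseteq> ?V (Suc n)" for n using C(3)[of n] interior_subset[of "C n"] by blast
 show ?thesis using that[of ?V, OF 1 4 3 2] .
qed

lemma open_compactly_in_mono: "open_compactly_in V W ==> W \<subseteq> U ==> open_compactly_in V U"
 by (auto simp: open_compactly_in_def)

lemma open_compactly_in_subset: "open_compactly_in V U ==> V \<subseteq> U"
 using closure_subset by (auto simp: open_compactly_in_def)

text \<open>A test function sees only a relatively compact neighbourhood of its support, and local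
  integrability is also a condition on compact sets.\<close>

lemma has_weak_partial_local:
 fixes U :: "(real^'n) set"
 assumes "open U" and loc: "!!V. open_compactly_in V U ==> has_weak_partial V i f g"
 shows "has_weak_partial U i f g"
 unfolding has_weak_partial_iff
proof (intro conjI allI impI)
 have "set_integrable lebesgue K f & set_integrable lebesgue K g" if "compact K" "K \<subseteq> U" for K
  using compact_between[OF \<open>open U\<close> that] loc that(1)
  by (metis has_weak_partial_def locally_integrable_def)
 then show "locally_integrable U f" "locally_integrable U g" by (auto simp: locally_integrable_def)
 fix phi assume phi: "test_function U phi"
 let ?K = "closure {x. phi x ~= 0}"
 obtain V where V: "open_compactly_in V U" "?K \<subseteq> V"
  using compact_between[OF \<open>open U\<close>, of ?K] phi by (auto simp: test_function_def)
 then have "test_function V phi" using phi by (auto simp: test_function_def)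
 then show "(LINT x|lebesgue. partial i phi x *R f x) = - (LINT x|lebesgue. phi x *R g x)"
  using loc[OF V(1)] by (auto simp: has_weak_partial_iff)
qed

section \<open>Uniqueness of weak derivatives\<close>

lemma locally_integrable_measurable:
 fixes f :: "real^'n => 'b::euclidean_space"
 assumes "open U" "locally_integrable U f"
 shows "(%x. indicator U x *R f x) \<in> borel_measurable lebesgue"
proof -
 obtain V :: "nat => (real^'n) set" where V: "!!n. open_compactly_in (V n) U" "!!n. V n \<subseteq> V (Suc n)" "(\<Union>n. V n) = U"
  using open_exhaustion[OF assms(1)] by metis
 let ?C = "%n. closure (V n)"
 have "mono V" using V(2) by (rule mono_iff_le_Suc[THEN iffD2, rule_format])
 have lim: "(%n. indicator (?C n) x *R f x) \<longlonglongrightarrow> indicator U x *R f x" for x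
 proof (cases "x \<in> U")
  case True
  then obtain n where "x \<in> V n" using V(3) by auto
  then have "\<forall>k\<ge>n. x \<in> ?C k" using \<open>mono V\<close> closure_subset by (meson monoD subsetD)
  then have "\<forall>k\<ge>n. indicator (?C k) x *R f x = indicator U x *R f x" using True by simp
  then show ?thesis by (intro tendsto_eventually) (auto simp: eventually_sequentially)
 next
  case False
  then have "x \<notin> ?C k" for k using V(1)[of k] by (auto simp: open_compactly_in_def)
  then show ?thesis using False by simp
 qed
 have "(%x. indicator (?C n) x *R f x) \<in> borel_measurable lebesgue" for n
  using assms(2) V(1)[of n]
  by (auto simp: locally_integrable_def open_compactly_in_def set_integrable_def intro!: borel_measurable_integrable)
 then show ?thesis by (rule borel_measurable_LIMSEQ_metric) (rule lim)
qed

text \<open>Translations and Fubini are carried out below for Borel functions and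
  \<open>lborel\<close>; a Borel representative is obtained coordinate by coordinate.\<close>

lemma lebesgue_borel_rep:
 fixes f :: "real^'n => 'b::euclidean_space"
 assumes "f \<in> borel_measurable lebesgue"
 obtains g where "g \<in> borel_measurable borel" "AE x in lebesgue. f x = g x"
proof -
 have "\<exists>h\<in>borel_measurable lborel. (AE x in lborel. f x \<bullet> b = h x)" for b
  by (rule completion_ex_borel_measurable_real) (use assms in measurable)
 then obtain h where h: "!!b. h b \<in> borel_measurable lborel" "!!b. AE x in lborel. f x \<bullet> b = h b x" by metis
 let ?g = "%x. \<Sum>b\<in>Basis. h b x *R b"
 have "?g \<in> borel_measurable borel"
  using h(1) by (intro borel_measurable_sum borel_measurable_scaleR) auto
 moreover have "AE x in lborel. \<forall>b\<in>Basis. f x \<bullet> b = h b x"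
  by (rule AE_finite_allI) (use h(2) in auto)
 then have "AE x in lborel. f x = ?g x"
  by eventually_elim (metis (no_types, lifting) euclidean_representation sum.cong)
 then have "AE x in lebesgue. f x = ?g x" by (rule AE_completion)
 ultimately show ?thesis by (rule that)
qed

lemma Int_stable_boxes: "Int_stable (range (%(a, b). box a b :: 'a::euclidean_space set))"
 by (auto simp: Int_stable_def box_Int_box)

text \<open>Boxes form an intersection-stable generator of the Borel sets, and the sets over which
  the integral of \<open>g\<close> vanishes form a Dynkin system. \<open>UN\<close> supplies the
  whole space, from which complements are taken.\<close>

lemma borel_integral_zero_of_boxes:
 fixes g :: "real^'n => 'b::euclidean_space"
 assumes int: "integrable lborel g"
  and box: "!!a b. (LINT x|lborel. indicator (box a b) x *R g x) = 0"
  and UN: "(LINT x|lborel. g x) = 0"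
 shows "AE x in lborel. g x = 0"
proof (rule sigma_finite_measure.density_zero[OF lborel.sigma_finite_measure_axioms int])
 have I: "integrable lborel (%x. indicator A x *R g x)" if "A \<in> sets borel" for A
  using that int by (intro integrable_mult_indicator) auto
 fix A :: "(real^'n) set" assume "A \<in> sets lborel"
 then have "A \<in> sigma_sets UNIV (range (%(a, b). box a b))"
  using arg_cong[OF borel_eq_box[where 'a = "real^'n"], of sets] by (simp add: sets_measure_of)
 from Int_stable_boxes Pow_UNIV[THEN equalityD2, THEN order_trans[OF subset_UNIV]] this have "(LINT x|lborel. indicator A x *R g x) = 0"
 proof (induction rule: sigma_sets_induct_disjoint)
  case (compl A)
  then have A: "A \<in> sets borel" by (simp add: borel_eq_box sets_measure_of)
  have "(LINT x|lborel. indicator (UNIV - A) x *R g x) = (LINT x|lborel. g x - indicator A x *R g x)"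
   by (rule Bochner_Integration.integral_cong) (auto simp: indicator_def)
  also have "... = 0" using compl UN I[OF A] int by simp
  finally show ?case .
 next
  case (union A)
  then have A: "A i \<in> sets borel" for i by (auto simp: borel_eq_box sets_measure_of)
  have "set_lebesgue_integral lborel (\<Union>i. A i) g = (\<Sum>i. set_lebesgue_integral lborel (A i) g)"
   using union A I[of "\<Union>i. A i"]
   by (intro lebesgue_integral_countable_add) (auto simp: disjoint_family_on_def set_integrable_def)
  then show ?case using union by (simp add: set_lebesgue_integral_def)
 qed (use box in auto)
 then show "set_lebesgue_integral lborel A g = 0" by (simp add: set_lebesgue_integral_def)
qed

lemma cbox_box_AE: "AE x in lebesgue. x \<in> cbox a b \<longleftrightarrow> x \<in> box a (b :: real^'n)"
proof -
 have "cbox a b - box a b \<in> null_sets lebesgue"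
  using negligible_frontier_interval[of a b] by (simp add: negligible_iff_null_sets)
 from AE_not_in[OF this] show ?thesis
  by eventually_elim (use box_subset_cbox in auto)
qed

text \<open>On a closed box inside \<open>U\<close> the function is integrable, so the Dynkin
  argument applies to its restriction, intersections of boxes being boxes with null boundary.
  Countably many such closed boxes cover \<open>U\<close>.\<close>

lemma AE_zero_of_box_integrals:
 fixes f :: "real^'n => 'b::euclidean_space"
 assumes U: "open U" and f: "locally_integrable U f"
  and box: "!!a b. cbox a b \<subseteq> U ==> (LINT x|lebesgue. indicator (box a b) x *R f x) = 0"
 shows "AE x in lebesgue. x \<in> U --> f x = 0"
proof -
 obtain g where g[measurable]: "g \<in> borel_measurable borel"
  and AEg: "AE x in lebesgue. indicator U x *R f x = g x"
  using lebesgue_borel_rep[OF locally_integrable_measurable[OF U f]] .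
 have *: "AE x in lebesgue. x \<in> cbox a b --> f x = 0" if ab: "cbox a b \<subseteq> U" for a b
 proof -
  let ?g = "%x. indicator (cbox a b) x *R g x"
  have fI: "integrable lebesgue (%x. indicator (cbox a b) x *R f x)"
   using f ab by (auto simp: locally_integrable_def set_integrable_def)
  have AE2: "AE x in lebesgue. indicator (cbox a b) x *R f x = ?g x"
   using AEg by eventually_elim (use ab in \<open>auto simp: indicator_def split: if_splits\<close>)
  have "integrable lebesgue ?g"
   by (rule integrable_cong_AE_imp[OF fI _ AE2]) (auto intro!: measurable_completion)
  then have int: "integrable lborel ?g" by (subst (asm) integrable_completion) auto
  have bx: "(LINT x|lborel. indicator (box c d) x *R ?g x) = 0" for c d
  proof -
   have "\<exists>a' b'. box c d \<inter> box a b = box a' b'" unfolding box_Int_box by (intro exI) (rule refl)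
   then obtain a' b' where 1: "box c d \<inter> box a b = box a' b'" by blast
   show ?thesis
   proof (cases "box a' b' = {}")
    case True
    have "AE x in lebesgue. indicator (box c d) x *R ?g x = 0"
     using cbox_box_AE[of a b] by eventually_elim (use 1 True in \<open>auto simp: indicator_def\<close>)
    then have "(LINT x|lebesgue. indicator (box c d) x *R ?g x) = 0" by (rule integral_eq_zero_AE)
    then show ?thesis by (subst (asm) integral_completion) auto
   next
    case False
    \<comment> \<open>A nonempty open box has the closed box as its closure; this gives the
      inclusion in \<open>U\<close> that the hypothesis \<open>box\<close> demands.\<close>
    then have "cbox a' b' \<subseteq> closure (box a' b')" by (simp add: closure_box)
    also have "... \<subseteq> cbox a b" using 1 box_subset_cbox by (intro closure_minimal) auto
    finally have 2: "cbox a' b' \<subseteq> U" using ab by auto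
    have "AE x in lebesgue. indicator (box a' b') x *R f x = indicator (box c d) x *R ?g x"
     using cbox_box_AE[of a b] AE2
    proof eventually_elim
     case (elim x)
     have "x \<in> box a' b' \<longleftrightarrow> x \<in> box c d & x \<in> box a b" using 1 by blast
     then show ?case using elim(1) elim(2)[symmetric] by (cases "x \<in> cbox a b") (simp_all split: split_indicator)
    qed
    moreover have "integrable lebesgue (%x. indicator (box a' b') x *R (indicator (cbox a' b') x *R f x))"
     using f 2 by (rule_tac integrable_mult_indicator) (auto simp: locally_integrable_def set_integrable_def)
    then have "integrable lebesgue (%x. indicator (box a' b') x *R f x)"
     using box_subset_cbox[of a' b'] by (simp flip: indicator_inter_arith add: Int_absorb2)
    ultimately have "(LINT x|lebesgue. indicator (box c d) x *R ?g x) = (LINT x|lebesgue. indicator (box a' b') x *R f x)"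
     using borel_measurable_integrable
     by (intro integral_cong_AE) (auto simp: eq_commute intro!: measurable_completion)
    then show ?thesis using box[OF 2] by (subst (asm) integral_completion) auto
   qed
  qed
  have "(LINT x|lborel. ?g x) = (LINT x|lebesgue. ?g x)" by (rule integral_completion[symmetric]) auto
  also have "... = (LINT x|lebesgue. indicator (box a b) x *R ?g x)"
   by (rule integral_cong_AE)
    (use cbox_box_AE[of a b] in \<open>auto intro!: measurable_completion elim!: eventually_mono simp: indicator_def\<close>)
  also have "... = 0" using bx[of a b] by (subst integral_completion) auto
  finally have "AE x in lborel. ?g x = 0" by (intro borel_integral_zero_of_boxes[OF int bx])
  then have "AE x in lebesgue. ?g x = 0" by (rule AE_completion)
  with AE2 show ?thesis by eventually_elim (auto simp: indicator_def)
 qed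
 obtain D where D: "countable D" "D \<subseteq> Pow U" "!!X. X \<in> D ==> \<exists>a b. X = cbox a b" "\<Union>D = U"
  using open_countable_Union_open_cbox[OF U] by metis
 have "AE x in lebesgue. \<forall>X\<in>D. x \<in> X --> f x = 0"
  unfolding AE_ball_countable[OF D(1)] using * D(2,3) by blast
 then show ?thesis by eventually_elim (use D(4) in blast)
qed

text \<open>The bumps of a box are bounded by 1 and tend to its indicator, so by dominated
  convergence the integral of \<open>g - h\<close> over every box vanishes.\<close>

lemma weak_derivative_unique:
 fixes g h :: "real^'n => 'b::euclidean_space"
 assumes U: "open U" and gh: "locally_integrable U g" "locally_integrable U h"
  and eq: "!!phi. test_function U phi ==> (LINT x|lebesgue. phi x *R g x) = (LINT x|lebesgue. phi x *R h x)"
 shows "AE x in lebesgue. x \<in> U --> g x = h x"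
proof -
 have li: "locally_integrable U (%x. g x - h x)"
  using gh unfolding locally_integrable_def by (blast intro: set_integral_diff(1))
 have *: "(LINT x|lebesgue. indicator (box a b) x *R (g x - h x)) = 0" if ab: "cbox a b \<subseteq> U" for a b
 proof -
  have m: "(%x. indicator U x *R (g x - h x)) \<in> borel_measurable lebesgue"
   by (rule locally_integrable_measurable[OF U li])
  have I: "integrable lebesgue (%x. indicator (cbox a b) x *R (g x - h x))"
   using li ab by (auto simp: locally_integrable_def set_integrable_def)
  have rew: "boxbump k a b x *R (indicator (cbox a b) x *R (g x - h x)) = boxbump k a b x *R (g x - h x)" for k x
   using boxbump_outside[of x a b k] box_subset_cbox[of a b] by (cases "x \<in> box a b") auto
  have [measurable]: "boxbump k a b \<in> borel_measurable lebesgue" for k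
   using test_function_wtest[OF test_function_boxbump[OF ab]] by (auto simp: wtest_def)
  have "(%k. LINT x|lebesgue. boxbump k a b x *R (indicator (cbox a b) x *R (g x - h x)))
    \<longlonglongrightarrow> (LINT x|lebesgue. indicator (box a b) x *R (indicator (cbox a b) x *R (g x - h x)))"
  proof (rule integral_dominated_convergence[where w = "%x. norm (indicator (cbox a b) x *R (g x - h x))"])
   show "AE x in lebesgue. (%k. boxbump k a b x *R (indicator (cbox a b) x *R (g x - h x)))
     \<longlonglongrightarrow> indicator (box a b) x *R (indicator (cbox a b) x *R (g x - h x))"
    by (intro AE_I2 tendsto_intros boxbump_tendsto)
   show "AE x in lebesgue. norm (boxbump k a b x *R (indicator (cbox a b) x *R (g x - h x)))
    <= norm (indicator (cbox a b) x *R (g x - h x))" for k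
    by (intro AE_I2) (auto simp: boxbump_bounds mult.assoc intro!: mult_left_le_one_le)
  qed (use integrable_norm[OF I] borel_measurable_integrable[OF I] in
    \<open>auto simp del: scaleR_scaleR norm_scaleR intro: borel_measurable_indicator intro!: borel_measurable_scaleR[OF _ borel_measurable_integrable[OF I]]\<close>)
  moreover have "(LINT x|lebesgue. boxbump k a b x *R (g x - h x)) = 0" for k
  proof -
   note t = test_function_boxbump[OF ab, of k]
   have "(LINT x|lebesgue. boxbump k a b x *R (g x - h x)) =
     (LINT x|lebesgue. boxbump k a b x *R g x - boxbump k a b x *R h x)"
    by (simp add: scaleR_diff_right)
   also have "... = 0"
    using eq[OF t] wtest_integrable[OF test_function_wtest[OF t] gh(1)] wtest_integrable[OF test_function_wtest[OF t] gh(2)]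
    by simp
   finally show ?thesis .
  qed
  moreover have "indicator (box a b) x *R (indicator (cbox a b) x *R (g x - h x)) = indicator (box a b) x *R (g x - h x)" for x
   using box_subset_cbox[of a b] by (auto simp: indicator_def)
  ultimately have "(%k::nat. 0) \<longlonglongrightarrow> (LINT x|lebesgue. indicator (box a b) x *R (g x - h x))"
   unfolding rew by (simp only:)
  from LIMSEQ_unique[OF tendsto_const this] show ?thesis by (rule sym)
 qed
 have "AE x in lebesgue. x \<in> U --> g x - h x = 0"
  by (rule AE_zero_of_box_integrals[OF U li]) (rule *)
 then show ?thesis by eventually_elim auto
qed

lemma has_weak_partial_unique:
 assumes "open U" "has_weak_partial U i f g" "has_weak_partial U i f h"
 shows "AE x in lebesgue. x \<in> U --> g x = h x"
 using assms by (intro weak_derivative_unique) (auto simp: has_weak_partial_iff)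

lemma weak_partial_AE:
 assumes "open U" "has_weak_partial U i f g"
 shows "AE x in lebesgue. x \<in> U --> weak_partial U i f x = g x"
proof -
 have "has_weak_partial U i f (weak_partial U i f)"
  using assms(2) by (intro has_weak_partial_weak_partial_ex)
 from has_weak_partial_unique[OF assms(1) this assms(2)] show ?thesis .
qed

text \<open>Derivatives on an exhausting sequence are glued: at \<open>x\<close> the function
  \<open>g\<close> uses the derivative belonging to the first \<open>V n\<close> that contains
  \<open>x\<close>. By uniqueness it agrees almost everywhere on \<open>V n\<close> with the
  derivative chosen there, at the cost of countably many null sets.\<close>

lemma weakly_differentiable_local:
 fixes U :: "(real^'n) set" and f :: "real^'n => 'b::euclidean_space"
 assumes "open U" and loc: "!!V. open_compactly_in V U ==> weakly_differentiable V f"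
 shows "weakly_differentiable U f"
 unfolding weakly_differentiable_def
proof
 fix i
 obtain V :: "nat => (real^'n) set" where V: "!!n. open_compactly_in (V n) U" "!!n. V n \<subseteq> V (Suc n)" "(\<Union>n. V n) = U"
  "!!K. compact K ==> K \<subseteq> U ==> \<exists>n. K \<subseteq> V n"
  using open_exhaustion[OF assms(1)] by metis
 have oV: "open (V n)" for n using V(1) by (auto simp: open_compactly_in_def)
 have "mono V" using V(2) by (rule mono_iff_le_Suc[THEN iffD2, rule_format])
 define w where "w = (%n. weak_partial (V n) i f)"
 have w: "has_weak_partial (V n) i f (w n)" for n
  unfolding w_def by (intro has_weak_partial_weak_partial loc V)
 define g where "g = (%x. w (LEAST n. x \<in> V n) x)"
 have "AE x in lebesgue. x \<in> V m --> w m x = w n x" if "m <= n" for m n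
  using has_weak_partial_unique[OF oV w has_weak_partial_mono[OF monoD[OF \<open>mono V\<close> that] w]] .
 then have "AE x in lebesgue. \<forall>m n. m <= n --> x \<in> V m --> w m x = w n x"
  by (simp add: AE_all_countable)
 then have AE: "AE x in lebesgue. x \<in> V n --> w n x = g x" for n
  by eventually_elim (metis g_def LeastI Least_le)
 have "has_weak_partial U i f g"
 proof (rule has_weak_partial_local[OF assms(1)])
  fix W assume W: "open_compactly_in W U"
  then obtain n where "closure W \<subseteq> V n" using V(4)[of "closure W"] by (auto simp: open_compactly_in_def)
  then have "W \<subseteq> V n" using closure_subset by blast
  then show "has_weak_partial W i f g"
   using has_weak_partial_cong[OF _ AE w, of n f] by (auto intro: has_weak_partial_mono)
 qed
 then show "\<exists>g. has_weak_partial U i f g" by blast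
qed

section \<open>Weak Lebesgue and Morrey bounds\<close>

text \<open>An admissible constant in the infimum that defines \<open>weak_Lp_norm\<close>; with
  real constants the estimates avoid arithmetic in \<open>ennreal\<close>.\<close>

definition weak_Lp_bound :: "real => (real^'n) set => (real^'n => 'b::euclidean_space) => real => bool" where
 "weak_Lp_bound p S f C \<longleftrightarrow> 0 <= C \<and>
  (\<forall>t>0. emeasure lebesgue {x \<in> S. t < norm (f x)} <= ennreal ((C / t) powr p))"

definition Morrey_bound :: "real => real => (real^'n) set => (real^'n => 'b::euclidean_space) => real => bool" where
 "Morrey_bound p la U f C \<longleftrightarrow> 0 <= C \<and>
  (\<forall>x\<in>U. \<forall>r\<in>{0<..diameter U}. weak_Lp_bound p (ball x r \<inter> U) f (C * r powr (la / p)))"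

lemma weak_Lp_norm_le: "weak_Lp_bound p S f C ==> weak_Lp_norm p S f <= ennreal C"
 unfolding weak_Lp_norm_def weak_Lp_bound_def by (rule Inf_lower) auto

text \<open>Strict inequality produces an admissible constant below \<open>C\<close> without knowing
  that the infimum is attained. This is the origin of the \<open>C + 1\<close> in
  \<open>Morrey_bound_of_norm\<close>.\<close>

lemma weak_Lp_bound_of_norm:
 assumes "weak_Lp_norm p S f < ennreal C" "p >= 0"
 shows "weak_Lp_bound p S f C"
proof -
 obtain D where D: "ennreal D < ennreal C" "0 <= D"
  "\<forall>t>0. emeasure lebesgue {x \<in> S. t < norm (f x)} <= ennreal ((D / t) powr p)"
  using assms(1) unfolding weak_Lp_norm_def Inf_less_iff by blast
 then have "D < C" by (simp add: ennreal_less_iff)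
 have "ennreal ((D / t) powr p) <= ennreal ((C / t) powr p)" if "t > 0" for t
  using \<open>D < C\<close> D(2) that assms(2) by (intro ennreal_leI powr_mono2 divide_right_mono) auto
 then show ?thesis
  using D \<open>D < C\<close> unfolding weak_Lp_bound_def by (auto intro: order_trans)
qed

lemma weak_Morrey_norm_le:
 assumes "Morrey_bound p la U f C"
 shows "weak_Morrey_norm p la U f <= ennreal C"
 unfolding weak_Morrey_norm_def
proof (intro SUP_least)
 fix x r assume xr: "x \<in> U" "r \<in> {0<..diameter U}"
 have "ennreal (r powr - (la / p)) * weak_Lp_norm p (ball x r \<inter> U) f \<le>
   ennreal (r powr - (la / p)) * ennreal (C * r powr (la / p))"
  using assms xr by (intro mult_left_mono weak_Lp_norm_le) (auto simp: Morrey_bound_def)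
 also have "... = ennreal C"
  using assms xr by (simp add: Morrey_bound_def powr_minus field_simps flip: ennreal_mult'')
 finally show "ennreal (r powr - (la / p)) * weak_Lp_norm p (ball x r \<inter> U) f <= ennreal C" .
qed

lemma Morrey_bound_of_norm:
 assumes "weak_Morrey_norm p la U f <= ennreal C" "p >= 0" "C >= 0"
 shows "Morrey_bound p la U f (C + 1)"
 unfolding Morrey_bound_def
proof (intro conjI ballI)
 fix x r assume xr: "x \<in> U" "r \<in> {0<..diameter U}"
 let ?N = "weak_Lp_norm p (ball x r \<inter> U) f"
 have "ennreal (r powr - (la / p)) * ?N <= weak_Morrey_norm p la U f"
  unfolding weak_Morrey_norm_def using xr by (intro SUP_upper2[OF xr(1)] SUP_upper2[OF xr(2)]) auto
 then have le: "ennreal (r powr - (la / p)) * ?N <= ennreal C" using assms(1) by (rule order_trans)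
 have "?N = ennreal (r powr (la / p)) * (ennreal (r powr - (la / p)) * ?N)"
  using xr by (simp add: powr_minus flip: mult.assoc ennreal_mult'')
 also have "... <= ennreal (r powr (la / p)) * ennreal C" by (rule mult_left_mono[OF le]) auto
 also have "... = ennreal (C * r powr (la / p))" using assms(3) by (simp add: mult.commute flip: ennreal_mult'')
 also have "... < ennreal ((C + 1) * r powr (la / p))"
  using xr assms(3) by (intro ennreal_lessI) auto
 finally show "weak_Lp_bound p (ball x r \<inter> U) f ((C + 1) * r powr (la / p))"
  by (rule weak_Lp_bound_of_norm) (use assms in auto)
qed (use assms in auto)

lemma subset_ball_diameter:
 fixes U :: "(real^'n) set"
 assumes "open U" "bounded U" "x \<in> U"
 shows "U \<subseteq> ball x (diameter U)"
proof
 fix y assume y: "y \<in> U"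
 obtain e where e: "e > 0" "ball y e \<subseteq> U" using openE[OF assms(1) y] by blast
 obtain u :: "real^'n" where u: "norm u = 1" "norm (y + (e / 2) *R u - x) = norm (y - x) + e / 2"
 proof (cases "y = x")
  case True
  then show ?thesis using that[of "axis undefined 1"] e by simp
 next
  case False
  let ?u = "(1 / norm (y - x)) *R (y - x)"
  have "y + (e / 2) *R ?u - x = (1 + e / 2 / norm (y - x)) *R (y - x)"
   by (simp add: algebra_simps)
  moreover have "norm ((1 + e / 2 / norm (y - x)) *R (y - x)) = norm (y - x) + e / 2"
   unfolding norm_scaleR using e False by (simp add: field_simps abs_of_nonneg add_nonneg_nonneg)
  ultimately show ?thesis using that[of ?u] False by simp
 qed
 have "y + (e / 2) *R u \<in> ball y e" using e u by (simp add: dist_norm)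
 then have "y + (e / 2) *R u \<in> U" using e by blast
 from diameter_bounded_bound[OF assms(2) this assms(3)]
 have "norm (y + (e / 2) *R u - x) <= diameter U" by (simp add: dist_norm)
 then show "y \<in> ball x (diameter U)" using u e by (simp add: dist_norm norm_minus_commute)
qed

lemma Morrey_bound_imp_weak_Lp_bound:
 assumes "open U" "bounded U" "Morrey_bound p la U f C"
 shows "weak_Lp_bound p U f (C * diameter U powr (la / p))"
proof (cases "U = {}")
 case True
 then show ?thesis using assms(3) by (auto simp: weak_Lp_bound_def Morrey_bound_def)
next
 case False
 then obtain x where x: "x \<in> U" by auto
 have "x \<in> ball x (diameter U)" using subset_ball_diameter[OF assms(1,2) x] x by auto
 moreover have "ball x (diameter U) \<inter> U = U" using subset_ball_diameter[OF assms(1,2) x] by auto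
 ultimately show ?thesis using assms(3) x unfolding Morrey_bound_def
  by (metis centre_in_ball greaterThanAtMost_iff order_refl)
qed

lemma weak_MorreyI:
 assumes "open U" "bounded U" "Morrey_bound p la U f C" "f \<in> borel_measurable (lebesgue_on U)"
 shows "f \<in> weak_Morrey p la U"
proof -
 have "weak_Lp_norm p U f < \<infinity>"
  using weak_Lp_norm_le[OF Morrey_bound_imp_weak_Lp_bound[OF assms(1-3)]] by (rule le_less_trans) simp
 moreover have "weak_Morrey_norm p la U f < \<infinity>"
  using weak_Morrey_norm_le[OF assms(3)] by (rule le_less_trans) simp
 ultimately show ?thesis using assms(4) by (simp add: weak_Morrey_def)
qed

lemma Morrey_bound_mono:
 assumes "Morrey_bound p la U f C" "C <= D" "p >= 0"
 shows "Morrey_bound p la U f D"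
 unfolding Morrey_bound_def
proof (intro conjI ballI)
 show "0 <= D" using assms by (auto simp: Morrey_bound_def)
 fix x r assume xr: "x \<in> U" "r \<in> {0<..diameter U}"
 have "ennreal ((C * r powr (la / p) / t) powr p) <= ennreal ((D * r powr (la / p) / t) powr p)" if "t > 0" for t
  using assms that by (intro ennreal_leI powr_mono2 divide_right_mono mult_right_mono)
   (auto simp: Morrey_bound_def)
 moreover have "weak_Lp_bound p (ball x r \<inter> U) f (C * r powr (la / p))"
  using assms(1) xr by (simp add: Morrey_bound_def)
 ultimately show "weak_Lp_bound p (ball x r \<inter> U) f (D * r powr (la / p))"
  using \<open>0 <= D\<close> unfolding weak_Lp_bound_def by (meson mult_nonneg_nonneg order_trans powr_ge_zero)
qed

text \<open>Where |f| exceeds t, one of the N functions \<open>g i\<close> exceeds t / (L N) in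
  norm. The union bound costs a factor N in measure, and N <= N^p for p >= 1 turns it into a second
  factor N of the constant; hence the square.\<close>

lemma weak_Lp_bound_dominated:
 fixes f :: "real^'n => 'b::euclidean_space" and g :: "'i => real^'n => 'c::euclidean_space"
 assumes I: "finite I" "I ~= {}" and L: "L > 0" and p: "p >= 1"
  and g: "!!i. i \<in> I ==> g i \<in> borel_measurable (lebesgue_on S)" "!!i. i \<in> I ==> weak_Lp_bound p S (g i) C"
  and S: "S \<in> sets lebesgue"
  and le: "AE x in lebesgue. x \<in> S --> norm (f x) <= L * (\<Sum>i\<in>I. norm (g i x))"
 shows "weak_Lp_bound p S f (L * real (card I)^2 * C)"
 unfolding weak_Lp_bound_def
proof (intro conjI allI impI)
 define N where "N = real (card I)"
 have N: "N >= 1" using I by (simp add: N_def Suc_le_eq card_gt_0_iff)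
 have C: "C >= 0" using g(2) I by (auto simp: weak_Lp_bound_def)
 show "0 <= L * real (card I)^2 * C" using L C by simp
 fix t :: real assume t: "t > 0"
 let ?G = "%i. {x \<in> S. t / (L * N) < norm (g i x)}"
 have mG: "?G i \<in> sets lebesgue" if "i \<in> I" for i
 proof -
  have "{x \<in> space (lebesgue_on S). t / (L * N) < norm (g i x)} \<in> sets (lebesgue_on S)"
   using g(1)[OF that] by measurable
  then show ?thesis using S by (auto simp: sets_restrict_space_iff)
 qed
 have "emeasure lebesgue {x \<in> S. t < norm (f x)} <= emeasure lebesgue (\<Union>i\<in>I. ?G i)"
 proof (rule emeasure_mono_AE)
  show "AE x in lebesgue. x \<in> {x \<in> S. t < norm (f x)} --> x \<in> (\<Union>i\<in>I. ?G i)"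
   using le
  proof eventually_elim
   case (elim x)
   show ?case
   proof (intro impI, rule ccontr)
    assume x: "x \<in> {x \<in> S. t < norm (f x)}" "x \<notin> (\<Union>i\<in>I. ?G i)"
    then have "(\<Sum>i\<in>I. norm (g i x)) <= (\<Sum>i\<in>I. t / (L * N))" by (intro sum_mono) auto
    also have "... = t / L" using N by (simp add: N_def)
    finally have "L * (\<Sum>i\<in>I. norm (g i x)) <= t" using L by (simp add: field_simps)
    then show False using elim x by auto
   qed
  qed
  show "(\<Union>i\<in>I. ?G i) \<in> sets lebesgue" using I mG by (intro sets.finite_UN) auto
 qed
 also have "... <= (\<Sum>i\<in>I. emeasure lebesgue (?G i))"
  by (rule emeasure_subadditive_finite) (use I mG in auto)
 also have "... <= (\<Sum>i\<in>I. ennreal ((C / (t / (L * N))) powr p))"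
 proof (rule sum_mono)
  fix i assume "i \<in> I"
  moreover have "t / (L * N) > 0" using t L N by simp
  ultimately show "emeasure lebesgue (?G i) <= ennreal ((C / (t / (L * N))) powr p)"
   using g(2) unfolding weak_Lp_bound_def by blast
 qed
 also have "... = ennreal (N * (C / (t / (L * N))) powr p)"
  by (simp add: N_def ennreal_mult'' ennreal_of_nat_eq_real_of_nat)
 also have "... <= ennreal (N powr p * (C / (t / (L * N))) powr p)"
  using N p powr_mono[of 1 p N] by (intro ennreal_leI mult_right_mono) auto
 also have "N powr p * (C / (t / (L * N))) powr p = (L * real (card I)^2 * C / t) powr p"
  using N C L t by (simp add: N_def[symmetric] power2_eq_square mult_ac flip: powr_mult)
 finally show "emeasure lebesgue {x \<in> S. t < norm (f x)} <= ennreal ((L * real (card I)^2 * C / t) powr p)" .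
qed

lemma Morrey_bound_dominated:
 fixes f :: "real^'n => 'b::euclidean_space" and g :: "'i => real^'n => 'c::euclidean_space"
 assumes I: "finite I" "I ~= {}" and L: "L > 0" and p: "p >= 1"
  and g: "!!i. i \<in> I ==> g i \<in> borel_measurable (lebesgue_on U)" "!!i. i \<in> I ==> Morrey_bound p la U (g i) C"
  and U: "open U"
  and le: "AE x in lebesgue. x \<in> U --> norm (f x) <= L * (\<Sum>i\<in>I. norm (g i x))"
 shows "Morrey_bound p la U f (L * real (card I)^2 * C)"
 unfolding Morrey_bound_def
proof (intro conjI ballI)
 have C: "C >= 0" using g(2) I by (auto simp: Morrey_bound_def)
 show "0 <= L * real (card I)^2 * C" using L C by simp
 fix x r assume xr: "x \<in> U" "r \<in> {0<..diameter U}"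
 have S: "ball x r \<inter> U \<in> sets lebesgue" using U by auto
 have "weak_Lp_bound p (ball x r \<inter> U) f (L * real (card I)^2 * (C * r powr (la / p)))"
 proof (rule weak_Lp_bound_dominated[OF I L p _ _ S])
  show "g i \<in> borel_measurable (lebesgue_on (ball x r \<inter> U))" if "i \<in> I" for i
   using measurable_restrict_mono[OF g(1)[OF that]] by auto
  show "AE x' in lebesgue. x' \<in> ball x r \<inter> U --> norm (f x') <= L * (\<Sum>i\<in>I. norm (g i x'))"
   using le by eventually_elim auto
 qed (use g(2) xr in \<open>auto simp: Morrey_bound_def\<close>)
 then show "weak_Lp_bound p (ball x r \<inter> U) f (L * real (card I)^2 * C * r powr (la / p))"
  by (simp add: mult.assoc)
qed

text \<open>A ball of radius r has volume w r^n = w r^(n-p) r^p, and r <= diameter U makes r^p a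
  constant. Levels t >= B are exceeded only on null sets, and for t < B the factor B / t exceeds 1
  and may be inserted.\<close>

lemma Morrey_bound_bounded:
 fixes f :: "real^'n => 'b::euclidean_space"
 assumes p: "p >= 1" and U: "open U" "bounded U" and B: "B >= 0"
  and le: "AE x in lebesgue. x \<in> U --> norm (f x) <= B"
 shows "Morrey_bound p (real CARD('n) - p) U f (B * diameter U * (unit_ball_vol (real CARD('n)) + 1))"
 unfolding Morrey_bound_def
proof (intro conjI ballI)
 let ?n = "real CARD('n)"
 define w where "w = unit_ball_vol ?n"
 have w: "w >= 0" by (simp add: w_def)
 \<comment> \<open>The base \<open>w + 1\<close> is at least 1, which gives w <= (w + 1)^p even when
   w < 1.\<close>
 define C where "C = B * diameter U * (w + 1)"
 have C: "0 <= C" using B w by (simp add: C_def diameter_ge_0[OF U(2)])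
 then show "0 <= B * diameter U * (unit_ball_vol ?n + 1)" by (simp add: C_def w_def)
 fix x r assume xr: "x \<in> U" "r \<in> {0<..diameter U}"
 have "weak_Lp_bound p (ball x r \<inter> U) f (C * r powr ((?n - p) / p))"
  unfolding weak_Lp_bound_def
 proof (intro conjI allI impI)
  show "0 <= C * r powr ((?n - p) / p)" using C by simp
  fix t :: real assume t: "t > 0"
  show "emeasure lebesgue {x' \<in> ball x r \<inter> U. t < norm (f x')} <= ennreal ((C * r powr ((?n - p) / p) / t) powr p)"
  proof (cases "t < B")
   case False
   have "emeasure lebesgue {x' \<in> ball x r \<inter> U. t < norm (f x')} <= emeasure lebesgue ({} :: (real^'n) set)"
    by (rule emeasure_mono_AE) (use le False in \<open>auto elim!: eventually_mono\<close>)
   then show ?thesis by simp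
  next
   case True
   have "w * r powr ?n = w * (r powr (?n - p) * r powr p)" using xr by (simp flip: powr_add)
   also have "... <= (w + 1) powr p * (r powr (?n - p) * (B * diameter U / t) powr p)"
   proof -
    have "w <= (w + 1) powr 1" using w by simp
    also have "... <= (w + 1) powr p" using w p by (intro powr_mono) auto
    finally have 1: "w <= (w + 1) powr p" .
    have "r * 1 <= diameter U * (B / t)" using xr True t by (intro mult_mono) auto
    then have "r powr p <= (B * diameter U / t) powr p"
     using xr p by (intro powr_mono2) (auto simp: mult.commute)
    then show ?thesis by (intro mult_mono[OF 1 mult_left_mono]) auto
   qed
   also have "r powr (?n - p) = (r powr ((?n - p) / p)) powr p" using p by (simp add: powr_powr)
   also have "(w + 1) powr p * ((r powr ((?n - p) / p)) powr p * (B * diameter U / t) powr p) = (C * r powr ((?n - p) / p) / t) powr p"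
    using w B t diameter_ge_0[OF U(2)] by (simp add: C_def mult_ac flip: powr_mult)
   finally have *: "w * r powr ?n <= (C * r powr ((?n - p) / p) / t) powr p" .
   have "emeasure lebesgue {x' \<in> ball x r \<inter> U. t < norm (f x')} <= emeasure lebesgue (ball x r)"
    by (rule emeasure_mono) auto
   also have "... = ennreal (w * r powr ?n)"
    using xr by (simp add: emeasure_ball w_def powr_realpow)
   also have "... <= ennreal ((C * r powr ((?n - p) / p) / t) powr p)" using * by (rule ennreal_leI)
   finally show ?thesis .
  qed
 qed
 then show "weak_Lp_bound p (ball x r \<inter> U) f (B * diameter U * (unit_ball_vol ?n + 1) * r powr ((?n - p) / p))"
  by (simp add: C_def w_def)
qed

section \<open>Layer-cake estimates for weak Lebesgue functions\<close>

text \<open>The positive part of \<open>phi x - N\<close> is the length of the interval from N to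
  \<open>phi x\<close>; Fubini does the rest. Level N = 0 gives integrals, while large N gives the
  tails that measure the error of truncating at N.\<close>

lemma layer_cake:
 assumes "sigma_finite_measure M"
  and [measurable]: "phi \<in> borel_measurable M" "w \<in> borel_measurable M"
 shows "(\<integral>\<^sup>+x. ennreal (phi x - N) * w x \<partial>M) =
  (\<integral>\<^sup>+t. indicator {N<..} t * (\<integral>\<^sup>+x. indicator {x \<in> space M. t < phi x} x * w x \<partial>M) \<partial>lborel)"
proof -
 interpret P: pair_sigma_finite M lborel
  by (intro pair_sigma_finite.intro assms sigma_finite_lborel)
 have lborel_Ioo: "emeasure lborel {N<..<phi x} = ennreal (phi x - N)" for x
  by (cases "N <= phi x") (auto simp: ennreal_neg)
 let ?F = "%x t. indicator {N<..<phi x} t * w x"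
 have [measurable]: "(%(x, t). ?F x t) \<in> borel_measurable (M \<Otimes>\<^sub>M lborel)"
  unfolding indicator_def greaterThanLessThan_iff by measurable
 have "(\<integral>\<^sup>+x. ennreal (phi x - N) * w x \<partial>M) = (\<integral>\<^sup>+x. (\<integral>\<^sup>+t. ?F x t \<partial>lborel) \<partial>M)"
  by (intro nn_integral_cong) (auto simp: nn_integral_multc ennreal_neg lborel_Ioo)
 also have "... = (\<integral>\<^sup>+t. (\<integral>\<^sup>+x. ?F x t \<partial>M) \<partial>lborel)"
  by (rule P.Fubini'[symmetric]) measurable
 also have "... = (\<integral>\<^sup>+t. (\<integral>\<^sup>+x. indicator {N<..} t * (indicator {x \<in> space M. t < phi x} x * w x) \<partial>M) \<partial>lborel)"
  by (intro nn_integral_cong) (auto simp: indicator_def)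
 also have "... = (\<integral>\<^sup>+t. indicator {N<..} t * (\<integral>\<^sup>+x. indicator {x \<in> space M. t < phi x} x * w x \<partial>M) \<partial>lborel)"
  by (intro nn_integral_cong nn_integral_cmult) measurable
 finally show ?thesis .
qed

text \<open>Within \<open>A\<close>, the set where |f| > t has measure at most the minimum of |A|
  and (C / t)^p. Integrating this minimum over t produces the factor p / (p - 1).\<close>

lemma weak_Lp_integral_bound:
 fixes f :: "real^'n => 'b::euclidean_space"
 assumes f: "weak_Lp_bound p S f C" "f \<in> borel_measurable (lebesgue_on S)" and S: "S \<in> lmeasurable"
  and p: "p > 1" and A: "A \<in> sets (lebesgue_on S)"
 shows "(\<integral>\<^sup>+x. indicator A x * ennreal (norm (f x)) \<partial>lebesgue_on S) <= ennreal (C * (p / (p - 1)) * measure lebesgue A powr (1 - 1 / p))"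
proof -
 note [measurable] = f(2) A
 have C: "C >= 0" using f by (auto simp: weak_Lp_bound_def)
 have S': "S \<in> sets lebesgue" using S by auto
 have A': "A \<subseteq> S" "A \<in> sets lebesgue" using A S' by (auto simp: sets_restrict_space_iff)
 then have Al: "A \<in> lmeasurable" by (intro fmeasurableI2[OF S])
 define a where "a = measure lebesgue A"
 have ema: "emeasure lebesgue A = ennreal a" using Al by (simp add: a_def emeasure_eq_measure2)
 have a0: "a >= 0" by (simp add: a_def)
 interpret finite_measure "lebesgue_on S" using S by (rule finite_measure_lebesgue_on)
 define m where "m = (%t. \<integral>\<^sup>+x. indicator {x \<in> space (lebesgue_on S). t < norm (f x)} x * indicator A x \<partial>lebesgue_on S)"
 have eq: "(\<integral>\<^sup>+x. indicator A x * ennreal (norm (f x)) \<partial>lebesgue_on S) = (\<integral>\<^sup>+t. indicator {0<..} t * m t \<partial>lborel)"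
  using layer_cake[OF sigma_finite_measure_axioms, of "%x. norm (f x)" "indicator A" 0] by (simp add: m_def mult.commute)
 have m_eq: "m t = emeasure lebesgue ({x \<in> S. t < norm (f x)} \<inter> A)" for t
 proof -
  have "m t = (\<integral>\<^sup>+x. indicator ({x \<in> space (lebesgue_on S). t < norm (f x)} \<inter> A) x \<partial>lebesgue_on S)"
   unfolding m_def by (intro nn_integral_cong) (auto simp: indicator_def)
  also have "... = emeasure (lebesgue_on S) ({x \<in> space (lebesgue_on S). t < norm (f x)} \<inter> A)"
   by (rule nn_integral_indicator) measurable
  also have "... = emeasure lebesgue ({x \<in> S. t < norm (f x)} \<inter> A)"
   using S' A' by (subst emeasure_restrict_space) auto
  finally show ?thesis .
 qed
 have m1: "m t <= ennreal a" for t
  unfolding m_eq ema[symmetric] using A' by (intro emeasure_mono) auto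
 have mS: "{x \<in> S. t < norm (f x)} \<in> sets lebesgue" for t
 proof -
  have "{x \<in> space (lebesgue_on S). t < norm (f x)} \<in> sets (lebesgue_on S)" by measurable
  then show ?thesis using S' by (auto simp: sets_restrict_space_iff)
 qed
 have m2: "m t <= ennreal ((C / t) powr p)" if "t > 0" for t
 proof -
  have "m t <= emeasure lebesgue {x \<in> S. t < norm (f x)}"
   unfolding m_eq by (intro emeasure_mono mS) auto
  then show ?thesis using f(1) that by (auto simp: weak_Lp_bound_def intro: order_trans)
 qed
 show ?thesis
 proof (cases "a = 0 \<or> C = 0")
  case True
  then have "indicator {0<..} t * m t = 0" for t
   using m1[of t] m2[of t] p by (cases "t > 0") auto
  then have "(%t. indicator {0<..} t * m t) = (%t. 0)" by blast
  then show ?thesis unfolding eq by simp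
 next
  case False
  then have aC: "a > 0" "C > 0" using a0 C by auto
  \<comment> \<open>The level at which the two bounds \<open>a\<close> and
    \<open>(C / t) powr p\<close> coincide.\<close>
  define T where "T = C * a powr (- 1 / p)"
  have T: "T > 0" using aC by (simp add: T_def)
  let ?F = "%t. - (C powr p / (p - 1)) * t powr (1 - p)"
  have FTC: "(\<integral>\<^sup>+t. ennreal (C powr p * t powr (- p)) * indicator {T..} t \<partial>lborel) = ennreal (0 - ?F T)"
  proof (rule nn_integral_FTC_atLeast)
   fix t assume "T <= t"
   then have "t > 0" using T by simp
   from DERIV_cmult[OF has_real_derivative_powr[OF this, of "1 - p"], of "- (C powr p / (p - 1))"]
   show "(?F has_real_derivative C powr p * t powr (- p)) (at t)"
   proof (rule DERIV_cong)
    show "- (C powr p / (p - 1)) * ((1 - p) * t powr (1 - p - 1)) = C powr p * t powr - p"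
     using p by (simp add: divide_simps) (simp add: algebra_simps)
   qed
  next
   have "(?F \<longlongrightarrow> - (C powr p / (p - 1)) * 0) at_top"
    using p by (intro tendsto_intros tendsto_neg_powr filterlim_ident) auto
   then show "(?F \<longlongrightarrow> 0) at_top" by simp
  qed auto
  have "(\<integral>\<^sup>+t. indicator {0<..} t * m t \<partial>lborel) \<le>
    (\<integral>\<^sup>+t. ennreal a * indicator {0..T} t + ennreal (C powr p * t powr (- p)) * indicator {T..} t \<partial>lborel)"
  proof (rule nn_integral_mono)
   fix t :: real
   consider "t <= 0" | "0 < t" "t <= T" | "T < t" by linarith
   then show "indicator {0<..} t * m t <= ennreal a * indicator {0..T} t + ennreal (C powr p * t powr (- p)) * indicator {T..} t"
   proof cases
    case 2
    then have "indicator {0<..} t * m t <= ennreal a * indicator {0..T} t" using m1[of t] by simp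
    then show ?thesis by (rule add_increasing2[rotated]) simp
   next
    case 3
    then have "(C / t) powr p = C powr p * t powr (- p)" using T aC by (simp add: powr_divide powr_minus field_simps)
    then have "m t <= ennreal (C powr p * t powr (- p))" using m2[of t] 3 T by simp
    then show ?thesis using 3 T by simp
   qed auto
  qed
  also have "... = (\<integral>\<^sup>+t. ennreal a * indicator {0..T} t \<partial>lborel) + ennreal (0 - ?F T)"
   by (subst nn_integral_add) (auto simp: FTC)
  also have "... = ennreal (a * T) + ennreal (0 - ?F T)"
   using T a0 by (simp add: nn_integral_cmult_indicator ennreal_mult'')
  also have "... = ennreal (a * T + C powr p * T powr (1 - p) / (p - 1))"
   using T a0 p by (simp flip: ennreal_plus)
  also have "a * T + C powr p * T powr (1 - p) / (p - 1) = C * (p / (p - 1)) * a powr (1 - 1 / p)"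
  proof -
   have 1: "a * T = C * a powr (1 - 1 / p)"
    using aC by (simp add: T_def powr_diff powr_minus field_simps)
   have "C powr p * T powr (1 - p) = (C powr p * C powr (1 - p)) * (a powr (- 1 / p)) powr (1 - p)"
    using aC by (simp add: T_def powr_mult)
   also have "... = C * a powr (1 - 1 / p)"
   proof -
    have "- 1 / p * (1 - p) = 1 - 1 / p" using p by (simp add: field_simps)
    then show ?thesis using aC by (simp only: powr_powr) (simp flip: powr_add)
   qed
   finally have 2: "C powr p * T powr (1 - p) = C * a powr (1 - 1 / p)" .
   show ?thesis unfolding 1 2 using p by (simp add: field_simps)
  qed
  finally show ?thesis using eq by (simp add: a_def)
 qed
qed

text \<open>The square of |f| lies in weak L^(p/2) with constant C^2, and p > 2 makes this exponent
  larger than 1, so the preceding integral bound applies with \<open>A = S\<close>.\<close>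

lemma weak_Lp_square_bound:
 fixes f :: "real^'n => 'b::euclidean_space"
 assumes f: "weak_Lp_bound p S f C" "f \<in> borel_measurable (lebesgue_on S)" and S: "S \<in> lmeasurable" and p: "p > 2"
 shows "(\<integral>\<^sup>+x. ennreal ((norm (f x))^2) \<partial>lebesgue_on S) \<le>
  ennreal (C^2 * (p / 2 / (p / 2 - 1)) * measure lebesgue S powr (1 - 2 / p))"
proof -
 have C: "C >= 0" using f by (auto simp: weak_Lp_bound_def)
 have *: "weak_Lp_bound (p / 2) S (%x. (norm (f x))^2) (C^2)"
  unfolding weak_Lp_bound_def
 proof (intro conjI allI impI)
  fix t :: real assume t: "t > 0"
  have "{x \<in> S. t < norm ((norm (f x))^2)} = {x \<in> S. sqrt t < norm (f x)}"
   using real_sqrt_less_iff[of t "(norm (f x))\<^sup>2" for x] by simp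
  also have "emeasure lebesgue ... <= ennreal ((C / sqrt t) powr p)"
   using f(1) t by (auto simp: weak_Lp_bound_def)
  also have "(C / sqrt t) powr p = (C^2 / t) powr (p / 2)"
  proof -
   have "(C / sqrt t) powr p = ((C / sqrt t) powr 2) powr (p / 2)" by (simp add: powr_powr)
   also have "(C / sqrt t) powr 2 = C^2 / t" using C t by (simp add: power_divide)
   finally show ?thesis .
  qed
  finally show "emeasure lebesgue {x \<in> S. t < norm ((norm (f x))^2)} <= ennreal ((C^2 / t) powr (p / 2))" .
 qed auto
 have "space (lebesgue_on S) \<in> sets (lebesgue_on S)" by (rule sets.top)
 then have SS: "S \<in> sets (lebesgue_on S)" by simp
 have "(\<integral>\<^sup>+x. ennreal ((norm (f x))^2) \<partial>lebesgue_on S) = (\<integral>\<^sup>+x. indicator S x * ennreal (norm ((norm (f x))^2)) \<partial>lebesgue_on S)"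
  by (intro nn_integral_cong) auto
 also have "... <= ennreal (C^2 * (p / 2 / (p / 2 - 1)) * measure lebesgue S powr (1 - 1 / (p / 2)))"
  by (rule weak_Lp_integral_bound[OF * _ S _ SS]) (use f(2) p in \<open>auto intro!: borel_measurable_power borel_measurable_norm\<close>)
 finally show ?thesis by simp
qed

lemma borel_measurable_distribution:
 fixes phi :: "real^'n => real"
 assumes S: "S \<in> lmeasurable" and [measurable]: "phi \<in> borel_measurable (lebesgue_on S)"
 shows "(%t. measure lebesgue {x \<in> S. t < \<bar>phi x\<bar>}) \<in> borel_measurable borel"
proof -
 have "antimono (%t. measure lebesgue {x \<in> S. t < \<bar>phi x\<bar>})"
 proof (rule antimonoI)
  fix s t :: real assume "s <= t"
  have l: "{x \<in> S. t < \<bar>phi x\<bar>} \<in> lmeasurable" for t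
  proof -
   have "{x \<in> space (lebesgue_on S). t < \<bar>phi x\<bar>} \<in> sets (lebesgue_on S)" by measurable
   then have "{x \<in> S. t < \<bar>phi x\<bar>} \<in> sets lebesgue" using S by (auto simp: sets_restrict_space_iff)
   then show ?thesis by (intro fmeasurableI2[OF S]) auto
  qed
  show "measure lebesgue {x \<in> S. t < \<bar>phi x\<bar>} <= measure lebesgue {x \<in> S. s < \<bar>phi x\<bar>}"
   using \<open>s <= t\<close> l[of s] l[of t] by (intro measure_mono_fmeasurable) auto
 qed
 then have "mono (%t. - measure lebesgue {x \<in> S. t < \<bar>phi x\<bar>})" by (simp add: monotone_def)
 then have "(%t. - measure lebesgue {x \<in> S. t < \<bar>phi x\<bar>}) \<in> borel_measurable borel" by (rule borel_measurable_mono)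
 then show "(%t. measure lebesgue {x \<in> S. t < \<bar>phi x\<bar>}) \<in> borel_measurable borel"
  using borel_measurable_uminus by fastforce
qed

text \<open>Each layer where |phi| > t is estimated by \<open>weak_Lp_integral_bound\<close>. The
  part of the pairing above level N is thus bounded by the tail of the Lorentz integral of
  \<open>phi\<close>, uniformly over all \<open>f\<close> with the same weak constant.\<close>

lemma weak_Lp_Lorentz_bound:
 fixes f :: "real^'n => 'b::euclidean_space"
 assumes f: "weak_Lp_bound p S f C" "f \<in> borel_measurable (lebesgue_on S)" and S: "S \<in> lmeasurable"
  and p: "p > 1" and phi[measurable]: "phi \<in> borel_measurable (lebesgue_on S)"
 shows "(\<integral>\<^sup>+x. ennreal (\<bar>phi x\<bar> - N) * ennreal (norm (f x)) \<partial>lebesgue_on S) \<le>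
  ennreal (C * (p / (p - 1))) * (\<integral>\<^sup>+t. indicator {N<..} t * ennreal (measure lebesgue {x \<in> S. t < \<bar>phi x\<bar>} powr (1 - 1 / p)) \<partial>lborel)"
proof -
 note [measurable] = f(2)
 have C: "C >= 0" using f by (auto simp: weak_Lp_bound_def)
 interpret finite_measure "lebesgue_on S" using S by (rule finite_measure_lebesgue_on)
 let ?A = "%t. {x \<in> space (lebesgue_on S). t < \<bar>phi x\<bar>}"
 have mA: "?A t \<in> sets (lebesgue_on S)" for t by measurable
 have "(\<integral>\<^sup>+x. ennreal (\<bar>phi x\<bar> - N) * ennreal (norm (f x)) \<partial>lebesgue_on S) =
   (\<integral>\<^sup>+t. indicator {N<..} t * (\<integral>\<^sup>+x. indicator (?A t) x * ennreal (norm (f x)) \<partial>lebesgue_on S) \<partial>lborel)"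
  by (rule layer_cake[OF sigma_finite_measure_axioms]) measurable
 also have "... <= (\<integral>\<^sup>+t. indicator {N<..} t * ennreal (C * (p / (p - 1)) * measure lebesgue (?A t) powr (1 - 1 / p)) \<partial>lborel)"
  by (intro nn_integral_mono mult_left_mono weak_Lp_integral_bound[OF f S p mA]) auto
 also have "... = (\<integral>\<^sup>+t. ennreal (C * (p / (p - 1))) * (indicator {N<..} t * ennreal (measure lebesgue {x \<in> S. t < \<bar>phi x\<bar>} powr (1 - 1 / p))) \<partial>lborel)"
 proof (rule nn_integral_cong)
  fix t
  show "indicator {N<..} t * ennreal (C * (p / (p - 1)) * measure lebesgue (?A t) powr (1 - 1 / p)) =
   ennreal (C * (p / (p - 1))) * (indicator {N<..} t * ennreal (measure lebesgue {x \<in> S. t < \<bar>phi x\<bar>} powr (1 - 1 / p)))"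
   by (subst ennreal_mult'') (simp_all add: mult_ac)
 qed
 also have "... = ennreal (C * (p / (p - 1))) * (\<integral>\<^sup>+t. indicator {N<..} t * ennreal (measure lebesgue {x \<in> S. t < \<bar>phi x\<bar>} powr (1 - 1 / p)) \<partial>lborel)"
 proof (rule nn_integral_cmult)
  note [measurable] = borel_measurable_distribution[OF S phi]
  show "(%t. indicator {N<..} t * ennreal (measure lebesgue {x \<in> S. t < \<bar>phi x\<bar>} powr (1 - 1 / p))) \<in> borel_measurable lborel"
   by measurable
 qed
 finally show ?thesis .
qed

section \<open>Weak compactness\<close>

lemma tendsto_of_approx:
 fixes a :: "nat => 'a::real_normed_vector"
 assumes "!!e. e > 0 ==> \<exists>b L'. b \<longlonglongrightarrow> L' & (\<forall>m. norm (a m - b m) <= e) & norm (L - L') <= e"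
 shows "a \<longlonglongrightarrow> L"
proof (rule LIMSEQ_I)
 fix e :: real assume "e > 0"
 then obtain b L' where b: "b \<longlonglongrightarrow> L'" "!!m. norm (a m - b m) <= e / 4" "norm (L - L') <= e / 4"
  using assms[of "e / 4"] by auto
 obtain N where N: "!!m. m >= N ==> norm (b m - L') < e / 4"
  using LIMSEQ_D[OF b(1), of "e / 4"] \<open>e > 0\<close> by auto
 have "norm (a m - L) < e" if "m >= N" for m
 proof -
  have "norm ((a m - b m) + (b m - L') - (L - L')) <= e / 4 + e / 4 + e / 4"
   using b(2)[of m] b(3) N[OF that]
   by (intro order_trans[OF norm_triangle_ineq4 add_mono[OF order_trans[OF norm_triangle_ineq add_mono]]]) auto
  then show ?thesis using \<open>e > 0\<close> by simp
 qed
 then show "\<exists>N. \<forall>m\<ge>N. norm (a m - L) < e" by blast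
qed

lemma convergent_of_approx:
 fixes a :: "nat => real"
 assumes "!!e. e > 0 ==> \<exists>b. convergent b & (\<forall>m. \<bar>a m - b m\<bar> <= e)"
 shows "convergent a"
 unfolding Cauchy_convergent_iff[symmetric]
proof (rule CauchyI)
 fix e :: real assume "e > 0"
 then obtain b where b: "convergent b" "!!m. \<bar>a m - b m\<bar> <= e / 4"
  using assms[of "e / 4"] by auto
 obtain N where N: "!!m n. m >= N ==> n >= N ==> \<bar>b m - b n\<bar> < e / 4"
  using CauchyD[OF convergent_Cauchy[OF b(1)], of "e / 4"] \<open>e > 0\<close> by auto
 have "norm (a m - a n) < e" if "m >= N" "n >= N" for m n
  using b(2)[of m] b(2)[of n] N[OF that] \<open>e > 0\<close> by (simp add: abs_if split: if_splits)
 then show "\<exists>M. \<forall>m\<ge>M. \<forall>n\<ge>M. norm (a m - a n) < e" by blast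
qed

lemma diagonal_convergent:
 fixes a :: "nat => nat => real"
 assumes "!!n. bounded (range (a n))"
 obtains r where "strict_mono r" "!!n. convergent (%m. a n (r m))"
proof -
 interpret subseqs "%n s. convergent (%m. a n (s m))"
 proof
  fix n and s :: "nat => nat" assume "strict_mono s"
  have "bounded (range (%m. a n (s m)))" by (rule bounded_subset[OF assms[of n]]) auto
  then obtain l r where "strict_mono r" "((%m. a n (s m)) \<circ> r) \<longlonglongrightarrow> l"
   using bounded_imp_convergent_subsequence by blast
  then show "\<exists>r'. strict_mono r' & convergent (%m. a n ((s \<circ> r') m))"
   by (auto simp: convergent_def o_def)
 qed
 have "convergent (%m. a n (diagseq m))" for n
 proof -
  have "convergent (%m. a n ((diagseq \<circ> (+) (Suc n)) m))"
  proof (rule diagseq_holds)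
   fix r s :: "nat => nat" and n assume "strict_mono r" "convergent (%m. a n (s m))"
   then show "convergent (%m. a n ((s \<circ> r) m))"
    using convergent_subseq_convergent[of "%m. a n (s m)" r] by (simp add: o_def)
  qed
  then show ?thesis
   using convergent_ignore_initial_segment[of "%m. a n (diagseq m)" "Suc n"] by (simp add: o_def add.commute)
 qed
 with subseq_diagseq show ?thesis by (rule that)
qed

text \<open>Countability permits a diagonal subsequence, and intersection stability extends the
  resulting convergence to all Borel sets. The finite intersections of members of a countable basis
  offer both.\<close>

lemma countable_borel_generator:
 obtains G :: "'a::euclidean_space set set" where "countable G" "Int_stable G" "UNIV \<in> G"
  "sets borel = sigma_sets UNIV G"
proof -
 obtain B :: "'a set set" where B: "countable B" "topological_basis B" using ex_countable_basis by blast
 let ?G = "Inter ` {F. finite F & F \<subseteq> B}"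
 have "countable ?G" using B(1) by (intro countable_image countable_Collect_finite_subset)
 moreover have "Int_stable ?G"
  unfolding Int_stable_def
 proof safe
  fix F F' assume "finite F" "F \<subseteq> B" "finite F'" "F' \<subseteq> B"
  then show "\<Inter>F \<inter> \<Inter>F' \<in> ?G" by (intro image_eqI[of _ _ "F \<union> F'"]) auto
 qed
 moreover have "UNIV \<in> ?G" by (rule image_eqI[of _ _ "{}"]) auto
 moreover have "sets borel = sigma_sets UNIV ?G"
 proof
  have "B \<subseteq> ?G"
  proof
   fix X assume "X \<in> B" then show "X \<in> ?G" by (intro image_eqI[of _ _ "{X}"]) auto
  qed
  then show "sets borel \<subseteq> sigma_sets UNIV ?G"
   unfolding borel_eq_countable_basis[OF B] by (simp add: sets_measure_of sigma_sets_mono')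
  have "?G \<subseteq> sets borel"
   using topological_basis_open[OF B(2)] by (auto intro!: borel_open open_Inter)
  then show "sigma_sets UNIV ?G \<subseteq> sets borel"
   using sets.sigma_sets_subset[of ?G borel] by simp
 qed
 ultimately show ?thesis by (rule that)
qed

section \<open>Weak limits of square-bounded sequences on a finite measure space\<close>

text \<open>Square bounds on a finite measure give uniform integrability. Nonnegativity makes the
  limiting set function a measure, so vector-valued sequences are split into positive and negative
  parts of their components before this is applied.\<close>

locale square_bounded = finite_measure mu for mu :: "'a::euclidean_space measure" +
 fixes f :: "nat => 'a => real" and C :: real
 assumes sets_eq[measurable_cong]: "sets mu = sets borel"
  and meas[measurable]: "!!m. f m \<in> borel_measurable borel"
  and nonneg: "!!m x. 0 <= f m x"
  and sq: "!!m. (\<integral>\<^sup>+x. ennreal ((f m x)^2) \<partial>mu) <= ennreal C" and C: "C >= 0"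
begin

lemma space_eq[simp]: "space mu = UNIV"
 using sets_eq_imp_space_eq[OF sets_eq] by simp

lemma square_integrable: "integrable mu (%x. (f m x)^2)" and square_le: "(\<integral>x. (f m x)^2 \<partial>mu) <= C"
proof -
 show *: "integrable mu (%x. (f m x)^2)"
  using sq[of m] by (intro integrableI_nonneg) (auto intro: le_less_trans)
 have "ennreal (\<integral>x. (f m x)^2 \<partial>mu) <= ennreal C"
  using sq[of m] by (subst nn_integral_eq_integral[symmetric]) (auto intro: *)
 then show "(\<integral>x. (f m x)^2 \<partial>mu) <= C" using C by simp
qed

lemma AM_GM: "d > 0 ==> f m x <= d * (f m x)^2 + 1 / d"
proof -
 assume d: "d > 0"
 have "f m x * d <= (f m x * d)^2 + 1"
  using sum_squares_bound[of "f m x * d" 1] mult_nonneg_nonneg[OF nonneg[of m x] less_imp_le[OF d]] by simp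
 then have "f m x * d <= (d * (f m x)^2 + 1 / d) * d"
  using d by (simp add: power_mult_distrib power2_eq_square algebra_simps)
 then show ?thesis using d by (metis mult_le_cancel_right_pos)
qed

lemma f_integrable: "integrable mu (f m)"
 by (rule Bochner_Integration.integrable_bound[of _ "%x. (f m x)^2 + 1"])
  (use AM_GM[of 1 m] nonneg[of m] square_integrable[of m] in \<open>auto simp: abs_of_nonneg\<close>)

lemma psi_integrable:
 assumes "psi \<in> borel_measurable borel" "!!x. \<bar>psi x\<bar> <= B"
 shows "integrable mu (%x. psi x * f m x)"
 by (rule Bochner_Integration.integrable_bound[of _ "%x. B * f m x"])
  (use assms f_integrable[of m] nonneg[of m] order_trans[OF assms(2) abs_ge_self] in
   \<open>auto simp: abs_mult intro!: mult_right_mono\<close>)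

lemma ind_integrable: "A \<in> sets borel ==> integrable mu (%x. indicator A x * f m x)"
 by (rule psi_integrable[of _ 1]) (auto simp: indicator_def)

definition S where "S A m = (\<integral>x. indicator A x * f m x \<partial>mu)"

lemma S_nonneg: "0 <= S A m"
 unfolding S_def using nonneg by (intro integral_nonneg_AE) auto

lemma S_bound: "S A m <= C + measure mu UNIV"
proof -
 have "S A m <= (\<integral>x. (f m x)^2 + 1 \<partial>mu)"
  unfolding S_def
 proof (rule integral_mono')
  show "indicator A x * f m x <= (f m x)^2 + 1" for x
   using AM_GM[of 1 m x] nonneg[of m x] by (auto simp: indicator_def intro: add_nonneg_nonneg)
 qed (use square_integrable in \<open>auto intro: add_nonneg_nonneg\<close>)
 also have "... <= C + measure mu UNIV" using square_integrable[of m] square_le[of m] by simp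
 finally show ?thesis .
qed

text \<open>Uniform integrability from f <= k f^2 + 1 / k: the constant k is chosen so that the
  square term stays below e / 2, and a small measure of A then keeps the other term below e / 2 for
  every m.\<close>

lemma UI:
 assumes "e > 0"
 shows "\<exists>d>0. \<forall>A\<in>sets borel. measure mu A < d --> (\<forall>m. S A m <= e)"
proof -
 define k where "k = e / (2 * (C + 1))"
 have k: "k > 0" using assms C by (simp add: k_def)
 have "S A m <= e" if A: "A \<in> sets borel" "measure mu A < e * k / 2" for A m
 proof -
  have "S A m <= (\<integral>x. k * (f m x)^2 + indicator A x / k \<partial>mu)"
   unfolding S_def
  proof (rule integral_mono')
   show "indicator A x * f m x <= k * (f m x)^2 + indicator A x / k" for x
    using AM_GM[OF k, of m x] k by (auto simp: indicator_def)
   show "integrable mu (%x. k * (f m x)^2 + indicator A x / k)"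
    using square_integrable A sets_eq by (auto intro!: Bochner_Integration.integrable_add integrable_real_indicator simp: less_top[symmetric] emeasure_finite)
   show "0 <= k * (f m x)^2 + indicator A x / k" for x using k by auto
  qed
  also have "... = k * (\<integral>x. (f m x)^2 \<partial>mu) + measure mu A / k"
   using square_integrable A sets_eq by (subst Bochner_Integration.integral_add)
    (auto intro!: integrable_real_indicator simp: less_top[symmetric] emeasure_finite)
  also have "... <= k * C + e / 2"
   using k A square_le[of m] by (intro add_mono mult_left_mono) (auto simp: field_simps)
  also have "k * C <= e / 2" using C assms by (simp add: k_def field_simps)
  finally show ?thesis by simp
 qed
 then show ?thesis using k assms by (intro exI[of _ "e * k / 2"]) auto
qed

lemma S_compl: "A \<in> sets borel ==> B \<in> sets borel ==> B \<subseteq> A ==> S (A - B) m = S A m - S B m"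
proof -
 assume A: "A \<in> sets borel" "B \<in> sets borel" "B \<subseteq> A"
 have "S (A - B) m = (\<integral>x. indicator A x * f m x - indicator B x * f m x \<partial>mu)"
  unfolding S_def by (rule Bochner_Integration.integral_cong) (use A in \<open>auto simp: indicator_def\<close>)
 then show ?thesis
  unfolding S_def using Bochner_Integration.integral_diff[OF ind_integrable[OF A(1)] ind_integrable[OF A(2)], of m m] by simp
qed

lemma S_UN_finite:
 fixes N :: nat
 assumes "!!i. A i \<in> sets borel" "disjoint_family A"
 shows "S (\<Union>i<N. A i) m = (\<Sum>i<N. S (A i) m)"
proof -
 have "indicator (\<Union>i<N. A i) x = (\<Sum>i<N. indicator (A i) x :: real)" for x
  using assms(2) by (intro indicator_UN_disjoint) (auto simp: disjoint_family_on_def)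
 then have "S (\<Union>i<N. A i) m = (\<integral>x. (\<Sum>i<N. indicator (A i) x * f m x) \<partial>mu)"
  unfolding S_def by (simp add: sum_distrib_right)
 also have "... = (\<Sum>i<N. S (A i) m)"
  unfolding S_def by (rule Bochner_Integration.integral_sum) (auto intro!: ind_integrable assms)
 finally show ?thesis .
qed

text \<open>Smallness uniform in \<open>m\<close> is what permits the limit in \<open>m\<close> to
  be interchanged with a countable union.\<close>

lemma tail_small:
 assumes "!!i::nat. A i \<in> sets borel" "e > 0"
 shows "\<exists>N. \<forall>n\<ge>N. \<forall>m. S ((\<Union>i. A i) - (\<Union>i<n. A i)) m <= e"
proof -
 obtain d where d: "d > 0" "!!A m. A \<in> sets borel ==> measure mu A < d ==> S A m <= e"
  using UI[OF assms(2)] by blast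
 let ?T = "%n. (\<Union>i. A i) - (\<Union>i<n. A i)"
 have "(%n. measure mu (?T n)) \<longlonglongrightarrow> measure mu (\<Inter>n. ?T n)"
  by (rule finite_Lim_measure_decseq) (use assms sets_eq in \<open>auto simp: decseq_def\<close>)
 also have "(\<Inter>n. ?T n) = {}" by auto
 finally have "\<forall>\<^sub>F n in sequentially. measure mu (?T n) < d" using d(1) by (simp add: order_tendstoD(2))
 then obtain N where "!!n. n >= N ==> measure mu (?T n) < d" by (auto simp: eventually_sequentially)
 then show ?thesis using d(2) assms(1) by (intro exI[of _ N]) auto
qed

text \<open>The sets on which the integrals converge form a Dynkin system: a countable disjoint
  union is approximated by finite ones, uniformly along the sequence.\<close>

lemma convergent_sets:
 assumes G: "Int_stable G" "UNIV \<in> G" "sets borel = sigma_sets UNIV G"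
  and conv: "!!A. A \<in> G ==> convergent (S A)" and A: "A \<in> sets borel"
 shows "convergent (S A)"
proof -
 have "A \<in> sigma_sets UNIV G" using A G(3) by simp
 from G(1) Pow_UNIV[THEN equalityD2, THEN order_trans[OF subset_UNIV]] this show ?thesis
 proof (induction rule: sigma_sets_induct_disjoint)
  case (compl A)
  then have "A \<in> sets borel" using G(3) by simp
  then have "S (UNIV - A) = (%m. S UNIV m - S A m)" by (intro ext S_compl) auto
  then show ?case using compl conv[OF G(2)] by (simp add: convergent_diff)
 next
  case (union A)
  have A: "A i \<in> sets borel" for i using union G(3) by auto
  show ?case
  proof (rule convergent_of_approx)
   fix e :: real assume "e > 0"
   then obtain n where n: "!!m. S ((\<Union>i. A i) - (\<Union>i<n. A i)) m <= e" using tail_small[of A e] A by blast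
   have "convergent (S (\<Union>i<n. A i))"
    unfolding S_UN_finite[OF A union(1), of n, abs_def]
    using union(3) by (intro convergent_sum)
   moreover have "\<bar>S (\<Union>i. A i) m - S (\<Union>i<n. A i) m\<bar> <= e" for m
    using n[of m] S_nonneg[of "(\<Union>i. A i) - (\<Union>i<n. A i)" m] A by (subst (asm) (1 2) S_compl) auto
   ultimately show "\<exists>b. convergent b & (\<forall>m. \<bar>S (\<Union>i. A i) m - b m\<bar> <= e)" by blast
  qed
 next
  case empty
  have "S {} = (%m. 0)" by (auto simp: S_def)
  then show ?case by (simp add: convergent_const)
 qed (rule conv)
qed

text \<open>The limit of the set functions is countably additive because the tails are uniformly
  small, and absolutely continuous because every member of the sequence vanishes on null sets. The
  limit function is its Radon-Nikodym density, finite almost everywhere since the total mass is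
  finite.\<close>

lemma weak_limit:
 assumes conv: "!!A. A \<in> sets borel ==> convergent (S A)"
 obtains h where "integrable mu h" "h \<in> borel_measurable borel"
  "!!A. A \<in> sets borel ==> S A \<longlonglongrightarrow> (\<integral>x. indicator A x * h x \<partial>mu)"
proof -
 define v where "v A = lim (S A)" for A
 have v: "S A \<longlonglongrightarrow> v A" if "A \<in> sets borel" for A
  using conv[OF that] by (simp add: v_def convergent_LIMSEQ_iff)
 have v0: "0 <= v A" if "A \<in> sets borel" for A
  by (rule LIMSEQ_le_const[OF v[OF that]]) (use S_nonneg in auto)
 have vle: "v A <= e" if "A \<in> sets borel" "!!m. S A m <= e" for A e
  by (rule LIMSEQ_le_const2[OF v[OF that(1)]]) (use that in auto)
 have add: "(%i. v (A i)) sums v (\<Union>i. A i)" if A: "!!i::nat. A i \<in> sets borel" "disjoint_family A" for A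
  unfolding sums_def
 proof (rule LIMSEQ_I)
  fix e :: real assume "e > 0"
  then obtain N where N: "!!n m. n >= N ==> S ((\<Union>i. A i) - (\<Union>i<n. A i)) m <= e / 2"
   using tail_small[of A "e / 2"] A by auto
  have "norm ((\<Sum>i<n. v (A i)) - v (\<Union>i. A i)) < e" if "n >= N" for n
  proof -
   have "(%m. S (\<Union>i. A i) m - (\<Sum>i<n. S (A i) m)) \<longlonglongrightarrow> v (\<Union>i. A i) - (\<Sum>i<n. v (A i))"
    using A by (intro tendsto_intros v) auto
   moreover have "S (\<Union>i. A i) m - (\<Sum>i<n. S (A i) m) = S ((\<Union>i. A i) - (\<Union>i<n. A i)) m" for m
    using A by (subst S_compl) (auto simp: S_UN_finite)
   moreover have "S ((\<Union>i. A i) - (\<Union>i<n. A i)) \<longlonglongrightarrow> v ((\<Union>i. A i) - (\<Union>i<n. A i))"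
    using A by (intro v) auto
   ultimately have "v (\<Union>i. A i) - (\<Sum>i<n. v (A i)) = v ((\<Union>i. A i) - (\<Union>i<n. A i))"
    using LIMSEQ_unique by auto
   moreover have "0 <= v ((\<Union>i. A i) - (\<Union>i<n. A i))" "v ((\<Union>i. A i) - (\<Union>i<n. A i)) <= e / 2"
    by (rule v0, use A in measurable) (rule vle[OF _ N[OF that]], use A in measurable)
   ultimately show ?thesis using \<open>e > 0\<close> by simp
  qed
  then show "\<exists>no. \<forall>n\<ge>no. norm ((\<Sum>i<n. v (A i)) - v (\<Union>i. A i)) < e" by blast
 qed
 define N where "N = measure_of UNIV (sets borel) (%A. ennreal (v A))"
 have setsN: "sets N = sets mu" using sets.sigma_sets_eq[of "borel :: 'a measure"] sets_eq by (simp add: N_def sets_measure_of)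
 have emN: "emeasure N A = ennreal (v A)" if "A \<in> sets borel" for A
  unfolding N_def
 proof (rule emeasure_measure_of_sigma)
  show "sigma_algebra UNIV (sets (borel :: 'a measure))" using sets.sigma_algebra_axioms[of "borel :: 'a measure"] by simp
  have "S {} = (%m. 0)" by (auto simp: S_def)
  then have "v {} = 0" by (simp add: v_def)
  then show "positive (sets borel) (%A. ennreal (v A))" by (simp add: positive_def)
  show "countably_additive (sets borel) (%A. ennreal (v A))"
   unfolding countably_additive_def
  proof safe
   fix A :: "nat => 'a set" assume A: "range A \<subseteq> sets borel" "disjoint_family A"
   then have "(%i. v (A i)) sums v (\<Union>i. A i)" by (intro add) auto
   then have "(%i. ennreal (v (A i))) sums ennreal (v (\<Union>i. A i))"
    using A v0 by (subst sums_ennreal) (auto intro!: v0)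
   then show "(\<Sum>i. ennreal (v (A i))) = ennreal (v (\<Union> (range A)))" by (simp add: sums_iff)
  qed
 qed (use that in auto)
 have "absolutely_continuous mu N"
  unfolding absolutely_continuous_def
 proof
  fix A assume A: "A \<in> null_sets mu"
  then have Ab: "A \<in> sets borel" using sets_eq by auto
  have "S A m = 0" for m
   unfolding S_def by (rule integral_eq_zero_AE) (use AE_not_in[OF A] in \<open>auto elim!: eventually_mono\<close>)
  then have "S A = (%m. 0)" by blast
  then have "v A = 0" by (simp add: v_def)
  then show "A \<in> null_sets N" using emN[OF Ab] A setsN by (auto simp: null_sets_def)
 qed
 from Radon_Nikodym_finite_measure_infinite[OF this setsN] obtain h where
  h[measurable]: "h \<in> borel_measurable borel" and dens: "density mu h = N"
  using measurable_cong_sets[OF sets_eq refl] by (metis)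
 have eqh: "(\<integral>\<^sup>+x. h x * indicator A x \<partial>mu) = ennreal (v A)" if A: "A \<in> sets borel" for A
  using emN[OF A] A unfolding dens[symmetric] by (subst (asm) emeasure_density) (auto simp: sets_eq)
 have fin: "AE x in mu. h x ~= \<infinity>"
  using eqh[of UNIV] by (intro nn_integral_noteq_infinite) auto
 have eqh2: "(\<integral>\<^sup>+x. ennreal (indicator A x * enn2real (h x)) \<partial>mu) = ennreal (v A)" if A: "A \<in> sets borel" for A
  unfolding eqh[OF A, symmetric]
  by (rule nn_integral_cong_AE) (use fin in eventually_elim, auto simp: indicator_def less_top)
 have "integrable mu (%x. enn2real (h x))"
  using eqh2[of UNIV] by (intro integrableI_nonneg) auto
 moreover have "(\<integral>x. indicator A x * enn2real (h x) \<partial>mu) = v A" if A: "A \<in> sets borel" for A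
  using eqh2[OF A] v0[OF A] A by (subst integral_eq_nn_integral) auto
 ultimately show ?thesis using v by (intro that[of "%x. enn2real (h x)"]) auto
qed

text \<open>Rounding \<open>psi\<close> down to multiples of 1 / N leaves finitely many values, for
  which the claim is a finite sum over level sets. The error is at most M / N uniformly in m, where
  M bounds the L^1 norms of the sequence and of the limit.\<close>

lemma weak_limit_bounded:
 assumes h: "integrable mu h"
  and lim: "!!A. A \<in> sets borel ==> S A \<longlonglongrightarrow> (\<integral>x. indicator A x * h x \<partial>mu)"
  and psi[measurable]: "psi \<in> borel_measurable borel" and B: "!!x. \<bar>psi x\<bar> <= B"
 shows "(%m. \<integral>x. psi x * f m x \<partial>mu) \<longlonglongrightarrow> (\<integral>x. psi x * h x \<partial>mu)"
proof (rule tendsto_of_approx)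
 fix e :: real assume e: "e > 0"
 define M where "M = (C + measure mu UNIV) + (\<integral>x. \<bar>h x\<bar> \<partial>mu) + 1"
 have M: "M > 0" "!!m. (\<integral>x. f m x \<partial>mu) <= M" "(\<integral>x. \<bar>h x\<bar> \<partial>mu) <= M"
 proof -
  have "0 <= (\<integral>x. \<bar>h x\<bar> \<partial>mu)" "0 <= measure mu UNIV" by auto
  moreover have "(\<integral>x. f m x \<partial>mu) <= C + measure mu UNIV" for m using S_bound[of UNIV m] by (simp add: S_def)
  ultimately show "M > 0" "!!m. (\<integral>x. f m x \<partial>mu) <= M" "(\<integral>x. \<bar>h x\<bar> \<partial>mu) <= M"
   unfolding M_def using C by (smt (verit))+
 qed
 define N :: nat where "N = nat \<lceil>M / e\<rceil> + 1"
 have N: "N > 0" "M / N <= e"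
 proof -
  have "M / e <= N" unfolding N_def by linarith
  then have *: "M <= e * N" using e by (simp add: divide_le_eq mult.commute)
  show "N > 0" by (simp add: N_def)
  with * show "M / N <= e" by (simp add: divide_le_eq)
 qed
 define z where "z x = \<lfloor>real N * psi x\<rfloor>" for x
 define Z :: "int set" where "Z = {-\<lceil>real N * B\<rceil> - 1..\<lceil>real N * B\<rceil> + 1}"
 have zk[measurable]: "z -` {k} \<in> sets borel" for k
 proof -
  have "{x \<in> space borel. \<lfloor>real N * psi x\<rfloor> = k} \<in> sets borel" by measurable
  then show ?thesis by (simp add: z_def vimage_def)
 qed
 have zZ: "z x \<in> Z" for x
 proof -
  have "\<bar>real N * psi x\<bar> <= real N * B" using B[of x] by (simp add: abs_mult mult_left_mono)
  then show ?thesis unfolding z_def Z_def atLeastAtMost_iff by linarith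
 qed
 define q where "q x = (\<Sum>k\<in>Z. (k / N) * indicator (z -` {k}) x)" for x
 have q: "q x = z x / N" for x
 proof -
  have "q x = (\<Sum>k\<in>Z. if k = z x then k / N else 0)"
   unfolding q_def by (rule sum.cong) (auto simp: indicator_def)
  then show ?thesis using zZ[of x] by (simp add: Z_def)
 qed
 have [measurable]: "q \<in> borel_measurable borel" unfolding q_def[abs_def] by measurable
 have d: "\<bar>psi x - q x\<bar> <= 1 / N" for x
 proof -
  have "\<bar>real N * psi x - z x\<bar> <= 1" unfolding z_def by linarith
  then have "\<bar>(real N * psi x - z x) / N\<bar> <= 1 / N" unfolding abs_divide using N by (simp add: divide_right_mono)
  then show ?thesis using N by (simp add: q diff_divide_distrib)
 qed
 have qB: "\<bar>q x\<bar> <= B + 1 / N" for x using d[of x] B[of x] by linarith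
 have hI: "integrable mu (%x. g x * h x)" if "g \<in> borel_measurable borel" "!!x. \<bar>g x\<bar> <= K" for g K
  by (rule Bochner_Integration.integrable_bound[of _ "%x. K * h x"])
   (use that h order_trans[OF that(2) abs_ge_self] borel_measurable_integrable[OF h] in \<open>auto simp: abs_mult intro!: mult_right_mono\<close>)
 show "\<exists>b L'. b \<longlonglongrightarrow> L' & (\<forall>m. norm ((\<integral>x. psi x * f m x \<partial>mu) - b m) <= e) & norm ((\<integral>x. psi x * h x \<partial>mu) - L') <= e"
  unfolding real_norm_def
 proof (intro exI conjI allI)
  have "(%m. \<Sum>k\<in>Z. (k / N) * S (z -` {k}) m) \<longlonglongrightarrow> (\<Sum>k\<in>Z. (k / N) * (\<integral>x. indicator (z -` {k}) x * h x \<partial>mu))"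
   by (intro tendsto_intros lim) measurable
  moreover have "(\<integral>x. q x * f m x \<partial>mu) = (\<Sum>k\<in>Z. (k / N) * S (z -` {k}) m)" for m
  proof -
   have "(\<integral>x. q x * f m x \<partial>mu) = (\<integral>x. (\<Sum>k\<in>Z. (k / N) * (indicator (z -` {k}) x * f m x)) \<partial>mu)"
    by (simp add: q_def sum_distrib_right mult.assoc)
   also have "... = (\<Sum>k\<in>Z. (k / N) * S (z -` {k}) m)"
   proof -
    have I: "integrable mu (%x. (k / N) * (indicator (z -` {k}) x * f m x))" for k
     by (intro integrable_mult_right ind_integrable) measurable
    show ?thesis unfolding S_def by (subst Bochner_Integration.integral_sum[OF I]) (simp only: integral_mult_right_zero)
   qed
   finally show ?thesis .
  qed
  moreover have "(\<integral>x. q x * h x \<partial>mu) = (\<Sum>k\<in>Z. (k / N) * (\<integral>x. indicator (z -` {k}) x * h x \<partial>mu))"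
  proof -
   have "(\<integral>x. q x * h x \<partial>mu) = (\<integral>x. (\<Sum>k\<in>Z. (k / N) * (indicator (z -` {k}) x * h x)) \<partial>mu)"
    by (simp add: q_def sum_distrib_right mult.assoc)
   also have "... = (\<Sum>k\<in>Z. (k / N) * (\<integral>x. indicator (z -` {k}) x * h x \<partial>mu))"
   proof -
    have I: "integrable mu (%x. (k / N) * (indicator (z -` {k}) x * h x))" for k
     by (intro integrable_mult_right hI[of _ 1] borel_measurable_indicator zk) (auto simp: indicator_def)
    show ?thesis by (subst Bochner_Integration.integral_sum[OF I]) (simp only: integral_mult_right_zero)
   qed
   finally show ?thesis .
  qed
  ultimately show "(%m. \<integral>x. q x * f m x \<partial>mu) \<longlonglongrightarrow> (\<integral>x. q x * h x \<partial>mu)" by simp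
  fix m
  have "\<bar>(\<integral>x. psi x * f m x \<partial>mu) - (\<integral>x. q x * f m x \<partial>mu)\<bar> = \<bar>\<integral>x. (psi x - q x) * f m x \<partial>mu\<bar>"
   using psi_integrable[OF psi B] psi_integrable[of q, OF _ qB]
   by (subst Bochner_Integration.integral_diff[symmetric]) (auto simp: algebra_simps)
  also have "... <= (\<integral>x. (1 / N) * f m x \<partial>mu)"
   by (rule integral_abs_bound[THEN order_trans], rule integral_mono')
    (use mult_right_mono[OF d nonneg] f_integrable[of m] nonneg[of m] in \<open>auto simp: abs_mult\<close>)
  also have "... <= (1 / N) * M" unfolding integral_mult_right_zero using M(2)[of m] by (intro mult_left_mono) auto
  finally show "\<bar>(\<integral>x. psi x * f m x \<partial>mu) - (\<integral>x. q x * f m x \<partial>mu)\<bar> <= e" using N(2) by simp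
 next
  have "\<bar>(\<integral>x. psi x * h x \<partial>mu) - (\<integral>x. q x * h x \<partial>mu)\<bar> = \<bar>\<integral>x. (psi x - q x) * h x \<partial>mu\<bar>"
   using hI[OF psi B] hI[of q, OF _ qB]
   by (subst Bochner_Integration.integral_diff[symmetric]) (auto simp: algebra_simps)
  also have "... <= (\<integral>x. (1 / N) * \<bar>h x\<bar> \<partial>mu)"
   by (rule integral_abs_bound[THEN order_trans], rule integral_mono')
    (use mult_right_mono[OF d abs_ge_zero] h in \<open>auto simp: abs_mult\<close>)
  also have "... <= (1 / N) * M" unfolding integral_mult_right_zero using M(3) by (intro mult_left_mono) auto
  finally show "\<bar>(\<integral>x. psi x * h x \<partial>mu) - (\<integral>x. q x * h x \<partial>mu)\<bar> <= e" using N(2) by simp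
 qed
qed

end

section \<open>Weak compactness on open sets with local bounds\<close>

text \<open>Weak convergence in local L^1, whose dual consists of the bounded functions with compact
  support.\<close>

definition wconv :: "(real^'n) set => (nat => real^'n => 'b::euclidean_space) => (real^'n => 'b) => bool" where
 "wconv U F f \<longleftrightarrow> (\<forall>psi. wtest U psi -->
  (%m. LINT x|lebesgue. psi x *R F m x) \<longlonglongrightarrow> (LINT x|lebesgue. psi x *R f x))"

lemma wtest_borel_rep:
 fixes psi :: "real^'n => real"
 assumes "wtest U psi"
 shows "\<exists>psi' B K. psi' \<in> borel_measurable borel & (AE x in lebesgue. psi x = psi' x) & (\<forall>x. \<bar>psi' x\<bar> <= B) \<and>
  compact K & K \<subseteq> U & (\<forall>x. x \<notin> K --> psi' x = 0)"
proof -
 obtain B K where B: "!!x. \<bar>psi x\<bar> <= B" and K: "compact K" "K \<subseteq> U" "!!x. x \<notin> K ==> psi x = 0"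
  and m: "psi \<in> borel_measurable lebesgue"
  using assms(1) by (auto simp: wtest_def)
 obtain g where g[measurable]: "g \<in> borel_measurable borel" and ae: "AE x in lebesgue. psi x = g x"
  using lebesgue_borel_rep[OF m] .
 have [measurable]: "K \<in> sets borel" using K(1) by (simp add: borel_compact)
 have B0: "0 <= B" using B[of undefined] by linarith
 show ?thesis
 proof (intro exI[of _ "%x. indicator K x * max (- B) (min B (g x))"] exI[of _ B] exI[of _ K] conjI allI impI)
  show "AE x in lebesgue. psi x = indicator K x * max (- B) (min B (g x))"
   using ae
  proof eventually_elim
   case (elim x)
   have "max (- B) (min B (psi x)) = psi x" using B[of x] by (auto simp: max_def min_def)
   then show ?case using K(3)[of x] elim by (cases "x \<in> K") auto
  qed
  show "\<bar>indicator K x * max (- B) (min B (g x))\<bar> <= B" for x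
   using B0 by (auto simp: indicator_def)
 qed (use K B0 in auto)
qed

text \<open>One weight absorbs infinitely many local bounds: \<open>c n\<close> is so small that
  both \<open>c n\<close> and \<open>c n * C n\<close> are at most 2^-n, and these sum to 2. Being
  bounded below on each \<open>V n\<close>, the weight can be divided out of functions with compact
  support.\<close>

lemma exhaustion_weight:
 fixes U :: "(real^'n) set" and C :: "nat => real"
 assumes U: "open U" and V: "!!n::nat. open (V n)" "(\<Union>n. V n) = U" and C: "!!n. C n >= 0"
 shows "\<exists>w. w \<in> borel_measurable borel & (\<forall>x. 0 <= w x) & (\<forall>n. \<exists>c>0. \<forall>x\<in>V n. c <= w x) \<and>
   (\<forall>g\<in>borel_measurable borel. (\<forall>n. (\<integral>\<^sup>+x\<in>V n. g x \<partial>lborel) <= ennreal (C n)) -->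
    (\<integral>\<^sup>+x. ennreal (w x) * g x \<partial>lborel) <= 2)"
proof -
 define c where "c n = (1 / 2) ^ n * (1 / (1 + C n))" for n
 have c: "0 < c n" "c n <= (1 / 2) ^ n" "c n * C n <= (1 / 2) ^ n" for n
 proof -
  have *: "1 / (1 + C n) <= 1" "1 / (1 + C n) * C n <= 1" "0 < 1 / (1 + C n)" using C[of n] by (auto simp: field_simps)
  then show "0 < c n" unfolding c_def by (intro mult_pos_pos) auto
  show "c n <= (1 / 2) ^ n" "c n * C n <= (1 / 2) ^ n"
   unfolding c_def mult.assoc by (rule mult_left_le[OF *(1)], simp) (rule mult_left_le[OF *(2)], simp)
 qed
 define w where "w x = (\<Sum>n. c n * indicator (V n) x)" for x
 have sm: "summable (%n. c n * indicator (V n) x)" for x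
  by (rule summable_comparison_test[OF _ summable_geometric[of "1 / 2 :: real"]])
   (use c in \<open>auto simp: indicator_def less_imp_le\<close>)
 have [measurable]: "V n \<in> sets borel" for n using V(1) by simp
 have ew: "ennreal (w x) = (\<Sum>n. ennreal (c n) * indicator (V n) x)" for x
 proof -
  have "ennreal (w x) = (\<Sum>n. ennreal (c n * indicator (V n) x))"
   unfolding w_def using c sm by (intro suminf_ennreal2[symmetric]) (auto simp: less_imp_le)
  also have "... = (\<Sum>n. ennreal (c n) * indicator (V n) x)"
   by (intro suminf_cong) (auto simp: indicator_def)
  finally show ?thesis .
 qed
 show ?thesis
 proof (intro exI[of _ w] conjI allI ballI impI)
  show "w \<in> borel_measurable borel" unfolding w_def[abs_def] by measurable
  show "0 <= w x" for x unfolding w_def using c sm by (intro suminf_nonneg) (auto simp: less_imp_le)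
  show "\<exists>d>0. \<forall>x\<in>V n. d <= w x" for n
  proof (intro exI[of _ "c n"] conjI ballI)
   fix x assume "x \<in> V n"
   have "(\<Sum>k\<in>{n}. c k * indicator (V k) x) <= w x"
    unfolding w_def using c sm by (intro sum_le_suminf) (auto simp: less_imp_le)
   then show "c n <= w x" using \<open>x \<in> V n\<close> by simp
  qed (rule c)
  fix g :: "real^'n => ennreal"
  assume [measurable]: "g \<in> borel_measurable borel" and g: "\<forall>n. (\<integral>\<^sup>+x\<in>V n. g x \<partial>lborel) <= ennreal (C n)"
  have "(\<integral>\<^sup>+x. ennreal (w x) * g x \<partial>lborel) = (\<integral>\<^sup>+x. (\<Sum>n. ennreal (c n) * (g x * indicator (V n) x)) \<partial>lborel)"
   unfolding ew by (intro nn_integral_cong) (simp add: ennreal_suminf_multc[symmetric] mult_ac)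
  also have "... = (\<Sum>n. ennreal (c n) * (\<integral>\<^sup>+x\<in>V n. g x \<partial>lborel))"
   by (subst nn_integral_suminf) (auto simp: nn_integral_cmult)
  also have "... <= (\<Sum>n. ennreal ((1 / 2) ^ n))"
  proof (rule suminf_le)
   show "ennreal (c n) * (\<integral>\<^sup>+x\<in>V n. g x \<partial>lborel) <= ennreal ((1 / 2) ^ n)" for n
   proof -
    have "ennreal (c n) * (\<integral>\<^sup>+x\<in>V n. g x \<partial>lborel) <= ennreal (c n) * ennreal (C n)"
     using g by (intro mult_left_mono) auto
    also have "... = ennreal (c n * C n)" using c(1)[of n] C[of n] by (simp add: ennreal_mult)
    also have "... <= ennreal ((1 / 2) ^ n)" using c(3) by (rule ennreal_leI)
    finally show ?thesis .
   qed
  qed auto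
  also have "... = ennreal (\<Sum>n. (1 / 2) ^ n)"
   by (rule suminf_ennreal2) (auto simp: summable_geometric)
  also have "... = 2" by (simp add: suminf_geometric)
  finally show "(\<integral>\<^sup>+x. ennreal (w x) * g x \<partial>lborel) <= 2" .
 qed
qed

text \<open>The weighted measure turns the local L^2 bounds into the finite-measure setting of
  \<open>square_bounded\<close>. One diagonal subsequence makes the integrals converge for every
  signed part of every component and every set of a countable generator; the limits of the parts are
  then reassembled.\<close>

theorem weak_compactness:
 fixes F :: "nat => real^'n => 'b::euclidean_space"
 assumes U: "open U" and li: "!!m. locally_integrable U (F m)"
  and bd: "!!V. open_compactly_in V U ==>
   \<exists>C. \<forall>m. (\<integral>\<^sup>+x\<in>V. ennreal ((norm (F m x))^2) \<partial>lebesgue) <= ennreal C"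
 obtains r f where "strict_mono (r :: nat => nat)" "locally_integrable U f" "wconv U (%m. F (r m)) f"
proof -
 have "\<exists>g. g \<in> borel_measurable borel & (AE x in lebesgue. indicator U x *R F m x = g x)" for m
  using lebesgue_borel_rep[OF locally_integrable_measurable[OF U li[of m]]] by blast
 then obtain G where G[measurable]: "!!m. G m \<in> borel_measurable borel"
  and FG: "!!m. AE x in lebesgue. indicator U x *R F m x = G m x" by metis
 obtain V :: "nat => (real^'n) set" where V: "!!n. open_compactly_in (V n) U" "!!n. V n \<subseteq> V (Suc n)" "(\<Union>n. V n) = U"
  "!!K. compact K ==> K \<subseteq> U ==> \<exists>n. K \<subseteq> V n"
  using open_exhaustion[OF U] by metis
 have oV: "open (V n)" for n using V(1) by (auto simp: open_compactly_in_def)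
 have [measurable]: "V n \<in> sets borel" for n using oV by simp
 obtain C0 where C0: "!!n m. (\<integral>\<^sup>+x\<in>V n. ennreal ((norm (F m x))^2) \<partial>lebesgue) <= ennreal (C0 n)"
  using bd[OF V(1)] by metis
 \<comment> \<open>The maximum with the volume of \<open>V n\<close> lets the weight estimate apply
   to the constant function 1 as well, so that \<open>mu\<close> is a finite measure.\<close>
 define C where "C n = max (C0 n) (measure lborel (V n))" for n
 have C: "C n >= 0" for n by (simp add: C_def max.coboundedI2)
 obtain w where W: "w \<in> borel_measurable borel & (\<forall>x. 0 <= w x) & (\<forall>n. \<exists>c>0. \<forall>x\<in>V n. c <= w x) \<and>
   (\<forall>g\<in>borel_measurable borel. (\<forall>n. (\<integral>\<^sup>+x\<in>V n. g x \<partial>lborel) <= ennreal (C n)) -->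
    (\<integral>\<^sup>+x. ennreal (w x) * g x \<partial>lborel) <= 2)"
  by (rule exE[OF exhaustion_weight[where C = C, OF U oV V(3) C]])
 note w[measurable] = W[THEN conjunct1]
 have w0: "0 <= w x" and wV: "\<exists>c>0. \<forall>x\<in>V n. c <= w x" for x n using W by blast+
 have wint: "(\<integral>\<^sup>+x. ennreal (w x) * g x \<partial>lborel) <= 2"
  if "g \<in> borel_measurable borel" "!!n. (\<integral>\<^sup>+x\<in>V n. g x \<partial>lborel) <= ennreal (C n)" for g
  using W[THEN conjunct2, THEN conjunct2, THEN conjunct2, rule_format, OF that] .
 define mu where "mu = density lborel (%x. ennreal (w x))"
 have nn: "(\<integral>\<^sup>+x. g x \<partial>mu) = (\<integral>\<^sup>+x. ennreal (w x) * g x \<partial>lborel)" if "g \<in> borel_measurable borel" for g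
  unfolding mu_def using that by (subst nn_integral_density) auto
 have "emeasure mu (space mu) = (\<integral>\<^sup>+x. ennreal (w x) * 1 \<partial>lborel)"
  by (simp add: mu_def emeasure_density)
 also have "... <= 2"
 proof (rule wint)
  fix n
  have "bounded (V n)" using V(1)[of n] unfolding open_compactly_in_def
   by (meson bounded_subset closure_subset compact_imp_bounded)
  then have "emeasure lborel (V n) < \<infinity>" by (rule emeasure_bounded_finite)
  then have "emeasure lborel (V n) = ennreal (measure lborel (V n))" by (intro emeasure_eq_ennreal_measure) auto
  then show "(\<integral>\<^sup>+x\<in>V n. 1 \<partial>lborel) <= ennreal (C n)" by (simp add: C_def ennreal_leI)
 qed simp
 finally interpret mu: finite_measure mu by (intro finite_measureI) (auto simp: top_unique)
 have setsmu: "sets mu = sets borel" by (simp add: mu_def)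
 have gm: "(%x. ennreal ((norm (G m x))^2)) \<in> borel_measurable borel" for m by measurable
 have Gsq: "(\<integral>\<^sup>+x. ennreal ((norm (G m x))^2) \<partial>mu) <= 2" for m
  unfolding nn[OF gm]
 proof (rule wint)
  fix n
  have "V n \<subseteq> U" using V(3) by auto
  have "(\<integral>\<^sup>+x\<in>V n. ennreal ((norm (G m x))^2) \<partial>lborel) = (\<integral>\<^sup>+x\<in>V n. ennreal ((norm (G m x))^2) \<partial>lebesgue)"
   by (rule nn_integral_completion[symmetric])
  also have "... = (\<integral>\<^sup>+x\<in>V n. ennreal ((norm (F m x))^2) \<partial>lebesgue)"
   by (rule nn_integral_cong_AE, use FG[of m] in eventually_elim)
    (use \<open>V n \<subseteq> U\<close> in \<open>auto simp: indicator_def split: if_splits\<close>)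
  also have "... <= ennreal (C0 n)" by (rule C0)
  also have "... <= ennreal (C n)" by (simp add: C_def ennreal_leI)
  finally show "(\<integral>\<^sup>+x\<in>V n. ennreal ((norm (G m x))^2) \<partial>lborel) <= ennreal (C n)" .
 qed simp
 \<comment> \<open>For s = 1 and s = -1 these are the positive and the negative part of the
   component along \<open>b\<close>.\<close>
 define phi where "phi = (%(b::'b, s::real) m x. max 0 (s * (G m x \<bullet> b)))"
 define I where "I = (Basis :: 'b set) \<times> {1, -1 :: real}"
 have sb: "square_bounded mu (%m. phi k (r m)) 2" if k: "k \<in> I" for k and r :: "nat => nat"
 proof
  show "sets mu = sets borel" by (rule setsmu)
  show "phi k (r m) \<in> borel_measurable borel" for m unfolding phi_def by (cases k) simp
  show "0 <= phi k (r m) x" for m x unfolding phi_def by (cases k) simp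
  show "(\<integral>\<^sup>+x. ennreal ((phi k (r m) x)^2) \<partial>mu) <= ennreal 2" for m
  proof -
   have "(phi k (r m) x)^2 <= (norm (G (r m) x))^2" for x
   proof (rule power_mono)
    obtain b s where b: "k = (b, s)" "b \<in> Basis" "\<bar>s\<bar> = 1" using k by (auto simp: I_def)
    have "\<bar>s * (G (r m) x \<bullet> b)\<bar> <= norm (G (r m) x)"
     using Basis_le_norm[OF b(2), of "G (r m) x"] b(3) by (simp add: abs_mult)
    then show "phi k (r m) x <= norm (G (r m) x)" by (simp add: b(1) phi_def)
   qed (auto simp: phi_def split: prod.splits)
   then have "(\<integral>\<^sup>+x. ennreal ((phi k (r m) x)^2) \<partial>mu) <= (\<integral>\<^sup>+x. ennreal ((norm (G (r m) x))^2) \<partial>mu)"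
    by (intro nn_integral_mono ennreal_leI)
   also have "... <= 2" by (rule Gsq)
   finally show ?thesis by simp
  qed
 qed simp
 obtain \<G> :: "(real^'n) set set" where \<G>: "countable \<G>" "Int_stable \<G>" "UNIV \<in> \<G>"
  "sets borel = sigma_sets UNIV \<G>"
  by (rule countable_borel_generator)
 have count: "countable (I \<times> \<G>)" and ne: "I \<times> \<G> ~= {}"
  using \<G>(1,3) countable_finite[of I] by (auto simp: I_def intro: countable_SIGMA)
 define J where "J = (%(k, A) m. \<integral>x. indicator A x * phi k m x \<partial>mu)"
 obtain r where r: "strict_mono r" and rc: "!!n. convergent (%m. J (from_nat_into (I \<times> \<G>) n) (r m))"
 proof (rule diagonal_convergent[of "%n. J (from_nat_into (I \<times> \<G>) n)"])
  fix n
  obtain k A where kA: "from_nat_into (I \<times> \<G>) n = (k, A)" "k \<in> I" "A \<in> \<G>"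
   using from_nat_into[OF ne, of n] by auto
  interpret square_bounded mu "%m. phi k m" 2 using sb[OF kA(2), of "%m. m"] .
  show "bounded (range (J (from_nat_into (I \<times> \<G>) n)))"
   unfolding bounded_iff kA J_def using S_nonneg S_bound
   by (auto simp: S_def intro!: exI[of _ "2 + measure mu UNIV"])
 qed blast
 have "\<exists>h. integrable mu h & (\<forall>psi B. psi \<in> borel_measurable borel --> (\<forall>x. \<bar>psi x\<bar> <= B) -->
   (%m. \<integral>x. psi x * phi k (r m) x \<partial>mu) \<longlonglongrightarrow> (\<integral>x. psi x * h x \<partial>mu))" if k: "k \<in> I" for k
 proof -
  interpret square_bounded mu "%m. phi k (r m)" 2 using sb[OF k] .
  have "convergent (S A)" if "A \<in> \<G>" for A
  proof -
   obtain n where "from_nat_into (I \<times> \<G>) n = (k, A)"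
    using from_nat_into_surj[OF count, of "(k, A)"] k \<open>A \<in> \<G>\<close> by blast
   then show ?thesis using rc[of n] by (simp add: J_def S_def[abs_def])
  qed
  then have c: "convergent (S A)" if "A \<in> sets borel" for A
   using convergent_sets[OF \<G>(2-4)] that by blast
  show ?thesis
  proof (rule weak_limit[OF c])
   fix h assume h: "integrable mu h" "!!A. A \<in> sets borel ==> S A \<longlonglongrightarrow> (\<integral>x. indicator A x * h x \<partial>mu)"
   show ?thesis by (intro exI[of _ h] conjI allI impI h weak_limit_bounded) auto
  qed
 qed
 then have "\<forall>k\<in>I. \<exists>h. integrable mu h & (\<forall>psi B. psi \<in> borel_measurable borel --> (\<forall>x. \<bar>psi x\<bar> <= B) -->
   (%m. \<integral>x. psi x * phi k (r m) x \<partial>mu) \<longlonglongrightarrow> (\<integral>x. psi x * h x \<partial>mu))" by (rule ballI)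
 from bchoice[OF this] obtain h where H: "\<forall>k\<in>I. integrable mu (h k) & (\<forall>psi B. psi \<in> borel_measurable borel --> (\<forall>x. \<bar>psi x\<bar> <= B) -->
   (%m. \<integral>x. psi x * phi k (r m) x \<partial>mu) \<longlonglongrightarrow> (\<integral>x. psi x * h k x \<partial>mu))" ..
 then have h: "!!k. k \<in> I ==> integrable mu (h k)" by blast
 have hlim: "(%m. \<integral>x. psi x * phi k (r m) x \<partial>mu) \<longlonglongrightarrow> (\<integral>x. psi x * h k x \<partial>mu)"
  if "k \<in> I" "psi \<in> borel_measurable borel" "!!x. \<bar>psi x\<bar> <= B" for k psi B
  using H[rule_format, THEN conjunct2, rule_format, OF that] .
 define f where "f x = (\<Sum>b\<in>Basis. (h (b, 1) x - h (b, -1) x) *R b)" for x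
 have hm[measurable]: "h k \<in> borel_measurable borel" if "k \<in> I" for k
  using borel_measurable_integrable[OF h[OF that]] by (simp add: mu_def)
 have kI: "(b, 1) \<in> I" "(b, -1) \<in> I" if "b \<in> Basis" for b using that by (auto simp: I_def)
 have [measurable]: "f \<in> borel_measurable borel"
  unfolding f_def[abs_def]
  by (intro borel_measurable_sum borel_measurable_scaleR borel_measurable_diff hm kI) auto
 have fb: "f x \<bullet> b = h (b, 1) x - h (b, -1) x" if "b \<in> Basis" for b x
  unfolding f_def using that by (simp add: inner_sum_left_Basis)
 have Gb: "G m x \<bullet> b = phi (b, 1) m x - phi (b, -1) m x" for m x b by (auto simp: phi_def max_def)
 \<comment> \<open>On a compact subset of \<open>U\<close> the weight is bounded below, so a test
   divided by \<open>w\<close> is again bounded; this converts integrals for \<open>lborel\<close>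
   into integrals for \<open>mu\<close>.\<close>
 have div: "\<exists>psiw B'. psiw \<in> borel_measurable borel & (\<forall>x. \<bar>psiw x\<bar> <= B') & (\<forall>x. w x * psiw x = psi x)"
  if [measurable]: "psi \<in> borel_measurable borel" and B: "!!x. \<bar>psi x\<bar> <= B" and K: "compact K" "K \<subseteq> U" "!!x. x \<notin> K ==> psi x = 0"
  for psi :: "real^'n => real" and B K
 proof -
  obtain n where n: "K \<subseteq> V n" using V(4)[OF K(1,2)] by blast
  obtain c where c: "c > 0" "!!x. x \<in> V n ==> c <= w x" using wV by blast
  have B0: "0 <= B" using B[of undefined] by linarith
  have cw: "c <= w x" if "psi x ~= 0" for x using that K(3) n c(2) by blast
  have "\<bar>psi x / w x\<bar> <= B / c" for x
   using cw[of x] c(1) B[of x] B0 by (cases "psi x = 0") (auto simp: abs_divide intro!: frac_le)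
  moreover have "w x * (psi x / w x) = psi x" for x using cw[of x] c(1) by (cases "psi x = 0") auto
  ultimately show ?thesis by (intro exI[of _ "%x. psi x / w x"] exI[of _ "B / c"]) auto
 qed
 have transfer: "integrable lborel (%x. psi x * g x)" "(\<integral>x. psi x * g x \<partial>lborel) = (\<integral>x. psiw x * g x \<partial>mu)"
  if [measurable]: "g \<in> borel_measurable borel" "psiw \<in> borel_measurable borel" and gi: "integrable mu (%x. psiw x * g x)"
   and e: "!!x. w x * psiw x = psi x" for g psi psiw :: "real^'n => real"
 proof -
  have *: "(%x. psi x * g x) = (%x. w x *R (psiw x * g x))" using e by (auto simp flip: mult.assoc)
  show "integrable lborel (%x. psi x * g x)"
   using gi unfolding mu_def by (subst (asm) integrable_density) (auto simp: * w0 simp del: real_scaleR_def)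
  show "(\<integral>x. psi x * g x \<partial>lborel) = (\<integral>x. psiw x * g x \<partial>mu)"
   unfolding mu_def by (subst integral_density) (auto simp: * w0 simp del: real_scaleR_def)
 qed
 have hI: "integrable mu (%x. psi x * h k x)" if "k \<in> I" "psi \<in> borel_measurable borel" "!!x. \<bar>psi x\<bar> <= B" for k psi B
  by (rule Bochner_Integration.integrable_bound[of _ "%x. B * h k x"])
   (use that h[OF that(1)] hm[OF that(1)] order_trans[OF that(3) abs_ge_self] in
    \<open>auto simp: abs_mult mu_def intro!: mult_right_mono\<close>)
 have li_f: "integrable lborel (%x. psi x *R f x)"
  and lim_f: "b \<in> Basis ==> (%m. (\<integral>x. psi x * (G (r m) x \<bullet> b) \<partial>lborel)) \<longlonglongrightarrow> (\<integral>x. psi x * (f x \<bullet> b) \<partial>lborel)"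
  if psi: "psi \<in> borel_measurable borel" "!!x. \<bar>psi x\<bar> <= B" "compact K" "K \<subseteq> U" "!!x. x \<notin> K ==> psi x = 0"
  for psi :: "real^'n => real" and B K b
 proof -
  note [measurable] = psi(1)
  obtain psiw B' where p[measurable]: "psiw \<in> borel_measurable borel" and pb: "!!x. \<bar>psiw x\<bar> <= B'" "!!x. w x * psiw x = psi x"
   using div[OF psi] by blast
  have 1: "integrable lborel (%x. psi x * h k x)" "(\<integral>x. psi x * h k x \<partial>lborel) = (\<integral>x. psiw x * h k x \<partial>mu)" if "k \<in> I" for k
   using transfer[OF hm[OF that] p hI[OF that p pb(1)] pb(2)] by auto
  have 2: "integrable lborel (%x. psi x * phi k m x)" "(\<integral>x. psi x * phi k m x \<partial>lborel) = (\<integral>x. psiw x * phi k m x \<partial>mu)" if "k \<in> I" for k m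
  proof -
   interpret square_bounded mu "%m. phi k m" 2 using sb[OF that, of "%m. m"] .
   show "integrable lborel (%x. psi x * phi k m x)" "(\<integral>x. psi x * phi k m x \<partial>lborel) = (\<integral>x. psiw x * phi k m x \<partial>mu)"
    using transfer[OF meas p psi_integrable[OF p pb(1)] pb(2)] by auto
  qed
  have "integrable lborel (%x. \<Sum>b\<in>Basis. (psi x * h (b, 1) x - psi x * h (b, -1) x) *R b)"
   by (intro Bochner_Integration.integrable_sum integrable_scaleR_left Bochner_Integration.integrable_diff 1 kI)
  then show "integrable lborel (%x. psi x *R f x)"
   by (simp add: f_def scaleR_sum_right right_diff_distrib)
  assume b: "b \<in> Basis"
  have "(\<integral>x. psi x * (f x \<bullet> b) \<partial>lborel) = (\<integral>x. psiw x * h (b, 1) x \<partial>mu) - (\<integral>x. psiw x * h (b, -1) x \<partial>mu)"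
   using 1[OF kI(1)[OF b]] 1[OF kI(2)[OF b]] by (simp add: fb[OF b] right_diff_distrib)
  moreover have "(\<integral>x. psi x * (G m x \<bullet> b) \<partial>lborel) = (\<integral>x. psiw x * phi (b, 1) m x \<partial>mu) - (\<integral>x. psiw x * phi (b, -1) m x \<partial>mu)" for m
   using 2[OF kI(1)[OF b], of m] 2[OF kI(2)[OF b], of m] by (simp add: Gb right_diff_distrib)
  ultimately show "(%m. (\<integral>x. psi x * (G (r m) x \<bullet> b) \<partial>lborel)) \<longlonglongrightarrow> (\<integral>x. psi x * (f x \<bullet> b) \<partial>lborel)"
   using hlim[OF kI(1)[OF b] p pb(1)] hlim[OF kI(2)[OF b] p pb(1)] by (auto intro: tendsto_diff)
 qed
 have lif: "locally_integrable U f"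
  unfolding locally_integrable_def set_integrable_def
 proof safe
  fix K assume K: "compact K" "K \<subseteq> U"
  then have [measurable]: "K \<in> sets borel" by (simp add: borel_compact)
  have "integrable lborel (%x. indicator K x *R f x)"
   by (rule li_f[of _ 1 K]) (use K in \<open>auto simp: indicator_def\<close>)
  then show "integrable lebesgue (%x. indicator K x *R f x)"
   by (subst integrable_completion) auto
 qed
 have "wconv U (%m. F (r m)) f"
  unfolding wconv_def
 proof (intro allI impI)
  fix psi assume psi: "wtest U psi"
  obtain psi' B K where p[measurable]: "psi' \<in> borel_measurable borel" and ae: "AE x in lebesgue. psi x = psi' x"
   and p2: "!!x. \<bar>psi' x\<bar> <= B" "compact K" "K \<subseteq> U" "!!x. x \<notin> K ==> psi' x = 0"
   using wtest_borel_rep[OF psi] by blast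
  have F: "(LINT x|lebesgue. psi x *R F m x) \<bullet> b = (\<integral>x. psi' x * (G m x \<bullet> b) \<partial>lborel)" for m b
  proof -
   have "(LINT x|lebesgue. psi x *R F m x) \<bullet> b = (LINT x|lebesgue. (psi x *R F m x) \<bullet> b)"
    by (rule integral_inner_left[symmetric]) (use wtest_integrable[OF psi li] in auto)
   also have "... = (LINT x|lebesgue. psi' x * (G m x \<bullet> b))"
   proof (rule integral_cong_AE)
    show "(%x. (psi x *R F m x) \<bullet> b) \<in> borel_measurable lebesgue"
     using borel_measurable_integrable[OF wtest_integrable[OF psi li]] by (intro borel_measurable_inner) auto
    show "AE x in lebesgue. (psi x *R F m x) \<bullet> b = psi' x * (G m x \<bullet> b)"
     using ae FG[of m]
    proof eventually_elim
     case (elim x)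
     then show ?case using p2(3,4) by (cases "x \<in> K") auto
    qed
   qed (auto intro!: measurable_completion)
   also have "... = (\<integral>x. psi' x * (G m x \<bullet> b) \<partial>lborel)" by (rule integral_completion) simp
   finally show ?thesis .
  qed
  have f: "(LINT x|lebesgue. psi x *R f x) \<bullet> b = (\<integral>x. psi' x * (f x \<bullet> b) \<partial>lborel)" for b
  proof -
   have "(LINT x|lebesgue. psi x *R f x) \<bullet> b = (LINT x|lebesgue. (psi x *R f x) \<bullet> b)"
    by (rule integral_inner_left[symmetric]) (use wtest_integrable[OF psi lif] in auto)
   also have "... = (LINT x|lebesgue. psi' x * (f x \<bullet> b))"
   proof (rule integral_cong_AE)
    show "(%x. (psi x *R f x) \<bullet> b) \<in> borel_measurable lebesgue"
     using borel_measurable_integrable[OF wtest_integrable[OF psi lif]] by (intro borel_measurable_inner) auto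
    show "AE x in lebesgue. (psi x *R f x) \<bullet> b = psi' x * (f x \<bullet> b)"
     using ae by eventually_elim auto
   qed (auto intro!: measurable_completion)
   also have "... = (\<integral>x. psi' x * (f x \<bullet> b) \<partial>lborel)" by (rule integral_completion) simp
   finally show ?thesis .
  qed
  show "(%m. LINT x|lebesgue. psi x *R F (r m) x) \<longlonglongrightarrow> (LINT x|lebesgue. psi x *R f x)"
   by (rule tendsto_componentwise_iff[THEN iffD2]) (use lim_f[OF p p2] in \<open>auto simp: F f\<close>)
 qed
 with r lif show ?thesis by (rule that)
qed

section \<open>Stability of weak limits and of their Morrey bounds\<close>

lemma wconvD: "wconv U F f ==> wtest U psi ==> (%m. LINT x|lebesgue. psi x *R F m x) \<longlonglongrightarrow> (LINT x|lebesgue. psi x *R f x)"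
 by (simp add: wconv_def)

lemma wconv_subseq: "strict_mono r ==> wconv U F f ==> wconv U (%m. F (r m)) f"
 unfolding wconv_def using LIMSEQ_subseq_LIMSEQ[of "%m. LINT x|lebesgue. psi x *R F m x" for psi]
 by (auto simp: o_def)

lemma wtest_mono: "V \<subseteq> U ==> wtest V psi ==> wtest U psi"
 unfolding wtest_def by blast

lemma wconv_mono: "V \<subseteq> U ==> wconv U F f ==> wconv V F f"
 unfolding wconv_def by (blast intro: wtest_mono)

lemma wconv_cong:
 assumes "!!m. AE x in lebesgue. x \<in> U --> F m x = G m x" "AE x in lebesgue. x \<in> U --> f x = g x"
  "!!m. locally_integrable U (F m)" "locally_integrable U f" "wconv U F f"
 shows "wconv U G g"
 unfolding wconv_def
proof (intro allI impI)
 fix psi assume "wtest U psi"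
 then show "(%m. LINT x|lebesgue. psi x *R G m x) \<longlonglongrightarrow> (LINT x|lebesgue. psi x *R g x)"
  using wconvD[OF assms(5)] wtest_integral_cong[OF assms(1,3)] wtest_integral_cong[OF assms(2,4)] by simp
qed

lemma locally_integrable_linear:
 assumes "bounded_linear T" "locally_integrable U f"
 shows "locally_integrable U (%x. T (f x))"
 unfolding locally_integrable_def set_integrable_def
proof safe
 interpret bounded_linear T by fact
 fix K assume "compact K" "K \<subseteq> U"
 then have "integrable lebesgue (%x. indicator K x *R f x)"
  using assms(2) by (auto simp: locally_integrable_def set_integrable_def)
 from integrable_bounded_linear[OF assms(1) this]
 show "integrable lebesgue (%x. indicator K x *R T (f x))" by (simp add: scaleR)
qed

lemma wtest_integral_linear:
 assumes "bounded_linear T" "locally_integrable U f" "wtest U psi"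
 shows "(LINT x|lebesgue. psi x *R T (f x)) = T (LINT x|lebesgue. psi x *R f x)"
proof -
 interpret bounded_linear T by fact
 show ?thesis using integral_bounded_linear[OF assms(1) wtest_integrable[OF assms(3,2)]] by (simp add: scaleR)
qed

lemma wconv_linear:
 assumes "bounded_linear T" "!!m. locally_integrable U (F m)" "locally_integrable U f" "wconv U F f"
 shows "wconv U (%m x. T (F m x)) (%x. T (f x))"
 unfolding wconv_def
 using bounded_linear.tendsto[OF assms(1) wconvD[OF assms(4)]]
  wtest_integral_linear[OF assms(1,2)] wtest_integral_linear[OF assms(1,3)] by auto

lemma has_weak_partial_linear:
 assumes "bounded_linear T" "has_weak_partial U i f g"
 shows "has_weak_partial U i (%x. T (f x)) (%x. T (g x))"
proof -
 interpret bounded_linear T by fact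
 have li: "locally_integrable U f" "locally_integrable U g" using assms(2) by (auto simp: has_weak_partial_iff)
 show ?thesis
  unfolding has_weak_partial_iff
 proof (intro conjI allI impI locally_integrable_linear[OF assms(1)] li)
  fix phi assume phi: "test_function U phi"
  then have "(LINT x|lebesgue. partial i phi x *R f x) = - (LINT x|lebesgue. phi x *R g x)"
   using assms(2) by (simp add: has_weak_partial_iff)
  then show "(LINT x|lebesgue. partial i phi x *R T (f x)) = - (LINT x|lebesgue. phi x *R T (g x))"
   unfolding wtest_integral_linear[OF assms(1) li(1) test_function_partial_wtest[OF phi]]
    wtest_integral_linear[OF assms(1) li(2) test_function_wtest[OF phi]]
   by (simp add: linear_neg[OF linear_axioms])
 qed
qed

lemma wconv_has_weak_partial:
 assumes "!!m. has_weak_partial U i (F m) (G m)" "wconv U F f" "wconv U G g"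
  "locally_integrable U f" "locally_integrable U g"
 shows "has_weak_partial U i f g"
 unfolding has_weak_partial_iff
proof (intro conjI allI impI assms(4,5))
 fix phi assume phi: "test_function U phi"
 have "(%m. LINT x|lebesgue. partial i phi x *R F m x) \<longlonglongrightarrow> (LINT x|lebesgue. partial i phi x *R f x)"
  by (rule wconvD[OF assms(2) test_function_partial_wtest[OF phi]])
 moreover have "(%m. LINT x|lebesgue. partial i phi x *R F m x) \<longlonglongrightarrow> - (LINT x|lebesgue. phi x *R g x)"
  using tendsto_minus[OF wconvD[OF assms(3) test_function_wtest[OF phi]]] assms(1) phi
  by (simp add: has_weak_partial_iff)
 ultimately show "(LINT x|lebesgue. partial i phi x *R f x) = - (LINT x|lebesgue. phi x *R g x)"
  by (rule LIMSEQ_unique)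
qed

lemma locally_integrable_measurable_on:
 fixes f :: "real^'n => 'b::euclidean_space"
 assumes "open U" "locally_integrable U f" "V \<subseteq> U" "V \<in> sets lebesgue"
 shows "f \<in> borel_measurable (lebesgue_on V)"
proof -
 have "(%x. indicator V x *R (indicator U x *R f x)) \<in> borel_measurable lebesgue"
  by (intro borel_measurable_scaleR borel_measurable_indicator assms locally_integrable_measurable)
 also have "(%x. indicator V x *R (indicator U x *R f x)) = (%x. indicator V x *R f x)"
  using assms(3) by (auto simp: fun_eq_iff split: split_indicator)
 finally show ?thesis using assms(4) by (subst borel_measurable_restrict_space_iff) auto
qed

lemma open_compactly_in_lmeasurable:
 assumes "open_compactly_in V U"
 shows "open V" "bounded V" "V \<in> lmeasurable" "V \<in> sets lebesgue" "compact (closure V)" "closure V \<subseteq> U"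
proof -
 show 1: "open V" "compact (closure V)" "closure V \<subseteq> U" using assms by (auto simp: open_compactly_in_def)
 show 2: "bounded V" using 1(2) closure_subset by (metis bounded_subset compact_imp_bounded)
 show "V \<in> lmeasurable" using 1(1) 2 by (rule lmeasurable_open[rotated])
 then show "V \<in> sets lebesgue" by auto
qed

lemma wtest_indicator:
 assumes "A \<in> sets lebesgue" "A \<subseteq> S" "compact (closure S)" "closure S \<subseteq> U"
 shows "wtest U (indicator A)"
 unfolding wtest_def
proof (intro conjI exI[of _ "closure S"] exI[of _ 1] allI impI)
 show "indicator A x = (0 :: real)" if "x \<notin> closure S" for x
  using that assms(2) closure_subset[of S] by (auto simp: indicator_def)
qed (use assms in auto)

text \<open>The level set \<open>A\<close> of \<open>f\<close> is tested with \<open>sgn f\<close>: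
  t |A| is at most the integral of |f| over \<open>A\<close>, which is the limit of the integrals of
  \<open>F m\<close> against \<open>sgn f\<close> and hence at most c p/(p-1) |A|^(1-1/p). Solving
  for |A| gives the bound, with the factor p/(p-1) as the price of passing through the duality
  estimate.\<close>

lemma weak_Lp_bound_limit:
 fixes F :: "nat => real^'n => 'b::euclidean_space"
 assumes U: "open U" and S: "S \<in> lmeasurable" "closure S \<subseteq> U" "compact (closure S)"
  and li: "!!m. locally_integrable U (F m)" "locally_integrable U f" and conv: "wconv U F f"
  and bd: "!!m. weak_Lp_bound p S (F m) c" and p: "p > 1"
 shows "weak_Lp_bound p S f (c * (p / (p - 1)))"
 unfolding weak_Lp_bound_def
proof (intro conjI allI impI)
 have c: "0 <= c" using bd[of 0] by (simp add: weak_Lp_bound_def)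
 then show "0 <= c * (p / (p - 1))" using p by simp
 fix t :: real assume t: "t > 0"
 have SU: "S \<subseteq> U" using S(2) closure_subset by blast
 have Sl: "S \<in> sets lebesgue" using S(1) by auto
 have fm[measurable]: "f \<in> borel_measurable (lebesgue_on S)" "!!m. F m \<in> borel_measurable (lebesgue_on S)"
  using locally_integrable_measurable_on[OF U _ SU Sl] li by auto
 define A where "A = {x \<in> S. t < norm (f x)}"
 have AS: "A \<in> sets (lebesgue_on S)"
 proof -
  have "{x \<in> space (lebesgue_on S). t < norm (f x)} \<in> sets (lebesgue_on S)" by measurable
  then show ?thesis by (simp add: A_def)
 qed
 have A[measurable]: "A \<in> sets lebesgue" "A \<subseteq> S" using AS Sl by (auto simp: sets_restrict_space_iff)
 then have Al: "A \<in> lmeasurable" by (intro fmeasurableI2[OF S(1)])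
 define a where "a = measure lebesgue A"
 define psi where "psi b x = indicator A x * (sgn (f x) \<bullet> b)" for b x
 have m1: "(%x. indicator A x *R f x) \<in> borel_measurable lebesgue"
  using measurable_restrict_mono[OF fm(1) A(2)] A(1)
  by (subst (asm) borel_measurable_restrict_space_iff) auto
 have psi: "wtest U (psi b)" if "b \<in> Basis" for b
  unfolding wtest_def
 proof (intro conjI)
  have "psi b = (%x. sgn (indicator A x *R f x) \<bullet> b)" by (auto simp: psi_def indicator_def)
  then show "psi b \<in> borel_measurable lebesgue" using m1 by simp
  have "\<bar>psi b x\<bar> <= 1" for x
   using Basis_le_norm[OF that, of "sgn (f x)"] norm_sgn[of "f x"]
   by (auto simp: psi_def indicator_def split: if_splits)
  then show "\<exists>B. \<forall>x. \<bar>psi b x\<bar> <= B" by blast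
  show "\<exists>K. compact K & K \<subseteq> U & (\<forall>x. x \<notin> K --> psi b x = 0)"
   using S A(2) closure_subset[of S] by (intro exI[of _ "closure S"]) (auto simp: psi_def indicator_def)
 qed
 have eq: "(\<Sum>b\<in>Basis. (LINT x|lebesgue. psi b x *R g x) \<bullet> b) = (LINT x|lebesgue. indicator A x * (g x \<bullet> sgn (f x)))"
  if "locally_integrable U g" for g
 proof -
  have "(\<Sum>b\<in>Basis. (LINT x|lebesgue. psi b x *R g x) \<bullet> b) = (\<Sum>b\<in>Basis. (LINT x|lebesgue. (psi b x *R g x) \<bullet> b))"
   using wtest_integrable[OF psi that] by (intro sum.cong integral_inner_left[symmetric]) auto
  also have "... = (LINT x|lebesgue. (\<Sum>b\<in>Basis. (psi b x *R g x) \<bullet> b))"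
   using wtest_integrable[OF psi that] by (intro Bochner_Integration.integral_sum[symmetric] integrable_inner_left) auto
  also have "... = (LINT x|lebesgue. indicator A x * (g x \<bullet> sgn (f x)))"
   by (intro Bochner_Integration.integral_cong refl)
    (simp add: psi_def euclidean_inner[of "g x" "sgn (f x)" for x] sum_distrib_left mult_ac)
  finally show ?thesis .
 qed
 have Ibd: "integrable lebesgue (%x. indicator A x *R g x)" if "locally_integrable U g" for g :: "real^'n => 'b"
  by (rule wtest_integrable[OF wtest_indicator[OF A S(3,2)] that])
 have "(%m. \<Sum>b\<in>Basis. (LINT x|lebesgue. psi b x *R F m x) \<bullet> b) \<longlonglongrightarrow> (\<Sum>b\<in>Basis. (LINT x|lebesgue. psi b x *R f x) \<bullet> b)"
  by (intro tendsto_intros wconvD[OF conv] psi)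
 then have lim: "(%m. LINT x|lebesgue. indicator A x * (F m x \<bullet> sgn (f x))) \<longlonglongrightarrow> (LINT x|lebesgue. indicator A x * (f x \<bullet> sgn (f x)))"
  by (simp add: eq li)
 have "(LINT x|lebesgue. indicator A x * (F m x \<bullet> sgn (f x))) <= c * (p / (p - 1)) * a powr (1 - 1 / p)" for m
 proof -
  have "(LINT x|lebesgue. indicator A x * (F m x \<bullet> sgn (f x))) <= (LINT x|lebesgue. norm (indicator A x *R F m x))"
  proof (rule integral_mono')
   show "indicator A x * (F m x \<bullet> sgn (f x)) <= norm (indicator A x *R F m x)" for x
    using norm_cauchy_schwarz[of "F m x" "sgn (f x)"] norm_sgn[of "f x"]
    by (auto simp: indicator_def split: if_splits intro: order_trans)
  qed (use integrable_norm[OF Ibd[OF li(1)]] in auto)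
  also have "... <= c * (p / (p - 1)) * a powr (1 - 1 / p)"
  proof -
   have "ennreal (LINT x|lebesgue. norm (indicator A x *R F m x)) = (\<integral>\<^sup>+x. ennreal (norm (indicator A x *R F m x)) \<partial>lebesgue)"
    by (rule nn_integral_eq_integral[symmetric, OF integrable_norm[OF Ibd[OF li(1)]]]) simp
   also have "... = (\<integral>\<^sup>+x. indicator A x * ennreal (norm (F m x)) \<partial>lebesgue_on S)"
    using Sl A(2) by (subst nn_integral_restrict_space) (auto intro!: nn_integral_cong simp: indicator_def)
   also have "... <= ennreal (c * (p / (p - 1)) * measure lebesgue A powr (1 - 1 / p))"
    by (rule weak_Lp_integral_bound[OF bd fm(2) S(1) p AS])
   finally show ?thesis using c p by (simp add: a_def)
  qed
  finally show ?thesis .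
 qed
 then have up: "(LINT x|lebesgue. indicator A x * (f x \<bullet> sgn (f x))) <= c * (p / (p - 1)) * a powr (1 - 1 / p)"
  by (intro LIMSEQ_le_const2[OF lim]) auto
 have fsgn: "f x \<bullet> sgn (f x) = norm (f x)" for x
  by (cases "f x = 0") (simp_all add: sgn_div_norm dot_square_norm power2_eq_square)
 have "(LINT x|lebesgue. t * indicator A x) <= (LINT x|lebesgue. indicator A x * (f x \<bullet> sgn (f x)))"
  unfolding fsgn
 proof (rule integral_mono)
  show "integrable lebesgue (%x. t * indicator A x)"
   using Al by (intro integrable_mult_right integrable_real_indicator) (auto simp: fmeasurable_def)
  show "integrable lebesgue (%x. indicator A x * norm (f x))"
   using integrable_norm[OF Ibd[OF li(2)]] by simp
 qed (auto simp: A_def indicator_def)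
 then have ta: "t * a <= c * (p / (p - 1)) * a powr (1 - 1 / p)" using up by (simp add: a_def)
 have "a <= (c * (p / (p - 1)) / t) powr p"
 proof (cases "a = 0")
  case False
  then have a: "a > 0" by (simp add: a_def zero_less_measure_iff)
  have "a powr (1 - 1 / p) * a powr (1 / p) = a" using a by (simp flip: powr_add)
  then have "(t * a powr (1 / p)) * a powr (1 - 1 / p) <= c * (p / (p - 1)) * a powr (1 - 1 / p)"
   using ta by (simp add: mult_ac)
  then have "t * a powr (1 / p) <= c * (p / (p - 1))" by (rule mult_right_le_imp_le) (use a in simp)
  then have "a powr (1 / p) <= c * (p / (p - 1)) / t" using t by (subst pos_le_divide_eq) (simp_all only: mult.commute)
  then have "(a powr (1 / p)) powr p <= (c * (p / (p - 1)) / t) powr p" using p by (intro powr_mono2) auto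
  then show ?thesis using a p by (simp add: powr_powr)
 qed simp
 then show "emeasure lebesgue {x \<in> S. t < norm (f x)} <= ennreal ((c * (p / (p - 1)) / t) powr p)"
  using Al unfolding A_def[symmetric] a_def by (simp add: emeasure_eq_measure2 ennreal_leI)
qed

lemma Morrey_bound_limit:
 fixes F :: "nat => real^'n => 'b::euclidean_space"
 assumes U: "open U" and V: "open_compactly_in V U"
  and li: "!!m. locally_integrable U (F m)" "locally_integrable U f" and conv: "wconv U F f"
  and bd: "!!m. Morrey_bound p la V (F m) c" and p: "p > 1"
 shows "Morrey_bound p la V f (c * (p / (p - 1)))"
 unfolding Morrey_bound_def
proof (intro conjI ballI)
 show "0 <= c * (p / (p - 1))" using bd[of 0] p by (auto simp: Morrey_bound_def)
 note V' = open_compactly_in_lmeasurable[OF V]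
 fix x r assume xr: "x \<in> V" "r \<in> {0<..diameter V}"
 have cl: "closure (ball x r \<inter> V) \<subseteq> closure V" by (rule closure_mono) auto
 have "weak_Lp_bound p (ball x r \<inter> V) f (c * r powr (la / p) * (p / (p - 1)))"
 proof (rule weak_Lp_bound_limit[OF U _ _ _ li conv _ p])
  show "ball x r \<inter> V \<in> lmeasurable" using V' by (intro lmeasurable_open bounded_Int) auto
  show "closure (ball x r \<inter> V) \<subseteq> U" using cl V' by auto
  show "compact (closure (ball x r \<inter> V))" using V' by (auto intro: bounded_Int)
 qed (use bd xr in \<open>auto simp: Morrey_bound_def\<close>)
 then show "weak_Lp_bound p (ball x r \<inter> V) f (c * (p / (p - 1)) * r powr (la / p))" by (simp add: mult_ac)
qed

lemma Lorentz_tail: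
 assumes phi: "phi \<in> Lorentz_dual p S" and S: "S \<in> lmeasurable"
 shows "(%N. \<integral>\<^sup>+t. indicator {real N<..} t * ennreal (measure lebesgue {x \<in> S. t < \<bar>phi x\<bar>} powr (1 - 1 / p)) \<partial>lborel) \<longlonglongrightarrow> 0"
proof -
 have "phi \<in> borel_measurable (lebesgue_on S)" using phi by (simp add: Lorentz_dual_def)
 note [measurable] = borel_measurable_distribution[OF S this]
 let ?g = "%t. ennreal (measure lebesgue {x \<in> S. t < \<bar>phi x\<bar>} powr (1 - 1 / p))"
 have "(%N. \<integral>\<^sup>+t. indicator {real N<..} t * ?g t \<partial>lborel) \<longlonglongrightarrow> (\<integral>\<^sup>+t. 0 \<partial>(lborel :: real measure))"
 proof (rule nn_integral_dominated_convergence[where w = "%t. ?g t * indicator {0<..} t"])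
  show "(\<integral>\<^sup>+t. ?g t * indicator {0<..} t \<partial>lborel) < \<infinity>" using phi by (simp add: Lorentz_dual_def)
  show "AE t in lborel. indicator {real N<..} t * ?g t <= ?g t * indicator {0<..} t" for N
   by (intro AE_I2) (auto simp: indicator_def)
  show "AE t in lborel. (%N. indicator {real N<..} t * ?g t) \<longlonglongrightarrow> 0"
  proof (intro AE_I2)
   fix t :: real
   obtain n :: nat where "t <= real n" using real_arch_simple by blast
   then have "indicator {real N<..} t * ?g t = 0" if "N >= n" for N
    using that by (auto simp: indicator_def)
   then show "(%N. indicator {real N<..} t * ?g t) \<longlonglongrightarrow> 0"
    by (intro tendsto_eventually) (auto simp: eventually_sequentially)
  qed
 qed (auto simp: indicator_def)
 then show ?thesis by simp
qed

text \<open>Members of \<open>Lorentz_dual\<close> may be unbounded whereas \<open>wconv\<close>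
  tests only with bounded functions. Truncating \<open>phi\<close> at level N commits an error
  bounded by the tail of its Lorentz integral, uniformly in m and also for the limit.\<close>

lemma weak_conv_MorreyI:
 fixes F :: "nat => real^'n => 'b::euclidean_space"
 assumes U: "open U" and V: "open_compactly_in V U"
  and li: "!!m. locally_integrable U (F m)" "locally_integrable U f" and conv: "wconv U F f"
  and bd: "!!m. Morrey_bound p la V (F m) c" and p: "p > 1"
 shows "weak_conv_Morrey p la V F f"
 unfolding weak_conv_Morrey_def
proof (intro conjI allI ballI)
 note V' = open_compactly_in_lmeasurable[OF V]
 have VU: "V \<subseteq> U" using V by (rule open_compactly_in_subset)
 have m: "f \<in> borel_measurable (lebesgue_on V)" "F m \<in> borel_measurable (lebesgue_on V)" for m
  using locally_integrable_measurable_on[OF U _ VU V'(4)] li by auto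
 have bf: "Morrey_bound p la V f (c * (p / (p - 1)))"
  by (rule Morrey_bound_limit[OF U V li conv bd p])
 show "f \<in> weak_Morrey p la V" by (rule weak_MorreyI[OF V'(1,2) bf m(1)])
 show "F n \<in> weak_Morrey p la V" for n by (rule weak_MorreyI[OF V'(1,2) bd m(2)])
 show "\<exists>C. \<forall>m. weak_Morrey_norm p la V (F m) <= ennreal C" using weak_Morrey_norm_le[OF bd] by blast
 fix phi assume phi: "phi \<in> Lorentz_dual p V"
 then have phim[measurable]: "phi \<in> borel_measurable (lebesgue_on V)" by (simp add: Lorentz_dual_def)
 \<comment> \<open>One constant for the sequence and for the limit, whose Morrey bound carries an
   additional factor p/(p-1).\<close>
 define K where "K = max 0 (max (c * diameter V powr (la / p)) (c * (p / (p - 1)) * diameter V powr (la / p)) * (p / (p - 1)))"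
 define T where "T N = (\<integral>\<^sup>+t. indicator {real N<..} t * ennreal (measure lebesgue {x \<in> V. t < \<bar>phi x\<bar>} powr (1 - 1 / p)) \<partial>lborel)" for N
 have T: "T \<longlonglongrightarrow> 0" unfolding T_def by (rule Lorentz_tail[OF phi V'(3)])
 have tail: "(\<integral>\<^sup>+x\<in>V. ennreal ((\<bar>phi x\<bar> - real N) * norm (g x)) \<partial>lebesgue) <= ennreal K * T N"
  if "g = f \<or> g = F m" for g m N
 proof -
  have gm: "g \<in> borel_measurable (lebesgue_on V)" using that m by auto
  obtain c' where c': "weak_Lp_bound p V g c'" "c' * (p / (p - 1)) <= K"
  proof -
   have "weak_Lp_bound p V f (c * (p / (p - 1)) * diameter V powr (la / p))"
    "weak_Lp_bound p V (F m) (c * diameter V powr (la / p))"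
    by (rule Morrey_bound_imp_weak_Lp_bound[OF V'(1,2) bf], rule Morrey_bound_imp_weak_Lp_bound[OF V'(1,2) bd])
   moreover have "c * diameter V powr (la / p) * (p / (p - 1)) <= K" "c * (p / (p - 1)) * diameter V powr (la / p) * (p / (p - 1)) <= K"
    unfolding K_def using p by (intro max.coboundedI2 mult_right_mono max.cobounded1 max.cobounded2; simp)+
   ultimately show ?thesis using \<open>g = f \<or> g = F m\<close> that by blast
  qed
  have "(\<integral>\<^sup>+x\<in>V. ennreal ((\<bar>phi x\<bar> - real N) * norm (g x)) \<partial>lebesgue) =
    (\<integral>\<^sup>+x. ennreal (\<bar>phi x\<bar> - real N) * ennreal (norm (g x)) \<partial>lebesgue_on V)"
   using V'(4) by (subst nn_integral_restrict_space) (auto intro!: nn_integral_cong simp: ennreal_mult'')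
  also have "... <= ennreal (c' * (p / (p - 1))) * T N"
   unfolding T_def by (rule weak_Lp_Lorentz_bound[OF c'(1) gm V'(3) p phim])
  also have "... <= ennreal K * T N" using c'(2) by (intro mult_right_mono ennreal_leI) auto
  finally show ?thesis .
 qed
 have T0: "T 0 < \<infinity>"
  using phi by (simp add: T_def Lorentz_dual_def mult.commute)
 have K0: "0 <= K" by (simp add: K_def)
 have mV: "(%x. indicator V x *R (phi x *R g x)) \<in> borel_measurable lebesgue"
  if "g \<in> borel_measurable (lebesgue_on V)" for g :: "real^'n => 'b"
 proof -
  have "(%x. phi x *R g x) \<in> borel_measurable (lebesgue_on V)" using that by measurable
  then show ?thesis using V'(4) by (subst (asm) borel_measurable_restrict_space_iff) auto
 qed
 define psi where "psi N x = indicator V x * max (- real N) (min (real N) (phi x))" for N x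
 have psi: "wtest U (psi N)" for N
  unfolding wtest_def
 proof (intro conjI)
  have "(%x. max (- real N) (min (real N) (phi x))) \<in> borel_measurable (lebesgue_on V)" by measurable
  then show "psi N \<in> borel_measurable lebesgue"
   using V'(4) by (subst (asm) borel_measurable_restrict_space_iff) (auto simp: psi_def[abs_def])
  have "\<bar>psi N x\<bar> <= real N" for x by (auto simp: psi_def indicator_def)
  then show "\<exists>B. \<forall>x. \<bar>psi N x\<bar> <= B" by blast
  show "\<exists>K. compact K & K \<subseteq> U & (\<forall>x. x \<notin> K --> psi N x = 0)"
   using V' closure_subset[of V] by (intro exI[of _ "closure V"]) (auto simp: psi_def indicator_def)
 qed
 have close: "norm ((LINT x:V|lebesgue. phi x *R g x) - (LINT x|lebesgue. psi N x *R g x)) <= enn2real (ennreal K * T N)"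
  if g: "g = f \<or> g = F m" for g m N
 proof -
  have lig: "locally_integrable U g" and gm: "g \<in> borel_measurable (lebesgue_on V)" using g li m by auto
  have "(\<integral>\<^sup>+x. ennreal (norm (indicator V x *R (phi x *R g x))) \<partial>lebesgue) = (\<integral>\<^sup>+x\<in>V. ennreal ((\<bar>phi x\<bar> - real 0) * norm (g x)) \<partial>lebesgue)"
   by (intro nn_integral_cong) (auto simp: indicator_def)
  also have "... <= ennreal K * T 0" by (rule tail[OF g])
  also have "... < \<infinity>" using T0 by (simp add: ennreal_mult_less_top)
  finally have I1: "integrable lebesgue (%x. indicator V x *R (phi x *R g x))"
   by (intro integrableI_bounded mV gm)
  note I2 = wtest_integrable[OF psi[of N] lig]
  have "ennreal (norm ((LINT x:V|lebesgue. phi x *R g x) - (LINT x|lebesgue. psi N x *R g x))) =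
    ennreal (norm (LINT x|lebesgue. indicator V x *R (phi x *R g x) - psi N x *R g x))"
   unfolding set_lebesgue_integral_def using I1 I2 by simp
  also have "... <= (\<integral>\<^sup>+x. ennreal (norm (indicator V x *R (phi x *R g x) - psi N x *R g x)) \<partial>lebesgue)"
   using I1 I2 by (intro integral_norm_bound_ennreal) auto
  also have "... <= (\<integral>\<^sup>+x\<in>V. ennreal ((\<bar>phi x\<bar> - real N) * norm (g x)) \<partial>lebesgue)"
  proof (rule nn_integral_mono)
   fix x
   show "ennreal (norm (indicator V x *R (phi x *R g x) - psi N x *R g x)) \<le>
    ennreal ((\<bar>phi x\<bar> - real N) * norm (g x)) * indicator V x"
   proof (cases "x \<in> V")
    case True
    define d where "d = phi x - max (- real N) (min (real N) (phi x))"
    have d: "\<bar>d\<bar> = max 0 (\<bar>phi x\<bar> - real N)" by (auto simp: d_def max_def min_def)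
    have "indicator V x *R (phi x *R g x) - psi N x *R g x = d *R g x"
     using True by (simp add: psi_def d_def scaleR_diff_left)
    then have "ennreal (norm (indicator V x *R (phi x *R g x) - psi N x *R g x)) = ennreal (max 0 (\<bar>phi x\<bar> - real N) * norm (g x))"
     by (simp add: d)
    also have "... = ennreal ((\<bar>phi x\<bar> - real N) * norm (g x))"
     by (cases "\<bar>phi x\<bar> <= real N") (auto simp: ennreal_neg mult_nonpos_nonneg max_def)
    finally show ?thesis using True by simp
   qed (simp add: psi_def)
  qed
  also have "... <= ennreal K * T N" by (rule tail[OF g])
  finally have *: "ennreal (norm ((LINT x:V|lebesgue. phi x *R g x) - (LINT x|lebesgue. psi N x *R g x))) <= ennreal K * T N" .
  have "T N <= T 0" unfolding T_def by (intro nn_integral_mono mult_right_mono) (auto simp: indicator_def)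
  then have "ennreal K * T N < \<infinity>" using T0 by (simp add: ennreal_mult_less_top le_less_trans)
  then show ?thesis using * by (simp add: ennreal_le_iff2[symmetric] less_top enn2real_nonneg) (metis ennreal_enn2real ennreal_le_iff enn2real_nonneg less_top)
 qed
 show "(%m. LINT x:V|lebesgue. phi x *R F m x) \<longlonglongrightarrow> (LINT x:V|lebesgue. phi x *R f x)"
 proof (rule tendsto_of_approx)
  fix e :: real assume e: "e > 0"
  have "(%N. ennreal K * T N) \<longlonglongrightarrow> ennreal K * 0"
   by (rule ennreal_tendsto_cmult[OF _ T]) simp
  then have "(%N. enn2real (ennreal K * T N)) \<longlonglongrightarrow> enn2real 0"
   by (intro tendsto_enn2real) auto
  then have "\<forall>\<^sub>F N in sequentially. enn2real (ennreal K * T N) < e" using e by (simp add: order_tendstoD(2))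
  then obtain N where N: "enn2real (ennreal K * T N) <= e" by (meson eventually_sequentially less_imp_le order_refl)
  show "\<exists>b L'. b \<longlonglongrightarrow> L' & (\<forall>m. norm ((LINT x:V|lebesgue. phi x *R F m x) - b m) <= e) \<and>
    norm ((LINT x:V|lebesgue. phi x *R f x) - L') <= e"
   using wconvD[OF conv psi[of N]] order_trans[OF close N] by blast
 qed
qed

section \<open>Translations and difference quotients\<close>

lemma nn_integral_translate:
 fixes g :: "'a::euclidean_space => ennreal"
 assumes "g \<in> borel_measurable borel"
 shows "(\<integral>\<^sup>+x. g (x + c) \<partial>lborel) = (\<integral>\<^sup>+x. g x \<partial>lborel)"
proof -
 have "(\<integral>\<^sup>+x. g x \<partial>lborel) = (\<integral>\<^sup>+x. g x \<partial>distr lborel borel ((+) c))" by (simp add: lborel_distr_plus)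
 also have "... = (\<integral>\<^sup>+x. g (c + x) \<partial>lborel)" using assms by (intro nn_integral_distr) auto
 finally show ?thesis by (simp add: add.commute)
qed

lemma integral_translate:
 fixes g :: "'a::euclidean_space => 'b::euclidean_space"
 assumes "g \<in> borel_measurable borel"
 shows "(\<integral>x. g (x + c) \<partial>lborel) = (\<integral>x. g x \<partial>lborel)"
proof -
 have "(\<integral>x. g x \<partial>lborel) = (\<integral>x. g x \<partial>distr lborel borel ((+) c))" by (simp add: lborel_distr_plus)
 also have "... = (\<integral>x. g (c + x) \<partial>lborel)" using assms by (intro integral_distr) auto
 finally show ?thesis by (simp add: add.commute)
qed

lemma integrable_translate:
 fixes g :: "'a::euclidean_space => 'b::euclidean_space"
 assumes "integrable lborel g"
 shows "integrable lborel (%x. g (x + c))"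
proof -
 have m[measurable]: "g \<in> borel_measurable borel" using borel_measurable_integrable[OF assms] by simp
 show ?thesis
  using assms nn_integral_translate[of "%x. ennreal (norm (g x))" c] by (simp add: integrable_iff_bounded)
qed

lemma norm_triangle_ennreal:
 "ennreal (norm (a + b)) <= ennreal (norm a) + ennreal (norm (b :: 'b::real_normed_vector))"
 by (metis ennreal_leI ennreal_plus norm_ge_zero norm_triangle_ineq)

text \<open>\<open>A\<close> is replaced by a compact \<open>K\<close> inside it and
  \<open>K\<close> by an open \<open>W\<close> around it, each up to small measure. If
  \<open>y\<close> is shorter than the margin of \<open>K\<close> in \<open>W\<close> and exactly
  one of x and x + y lies in \<open>A\<close>, then one of these two points lies in
  \<open>E\<close>.\<close>

lemma L1_translation_indicator:
 fixes A :: "'a::euclidean_space set"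
 assumes A: "A \<in> sets borel" "emeasure lborel A < \<infinity>" and e: "e > 0"
 shows "\<exists>d>0. \<forall>y. norm y < d --> (\<integral>\<^sup>+x. ennreal \<bar>indicator A (x + y) - indicator A x\<bar> \<partial>lborel) <= ennreal e"
proof -
 have Al: "A \<in> sets lebesgue" using A(1) by auto
 obtain T where T: "closed T" "T \<subseteq> A" "A - T \<in> lmeasurable" "emeasure lebesgue (A - T) < ennreal (e / 16)"
  using sets_lebesgue_inner_closed[OF Al, of "e / 16"] e by auto
 have AL: "A \<in> lmeasurable" using A by (auto simp: fmeasurable_def)
 have TL: "T \<in> lmeasurable" using T(1,2) by (intro fmeasurableI2[OF AL]) auto
 have "\<exists>n::nat. emeasure lebesgue (T - cball 0 (real n)) < ennreal (e / 16)"
 proof -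
  have "(%n::nat. emeasure lebesgue (T - cball 0 (real n))) \<longlonglongrightarrow> emeasure lebesgue (\<Inter>n::nat. T - cball 0 (real n))"
  proof (rule Lim_emeasure_decseq)
   show "emeasure lebesgue (T - cball 0 (real n)) ~= \<infinity>" for n
    using fmeasurableD2[OF fmeasurable_Diff[OF TL, of "cball 0 (real n)"]] by simp
   show "range (%n::nat. T - cball 0 (real n)) \<subseteq> sets lebesgue" using T(1) by auto
  qed (auto simp: decseq_def)
  also have "(\<Inter>n::nat. T - cball 0 (real n)) = {}" using real_arch_simple by fastforce
  finally have "\<forall>\<^sub>F n in sequentially. emeasure lebesgue (T - cball 0 (real n)) < ennreal (e / 16)"
   using e by (intro order_tendstoD(2)) auto
  then show ?thesis by (auto simp: eventually_sequentially)
 qed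
 then obtain n :: nat where n: "emeasure lebesgue (T - cball 0 (real n)) < ennreal (e / 16)" by blast
 define K where "K = T \<inter> cball 0 (real n)"
 have K: "compact K" "K \<subseteq> A" using T by (auto simp: K_def closed_Int_compact)
 have [measurable]: "K \<in> sets borel" using K(1) by (simp add: borel_compact)
 have AK: "emeasure lborel (A - K) <= ennreal (e / 8)"
 proof -
  have "emeasure lborel (A - K) = emeasure lebesgue (A - K)" using A(1) by (simp add: emeasure_completion)
  also have "... <= emeasure lebesgue ((A - T) \<union> (T - cball 0 (real n)))"
   using T A by (intro emeasure_mono) (auto simp: K_def)
  also have "... <= emeasure lebesgue (A - T) + emeasure lebesgue (T - cball 0 (real n))"
   using T A by (intro emeasure_subadditive) auto
  also have "... <= ennreal (e / 16) + ennreal (e / 16)" using T n by (intro add_mono) auto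
  also have "... = ennreal (e / 8)" using e by (simp flip: ennreal_plus)
  finally show ?thesis .
 qed
 have Kl: "K \<in> sets lebesgue" by auto
 obtain W where W: "open W" "K \<subseteq> W" "emeasure lebesgue (W - K) < ennreal (e / 8)"
  by (rule sets_lebesgue_outer_open[OF Kl, of "e / 8"]) (use e in simp, blast)
 have [measurable]: "W \<in> sets borel" "A \<in> sets borel" using W A by auto
 have WK: "emeasure lborel (W - K) <= ennreal (e / 8)" using W(3) by (simp add: emeasure_completion)
 obtain d where d: "d > 0" "(\<Union>x\<in>K. ball x d) \<subseteq> W"
  using compact_subset_open_imp_ball_epsilon_subset[OF K(1) W(1,2)] by blast
 define E where "E = (A - K) \<union> (W - K)"
 have [measurable]: "E \<in> sets borel" by (simp add: E_def)
 have E: "emeasure lborel E <= ennreal (e / 4)"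
 proof -
  have "emeasure lborel E <= emeasure lborel (A - K) + emeasure lborel (W - K)"
   unfolding E_def by (intro emeasure_subadditive) auto
  also have "... <= ennreal (e / 8) + ennreal (e / 8)" using AK WK by (rule add_mono)
  also have "... = ennreal (e / 4)" using e by (simp flip: ennreal_plus)
  finally show ?thesis .
 qed
 have "(\<integral>\<^sup>+x. ennreal \<bar>indicator A (x + y) - indicator A x\<bar> \<partial>lborel) <= ennreal e" if y: "norm y < d" for y
 proof -
  have "\<bar>indicator A (x + y) - indicator A x\<bar> <= indicator E x + (indicator E (x + y) :: real)" for x
  proof (cases "x + y \<in> A \<longleftrightarrow> x \<in> A")
   case False
   have *: "x + y \<in> K ==> x \<in> W" "x \<in> K ==> x + y \<in> W"
   proof -
    have "x \<in> ball (x + y) d" "x + y \<in> ball x d" using y by (auto simp: dist_norm)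
    then show "x + y \<in> K ==> x \<in> W" "x \<in> K ==> x + y \<in> W" using d(2) by blast+
   qed
   show ?thesis using False * K(2) by (auto simp: indicator_def E_def)
  qed (auto simp: indicator_def)
  then have "(\<integral>\<^sup>+x. ennreal \<bar>indicator A (x + y) - indicator A x\<bar> \<partial>lborel) \<le>
    (\<integral>\<^sup>+x. indicator E x + indicator E (x + y) \<partial>lborel)"
  proof (intro nn_integral_mono)
   fix x assume *: "!!x. \<bar>indicator A (x + y) - indicator A x\<bar> <= indicator E x + (indicator E (x + y) :: real)"
   have "ennreal \<bar>indicator A (x + y) - indicator A x\<bar> <= ennreal (indicator E x + indicator E (x + y))"
    by (rule ennreal_leI) (rule *)
   also have "... = indicator E x + indicator E (x + y)" by (auto simp: indicator_def)
   finally show "ennreal \<bar>indicator A (x + y) - indicator A x\<bar> <= indicator E x + indicator E (x + y)" .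
  qed
  also have "... = emeasure lborel E + emeasure lborel E"
   by (subst nn_integral_add) (auto simp: nn_integral_translate[of "indicator E"])
  also have "... <= ennreal (e / 4) + ennreal (e / 4)" using E by (intro add_mono)
  also have "... <= ennreal e" using e by (simp add: ennreal_leI flip: ennreal_plus)
  finally show ?thesis .
 qed
 then show ?thesis using d(1) by blast
qed

lemma L1_translation_continuous:
 fixes g :: "'a::euclidean_space => 'b::euclidean_space"
 assumes "integrable lborel g" "e > 0"
 shows "\<exists>d>0. \<forall>y. norm y < d --> (\<integral>\<^sup>+x. ennreal (norm (g (x + y) - g x)) \<partial>lborel) <= ennreal e"
 using assms
proof (induction g arbitrary: e rule: integrable_induct)
 case (base A c)
 \<comment> \<open>Using \<open>norm c + 1\<close> as denominator covers c = 0.\<close>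
 have "e / (norm c + 1) > 0" using base by (simp add: add_nonneg_pos)
 then obtain d where d: "d > 0" "!!y. norm y < d ==>
   (\<integral>\<^sup>+x. ennreal \<bar>indicator A (x + y) - indicator A x\<bar> \<partial>lborel) <= ennreal (e / (norm c + 1))"
  using L1_translation_indicator[of A "e / (norm c + 1)"] base by auto
 have [measurable]: "A \<in> sets borel" using base by simp
 have "(\<integral>\<^sup>+x. ennreal (norm (indicator A (x + y) *R c - indicator A x *R c)) \<partial>lborel) <= ennreal e" if "norm y < d" for y
 proof -
  have "(\<integral>\<^sup>+x. ennreal (norm (indicator A (x + y) *R c - indicator A x *R c)) \<partial>lborel) =
    (\<integral>\<^sup>+x. ennreal \<bar>indicator A (x + y) - indicator A x\<bar> * ennreal (norm c) \<partial>lborel)"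
   by (intro nn_integral_cong) (simp add: ennreal_mult'' flip: scaleR_diff_left)
  also have "... = (\<integral>\<^sup>+x. ennreal \<bar>indicator A (x + y) - indicator A x\<bar> \<partial>lborel) * ennreal (norm c)"
   by (rule nn_integral_multc) measurable
  also have "... <= ennreal (e / (norm c + 1)) * ennreal (norm c)" using d(2)[OF that] by (rule mult_right_mono) simp
  also have "... = ennreal (e / (norm c + 1) * norm c)" by (rule ennreal_mult''[symmetric]) simp
  also have "... <= ennreal e"
  proof (rule ennreal_leI)
   have "norm c <= norm c + 1" by simp
   then have "e * norm c <= e * (norm c + 1)" using base by (intro mult_left_mono) auto
   then show "e / (norm c + 1) * norm c <= e" by (simp add: divide_le_eq add_nonneg_pos)
  qed
  finally show ?thesis .
 qed
 with d(1) show ?case by blast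
next
 case (add f g)
 have [measurable]: "f \<in> borel_measurable borel" "g \<in> borel_measurable borel"
  using borel_measurable_integrable[OF add.hyps(1)] borel_measurable_integrable[OF add.hyps(2)] by simp_all
 from add.IH(1)[of "e / 2"] obtain d1 where d1: "d1 > 0" "!!y. norm y < d1 ==> (\<integral>\<^sup>+x. ennreal (norm (f (x + y) - f x)) \<partial>lborel) <= ennreal (e / 2)"
  using add.prems by auto
 from add.IH(2)[of "e / 2"] obtain d2 where d2: "d2 > 0" "!!y. norm y < d2 ==> (\<integral>\<^sup>+x. ennreal (norm (g (x + y) - g x)) \<partial>lborel) <= ennreal (e / 2)"
  using add.prems by auto
 have "(\<integral>\<^sup>+x. ennreal (norm ((f (x + y) + g (x + y)) - (f x + g x))) \<partial>lborel) <= ennreal e" if y: "norm y < min d1 d2" for y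
 proof -
  have "(\<integral>\<^sup>+x. ennreal (norm ((f (x + y) + g (x + y)) - (f x + g x))) \<partial>lborel) \<le>
    (\<integral>\<^sup>+x. ennreal (norm (f (x + y) - f x)) + ennreal (norm (g (x + y) - g x)) \<partial>lborel)"
   using norm_triangle_ennreal[of "f (x + y) - f x" "g (x + y) - g x" for x] by (intro nn_integral_mono) (simp add: algebra_simps)
  also have "... <= ennreal (e / 2) + ennreal (e / 2)"
   using d1(2)[of y] d2(2)[of y] y by (subst nn_integral_add) (auto intro: add_mono)
  finally show ?thesis using add.prems by (simp flip: ennreal_plus)
 qed
 then show ?case using d1(1) d2(1) by (intro exI[of _ "min d1 d2"]) auto
next
 case (lim f s)
 have [measurable]: "f \<in> borel_measurable borel" "s i \<in> borel_measurable borel" for i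
  using borel_measurable_integrable[OF lim.hyps(4)] borel_measurable_integrable[OF lim.hyps(1)] by simp_all
 \<comment> \<open>The simple approximations are bounded by 2 |f|, so 3 |f| dominates the
   differences.\<close>
 have "(%i. \<integral>\<^sup>+x. ennreal (norm (f x - s i x)) \<partial>lborel) \<longlonglongrightarrow> (\<integral>\<^sup>+x. 0 \<partial>(lborel :: 'a measure))"
 proof (rule nn_integral_dominated_convergence[where w = "%x. ennreal (3 * norm (f x))"])
  show "(\<integral>\<^sup>+x. ennreal (3 * norm (f x)) \<partial>lborel) < \<infinity>"
   using lim.hyps(4) by (simp add: integrable_iff_bounded ennreal_mult nn_integral_cmult ennreal_mult_less_top)
  show "AE x in lborel. ennreal (norm (f x - s i x)) <= ennreal (3 * norm (f x))" for i
  proof (intro AE_I2 ennreal_leI)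
   fix x show "norm (f x - s i x) <= 3 * norm (f x)"
    using norm_triangle_ineq4[of "f x" "s i x"] lim.hyps(3)[of x i] by simp
  qed
  show "AE x in lborel. (%i. ennreal (norm (f x - s i x))) \<longlonglongrightarrow> 0"
  proof (intro AE_I2)
   fix x
   have "(%i. norm (f x - s i x)) \<longlonglongrightarrow> norm (f x - f x)" by (intro tendsto_intros lim.hyps(2)) simp
   then show "(%i. ennreal (norm (f x - s i x))) \<longlonglongrightarrow> 0" using tendsto_ennrealI[of _ 0] by simp
  qed
 qed measurable
 then have "\<forall>\<^sub>F i in sequentially. (\<integral>\<^sup>+x. ennreal (norm (f x - s i x)) \<partial>lborel) < ennreal (e / 3)"
  using lim.prems by (intro order_tendstoD(2)) auto
 then obtain i where i: "(\<integral>\<^sup>+x. ennreal (norm (f x - s i x)) \<partial>lborel) <= ennreal (e / 3)"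
  by (meson eventually_sequentially less_imp_le order_refl)
 from lim.IH[of "e / 3" i] obtain d where d: "d > 0" "!!y. norm y < d ==> (\<integral>\<^sup>+x. ennreal (norm (s i (x + y) - s i x)) \<partial>lborel) <= ennreal (e / 3)"
  using lim.prems by auto
 have "(\<integral>\<^sup>+x. ennreal (norm (f (x + y) - f x)) \<partial>lborel) <= ennreal e" if y: "norm y < d" for y
 proof -
  let ?h = "%x. ennreal (norm (f x - s i x))"
  have "(\<integral>\<^sup>+x. ennreal (norm (f (x + y) - f x)) \<partial>lborel) \<le>
    (\<integral>\<^sup>+x. ?h (x + y) + (ennreal (norm (s i (x + y) - s i x)) + ?h x) \<partial>lborel)"
  proof (rule nn_integral_mono)
   fix x
   have "f (x + y) - f x = (f (x + y) - s i (x + y)) + ((s i (x + y) - s i x) + (s i x - f x))" by simp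
   then have "ennreal (norm (f (x + y) - f x)) <= ennreal (norm (f (x + y) - s i (x + y))) + ennreal (norm ((s i (x + y) - s i x) + (s i x - f x)))"
    using norm_triangle_ennreal by metis
   also have "... <= ?h (x + y) + (ennreal (norm (s i (x + y) - s i x)) + ?h x)"
    using norm_triangle_ennreal[of "s i (x + y) - s i x" "s i x - f x"] by (intro add_left_mono) (simp add: norm_minus_commute)
   finally show "ennreal (norm (f (x + y) - f x)) <= ?h (x + y) + (ennreal (norm (s i (x + y) - s i x)) + ?h x)" .
  qed
  also have "... = (\<integral>\<^sup>+x. ?h (x + y) \<partial>lborel) + ((\<integral>\<^sup>+x. ennreal (norm (s i (x + y) - s i x)) \<partial>lborel) + (\<integral>\<^sup>+x. ?h x \<partial>lborel))"
   by (simp add: nn_integral_add)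
  also have "... = (\<integral>\<^sup>+x. ?h x \<partial>lborel) + ((\<integral>\<^sup>+x. ennreal (norm (s i (x + y) - s i x)) \<partial>lborel) + (\<integral>\<^sup>+x. ?h x \<partial>lborel))"
   by (subst nn_integral_translate[of ?h y]) auto
  also have "... <= ennreal (e / 3) + (ennreal (e / 3) + ennreal (e / 3))" using i d(2)[OF y] by (intro add_mono)
  also have "... = ennreal e" using lim.prems by (simp flip: ennreal_plus)
  finally show ?thesis .
 qed
 with d(1) show ?case by blast
qed

lemma integrable_bounded_scaleR:
 fixes g :: "'a::euclidean_space => 'b::euclidean_space"
 assumes "integrable lborel g" "psi \<in> borel_measurable borel" "!!x. \<bar>psi x\<bar> <= B"
 shows "integrable lborel (%x. psi x *R g x)"
proof (rule Bochner_Integration.integrable_bound[OF integrable_scaleR_right[of B, OF assms(1)]])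
 show "(%x. psi x *R g x) \<in> borel_measurable lborel"
  using assms(2) borel_measurable_integrable[OF assms(1)] by measurable
 show "AE x in lborel. norm (psi x *R g x) <= norm (B *R g x)"
  using order_trans[OF assms(3) abs_ge_self] by (auto intro!: mult_right_mono)
qed

text \<open>Fubini and a translation move the average along the segment from \<open>g\<close> to
  \<open>psi\<close>, reversing its direction. When \<open>psi\<close> is a bump, the averaged test
  on the right is the test function of \<open>shifted_boxbump\<close>.\<close>

lemma segment_average:
 fixes g :: "'a::euclidean_space => 'b::euclidean_space" and e :: 'a and t :: real
 assumes g: "integrable lborel g" and psi[measurable]: "psi \<in> borel_measurable borel" and B: "!!x. \<bar>psi x\<bar> <= B"
 defines "A \<equiv> %x. \<integral>s. indicator {0..t} s *R g (x + s *R e) \<partial>lborel"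
 shows "integrable lborel A" "AE x in lborel. integrable lborel (%s. indicator {0..t} s *R g (x + s *R e))"
  and "(\<integral>x. psi x *R A x \<partial>lborel) = (\<integral>x. (\<integral>s. psi (x - s *R e) * indicator {0..t} s \<partial>lborel) *R g x \<partial>lborel)"
proof -
 have m[measurable]: "g \<in> borel_measurable borel" using borel_measurable_integrable[OF g] by simp
 have gI: "(\<integral>\<^sup>+x. ennreal (norm (g x)) \<partial>lborel) < \<infinity>" using g by (simp add: integrable_iff_bounded)
 have I1: "integrable (lborel \<Otimes>\<^sub>M lborel) (%(x, s). \<xi> x *R indicator {0..t} s *R g (x + s *R e))"
  if [measurable]: "\<xi> \<in> borel_measurable borel" and \<xi>: "!!x. \<bar>\<xi> x\<bar> <= D" for \<xi> D
 proof (rule integrableI_bounded)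
  have "(\<integral>\<^sup>+p. ennreal (norm (case p of (x, s) => \<xi> x *R indicator {0..t} s *R g (x + s *R e))) \<partial>(lborel \<Otimes>\<^sub>M lborel)) =
    (\<integral>\<^sup>+s. (\<integral>\<^sup>+x. ennreal (norm (\<xi> x *R indicator {0..t} s *R g (x + s *R e))) \<partial>lborel) \<partial>lborel)"
   by (subst lborel_pair.nn_integral_snd[symmetric]) (auto simp: case_prod_beta)
  also have "... <= (\<integral>\<^sup>+s. (\<integral>\<^sup>+x. ennreal D * indicator {0..t} s * ennreal (norm (g (x + s *R e))) \<partial>lborel) \<partial>lborel)"
  proof (intro nn_integral_mono)
   fix s x
   have "ennreal (norm (\<xi> x *R indicator {0..t} s *R g (x + s *R e))) <= ennreal (D * (indicator {0..t} s * norm (g (x + s *R e))))"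
    using \<xi>[of x] by (intro ennreal_leI) (auto simp: abs_mult mult.assoc intro: mult_right_mono)
   also have "... = ennreal D * indicator {0..t} s * ennreal (norm (g (x + s *R e)))"
    by (auto simp: ennreal_mult'' indicator_def)
   finally show "ennreal (norm (\<xi> x *R indicator {0..t} s *R g (x + s *R e))) <= ennreal D * indicator {0..t} s * ennreal (norm (g (x + s *R e)))" .
  qed
  also have "... = (\<integral>\<^sup>+s. ennreal D * indicator {0..t} s * (\<integral>\<^sup>+x. ennreal (norm (g x)) \<partial>lborel) \<partial>lborel)"
   by (simp add: nn_integral_cmult nn_integral_translate[of "%x. ennreal (norm (g x))"])
  also have "... = ennreal D * emeasure lborel {0..t} * (\<integral>\<^sup>+x. ennreal (norm (g x)) \<partial>lborel)"
   by (simp add: nn_integral_multc nn_integral_cmult)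
  also have "... < \<infinity>"
  proof -
   have "emeasure lborel {0..t} < \<infinity>" by (rule emeasure_bounded_finite) simp
   then show ?thesis using gI by (simp add: ennreal_mult_less_top)
  qed
  finally show "(\<integral>\<^sup>+p. ennreal (norm (case p of (x, s) => \<xi> x *R indicator {0..t} s *R g (x + s *R e))) \<partial>(lborel \<Otimes>\<^sub>M lborel)) < \<infinity>" .
 qed measurable
 have "integrable (lborel \<Otimes>\<^sub>M lborel) (%(x, s). indicator {0..t} s *R g (x + s *R e))"
  using I1[of "%x. 1" 1] by simp
 from lborel_pair.integrable_fst'[OF this] lborel_pair.AE_integrable_fst'[OF this]
 show "integrable lborel A" "AE x in lborel. integrable lborel (%s. indicator {0..t} s *R g (x + s *R e))"
  by (simp_all add: A_def)
 have I2: "integrable lborel (%x. psi (x + c) *R g x)" for c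
  by (rule Bochner_Integration.integrable_bound[OF integrable_scaleR_right[of B, OF g]])
   (use order_trans[OF B abs_ge_self] in \<open>auto intro!: mult_right_mono\<close>)
 have "(\<integral>x. psi x *R A x \<partial>lborel) = (\<integral>x. (\<integral>s. psi x *R indicator {0..t} s *R g (x + s *R e) \<partial>lborel) \<partial>lborel)"
  unfolding A_def by (simp only: integral_scaleR_right)
 also have "... = (\<integral>s. (\<integral>x. psi x *R indicator {0..t} s *R g (x + s *R e) \<partial>lborel) \<partial>lborel)"
  by (rule lborel_pair.Fubini_integral[symmetric, OF I1[OF psi B]])
 also have "... = (\<integral>s. (\<integral>x. (psi (x - s *R e) * indicator {0..t} s) *R g x \<partial>lborel) \<partial>lborel)"
 proof (rule Bochner_Integration.integral_cong[OF refl])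
  fix s
  show "(\<integral>x. psi x *R indicator {0..t} s *R g (x + s *R e) \<partial>lborel) = (\<integral>x. (psi (x - s *R e) * indicator {0..t} s) *R g x \<partial>lborel)"
   using integral_translate[of "%x. (psi (x - s *R e) * indicator {0..t} s) *R g x" "s *R e"] by simp
 qed
 also have "... = (\<integral>x. (\<integral>s. (psi (x - s *R e) * indicator {0..t} s) *R g x \<partial>lborel) \<partial>lborel)"
 proof (rule lborel_pair.Fubini_integral)
  show "integrable (lborel \<Otimes>\<^sub>M lborel) (%(x, s). (psi (x - s *R e) * indicator {0..t} s) *R g x)"
  proof (rule integrableI_bounded)
   have "(\<integral>\<^sup>+p. ennreal (norm (case p of (x, s) => (psi (x - s *R e) * indicator {0..t} s) *R g x)) \<partial>(lborel \<Otimes>\<^sub>M lborel)) =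
     (\<integral>\<^sup>+s. (\<integral>\<^sup>+x. ennreal (norm ((psi (x - s *R e) * indicator {0..t} s) *R g x)) \<partial>lborel) \<partial>lborel)"
    by (subst lborel_pair.nn_integral_snd[symmetric]) (auto simp: case_prod_beta)
   also have "... <= (\<integral>\<^sup>+s. (\<integral>\<^sup>+x. ennreal B * indicator {0..t} s * ennreal (norm (g x)) \<partial>lborel) \<partial>lborel)"
   proof (intro nn_integral_mono)
    fix s x
    have "ennreal (norm ((psi (x - s *R e) * indicator {0..t} s) *R g x)) <= ennreal (B * (indicator {0..t} s * norm (g x)))"
     using B[of "x - s *R e"] by (intro ennreal_leI) (auto simp: abs_mult mult.assoc intro: mult_right_mono)
    also have "... = ennreal B * indicator {0..t} s * ennreal (norm (g x))"
     by (auto simp: ennreal_mult'' indicator_def)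
    finally show "ennreal (norm ((psi (x - s *R e) * indicator {0..t} s) *R g x)) <= ennreal B * indicator {0..t} s * ennreal (norm (g x))" .
   qed
   also have "... = ennreal B * emeasure lborel {0..t} * (\<integral>\<^sup>+x. ennreal (norm (g x)) \<partial>lborel)"
    by (simp add: nn_integral_multc nn_integral_cmult)
   also have "... < \<infinity>"
   proof -
    have "emeasure lborel {0..t} < \<infinity>" by (rule emeasure_bounded_finite) simp
    then show ?thesis using gI by (simp add: ennreal_mult_less_top)
   qed
   finally show "(\<integral>\<^sup>+p. ennreal (norm (case p of (x, s) => (psi (x - s *R e) * indicator {0..t} s) *R g x)) \<partial>(lborel \<Otimes>\<^sub>M lborel)) < \<infinity>" .
  qed measurable
 qed
 also have "... = (\<integral>x. (\<integral>s. psi (x - s *R e) * indicator {0..t} s \<partial>lborel) *R g x \<partial>lborel)"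
 proof (rule Bochner_Integration.integral_cong[OF refl])
  fix x
  have "integrable lborel (%s. psi (x - s *R e) * indicator {0..t} s)"
  proof -
   have "integrable lborel (indicator {0..t} :: real => real)"
    by (rule integrable_real_indicator) (auto simp: emeasure_lborel_Icc_eq)
   from integrable_bounded_scaleR[OF this, of "%s. psi (x - s *R e)" B] B show ?thesis by simp
  qed
  then show "(\<integral>s. (psi (x - s *R e) * indicator {0..t} s) *R g x \<partial>lborel) = (\<integral>s. psi (x - s *R e) * indicator {0..t} s \<partial>lborel) *R g x"
   by (intro integral_scaleR_left) auto
 qed
 finally show "(\<integral>x. psi x *R A x \<partial>lborel) = (\<integral>x. (\<integral>s. psi (x - s *R e) * indicator {0..t} s \<partial>lborel) *R g x \<partial>lborel)" .
qed

lemma locally_integrable_lborel: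
 fixes f :: "real^'n => 'b::euclidean_space"
 assumes [measurable]: "f \<in> borel_measurable borel"
 shows "locally_integrable U f \<longleftrightarrow> (\<forall>K. compact K & K \<subseteq> U --> integrable lborel (%x. indicator K x *R f x))"
proof -
 have "integrable lebesgue (%x. indicator K x *R f x) = integrable lborel (%x. indicator K x *R f x)"
  if "compact K" for K
 proof -
  have [measurable]: "K \<in> sets borel" using that by (simp add: borel_compact)
  show ?thesis by (rule integrable_completion) simp
 qed
 then show ?thesis by (auto simp: locally_integrable_def set_integrable_def)
qed

text \<open>The fundamental theorem of calculus along a coordinate direction, for one fixed step t.
  Testing the weak derivative with the averaged bumps of \<open>shifted_boxbump\<close> shows that
  the defect \<open>D\<close> integrates to zero against every bump, hence over every box, hence
  vanishes almost everywhere.\<close>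

lemma weak_partial_translation:
 fixes u v :: "real^'n => 'b::euclidean_space"
 assumes U: "open U" and t: "t > 0" and wp: "has_weak_partial U i u v"
  and [measurable]: "u \<in> borel_measurable borel" "v \<in> borel_measurable borel"
 shows "AE x in lborel. (\<forall>s\<in>{0..t}. x + s *R axis i 1 \<in> U) -->
  u (x + t *R axis i 1) - u x = (\<integral>s. indicator {0..t} s *R v (x + s *R axis i 1) \<partial>lborel)"
proof -
 define e :: "real^'n" where "e = axis i 1"
 define G where "G = {x. \<forall>s\<in>{0..t}. x + s *R e \<in> U}"
 define seg where "seg K = {x + y | x y. x \<in> K & y \<in> (%s. s *R e) ` {0..t}}" for K :: "(real^'n) set"
 \<comment> \<open>The complement of \<open>G\<close> is the closed complement of \<open>U\<close>
   swept backwards along a compact segment, hence closed.\<close>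
 have "closed (\<Union>x\<in>- U. \<Union>y\<in>(%s. (- s) *R e) ` {0..t}. {x + y})"
  using U by (intro closed_compact_sums compact_continuous_image continuous_intros) auto
 also have "(\<Union>x\<in>- U. \<Union>y\<in>(%s. (- s) *R e) ` {0..t}. {x + y}) = - G"
 proof (intro equalityI subsetI)
  fix z assume "z \<in> (\<Union>x\<in>- U. \<Union>y\<in>(%s. (- s) *R e) ` {0..t}. {x + y})"
  then obtain x s where "x \<notin> U" "s \<in> {0..t}" "z = x + (- s) *R e" by blast
  then show "z \<in> - G" by (auto simp: G_def intro!: bexI[of _ s])
 next
  fix x assume "x \<in> - G"
  then obtain s where s: "s \<in> {0..t}" "x + s *R e \<notin> U" by (auto simp: G_def)
  then show "x \<in> (\<Union>x\<in>- U. \<Union>y\<in>(%s. (- s) *R e) ` {0..t}. {x + y})"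
   by (intro UN_I[of "x + s *R e"] UN_I[of "(- s) *R e"]) auto
 qed
 finally have oG: "open G" by (simp add: closed_def)
 have cseg: "compact (seg K)" if "compact K" for K
  unfolding seg_def using that by (intro compact_sums compact_continuous_image continuous_intros) auto
 have segU: "seg K \<subseteq> U" if "K \<subseteq> G" for K using that by (auto simp: seg_def G_def)
 have segI: "x + s *R e \<in> seg K" if "x \<in> K" "s \<in> {0..t}" for x s K
  using that unfolding seg_def by (intro CollectI exI[of _ x] exI[of _ "s *R e"]) auto
 have seg0: "x \<in> K ==> x \<in> seg K" for x K using segI[of x K 0] t by simp
 have li: "locally_integrable U u" "locally_integrable U v" using wp by (auto simp: has_weak_partial_iff)
 define A where "A g x = (\<integral>s. indicator {0..t} s *R g (x + s *R e) \<partial>lborel)" for g :: "real^'n => 'b" and x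
 define D where "D x = u (x + t *R e) - u x - A v x" for x
 have [measurable]: "A v \<in> borel_measurable borel" unfolding A_def[abs_def] by measurable
 have [measurable]: "D \<in> borel_measurable borel" unfolding D_def[abs_def] by measurable
 have loc: "integrable lborel (%x. indicator (seg K) x *R u x)" "integrable lborel (%x. indicator (seg K) x *R v x)"
  "!!x. x \<in> K ==> D x = indicator (seg K) (x + t *R e) *R u (x + t *R e) - indicator (seg K) x *R u x
    - A (%x. indicator (seg K) x *R v x) x" if K: "compact K" "K \<subseteq> G" for K
 proof -
  show "integrable lborel (%x. indicator (seg K) x *R u x)" "integrable lborel (%x. indicator (seg K) x *R v x)"
   using li cseg[OF K(1)] segU[OF K(2)] by (auto simp: locally_integrable_lborel)
  show "D x = indicator (seg K) (x + t *R e) *R u (x + t *R e) - indicator (seg K) x *R u x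
    - A (%x. indicator (seg K) x *R v x) x" if x: "x \<in> K" for x
  proof -
   have "A v x = A (%x. indicator (seg K) x *R v x) x"
    unfolding A_def by (intro Bochner_Integration.integral_cong refl) (use segI[OF x] in \<open>auto simp: indicator_def\<close>)
   then show ?thesis using segI[OF x, of t] seg0[OF x] t by (simp add: D_def)
  qed
 qed
 have lin: "integrable lborel (%x. indicator (seg K) (x + t *R e) *R u (x + t *R e) - indicator (seg K) x *R u x
    - A (%x. indicator (seg K) x *R v x) x)" if K: "compact K" "K \<subseteq> G" for K
  using integrable_translate[OF loc(1)[OF K], of "t *R e"] loc(1)[OF K]
   segment_average(1)[OF loc(2)[OF K], of "%x. 1" 1 t e] by (auto simp: A_def)
 have liD: "locally_integrable G D"
  unfolding locally_integrable_lborel[OF \<open>D \<in> _\<close>]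
 proof (intro allI impI)
  fix K assume "compact K & K \<subseteq> G"
  then have K: "compact K" "K \<subseteq> G" by auto
  have [measurable]: "K \<in> sets borel" using K(1) by (simp add: borel_compact)
  have "integrable lborel (%x. indicator K x *R (indicator (seg K) (x + t *R e) *R u (x + t *R e) - indicator (seg K) x *R u x
    - A (%x. indicator (seg K) x *R v x) x))"
   by (rule integrable_mult_indicator[OF _ lin[OF K]]) simp
  also have "(%x. indicator K x *R (indicator (seg K) (x + t *R e) *R u (x + t *R e) - indicator (seg K) x *R u x
    - A (%x. indicator (seg K) x *R v x) x)) = (%x. indicator K x *R D x)"
  proof
   fix x show "indicator K x *R (indicator (seg K) (x + t *R e) *R u (x + t *R e) - indicator (seg K) x *R u x
    - A (%x. indicator (seg K) x *R v x) x) = indicator K x *R D x"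
    using loc(3)[OF K, of x] by (cases "x \<in> K") auto
  qed
  finally show "integrable lborel (%x. indicator K x *R D x)" .
 qed
 have "(LINT x|lebesgue. indicator (box a b) x *R D x) = 0" if ab: "cbox a b \<subseteq> G" for a b
 proof (cases "box a b = {}")
  case False
  let ?K = "cbox a b"
  have K: "compact ?K" "?K \<subseteq> G" using ab by auto
  \<comment> \<open>Cutting off at the compact set swept by the box makes both functions globally
    integrable, so that translation and Fubini apply, without changing \<open>D\<close> on the
    box.\<close>
  define uK where "uK x = indicator (seg ?K) x *R u x" for x
  define g where "g x = indicator (seg ?K) x *R v x" for x
  define h where "h x = uK (x + t *R e) - uK x - A g x" for x
  have uKI: "integrable lborel uK" and gI: "integrable lborel g"
   using loc(1,2)[OF K] by (simp_all add: uK_def[abs_def] g_def[abs_def])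
  have hI: "integrable lborel h" using lin[OF K] by (simp add: h_def[abs_def] uK_def g_def[abs_def])
  have hD: "h x = D x" if "x \<in> ?K" for x using loc(3)[OF K that] by (simp add: h_def uK_def g_def[abs_def])
  have [measurable]: "uK \<in> borel_measurable borel" using borel_measurable_integrable[OF uKI] by simp
  have sub: "cbox a (b + t *R axis i 1) \<subseteq> seg ?K"
  proof
   fix x assume x: "x \<in> cbox a (b + t *R axis i 1)"
   \<comment> \<open>The least shift back along the axis that brings \<open>x\<close> into the
     box.\<close>
   define s where "s = max 0 (x $ i - b $ i)"
   have ax: "e $ j = (if j = i then 1 else 0)" for j by (auto simp: e_def axis_def)
   have bx: "a $ j <= x $ j" "x $ j <= b $ j + t * e $ j" for j
    using x by (auto simp: mem_box_cart e_def)
   obtain z where "z \<in> box a b" using False by blast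
   then have abj: "a $ j <= b $ j" for j by (meson mem_box_cart less_trans less_imp_le)
   have "s \<in> {0..t}" using bx[of i] t by (auto simp: s_def ax)
   moreover have "x - s *R e \<in> ?K"
    unfolding mem_box_cart
   proof (intro allI conjI)
    fix j show "a $ j <= (x - s *R e) $ j" "(x - s *R e) $ j <= b $ j"
     using bx[of j] abj[of j] by (auto simp: ax s_def max_def)
   qed
   ultimately show "x \<in> seg ?K" using segI[of "x - s *R e" ?K s] by simp
  qed
  have phi0: "boxbump k a b (x - s *R e) = 0" if "x \<notin> seg ?K" "s \<in> {0..t}" for k x s
   using segI[of "x - s *R e" ?K s] that box_subset_cbox[of a b] by (intro boxbump_outside) auto
  have bb[measurable]: "boxbump k a b \<in> borel_measurable borel" for k
   using boxbump_continuous by (rule borel_measurable_continuous_onI)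
  have bbB: "\<bar>boxbump k a b x\<bar> <= 1" for k x using boxbump_bounds[of k a b x] by simp
  have zero: "(\<integral>x. boxbump k a b x *R h x \<partial>lborel) = 0" for k
  proof -
   obtain Phi where Phi: "test_function U Phi"
    "!!x. partial i Phi x = boxbump k a b x - boxbump k a b (x - t *R axis i 1)"
    "!!x. Phi x = (\<integral>s. boxbump k a b (x - s *R axis i 1) * indicator {0..t} s \<partial>lborel)"
    using shifted_boxbump[OF t order_trans[OF sub segU[OF K(2)]], of k] by blast
   have Phi0: "Phi x = 0" if "x \<notin> seg ?K" for x
   proof -
    have "(%s. boxbump k a b (x - s *R axis i 1) * indicator {0..t} s) = (%s. 0)"
     using phi0[OF that] by (auto simp: fun_eq_iff e_def split: split_indicator)
    then show ?thesis by (simp add: Phi(3))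
   qed
   have [measurable]: "Phi \<in> borel_measurable borel"
    by (rule test_function_support[OF Phi(1)]) (rule borel_measurable_continuous_onI)
   have "(LINT x|lebesgue. partial i Phi x *R u x) = (\<integral>x. boxbump k a b x *R uK x - boxbump k a b (x - t *R e) *R uK x \<partial>lborel)"
   proof -
    have "partial i Phi x *R u x = boxbump k a b x *R uK x - boxbump k a b (x - t *R e) *R uK x" for x
     using phi0[of x 0 k] phi0[of x t k] t
     by (cases "x \<in> seg ?K") (auto simp: Phi(2) uK_def e_def scaleR_diff_left)
    then show ?thesis by (simp only:) (rule integral_completion, simp)
   qed
   also have "... = (\<integral>x. boxbump k a b x *R uK x \<partial>lborel) - (\<integral>x. boxbump k a b (x - t *R e) *R uK x \<partial>lborel)"
    by (rule Bochner_Integration.integral_diff) (use bbB in \<open>auto intro!: integrable_bounded_scaleR[OF uKI, of _ 1]\<close>)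
   also have "(\<integral>x. boxbump k a b (x - t *R e) *R uK x \<partial>lborel) = (\<integral>x. boxbump k a b x *R uK (x + t *R e) \<partial>lborel)"
    using integral_translate[of "%x. boxbump k a b (x - t *R e) *R uK x" "t *R e"] by simp
   finally have 1: "(LINT x|lebesgue. partial i Phi x *R u x) = (\<integral>x. boxbump k a b x *R uK x \<partial>lborel) - (\<integral>x. boxbump k a b x *R uK (x + t *R e) \<partial>lborel)" .
   have "(LINT x|lebesgue. Phi x *R v x) = (\<integral>x. Phi x *R g x \<partial>lborel)"
   proof -
    have "Phi x *R v x = Phi x *R g x" for x using Phi0[of x] by (cases "x \<in> seg ?K") (auto simp: g_def)
    moreover have "(LINT x|lebesgue. Phi x *R v x) = (\<integral>x. Phi x *R v x \<partial>lborel)" by (rule integral_completion) simp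
    ultimately show ?thesis by (simp only:)
   qed
   also have "... = (\<integral>x. boxbump k a b x *R A g x \<partial>lborel)"
    using segment_average(3)[OF gI bb bbB, of k t e] by (simp add: A_def Phi(3) e_def)
   finally have 2: "(LINT x|lebesgue. Phi x *R v x) = (\<integral>x. boxbump k a b x *R A g x \<partial>lborel)" .
   have AgI: "integrable lborel (A g)" using segment_average(1)[OF gI bb bbB, of t e] by (simp add: A_def[abs_def])
   have "(\<integral>x. boxbump k a b x *R h x \<partial>lborel) = (\<integral>x. boxbump k a b x *R uK (x + t *R e) - boxbump k a b x *R uK x - boxbump k a b x *R A g x \<partial>lborel)"
    by (simp add: h_def scaleR_diff_right)
   also have "... = (\<integral>x. boxbump k a b x *R uK (x + t *R e) \<partial>lborel) - (\<integral>x. boxbump k a b x *R uK x \<partial>lborel) - (\<integral>x. boxbump k a b x *R A g x \<partial>lborel)"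
    using integrable_bounded_scaleR[OF integrable_translate[OF uKI] bb bbB] integrable_bounded_scaleR[OF uKI bb bbB]
     integrable_bounded_scaleR[OF AgI bb bbB] by simp
   also have "... = 0"
   proof -
    have "(\<integral>x. boxbump k a b x *R uK x \<partial>lborel) - (\<integral>x. boxbump k a b x *R uK (x + t *R e) \<partial>lborel) = - (\<integral>x. boxbump k a b x *R A g x \<partial>lborel)"
     using wp Phi(1) 1 2 by (simp add: has_weak_partial_iff)
    from arg_cong[OF this, of uminus] show ?thesis by simp
   qed
   finally show ?thesis .
  qed
  have "(%k. \<integral>x. boxbump k a b x *R h x \<partial>lborel) \<longlonglongrightarrow> (\<integral>x. indicator (box a b) x *R h x \<partial>lborel)"
  proof (rule integral_dominated_convergence[where w = "%x. norm (h x)"])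
   show "AE x in lborel. (%k. boxbump k a b x *R h x) \<longlonglongrightarrow> indicator (box a b) x *R h x"
    by (intro AE_I2 tendsto_intros boxbump_tendsto)
   show "AE x in lborel. norm (boxbump k a b x *R h x) <= norm (h x)" for k
    using bbB by (intro AE_I2) (auto intro!: mult_left_le_one_le)
  qed (use hI borel_measurable_integrable[OF hI] in auto)
  then have "(\<integral>x. indicator (box a b) x *R h x \<partial>lborel) = 0"
   unfolding zero using LIMSEQ_unique[OF _ tendsto_const] by blast
  moreover have "indicator (box a b) x *R h x = indicator (box a b) x *R D x" for x
   using hD[of x] box_subset_cbox[of a b] by (auto simp: indicator_def)
  ultimately show ?thesis by (simp add: integral_completion)
 qed simp
 from AE_zero_of_box_integrals[OF oG liD this] have "AE x in lebesgue. x \<in> G --> D x = 0" .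
 then have "AE x in lborel. x \<in> G --> D x = 0" by (simp add: AE_completion_iff)
 then show ?thesis by eventually_elim (auto simp: G_def D_def A_def e_def)
qed

lemma norm_integral_le_nn:
 fixes f :: "'a => 'b::euclidean_space"
 shows "ennreal (norm (integral\<^sup>L M f)) <= (\<integral>\<^sup>+x. ennreal (norm (f x)) \<partial>M)"
 by (cases "integrable M f") (auto intro: integral_norm_bound_ennreal simp: not_integrable_integral_eq)

text \<open>Integrates the segment formula over \<open>K\<close>. After Fubini, translation
  invariance bounds the contribution of each s in [0, t] by the integral over \<open>K'\<close>,
  which contains all segments starting in \<open>K\<close>.\<close>

lemma translation_L1_bound:
 fixes u v :: "real^'n => 'b::euclidean_space"
 assumes U: "open U" and t: "t > 0" and wp: "has_weak_partial U i u v"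
  and m[measurable]: "u \<in> borel_measurable borel" "v \<in> borel_measurable borel" "K \<in> sets borel" "K' \<in> sets borel"
  and K: "!!x s. x \<in> K ==> s \<in> {0..t} ==> x + s *R axis i 1 \<in> K'" "K' \<subseteq> U"
 shows "(\<integral>\<^sup>+x\<in>K. ennreal (norm (u (x + t *R axis i 1) - u x)) \<partial>lborel) <= ennreal t * (\<integral>\<^sup>+x\<in>K'. ennreal (norm (v x)) \<partial>lborel)"
proof -
 define e :: "real^'n" where "e = axis i 1"
 let ?g = "%x. ennreal (norm (v x)) * indicator K' x"
 have "(\<integral>\<^sup>+x\<in>K. ennreal (norm (u (x + t *R e) - u x)) \<partial>lborel) <= (\<integral>\<^sup>+x. (\<integral>\<^sup>+s. indicator {0..t} s * ?g (x + s *R e) \<partial>lborel) \<partial>lborel)"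
 proof (rule nn_integral_mono_AE)
  show "AE x in lborel. ennreal (norm (u (x + t *R e) - u x)) * indicator K x <= (\<integral>\<^sup>+s. indicator {0..t} s * ?g (x + s *R e) \<partial>lborel)"
   using weak_partial_translation[OF U t wp m(1,2)]
  proof eventually_elim
   case (elim x)
   show ?case
   proof (cases "x \<in> K")
    case True
    then have "u (x + t *R e) - u x = (\<integral>s. indicator {0..t} s *R v (x + s *R e) \<partial>lborel)"
     using elim K by (auto simp: e_def)
    then have "ennreal (norm (u (x + t *R e) - u x)) <= (\<integral>\<^sup>+s. ennreal (norm (indicator {0..t} s *R v (x + s *R e))) \<partial>lborel)"
     by (simp only: norm_integral_le_nn)
    also have "... = (\<integral>\<^sup>+s. indicator {0..t} s * ?g (x + s *R e) \<partial>lborel)"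
     by (intro nn_integral_cong) (use K(1)[OF True] in \<open>auto simp: indicator_def e_def\<close>)
    finally show ?thesis using True by simp
   qed simp
  qed
 qed
 also have "... = (\<integral>\<^sup>+s. (\<integral>\<^sup>+x. indicator {0..t} s * ?g (x + s *R e) \<partial>lborel) \<partial>lborel)"
  by (rule lborel_pair.Fubini'[symmetric]) measurable
 also have "... = (\<integral>\<^sup>+s. indicator {0..t} s * (\<integral>\<^sup>+x. ?g x \<partial>lborel) \<partial>lborel)"
  by (simp add: nn_integral_cmult nn_integral_translate[of ?g])
 also have "... = ennreal t * (\<integral>\<^sup>+x\<in>K'. ennreal (norm (v x)) \<partial>lborel)"
  using t by (simp add: nn_integral_multc)
 finally show ?thesis by (simp add: e_def)
qed

text \<open>By the segment formula, the difference quotient minus \<open>v\<close> is the average of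
  v(x + s e) - v(x) over s in [0, t], which is small in L^1 by continuity of translations.\<close>

lemma difference_quotient_L1:
 fixes u v :: "real^'n => 'b::euclidean_space"
 assumes U: "open U" and wp: "has_weak_partial U i u v"
  and m[measurable]: "u \<in> borel_measurable borel" "v \<in> borel_measurable borel"
  and K: "compact K" "K \<subseteq> U" and eps: "eps > 0"
 shows "\<exists>d>0. \<forall>t. 0 < t & t < d -->
  (\<integral>\<^sup>+x\<in>K. ennreal (norm ((1 / t) *R (u (x + t *R axis i 1) - u x) - v x)) \<partial>lborel) <= ennreal eps"
proof -
 define e :: "real^'n" where "e = axis i 1"
 have ne: "norm e = 1" by (simp add: e_def)
 have [measurable]: "K \<in> sets borel" using K(1) by (simp add: borel_compact)
 obtain eta where eta: "eta > 0" "(\<Union>x\<in>K. cball x eta) \<subseteq> U"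
  using compact_subset_open_imp_cball_epsilon_subset[OF K(1) U K(2)] by blast
 define K' where "K' = (\<Union>x\<in>K. cball x eta)"
 have "K' = {x + y | x y. x \<in> K & y \<in> cball 0 eta}"
 proof safe
  fix z assume "z \<in> K'"
  then obtain x where "x \<in> K" "dist x z <= eta" by (auto simp: K'_def)
  then show "\<exists>x y. z = x + y & x \<in> K & y \<in> cball 0 eta"
   by (intro exI[of _ x] exI[of _ "z - x"]) (auto simp: dist_norm norm_minus_commute)
 qed (auto simp: K'_def dist_norm intro!: bexI)
 then have cK': "compact K'" using K(1) compact_sums[OF K(1) compact_cball[of 0 eta]] by simp
 have [measurable]: "K' \<in> sets borel" using cK' by (simp add: borel_compact)
 define g where "g x = indicator K' x *R v x" for x
 have gI: "integrable lborel g"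
  using wp cK' eta(2) by (auto simp: has_weak_partial_iff locally_integrable_lborel K'_def g_def[abs_def])
 have [measurable]: "g \<in> borel_measurable borel" unfolding g_def by measurable
 obtain delta where delta: "delta > 0" "!!y. norm y < delta ==> (\<integral>\<^sup>+x. ennreal (norm (g (x + y) - g x)) \<partial>lborel) <= ennreal eps"
  using L1_translation_continuous[OF gI eps] by blast
 have "(\<integral>\<^sup>+x\<in>K. ennreal (norm ((1 / t) *R (u (x + t *R e) - u x) - v x)) \<partial>lborel) <= ennreal eps"
  if t: "0 < t" "t < min delta eta" for t
 proof -
  have inK': "x + s *R e \<in> K'" if "x \<in> K" "s \<in> {0..t}" for x s
   using that t ne by (auto simp: K'_def dist_norm intro!: bexI[of _ x])
  have "(\<integral>\<^sup>+x\<in>K. ennreal (norm ((1 / t) *R (u (x + t *R e) - u x) - v x)) \<partial>lborel) \<le>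
    (\<integral>\<^sup>+x. (\<integral>\<^sup>+s. ennreal (1 / t) * indicator {0..t} s * ennreal (norm (g (x + s *R e) - g x)) \<partial>lborel) \<partial>lborel)"
  proof (rule nn_integral_mono_AE)
   show "AE x in lborel. ennreal (norm ((1 / t) *R (u (x + t *R e) - u x) - v x)) * indicator K x
     <= (\<integral>\<^sup>+s. ennreal (1 / t) * indicator {0..t} s * ennreal (norm (g (x + s *R e) - g x)) \<partial>lborel)"
    using weak_partial_translation[OF U t(1) wp m] segment_average(2)[OF gI, of "%x. 1" 1 t e, simplified]
   proof eventually_elim
    case (elim x)
    show ?case
    proof (cases "x \<in> K")
     case True
     have vg: "v (x + s *R e) = g (x + s *R e)" if "s \<in> {0..t}" for s
      using inK'[OF True that] by (simp add: g_def)
     have vx: "v x = g x" using vg[of 0] t by simp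
     have "\<forall>s\<in>{0..t}. x + s *R e \<in> U" using inK'[OF True] eta(2) by (auto simp: K'_def)
     then have "u (x + t *R e) - u x = (\<integral>s. indicator {0..t} s *R v (x + s *R e) \<partial>lborel)"
      using elim(1) by (simp add: e_def)
     also have "... = (\<integral>s. indicator {0..t} s *R g (x + s *R e) \<partial>lborel)"
      by (intro Bochner_Integration.integral_cong refl) (use vg in \<open>auto simp: indicator_def\<close>)
     finally have 1: "u (x + t *R e) - u x = (\<integral>s. indicator {0..t} s *R g (x + s *R e) \<partial>lborel)" .
     have cI: "integrable lborel (%s. indicator {0..t} s *R g x)"
      by (intro integrable_scaleR_left integrable_real_indicator) (auto simp: emeasure_lborel_Icc_eq)
     have "(1 / t) *R (u (x + t *R e) - u x) - v x = (1 / t) *R ((\<integral>s. indicator {0..t} s *R g (x + s *R e) \<partial>lborel) - (\<integral>s. indicator {0..t} s *R g x \<partial>lborel))"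
      using t by (simp add: 1 vx scaleR_diff_right)
     also have "... = (1 / t) *R (\<integral>s. indicator {0..t} s *R g (x + s *R e) - indicator {0..t} s *R g x \<partial>lborel)"
      using elim(2) cI by simp
     also have "... = (\<integral>s. (1 / t) *R (indicator {0..t} s *R g (x + s *R e) - indicator {0..t} s *R g x) \<partial>lborel)"
      by simp
     finally have "ennreal (norm ((1 / t) *R (u (x + t *R e) - u x) - v x)) \<le>
       (\<integral>\<^sup>+s. ennreal (norm ((1 / t) *R (indicator {0..t} s *R g (x + s *R e) - indicator {0..t} s *R g x))) \<partial>lborel)"
      by (simp only: norm_integral_le_nn)
     also have "... = (\<integral>\<^sup>+s. ennreal (1 / t) * indicator {0..t} s * ennreal (norm (g (x + s *R e) - g x)) \<partial>lborel)"
     proof (intro nn_integral_cong)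
      fix s
      have "norm ((1 / t) *R (indicator {0..t} s *R g (x + s *R e) - indicator {0..t} s *R g x)) = (1 / t) * (indicator {0..t} s * norm (g (x + s *R e) - g x))"
       using t by (auto simp: indicator_def)
      then show "ennreal (norm ((1 / t) *R (indicator {0..t} s *R g (x + s *R e) - indicator {0..t} s *R g x))) =
        ennreal (1 / t) * indicator {0..t} s * ennreal (norm (g (x + s *R e) - g x))"
       using ennreal_mult''[of "norm (g (x + s *R e) - g x)" "1 / t"] by (auto simp: indicator_def)
     qed
     finally show ?thesis using True by simp
    qed simp
   qed
  qed
  also have "... = (\<integral>\<^sup>+s. (\<integral>\<^sup>+x. ennreal (1 / t) * indicator {0..t} s * ennreal (norm (g (x + s *R e) - g x)) \<partial>lborel) \<partial>lborel)"
   by (rule lborel_pair.Fubini'[symmetric]) measurable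
  also have "... <= (\<integral>\<^sup>+s. ennreal (1 / t) * indicator {0..t} s * ennreal eps \<partial>lborel)"
  proof (rule nn_integral_mono)
   fix s
   have "(\<integral>\<^sup>+x. ennreal (1 / t) * indicator {0..t} s * ennreal (norm (g (x + s *R e) - g x)) \<partial>lborel) =
     ennreal (1 / t) * indicator {0..t} s * (\<integral>\<^sup>+x. ennreal (norm (g (x + s *R e) - g x)) \<partial>lborel)"
    by (rule nn_integral_cmult) measurable
   also have "... <= ennreal (1 / t) * indicator {0..t} s * ennreal eps"
    using delta(2)[of "s *R e"] t ne by (cases "s \<in> {0..t}") (auto intro!: mult_left_mono)
   finally show "(\<integral>\<^sup>+x. ennreal (1 / t) * indicator {0..t} s * ennreal (norm (g (x + s *R e) - g x)) \<partial>lborel) <= ennreal (1 / t) * indicator {0..t} s * ennreal eps" .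
  qed
  also have "... = ennreal (1 / t) * ennreal t * ennreal eps"
   using t by (simp add: nn_integral_multc nn_integral_cmult)
  also have "... = ennreal eps" using t by (simp flip: ennreal_mult'')
  finally show ?thesis .
 qed
 then show ?thesis using delta(1) eta(1) by (intro exI[of _ "min delta eta"]) (auto simp: e_def)
qed

section \<open>The chain rule\<close>

text \<open>The function \<open>Phi\<close> is only given on the closed set \<open>S\<close>, where it has a first order expansion with
 uniform quadratic remainder; this covers the metric and the normal projection without any
 extension to the whole space.\<close>

locale C11_on =
 fixes S :: "'a::euclidean_space set" and Phi :: "'a => 'b::euclidean_space" and D :: "'a => 'a => 'b"
  and R B Q :: real
 assumes closed: "closed S" and nonempty: "S ~= {}"
  and R: "!!a. a \<in> S ==> norm a <= R"
  and lin: "!!a. a \<in> S ==> linear (D a)"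
  and DB: "!!a h. a \<in> S ==> norm (D a h) <= B * norm h"
  and quad: "!!a b. a \<in> S ==> b \<in> S ==> norm (Phi a - Phi b - D b (a - b)) <= Q * (norm (a - b))^2"
  and DL: "!!a b h. a \<in> S ==> b \<in> S ==> norm (D a h - D b h) <= Q * norm (a - b) * norm h"
  and nonneg: "0 <= B" "0 <= Q"
begin

lemma R0: "0 <= R" using nonempty R norm_ge_zero order_trans by blast

lemma diam: "a \<in> S ==> b \<in> S ==> norm (a - b) <= 2 * R"
 using R[of a] R[of b] norm_triangle_ineq4[of a b] by simp

definition Lip where "Lip = B + Q * (2 * R)"

lemma Lip0: "0 <= Lip" using nonneg R0 by (simp add: Lip_def)

lemma Phi_Lipschitz:
 assumes "a \<in> S" "b \<in> S"
 shows "norm (Phi a - Phi b) <= Lip * norm (a - b)"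
proof -
 have "norm (Phi a - Phi b) <= norm (Phi a - Phi b - D b (a - b)) + norm (D b (a - b))"
  using norm_triangle_ineq[of "Phi a - Phi b - D b (a - b)" "D b (a - b)"] by simp
 also have "... <= Q * (norm (a - b) * norm (a - b)) + B * norm (a - b)"
  using quad[OF assms] DB[OF assms(2), of "a - b"] by (simp add: power2_eq_square)
 also have "... <= Q * (2 * R * norm (a - b)) + B * norm (a - b)"
  using diam[OF assms] nonneg by (intro add_right_mono mult_left_mono mult_right_mono) auto
 finally show ?thesis by (simp add: Lip_def algebra_simps)
qed

lemma Phi_bounded: "\<exists>M. \<forall>a\<in>S. norm (Phi a) <= M"
proof -
 obtain b where b: "b \<in> S" using nonempty by blast
 have "norm (Phi a) <= Lip * (2 * R) + norm (Phi b)" if "a \<in> S" for a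
 proof -
  have "norm (Phi a) <= norm (Phi a - Phi b) + norm (Phi b)" using norm_triangle_ineq[of "Phi a - Phi b" "Phi b"] by simp
  also have "norm (Phi a - Phi b) <= Lip * (2 * R)"
   using Phi_Lipschitz[OF that b] mult_left_mono[OF diam[OF that b] Lip0] by linarith
  finally show ?thesis by simp
 qed
 then show ?thesis by blast
qed

lemma Phi_continuous: "continuous_on S Phi"
 using Phi_Lipschitz Lip0 by (intro lipschitz_on_continuous_on[of Lip] lipschitz_onI) (auto simp: dist_norm)

lemma D_continuous: "continuous_on S (%a. D a h)"
 using DL[of _ _ h] nonneg by (intro lipschitz_on_continuous_on[of "Q * norm h"] lipschitz_onI) (auto simp: dist_norm mult_ac)

lemma borel_extensions:
 "(%a. indicator S a *R Phi a) \<in> borel_measurable borel" "(%a. indicator S a *R D a h) \<in> borel_measurable borel"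
 using closed Phi_continuous D_continuous by (auto intro!: borel_measurable_continuous_on_indicator)

lemma D_expand: "a \<in> S ==> D a h = (\<Sum>b\<in>Basis. (h \<bullet> b) *R D a b)"
proof -
 assume "a \<in> S"
 then interpret linear "D a" by (rule lin)
 have "D a h = D a (\<Sum>b\<in>Basis. (h \<bullet> b) *R b)" by (simp add: euclidean_representation)
 then show ?thesis by (simp add: sum scale)
qed

text \<open>Write d for the difference quotient of the argument and r = |a' - a| = t |d|. The
  remainder divided by t is at most Q r |d|, and it is split so that L^1 closeness of d and h
  suffices: r |d - h| is bounded through r <= 2 R, and Young's inequality gives r |h| <= delta |h|^2
  + r^2 / delta, where r^2 <= 2 R t |d|. The term with |h|^2 is small through delta, those with t /
  delta through t.\<close>

lemma quotient_estimate:
 assumes a: "a \<in> S" "a' \<in> S" and t: "t > 0" and delta: "delta > 0"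
 shows "norm ((1 / t) *R (Phi a' - Phi a) - D a h) \<le>
  (Lip + Q * (2 * R) * t / delta) * norm ((1 / t) *R (a' - a) - h) + Q * delta * (norm h)^2 + Q * (2 * R) * t / delta * norm h"
proof -
 interpret linear "D a" by (rule lin[OF a(1)])
 define d where "d = (1 / t) *R (a' - a)"
 have d: "a' - a = t *R d" using t by (simp add: d_def)
 define r where "r = norm (a' - a)"
 have r: "0 <= r" "r <= 2 * R" "r = t * norm d" using diam[OF a(2,1)] t by (auto simp: r_def d)
 have nd: "norm d <= norm (d - h) + norm h" using norm_triangle_ineq[of "d - h" h] by simp
 have "D a d = (1 / t) *R D a (a' - a)" by (simp add: d_def scale)
 then have "(1 / t) *R (Phi a' - Phi a) - D a h = (1 / t) *R (Phi a' - Phi a - D a (a' - a)) + D a (d - h)"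
  by (simp add: diff scaleR_diff_right)
 then have "norm ((1 / t) *R (Phi a' - Phi a) - D a h) <= (1 / t) * norm (Phi a' - Phi a - D a (a' - a)) + norm (D a (d - h))"
  using norm_triangle_ineq[of "(1 / t) *R (Phi a' - Phi a - D a (a' - a))" "D a (d - h)"] t by simp
 also have "... <= (1 / t) * (Q * r^2) + B * norm (d - h)"
  using quad[OF a(2,1)] DB[OF a(1), of "d - h"] t by (intro add_mono mult_left_mono) (auto simp: r_def)
 also have "(1 / t) * (Q * r^2) = Q * (r * norm d)" using t by (simp add: r(3) power2_eq_square)
 also have "Q * (r * norm d) <= Q * (2 * R * norm (d - h) + r * norm h)"
 proof (rule mult_left_mono[OF _ nonneg(2)])
  have "r * norm d <= r * (norm (d - h) + norm h)" by (rule mult_left_mono[OF nd r(1)])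
  also have "... = r * norm (d - h) + r * norm h" by (simp add: algebra_simps)
  also have "... <= 2 * R * norm (d - h) + r * norm h" using mult_right_mono[OF r(2) norm_ge_zero[of "d - h"]] by simp
  finally show "r * norm d <= 2 * R * norm (d - h) + r * norm h" .
 qed
 also have "r * norm h <= delta * (norm h)^2 + (2 * R * t / delta) * (norm (d - h) + norm h)"
 proof -
  have "0 <= (delta * norm h - r)^2" by simp
  then have "2 * (delta * norm h) * r <= (delta * norm h)^2 + r^2" by (simp add: power2_diff)
  then have "delta * (norm h * r) * 2 <= (delta * norm h)^2 + r^2" by (simp add: mult_ac)
  moreover have "0 <= delta * (norm h * r)" using delta r(1) by simp
  ultimately have "delta * (norm h * r) <= (delta * norm h)^2 + r^2" by linarith
  also have "... = delta * (delta * (norm h)^2 + r * r / delta)" using delta by (simp add: power2_eq_square algebra_simps)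
  finally have "norm h * r <= delta * (norm h)^2 + r * r / delta" using delta by simp
  also have "r * r / delta <= (2 * R) * (t * (norm (d - h) + norm h)) / delta"
   using r t nd delta R0 by (intro divide_right_mono mult_mono) auto
  finally show ?thesis by (simp add: mult_ac)
 qed
 finally have "norm ((1 / t) *R (Phi a' - Phi a) - D a h) \<le>
   Q * (2 * R * norm (d - h) + (delta * (norm h)^2 + (2 * R * t / delta) * (norm (d - h) + norm h))) + B * norm (d - h)"
  using nonneg by (auto intro: order_trans mult_left_mono add_mono)
 also have "... = (Lip + Q * (2 * R) * t / delta) * norm (d - h) + Q * delta * (norm h)^2 + Q * (2 * R) * t / delta * norm h"
  by (simp add: Lip_def algebra_simps add_divide_distrib)
 finally show ?thesis by (simp add: d_def)
qed

end

lemma directional_derivative: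
 fixes phi :: "real^'n => real"
 assumes "!!x. phi differentiable (at x)"
 shows "((%s. phi (x + s *R axis i 1)) has_real_derivative partial i phi (x + s *R axis i 1)) (at s)"
proof -
 let ?y = "x + s *R axis i 1"
 have f: "(phi has_derivative frechet_derivative phi (at ?y)) (at ?y)"
  using assms frechet_derivative_works by blast
 have "((%s. x + s *R axis i 1) has_derivative (%h. h *R axis i 1)) (at s)"
  by (auto intro!: derivative_eq_intros)
 from has_derivative_compose[OF this f]
 have "((%s. phi (x + s *R axis i 1)) has_derivative (%h. frechet_derivative phi (at ?y) (h *R axis i 1))) (at s)" .
 moreover have "frechet_derivative phi (at ?y) (h *R axis i 1) = partial i phi ?y * h" for h
  using linear_frechet_derivative[OF assms[of ?y]] by (simp add: linear_scale partial_def mult.commute)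
 ultimately show ?thesis by (simp add: has_field_derivative_def)
qed

lemma difference_quotient_test:
 fixes phi :: "real^'n => real"
 assumes d: "!!x. phi differentiable (at x)" and L: "!!x. \<bar>partial i phi x\<bar> <= L" and t: "t > 0"
 shows "\<bar>(phi x - phi (x - t *R axis i 1)) / t\<bar> <= L"
proof -
 note dd = directional_derivative[OF d, of x i]
 have "\<exists>z. - t < z & z < 0 & phi (x + 0 *R axis i 1) - phi (x + (- t) *R axis i 1) = (0 - (- t)) * partial i phi (x + z *R axis i 1)"
  by (rule MVT2) (use t dd in auto)
 then obtain z where "phi x - phi (x - t *R axis i 1) = t * partial i phi (x + z *R axis i 1)" by auto
 then show ?thesis using t L by simp
qed

lemma difference_quotient_test_tendsto:
 fixes phi :: "real^'n => real"
 assumes d: "!!x. phi differentiable (at x)" and t: "!!k. t k > 0" "t \<longlonglongrightarrow> 0"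
 shows "(%k. (phi x - phi (x - t k *R axis i 1)) / t k) \<longlonglongrightarrow> partial i phi x"
proof -
 have "((%h. (phi (x + (0 + h) *R axis i 1) - phi (x + 0 *R axis i 1)) / h) \<longlongrightarrow> partial i phi x) (at 0)"
  using directional_derivative[OF d, of x i 0] by (simp add: DERIV_def)
 moreover have "filterlim (%k. - t k) (at 0) sequentially"
  using tendsto_minus[OF t(2)] t(1) by (auto simp: filterlim_at intro!: always_eventually) (metis less_irrefl)
 ultimately have "((%k. (phi (x + (0 + - t k) *R axis i 1) - phi (x + 0 *R axis i 1)) / (- t k)) \<longlonglongrightarrow> partial i phi x)"
  by (rule filterlim_compose)
 moreover have "(phi (x + (0 + - t k) *R axis i 1) - phi (x + 0 *R axis i 1)) / (- t k) = (phi x - phi (x - t k *R axis i 1)) / t k" for k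
  using t(1)[of k] by (simp add: field_simps)
 ultimately show ?thesis by simp
qed

lemma (in C11_on) quotient_L1:
 fixes u v :: "real^'n => 'a"
 assumes V: "open V" and wp: "has_weak_partial V i u v"
  and m[measurable]: "u \<in> borel_measurable borel" "v \<in> borel_measurable borel"
  and uS: "!!x. x \<in> V ==> u x \<in> S" and K: "compact K" "K \<subseteq> V"
  and v2: "(\<integral>\<^sup>+x\<in>K. ennreal ((norm (v x))^2) \<partial>lborel) < \<infinity>" and eps: "eps > 0"
 shows "\<exists>d>0. \<forall>t. 0 < t & t < d -->
  (\<integral>\<^sup>+x\<in>K. ennreal (norm ((1 / t) *R (Phi (u (x + t *R axis i 1)) - Phi (u x)) - D (u x) (v x))) \<partial>lborel) <= ennreal eps"
proof -
 have [measurable]: "K \<in> sets borel" using K(1) by (simp add: borel_compact)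
 define N2 where "N2 = enn2real (\<integral>\<^sup>+x\<in>K. ennreal ((norm (v x))^2) \<partial>lborel)"
 have N2: "(\<integral>\<^sup>+x\<in>K. ennreal ((norm (v x))^2) \<partial>lborel) = ennreal N2" "0 <= N2"
  using v2 by (simp_all add: N2_def)
 have "integrable lborel (%x. indicator K x *R v x)"
  using wp K by (auto simp: has_weak_partial_iff locally_integrable_lborel)
 then have "(\<integral>\<^sup>+x. ennreal (norm (indicator K x *R v x)) \<partial>lborel) < \<infinity>" by (simp add: integrable_iff_bounded)
 also have "(\<integral>\<^sup>+x. ennreal (norm (indicator K x *R v x)) \<partial>lborel) = (\<integral>\<^sup>+x\<in>K. ennreal (norm (v x)) \<partial>lborel)"
  by (intro nn_integral_cong) (auto simp: indicator_def)
 finally have v1: "(\<integral>\<^sup>+x\<in>K. ennreal (norm (v x)) \<partial>lborel) < \<infinity>" .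
 define N1 where "N1 = enn2real (\<integral>\<^sup>+x\<in>K. ennreal (norm (v x)) \<partial>lborel)"
 have N1: "(\<integral>\<^sup>+x\<in>K. ennreal (norm (v x)) \<partial>lborel) = ennreal N1" "0 <= N1"
  using v1 by (simp_all add: N1_def)
 have third: "X * (eps / (3 * X)) = eps / 3" if "X > 0" for X using that by simp
 \<comment> \<open>This makes the square term at most eps / 3. The step bound \<open>t1\<close> is
   chosen afterwards, because the coefficient \<open>P\<close> grows as \<open>delta\<close>
   shrinks.\<close>
 define delta where "delta = eps / (3 * (Q * N2 + 1))"
 have delta: "delta > 0" using eps nonneg N2(2) by (simp add: delta_def add_nonneg_pos)
 have delta2: "Q * delta * N2 <= eps / 3"
 proof -
  have "(Q * N2) * delta <= (Q * N2 + 1) * delta" using delta by (intro mult_right_mono) auto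
  also have "... = eps / 3" unfolding delta_def using nonneg N2(2) by (intro third add_nonneg_pos) auto
  finally show ?thesis by (simp add: mult_ac)
 qed
 define P where "P = Q * (2 * R) / delta"
 have P: "0 <= P" using nonneg R0 delta by (simp add: P_def)
 define t1 where "t1 = min (1 / (P + 1)) (eps / (3 * (P * N1 + 1)))"
 have t1: "t1 > 0" using P N1(2) eps by (simp add: t1_def add_nonneg_pos)
 have t1P: "P * t <= 1" "P * t * N1 <= eps / 3" if "0 < t" "t < t1" for t
 proof -
  have "P * t <= (P + 1) * (1 / (P + 1))" using that P by (intro mult_mono) (auto simp: t1_def)
  then show "P * t <= 1" using P by simp
  have "(P * N1) * t <= (P * N1 + 1) * (eps / (3 * (P * N1 + 1)))" using that P N1(2) by (intro mult_mono) (auto simp: t1_def)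
  also have "... = eps / 3" using P N1(2) by (intro third add_nonneg_pos) auto
  finally show "P * t * N1 <= eps / 3" by (simp add: mult_ac)
 qed
 \<comment> \<open>The coefficient of the first-order error is \<open>Lip + P * t\<close>, and
   \<open>P * t <= 1\<close> for t below \<open>t1\<close>.\<close>
 define eps' where "eps' = eps / (3 * (Lip + 1))"
 have eps': "eps' > 0" using eps Lip0 by (simp add: eps'_def)
 obtain d where d: "d > 0" "!!t. 0 < t ==> t < d ==>
   (\<integral>\<^sup>+x\<in>K. ennreal (norm ((1 / t) *R (u (x + t *R axis i 1) - u x) - v x)) \<partial>lborel) <= ennreal eps'"
  using difference_quotient_L1[OF V wp m K eps'] by blast
 obtain eta where eta: "eta > 0" "(\<Union>x\<in>K. cball x eta) \<subseteq> V"
  using compact_subset_open_imp_cball_epsilon_subset[OF K(1) V K(2)] by blast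
 have "(\<integral>\<^sup>+x\<in>K. ennreal (norm ((1 / t) *R (Phi (u (x + t *R axis i 1)) - Phi (u x)) - D (u x) (v x))) \<partial>lborel) <= ennreal eps"
  if t: "0 < t" "t < min d (min eta t1)" for t
 proof -
  let ?w = "%x. (1 / t) *R (u (x + t *R axis i 1) - u x) - v x"
  have "(\<integral>\<^sup>+x\<in>K. ennreal (norm ((1 / t) *R (Phi (u (x + t *R axis i 1)) - Phi (u x)) - D (u x) (v x))) \<partial>lborel) \<le>
    (\<integral>\<^sup>+x. ennreal (Lip + 1) * (ennreal (norm (?w x)) * indicator K x) +
     (ennreal (Q * delta) * (ennreal ((norm (v x))^2) * indicator K x) + ennreal (P * t) * (ennreal (norm (v x)) * indicator K x)) \<partial>lborel)"
  proof (rule nn_integral_mono)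
   fix x
   show "ennreal (norm ((1 / t) *R (Phi (u (x + t *R axis i 1)) - Phi (u x)) - D (u x) (v x))) * indicator K x \<le>
    ennreal (Lip + 1) * (ennreal (norm (?w x)) * indicator K x) +
     (ennreal (Q * delta) * (ennreal ((norm (v x))^2) * indicator K x) + ennreal (P * t) * (ennreal (norm (v x)) * indicator K x))"
   proof (cases "x \<in> K")
    case True
    have "x + t *R axis i 1 \<in> cball x eta" using t by (simp add: dist_norm)
    then have xt: "x + t *R axis i 1 \<in> V" using eta(2) True by blast
    have "norm ((1 / t) *R (Phi (u (x + t *R axis i 1)) - Phi (u x)) - D (u x) (v x)) \<le>
      (Lip + P * t) * norm (?w x) + Q * delta * (norm (v x))^2 + P * t * norm (v x)"
     using quotient_estimate[OF uS[of x] uS[OF xt] t(1) delta, of "v x"] True K(2) by (auto simp: P_def)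
    also have "... <= (Lip + 1) * norm (?w x) + Q * delta * (norm (v x))^2 + P * t * norm (v x)"
     using t1P(1)[of t] t by (intro add_right_mono mult_right_mono) auto
    finally have "ennreal (norm ((1 / t) *R (Phi (u (x + t *R axis i 1)) - Phi (u x)) - D (u x) (v x))) \<le>
      ennreal ((Lip + 1) * norm (?w x) + (Q * delta * (norm (v x))^2 + P * t * norm (v x)))"
     by (simp add: ennreal_leI add.assoc)
    also have "... = ennreal (Lip + 1) * ennreal (norm (?w x)) + (ennreal (Q * delta) * ennreal ((norm (v x))^2) + ennreal (P * t) * ennreal (norm (v x)))"
     using Lip0 nonneg delta P t by (simp add: ennreal_plus ennreal_mult)
    finally show ?thesis using True by simp
   qed simp
  qed
  also have "... = ennreal (Lip + 1) * (\<integral>\<^sup>+x\<in>K. ennreal (norm (?w x)) \<partial>lborel) +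
    (ennreal (Q * delta) * ennreal N2 + ennreal (P * t) * ennreal N1)"
   by (simp add: nn_integral_add nn_integral_cmult N1 N2)
  also have "... <= ennreal (Lip + 1) * ennreal eps' + (ennreal (Q * delta) * ennreal N2 + ennreal (P * t) * ennreal N1)"
   using d(2)[of t] t by (intro add_right_mono mult_left_mono) auto
  also have "... = ennreal ((Lip + 1) * eps' + (Q * delta * N2 + P * t * N1))"
   using Lip0 nonneg delta P t N1(2) N2(2) eps' by (simp add: ennreal_plus ennreal_mult)
  also have "... <= ennreal (eps / 3 + (eps / 3 + eps / 3))"
   using delta2 t1P(2)[of t] t third[of "Lip + 1"] Lip0 unfolding eps'_def by (intro ennreal_leI add_mono) auto
  finally show ?thesis by simp
 qed
 then show ?thesis using d(1) eta(1) t1 by (intro exI[of _ "min d (min eta t1)"]) auto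
qed

text \<open>By translation invariance, the difference quotient moves exactly from the test function
  to \<open>Phi (u x)\<close>. Then both sides pass to the limit: the quotient of the test function
  by dominated convergence, that of \<open>Phi (u x)\<close> by \<open>quotient_L1\<close>.\<close>

lemma (in C11_on) chain_rule_borel:
 fixes u v :: "real^'n => 'a"
 assumes V: "open V" and wp: "has_weak_partial V i u v"
  and m[measurable]: "u \<in> borel_measurable borel" "v \<in> borel_measurable borel"
  and uS: "!!x. x \<in> V ==> u x \<in> S"
  and v2: "!!K. compact K ==> K \<subseteq> V ==> (\<integral>\<^sup>+x\<in>K. ennreal ((norm (v x))^2) \<partial>lborel) < \<infinity>"
 shows "has_weak_partial V i (%x. Phi (u x)) (%x. D (u x) (v x))"
proof -
 have [measurable]: "V \<in> sets borel" using V by simp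
 define e :: "real^'n" where "e = axis i 1"
 have ne: "norm e = 1" by (simp add: e_def)
 \<comment> \<open>Outside \<open>V\<close> the values of \<open>u\<close> may leave
   \<open>S\<close>, where nothing is known about \<open>Phi\<close> or \<open>D\<close>; the
   cut-off makes both functions Borel measurable.\<close>
 define w where "w x = indicator V x *R Phi (u x)" for x
 define z where "z x = indicator V x *R D (u x) (v x)" for x
 have "w = (%x. indicator V x *R (indicator S (u x) *R Phi (u x)))"
  using uS by (auto simp: w_def indicator_def fun_eq_iff)
 then have wm[measurable]: "w \<in> borel_measurable borel"
  by (simp only:) (rule borel_measurable_scaleR[OF borel_measurable_indicator measurable_compose[OF m(1) borel_extensions(1)]], simp)
 have "z = (%x. indicator V x *R (\<Sum>b\<in>Basis. (v x \<bullet> b) *R (indicator S (u x) *R D (u x) b)))"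
  using uS D_expand by (auto simp: z_def indicator_def fun_eq_iff)
 then have zm[measurable]: "z \<in> borel_measurable borel"
  by (simp only:) (intro borel_measurable_scaleR[OF borel_measurable_indicator] borel_measurable_sum
   borel_measurable_scaleR[OF _ measurable_compose[OF m(1) borel_extensions(2)]], auto)
 obtain M0 where M0: "!!a. a \<in> S ==> norm (Phi a) <= M0" using Phi_bounded by blast
 define M where "M = max 0 M0"
 have wM: "norm (w x) <= M" for x using M0 uS by (auto simp: w_def M_def indicator_def intro: max.coboundedI2)
 have bi: "integrable lborel (%x. indicator K x *R w x)" if "compact K" for K
 proof -
  have [measurable]: "K \<in> sets borel" using that by (simp add: borel_compact)
  have "emeasure lborel K < \<infinity>" using that by (intro emeasure_bounded_finite compact_imp_bounded)
  then have "integrable lborel (%x. indicator K x *R M)" by (intro integrable_scaleR_left integrable_real_indicator) auto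
  then show ?thesis
   by (rule Bochner_Integration.integrable_bound) (use wM in \<open>auto simp: indicator_def intro!: AE_I2 order_trans[OF wM]\<close>)
 qed
 have zi: "integrable lborel (%x. indicator K x *R z x)" if K: "compact K" "K \<subseteq> V" for K
 proof -
  have [measurable]: "K \<in> sets borel" using K by (simp add: borel_compact)
  have "integrable lborel (%x. indicator K x *R v x)"
   using wp K by (auto simp: has_weak_partial_iff locally_integrable_lborel)
  from integrable_scaleR_right[OF this, of B] show ?thesis
  proof (rule Bochner_Integration.integrable_bound)
   show "AE x in lborel. norm (indicator K x *R z x) <= norm (B *R indicator K x *R v x)"
    using DB uS K nonneg by (auto simp: z_def indicator_def intro!: AE_I2)
  qed measurable
 qed
 have "has_weak_partial V i w z"
  unfolding has_weak_partial_iff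
 proof (intro conjI allI impI)
  show "locally_integrable V w" "locally_integrable V z"
   using bi zi by (auto simp: locally_integrable_lborel)
  fix phi assume "test_function V phi"
  then obtain K where K: "compact K" "K \<subseteq> V" "!!x. x \<notin> K ==> phi x = 0"
   "!!x i. x \<notin> K ==> partial i phi x = 0" "continuous_on UNIV phi"
   "!!i. continuous_on UNIV (partial i phi)" and diff: "!!x. phi differentiable (at x)"
   using test_function_support by metis
  have [measurable]: "phi \<in> borel_measurable borel" "partial i phi \<in> borel_measurable borel"
   using K by (auto intro: borel_measurable_continuous_onI)
  have [measurable]: "K \<in> sets borel" using K(1) by (simp add: borel_compact)
  obtain L where L: "!!x. \<bar>partial i phi x\<bar> <= L"
   using continuous_compact_support_bounded[OF K(6,1,4)] by blast
  obtain F where F: "!!x. \<bar>phi x\<bar> <= F"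
   using continuous_compact_support_bounded[OF K(5,1,3)] by blast
  have F0: "0 <= F" using F[of undefined] by linarith
  obtain eta where eta: "eta > 0" "(\<Union>x\<in>K. cball x eta) \<subseteq> V"
   using compact_subset_open_imp_cball_epsilon_subset[OF K(1) V K(2)] by blast
  define K' where "K' = {x + y | x y. x \<in> K & y \<in> cball 0 eta}"
  have cK': "compact K'" unfolding K'_def by (rule compact_sums[OF K(1) compact_cball])
  have inK': "x + s *R e \<in> K'" if "x \<in> K" "0 <= s" "s <= eta" for x s
   using that ne unfolding K'_def by (intro CollectI exI[of _ x] exI[of _ "s *R e"]) auto
  have [measurable]: "K' \<in> sets borel" using cK' by (simp add: borel_compact)
  define wK where "wK x = indicator K' x *R w x" for x
  have wKI: "integrable lborel wK" using bi[OF cK'] by (simp add: wK_def[abs_def])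
  have [measurable]: "wK \<in> borel_measurable borel" unfolding wK_def by measurable
  \<comment> \<open>Positive steps tending to zero; the factor \<open>eta\<close> keeps the shifted
    points inside \<open>K'\<close> and \<open>V\<close>.\<close>
  define t where "t k = eta * (1 / real (Suc k))" for k
  have t: "0 < t k" "t k <= eta" for k using eta(1) by (auto simp: t_def divide_le_eq)
  have t0: "t \<longlonglongrightarrow> 0"
   using tendsto_mult[OF tendsto_const[of eta] LIMSEQ_Suc[OF lim_const_over_n[of 1]]] by (simp add: t_def[abs_def])
  have phiK: "phi x *R wK x = phi x *R w x" "phi (x - t k *R e) *R wK x = phi (x - t k *R e) *R w x"
   "partial i phi x *R wK x = partial i phi x *R w x" for x k
   using inK'[of x 0] inK'[of "x - t k *R e" "t k"] t[of k] eta(1) K(3,4)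
   by (auto simp: wK_def indicator_def)
  have eqk: "(\<integral>x. ((phi x - phi (x - t k *R e)) / t k) *R wK x \<partial>lborel) = - (\<integral>x. phi x *R ((1 / t k) *R (w (x + t k *R e) - w x)) \<partial>lborel)" for k
  proof -
   have I1: "integrable lborel (%x. phi x *R wK x)" "integrable lborel (%x. phi (x - t k *R e) *R wK x)"
    using F by (auto intro!: integrable_bounded_scaleR[OF wKI, of _ F])
   have I2: "integrable lborel (%x. phi x *R wK (x + t k *R e))"
    by (rule integrable_bounded_scaleR[OF integrable_translate[OF wKI] _ F]) simp
   have "(\<integral>x. ((phi x - phi (x - t k *R e)) / t k) *R wK x \<partial>lborel) = (\<integral>x. (1 / t k) *R (phi x *R wK x - phi (x - t k *R e) *R wK x) \<partial>lborel)"
    by (simp add: scaleR_diff_left diff_divide_distrib scaleR_diff_right)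
   also have "... = (1 / t k) *R ((\<integral>x. phi x *R wK x \<partial>lborel) - (\<integral>x. phi (x - t k *R e) *R wK x \<partial>lborel))"
    using I1 by simp
   also have "(\<integral>x. phi (x - t k *R e) *R wK x \<partial>lborel) = (\<integral>x. phi x *R wK (x + t k *R e) \<partial>lborel)"
    using integral_translate[of "%x. phi (x - t k *R e) *R wK x" "t k *R e"] by simp
   also have "(\<integral>x. phi x *R wK x \<partial>lborel) - (\<integral>x. phi x *R wK (x + t k *R e) \<partial>lborel) = - (\<integral>x. phi x *R wK (x + t k *R e) - phi x *R wK x \<partial>lborel)"
    using I1 I2 by simp
   also have "(%x. phi x *R wK (x + t k *R e) - phi x *R wK x) = (%x. phi x *R (w (x + t k *R e) - w x))"
   proof
    fix x
    show "phi x *R wK (x + t k *R e) - phi x *R wK x = phi x *R (w (x + t k *R e) - w x)"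
     using inK'[of x 0] inK'[of x "t k"] t[of k] eta(1) K(3)[of x] by (cases "x \<in> K") (auto simp: wK_def scaleR_diff_right)
   qed
   finally show ?thesis by (simp add: scaleR_left_commute[of _ "1 / t k"] integral_scaleR_right[symmetric] del: integral_scaleR_right)
  qed
  have lim1: "(%k. \<integral>x. ((phi x - phi (x - t k *R e)) / t k) *R wK x \<partial>lborel) \<longlonglongrightarrow> (\<integral>x. partial i phi x *R wK x \<partial>lborel)"
  proof (rule integral_dominated_convergence[where w = "%x. norm (L *R wK x)"])
   show "AE x in lborel. (%k. ((phi x - phi (x - t k *R e)) / t k) *R wK x) \<longlonglongrightarrow> partial i phi x *R wK x"
    unfolding e_def by (intro AE_I2 tendsto_intros difference_quotient_test_tendsto diff t t0)
   show "AE x in lborel. norm (((phi x - phi (x - t k *R e)) / t k) *R wK x) <= norm (L *R wK x)" for k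
    unfolding norm_scaleR e_def
    by (intro AE_I2 mult_right_mono order_trans[OF difference_quotient_test[OF diff L t(1)] abs_ge_self]) auto
   show "integrable lborel (%x. norm (L *R wK x))" using wKI by (intro integrable_norm integrable_scaleR_right) 
  qed measurable
  have lim2: "(%k. \<integral>x. phi x *R ((1 / t k) *R (w (x + t k *R e) - w x)) \<partial>lborel) \<longlonglongrightarrow> (\<integral>x. phi x *R z x \<partial>lborel)"
  proof (rule LIMSEQ_I)
   fix eps :: real assume eps: "eps > 0"
   define eps' where "eps' = eps / (2 * (F + 1))"
   have eps': "eps' > 0" using eps F0 by (simp add: eps'_def)
   obtain d where d: "d > 0" "!!t. 0 < t ==> t < d ==>
     (\<integral>\<^sup>+x\<in>K. ennreal (norm ((1 / t) *R (Phi (u (x + t *R axis i 1)) - Phi (u x)) - D (u x) (v x))) \<partial>lborel) <= ennreal eps'"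
    using quotient_L1[OF V wp m uS K(1,2) v2[OF K(1,2)] eps'] by blast
   obtain k0 where k0: "!!k. k >= k0 ==> t k < d"
    using LIMSEQ_D[OF t0 d(1)] t(1) by (auto simp: abs_of_pos)
   have "norm ((\<integral>x. phi x *R ((1 / t k) *R (w (x + t k *R e) - w x)) \<partial>lborel) - (\<integral>x. phi x *R z x \<partial>lborel)) < eps" if k: "k >= k0" for k
   proof -
    have I1: "integrable lborel (%x. phi x *R ((1 / t k) *R (w (x + t k *R e) - w x)))"
    proof -
     have "integrable lborel (%x. phi x *R ((1 / t k) *R (wK (x + t k *R e) - wK x)))"
      by (rule integrable_bounded_scaleR[OF _ _ F])
       (use wKI integrable_translate[OF wKI] in \<open>auto intro!: integrable_scaleR_right Bochner_Integration.integrable_diff\<close>)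
     also have "(%x. phi x *R ((1 / t k) *R (wK (x + t k *R e) - wK x))) = (%x. phi x *R ((1 / t k) *R (w (x + t k *R e) - w x)))"
     proof
      fix x show "phi x *R ((1 / t k) *R (wK (x + t k *R e) - wK x)) = phi x *R ((1 / t k) *R (w (x + t k *R e) - w x))"
       using inK'[of x 0] inK'[of x "t k"] t[of k] eta(1) K(3)[of x] by (cases "x \<in> K") (auto simp: wK_def)
     qed
     finally show ?thesis .
    qed
    have I2: "integrable lborel (%x. phi x *R z x)"
    proof -
     have "integrable lborel (%x. phi x *R (indicator K x *R z x))"
      by (rule integrable_bounded_scaleR[OF zi[OF K(1,2)] _ F]) simp
     also have "(%x. phi x *R (indicator K x *R z x)) = (%x. phi x *R z x)" using K(3) by (force simp: indicator_def)
     finally show ?thesis .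
    qed
    have "ennreal (norm ((\<integral>x. phi x *R ((1 / t k) *R (w (x + t k *R e) - w x)) \<partial>lborel) - (\<integral>x. phi x *R z x \<partial>lborel))) =
      ennreal (norm (\<integral>x. phi x *R ((1 / t k) *R (w (x + t k *R e) - w x)) - phi x *R z x \<partial>lborel))"
     by (simp only: Bochner_Integration.integral_diff[OF I1 I2])
    also have "... <= (\<integral>\<^sup>+x. ennreal (norm (phi x *R ((1 / t k) *R (w (x + t k *R e) - w x)) - phi x *R z x)) \<partial>lborel)"
     by (rule norm_integral_le_nn)
    also have "... <= (\<integral>\<^sup>+x. ennreal F * (ennreal (norm ((1 / t k) *R (w (x + t k *R e) - w x) - z x)) * indicator K x) \<partial>lborel)"
    proof (rule nn_integral_mono)
     fix x
     show "ennreal (norm (phi x *R ((1 / t k) *R (w (x + t k *R e) - w x)) - phi x *R z x)) \<le>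
      ennreal F * (ennreal (norm ((1 / t k) *R (w (x + t k *R e) - w x) - z x)) * indicator K x)"
     proof (cases "x \<in> K")
      case True
      have "norm (phi x *R ((1 / t k) *R (w (x + t k *R e) - w x)) - phi x *R z x) = \<bar>phi x\<bar> * norm ((1 / t k) *R (w (x + t k *R e) - w x) - z x)"
       by (simp only: norm_scaleR scaleR_diff_right[symmetric])
      also have "... <= F * norm ((1 / t k) *R (w (x + t k *R e) - w x) - z x)" using F by (intro mult_right_mono) auto
      finally show ?thesis using True F0 by (simp add: ennreal_leI flip: ennreal_mult'')
     qed (use K(3) in simp)
    qed
    also have "... = ennreal F * (\<integral>\<^sup>+x\<in>K. ennreal (norm ((1 / t k) *R (w (x + t k *R e) - w x) - z x)) \<partial>lborel)"
     by (rule nn_integral_cmult) measurable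
    also have "(\<integral>\<^sup>+x\<in>K. ennreal (norm ((1 / t k) *R (w (x + t k *R e) - w x) - z x)) \<partial>lborel) =
      (\<integral>\<^sup>+x\<in>K. ennreal (norm ((1 / t k) *R (Phi (u (x + t k *R axis i 1)) - Phi (u x)) - D (u x) (v x))) \<partial>lborel)"
    proof (intro nn_integral_cong)
     fix x
     have "x \<in> V & x + t k *R e \<in> V" if "x \<in> K"
     proof -
      have "x + t k *R e \<in> cball x eta" using t[of k] ne by (simp add: dist_norm)
      then show ?thesis using eta(2) K(2) that by blast
     qed
     then show "ennreal (norm ((1 / t k) *R (w (x + t k *R e) - w x) - z x)) * indicator K x =
       ennreal (norm ((1 / t k) *R (Phi (u (x + t k *R axis i 1)) - Phi (u x)) - D (u x) (v x))) * indicator K x"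
      by (cases "x \<in> K") (auto simp: w_def z_def e_def)
    qed
    also have "ennreal F * ... <= ennreal F * ennreal eps'" using d(2)[OF t(1) k0[OF k]] by (rule mult_left_mono) simp
    also have "... = ennreal (F * eps')" using F0 eps' by (simp add: ennreal_mult)
    finally have "norm ((\<integral>x. phi x *R ((1 / t k) *R (w (x + t k *R e) - w x)) \<partial>lborel) - (\<integral>x. phi x *R z x \<partial>lborel)) <= F * eps'"
     using F0 eps' by simp
    also have "... <= (F + 1) * eps'" using eps' by (intro mult_right_mono) auto
    also have "... = eps / 2"
    proof -
     have "X * (eps / (2 * X)) = eps / 2" if "X > 0" for X using that by simp
     from this[of "F + 1"] show ?thesis using F0 by (simp only: eps'_def)
    qed
    also have "... < eps" using eps by simp
    finally show ?thesis .
   qed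
   then show "\<exists>no. \<forall>n\<ge>no. norm ((\<integral>x. phi x *R ((1 / t n) *R (w (x + t n *R e) - w x)) \<partial>lborel) - (\<integral>x. phi x *R z x \<partial>lborel)) < eps"
    by blast
  qed
  have "(\<integral>x. partial i phi x *R wK x \<partial>lborel) = - (\<integral>x. phi x *R z x \<partial>lborel)"
   using LIMSEQ_unique[OF lim1] tendsto_minus[OF lim2] by (simp add: eqk)
  then show "(LINT x|lebesgue. partial i phi x *R w x) = - (LINT x|lebesgue. phi x *R z x)"
   by (simp add: phiK integral_completion)
 qed
 then show ?thesis
  by (rule has_weak_partial_cong[rotated 2]) (auto simp: w_def z_def)
qed

lemma borel_rep_on:
 fixes f :: "real^'n => 'b::euclidean_space"
 assumes "open V" "locally_integrable V f"
 obtains g where "g \<in> borel_measurable borel" "AE x in lebesgue. x \<in> V --> f x = g x"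
proof -
 obtain g where g: "g \<in> borel_measurable borel" and AE: "AE x in lebesgue. indicator V x *R f x = g x"
  using lebesgue_borel_rep[OF locally_integrable_measurable[OF assms]] .
 from AE have "AE x in lebesgue. x \<in> V --> f x = g x"
  by eventually_elim auto
 with g show ?thesis by (rule that)
qed

lemma set_nn_integral_lebesgue_cong:
 assumes "AE x in lebesgue. x \<in> V --> f x = g x" "K \<subseteq> V"
 shows "(\<integral>\<^sup>+x\<in>K. h (f x) x \<partial>lebesgue) = (\<integral>\<^sup>+x\<in>K. h (g x) x \<partial>lebesgue)"
 by (rule nn_integral_cong_AE, use assms(1) in eventually_elim) (use assms(2) in \<open>auto simp: indicator_def\<close>)

lemma (in C11_on) chain_rule:
 fixes u v :: "real^'n => 'a"
 assumes V: "open V" and wp: "has_weak_partial V i u v"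
  and uS: "AE x in lebesgue. x \<in> V --> u x \<in> S"
  and v2: "!!K. compact K ==> K \<subseteq> V ==> (\<integral>\<^sup>+x\<in>K. ennreal ((norm (v x))^2) \<partial>lebesgue) < \<infinity>"
 shows "has_weak_partial V i (%x. Phi (u x)) (%x. D (u x) (v x))"
proof -
 have li: "locally_integrable V u" "locally_integrable V v" using wp by (auto simp: has_weak_partial_iff)
 obtain u0 where u0[measurable]: "u0 \<in> borel_measurable borel" and ae0: "AE x in lebesgue. x \<in> V --> u x = u0 x"
  using borel_rep_on[OF V li(1)] .
 obtain v0 where v0[measurable]: "v0 \<in> borel_measurable borel" and aev: "AE x in lebesgue. x \<in> V --> v x = v0 x"
  using borel_rep_on[OF V li(2)] .
 obtain s0 where s0: "s0 \<in> S" using nonempty by blast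
 have [measurable]: "S \<in> sets borel" using closed by simp
 \<comment> \<open>Values outside \<open>S\<close> are replaced by a fixed point of
   \<open>S\<close>. On \<open>V\<close> this changes \<open>u\<close> on a null set only, and the
   constraint then holds everywhere instead of almost everywhere.\<close>
 define u1 where "u1 x = (if u0 x \<in> S then u0 x else s0)" for x
 have u1m[measurable]: "u1 \<in> borel_measurable borel" unfolding u1_def by measurable
 have aeu: "AE x in lebesgue. x \<in> V --> u x = u1 x"
  using ae0 uS by eventually_elim (auto simp: u1_def)
 have "has_weak_partial V i (%x. Phi (u1 x)) (%x. D (u1 x) (v0 x))"
 proof (rule chain_rule_borel[OF V has_weak_partial_cong[OF aeu aev wp] u1m v0])
  fix K assume K: "compact K" "K \<subseteq> V"
  have [measurable]: "K \<in> sets borel" using K by (simp add: borel_compact)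
  have "(\<integral>\<^sup>+x\<in>K. ennreal ((norm (v0 x))^2) \<partial>lborel) = (\<integral>\<^sup>+x\<in>K. ennreal ((norm (v0 x))^2) \<partial>lebesgue)"
   by (rule nn_integral_completion[symmetric])
  also have "... = (\<integral>\<^sup>+x\<in>K. ennreal ((norm (v x))^2) \<partial>lebesgue)"
   by (rule set_nn_integral_lebesgue_cong[OF AE_imp_sym[OF aev] K(2), of "%y x. ennreal ((norm y)^2)"])
  also have "... < \<infinity>" by (rule v2[OF K])
  finally show "(\<integral>\<^sup>+x\<in>K. ennreal ((norm (v0 x))^2) \<partial>lborel) < \<infinity>" .
 qed (use s0 in \<open>auto simp: u1_def\<close>)
 then show ?thesis
  by (rule has_weak_partial_cong[rotated 2]) (use aeu aev in \<open>(eventually_elim, auto)+\<close>)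
qed

section \<open>Strong compactness\<close>

lemma ennreal_tendsto_0I:
 fixes X :: "nat => ennreal"
 assumes "!!e::real. e > 0 ==> \<forall>\<^sub>F m in sequentially. X m <= ennreal e"
 shows "X \<longlonglongrightarrow> 0"
proof (rule order_tendstoI)
 fix a :: ennreal assume a: "0 < a"
 have "\<exists>e>0. ennreal e < a"
 proof (cases a)
  case (real r)
  then have "0 < r" using a by simp
  then show ?thesis using real by (intro exI[of _ "r / 2"]) (auto simp: ennreal_less_iff)
 qed (auto intro: exI[of _ 1])
 then obtain e where "e > 0" "ennreal e < a" by blast
 with assms[of e] show "\<forall>\<^sub>F m in sequentially. X m < a" by (auto elim: eventually_mono)
qed simp

lemma ennreal_tendsto_0D:
 fixes X :: "nat => ennreal"
 assumes "X \<longlonglongrightarrow> 0" "e > (0::real)"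
 shows "\<forall>\<^sub>F m in sequentially. X m <= ennreal e"
proof -
 have "\<forall>\<^sub>F m in sequentially. X m < ennreal e" using assms by (intro order_tendstoD(2)) auto
 then show ?thesis by (rule eventually_mono) simp
qed

text \<open>A translation by \<open>y\<close> is carried out one coordinate at a time, so that weak
  partial derivatives along the axes suffice. \<open>J\<close> is the set of coordinates already
  moved, and \<open>K'\<close> has to contain all intermediate points.\<close>

lemma translation_L1_bound_box:
 fixes d :: "real^'n => 'b::euclidean_space" and J :: "'n set"
 assumes U: "open U" and wp: "!!i. has_weak_partial U i d (h i)"
  and m[measurable]: "d \<in> borel_measurable borel" "!!i. h i \<in> borel_measurable borel" "K \<in> sets borel" "K' \<in> sets borel"
  and K: "!!x y. x \<in> K ==> (!!j. 0 <= y $ j & y $ j <= delta) ==> x + y \<in> K'" "K' \<subseteq> U"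
  and C: "!!i. (\<integral>\<^sup>+x\<in>K'. ennreal (norm (h i x)) \<partial>lborel) <= ennreal C" "C >= 0"
  and y: "!!j. 0 <= y $ j & y $ j <= delta"
 shows "(\<integral>\<^sup>+x\<in>K. ennreal (norm (d (x + (\<Sum>j\<in>J. y $ j *R axis j 1)) - d x)) \<partial>lborel) <= ennreal (real (card J) * delta * C)"
proof -
 have delta: "0 <= delta" using y by (meson order_trans)
 have "finite J" by simp
 then show ?thesis
 proof (induction J rule: finite_induct)
  case (insert j J)
  let ?z = "(\<Sum>j\<in>J. y $ j *R axis j 1) :: real^'n"
  have comp: "(?z + s *R axis j 1) $ l = (if l \<in> J then y $ l else 0) + (if l = j then s else 0)" for l s
   using insert.hyps(1) by (simp add: axis_def if_distrib[of "%x. _ * x"] cong: if_cong)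
  have z: "(\<Sum>j\<in>insert j J. y $ j *R axis j 1) = ?z + y $ j *R axis j 1"
   using insert by (simp add: add.commute)
  have step: "(\<integral>\<^sup>+x\<in>K. ennreal (norm (d (x + ?z + y $ j *R axis j 1) - d (x + ?z))) \<partial>lborel) <= ennreal (delta * C)"
  proof (cases "y $ j = 0")
   case False
   then have yj: "y $ j > 0" using y[of j] by simp
   have [measurable]: "{x. x - ?z \<in> K} \<in> sets borel"
   proof -
    have "{x \<in> space borel. x - ?z \<in> K} \<in> sets borel" by measurable
    then show ?thesis by simp
   qed
   let ?g = "%x. ennreal (norm (d (x + y $ j *R axis j 1) - d x)) * indicator {x. x - ?z \<in> K} x"
   have "(\<integral>\<^sup>+x\<in>K. ennreal (norm (d (x + ?z + y $ j *R axis j 1) - d (x + ?z))) \<partial>lborel) = (\<integral>\<^sup>+x. ?g (x + ?z) \<partial>lborel)"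
    by (intro nn_integral_cong) (auto simp: indicator_def)
   also have "... = (\<integral>\<^sup>+x. ?g x \<partial>lborel)" by (rule nn_integral_translate) measurable
   also have "... <= ennreal (y $ j) * (\<integral>\<^sup>+x\<in>K'. ennreal (norm (h j x)) \<partial>lborel)"
   proof (rule translation_L1_bound[OF U yj wp m(1,2) _ m(4) _ K(2)])
    fix x s assume x: "x \<in> {x. x - ?z \<in> K}" and s: "s \<in> {0..y $ j}"
    have "(x - ?z) + (?z + s *R axis j 1) \<in> K'"
    proof (rule K(1))
     fix l show "0 <= (?z + s *R axis j 1) $ l & (?z + s *R axis j 1) $ l <= delta"
      using s y[of l] y[of j] insert.hyps(2) delta comp[of s l] by auto
    qed (use x in simp)
    then show "x + s *R axis j 1 \<in> K'" by simp
   qed simp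
   also have "... <= ennreal delta * ennreal C" using y[of j] C(1)[of j] by (intro mult_mono ennreal_leI) auto
   also have "... = ennreal (delta * C)" using C(2) by (simp add: ennreal_mult'')
   finally show ?thesis .
  qed simp
  have "(\<integral>\<^sup>+x\<in>K. ennreal (norm (d (x + (\<Sum>j\<in>insert j J. y $ j *R axis j 1)) - d x)) \<partial>lborel) \<le>
    (\<integral>\<^sup>+x. ennreal (norm (d (x + ?z + y $ j *R axis j 1) - d (x + ?z))) * indicator K x + ennreal (norm (d (x + ?z) - d x)) * indicator K x \<partial>lborel)"
  proof (rule nn_integral_mono)
   fix x
   have "ennreal (norm (d (x + ?z + y $ j *R axis j 1) - d x)) \<le>
     ennreal (norm (d (x + ?z + y $ j *R axis j 1) - d (x + ?z))) + ennreal (norm (d (x + ?z) - d x))"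
    using norm_triangle_ennreal[of "d (x + ?z + y $ j *R axis j 1) - d (x + ?z)" "d (x + ?z) - d x"] by simp
   then show "ennreal (norm (d (x + (\<Sum>j\<in>insert j J. y $ j *R axis j 1)) - d x)) * indicator K x \<le>
     ennreal (norm (d (x + ?z + y $ j *R axis j 1) - d (x + ?z))) * indicator K x + ennreal (norm (d (x + ?z) - d x)) * indicator K x"
    unfolding z by (simp add: indicator_def add.assoc)
  qed
  also have "... <= ennreal (delta * C) + ennreal (real (card J) * delta * C)"
   using step insert.IH by (subst nn_integral_add) (auto intro: add_mono)
  also have "... = ennreal (real (card (insert j J)) * delta * C)"
   using insert delta C(2) by (simp add: algebra_simps flip: ennreal_plus)
  finally show ?case .
 qed simp
qed

text \<open>\<open>d m\<close> is compared with its average over a small cube attached to x. The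
  averages tend to zero pointwise because the indicator of a cube is a weak test, and they are
  bounded, so dominated convergence applies. The deviation from the average is controlled by the
  derivatives through the translation estimate, independently of m.\<close>

lemma Rellich_borel:
 fixes d :: "nat => real^'n => 'b::euclidean_space"
 assumes U: "open U" and wp: "!!m i. has_weak_partial U i (d m) (h m i)"
  and meas[measurable]: "!!m. d m \<in> borel_measurable borel" "!!m i. h m i \<in> borel_measurable borel"
  and conv: "wconv U d (%x. 0)"
  and b1: "!!K. compact K ==> K \<subseteq> U ==> \<exists>C. \<forall>m i. (\<integral>\<^sup>+x\<in>K. ennreal (norm (h m i x)) \<partial>lborel) <= ennreal C"
  and b0: "!!K. compact K ==> K \<subseteq> U ==> \<exists>C. \<forall>m. (\<integral>\<^sup>+x\<in>K. ennreal (norm (d m x)) \<partial>lborel) <= ennreal C"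
  and K: "compact K" "K \<subseteq> U"
 shows "(%m. \<integral>\<^sup>+x\<in>K. ennreal (norm (d m x)) \<partial>lborel) \<longlonglongrightarrow> 0"
proof (rule ennreal_tendsto_0I)
 fix eps :: real assume eps: "eps > 0"
 have [measurable]: "K \<in> sets borel" using K(1) by (simp add: borel_compact)
 obtain eta where eta: "eta > 0" "(\<Union>x\<in>K. cball x eta) \<subseteq> U"
  using compact_subset_open_imp_cball_epsilon_subset[OF K(1) U K(2)] by blast
 define K' where "K' = {x + y | x y. x \<in> K & y \<in> cball 0 eta}"
 have cK': "compact K'" unfolding K'_def by (rule compact_sums[OF K(1) compact_cball])
 have [measurable]: "K' \<in> sets borel" using cK' by (simp add: borel_compact)
 have K'U: "K' \<subseteq> U"
 proof
  fix z assume "z \<in> K'"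
  then obtain x y where xy: "z = x + y" "x \<in> K" "norm y <= eta" by (auto simp: K'_def)
  then have "z \<in> cball x eta" by (simp add: dist_norm)
  then show "z \<in> U" using eta(2) xy(2) by blast
 qed
 obtain C1 where C1: "!!m i. (\<integral>\<^sup>+x\<in>K'. ennreal (norm (h m i x)) \<partial>lborel) <= ennreal C1"
  using b1[OF cK' K'U] by blast
 obtain C0 where C0: "!!m. (\<integral>\<^sup>+x\<in>K'. ennreal (norm (d m x)) \<partial>lborel) <= ennreal C0"
  using b0[OF cK' K'U] by blast
 define C where "C = max C1 0"
 have C: "!!m i. (\<integral>\<^sup>+x\<in>K'. ennreal (norm (h m i x)) \<partial>lborel) <= ennreal C" "C >= 0"
  using order_trans[OF C1 ennreal_leI[of C1 C]] by (auto simp: C_def)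
 define n where "n = real CARD('n)"
 have n: "n > 0" by (simp add: n_def)
 \<comment> \<open>The side of the cube: its points have norm at most n delta <= eta, and the
   translation error n delta C is at most eps / 2.\<close>
 define delta where "delta = min (eta / n) (eps / (2 * (n * C + 1)))"
 have delta: "delta > 0" using eta(1) n eps C(2) by (simp add: delta_def add_nonneg_pos)
 have ndelta: "n * delta <= eta" using n by (simp add: delta_def min_def field_simps)
 have ndeltaC: "n * delta * C <= eps / 2"
 proof -
  have "(n * C) * delta <= (n * C + 1) * (eps / (2 * (n * C + 1)))"
   using n C(2) delta by (intro mult_mono) (auto simp: delta_def)
  also have "... = eps / 2"
  proof -
   have "X * (eps / (2 * X)) = eps / 2" if "X > 0" for X using that by simp
   from this[of "n * C + 1"] show ?thesis using n C(2) by (simp add: add_nonneg_pos)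
  qed
  finally show ?thesis by (simp add: mult_ac)
 qed
 define Q :: "(real^'n) set" where "Q = cbox 0 (\<chi> j. delta)"
 have QD: "y \<in> Q \<longleftrightarrow> (\<forall>j. 0 <= y $ j & y $ j <= delta)" for y by (simp add: Q_def mem_box_cart)
 have [measurable]: "Q \<in> sets borel" by (simp add: Q_def)
 have inK': "x + y \<in> K'" if "x \<in> K" "y \<in> Q" for x y
 proof -
  have "norm y <= (\<Sum>j\<in>UNIV. \<bar>y $ j\<bar>)" by (rule norm_le_l1_cart)
  also have "... <= (\<Sum>j\<in>(UNIV :: 'n set). delta)" using that(2) by (intro sum_mono) (auto simp: QD)
  also have "... <= eta" using ndelta by (simp add: n_def)
  finally show ?thesis using that(1) unfolding K'_def by auto
 qed
 define q where "q = measure lborel Q"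
 have emQ: "emeasure lborel Q = ennreal q" unfolding q_def Q_def by (rule emeasure_eq_ennreal_measure) (simp add: emeasure_lborel_cbox_eq)
 have q: "q > 0"
 proof -
  have "(\<chi> j. delta / 2) \<in> box (0 :: real^'n) (\<chi> j. delta)" using delta by (simp add: mem_box_cart)
  then have "box (0 :: real^'n) (\<chi> j. delta) ~= {}" by blast
  then show ?thesis unfolding q_def Q_def using content_pos_lt_eq[of "0 :: real^'n" "\<chi> j. delta"] by (auto simp: box_ne_empty)
 qed
 define dK where "dK m x = indicator K' x *R d m x" for m x
 have dKI: "integrable lborel (dK m)" for m
  using wp[where m = m and i = undefined] cK' K'U by (auto simp: dK_def[abs_def] has_weak_partial_iff locally_integrable_lborel)
 have [measurable]: "dK m \<in> borel_measurable borel" for m unfolding dK_def by measurable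
 \<comment> \<open>The average is not normalised; the volume \<open>q\<close> of the cube appears as
   a factor in \<open>main\<close> instead.\<close>
 define a where "a m x = norm (\<integral>y. indicator Q (y - x) *R dK m y \<partial>lborel)" for m x
 have [measurable]: "a m \<in> borel_measurable borel" for m unfolding a_def by measurable
 have alim: "(%m. a m x) \<longlonglongrightarrow> 0" if "x \<in> K" for x
 proof -
  have sup: "y \<in> K'" if "y - x \<in> Q" for y using inK'[OF \<open>x \<in> K\<close> that] by simp
  have "wtest U (%y. indicator Q (y - x))"
   unfolding wtest_def
  proof (intro conjI exI[of _ K'] exI[of _ 1])
   show "(%y. indicator Q (y - x) :: real) \<in> borel_measurable lebesgue" by (rule measurable_completion) simp
  qed (use cK' K'U sup in \<open>auto simp: indicator_def\<close>)
  from wconvD[OF conv this] have "(%m. LINT y|lebesgue. indicator Q (y - x) *R d m y) \<longlonglongrightarrow> 0" by simp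
  moreover have "(LINT y|lebesgue. indicator Q (y - x) *R d m y) = (\<integral>y. indicator Q (y - x) *R dK m y \<partial>lborel)" for m
  proof -
   have "indicator Q (y - x) *R d m y = indicator Q (y - x) *R dK m y" for y
    using sup[of y] by (auto simp: dK_def split: split_indicator)
   then show ?thesis by (simp only:) (rule integral_completion, simp)
  qed
  ultimately show ?thesis unfolding a_def using tendsto_norm_zero by auto
 qed
 have abd: "ennreal (a m x) <= ennreal C0" for m x
 proof -
  have "ennreal (a m x) <= (\<integral>\<^sup>+y. ennreal (norm (indicator Q (y - x) *R dK m y)) \<partial>lborel)"
   unfolding a_def by (rule norm_integral_le_nn)
  also have "... <= (\<integral>\<^sup>+y\<in>K'. ennreal (norm (d m y)) \<partial>lborel)"
   by (intro nn_integral_mono) (auto simp: dK_def indicator_def)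
  also have "... <= ennreal C0" by (rule C0)
  finally show ?thesis .
 qed
 have "(%m. \<integral>\<^sup>+x\<in>K. ennreal (a m x) \<partial>lborel) \<longlonglongrightarrow> (\<integral>\<^sup>+x. 0 \<partial>(lborel :: (real^'n) measure))"
 proof (rule nn_integral_dominated_convergence[where w = "%x. ennreal C0 * indicator K x"])
  have "emeasure lborel K < \<infinity>" using K by (intro emeasure_bounded_finite compact_imp_bounded)
  then show "(\<integral>\<^sup>+x. ennreal C0 * indicator K x \<partial>lborel) < \<infinity>"
   by (simp add: nn_integral_cmult ennreal_mult_less_top)
  show "AE x in lborel. ennreal (a m x) * indicator K x <= ennreal C0 * indicator K x" for m
   using abd by (intro AE_I2 mult_right_mono) auto
  show "AE x in lborel. (%m. ennreal (a m x) * indicator K x) \<longlonglongrightarrow> 0"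
  proof (intro AE_I2)
   fix x show "(%m. ennreal (a m x) * indicator K x) \<longlonglongrightarrow> 0"
    using tendsto_ennrealI[OF alim[of x]] by (cases "x \<in> K") auto
  qed
 qed measurable
 then have alim2: "(%m. \<integral>\<^sup>+x\<in>K. ennreal (a m x) \<partial>lborel) \<longlonglongrightarrow> 0" by simp
 have main: "ennreal q * (\<integral>\<^sup>+x\<in>K. ennreal (norm (d m x)) \<partial>lborel) \<le>
   (\<integral>\<^sup>+x\<in>K. ennreal (a m x) \<partial>lborel) + ennreal (q * (eps / 2))" for m
 proof -
  have tri: "ennreal q * (ennreal (norm (d m x)) * indicator K x) <= ennreal (a m x) * indicator K x +
    (\<integral>\<^sup>+y. indicator Q y * (ennreal (norm (d m (x + y) - d m x)) * indicator K x) \<partial>lborel)" for x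
  proof (cases "x \<in> K")
   case True
   have dxy: "dK m (x + y) = d m (x + y)" if "y \<in> Q" for y using inK'[OF True that] by (simp add: dK_def)
   have iQ: "integrable lborel (indicator Q :: _ => real)" using emQ by (intro integrable_real_indicator) auto
   have I1: "integrable lborel (%y. indicator Q y *R dK m (x + y))"
    using integrable_translate[OF dKI, of m x] by (intro integrable_mult_indicator) (auto simp: add.commute)
   have I2: "integrable lborel (%y. indicator Q y *R d m x)" using iQ by (intro integrable_scaleR_left)
   have "q *R d m x = (\<integral>y. indicator Q y *R d m x \<partial>lborel)"
    using iQ by (simp add: q_def integral_scaleR_left)
   also have "... = (\<integral>y. indicator Q y *R dK m (x + y) \<partial>lborel) - (\<integral>y. indicator Q y *R dK m (x + y) - indicator Q y *R d m x \<partial>lborel)"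
    using I1 I2 by simp
   finally have "norm (q *R d m x) <= norm (\<integral>y. indicator Q y *R dK m (x + y) \<partial>lborel) + norm (\<integral>y. indicator Q y *R dK m (x + y) - indicator Q y *R d m x \<partial>lborel)"
    by (simp only: norm_triangle_ineq4)
   also have "(\<integral>y. indicator Q y *R dK m (x + y) \<partial>lborel) = (\<integral>y. indicator Q (y - x) *R dK m y \<partial>lborel)"
    using integral_translate[of "%y. indicator Q (y - x) *R dK m y" x] by (simp add: add.commute)
   finally have "ennreal (norm (q *R d m x)) <= ennreal (a m x + norm (\<integral>y. indicator Q y *R dK m (x + y) - indicator Q y *R d m x \<partial>lborel))"
    by (simp only: a_def ennreal_leI)
   also have "... = ennreal (a m x) + ennreal (norm (\<integral>y. indicator Q y *R dK m (x + y) - indicator Q y *R d m x \<partial>lborel))"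
    by (simp add: a_def)
   also have "... <= ennreal (a m x) + (\<integral>\<^sup>+y. ennreal (norm (indicator Q y *R dK m (x + y) - indicator Q y *R d m x)) \<partial>lborel)"
    by (intro add_left_mono norm_integral_le_nn)
   also have "(\<integral>\<^sup>+y. ennreal (norm (indicator Q y *R dK m (x + y) - indicator Q y *R d m x)) \<partial>lborel) =
     (\<integral>\<^sup>+y. indicator Q y * (ennreal (norm (d m (x + y) - d m x)) * indicator K x) \<partial>lborel)"
    by (intro nn_integral_cong) (use dxy True in \<open>auto split: split_indicator\<close>)
   finally show ?thesis using True q by (simp add: ennreal_mult)
  qed simp
  have "ennreal q * (\<integral>\<^sup>+x\<in>K. ennreal (norm (d m x)) \<partial>lborel) = (\<integral>\<^sup>+x. ennreal q * (ennreal (norm (d m x)) * indicator K x) \<partial>lborel)"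
   by (rule nn_integral_cmult[symmetric]) measurable
  also have "... <= (\<integral>\<^sup>+x. ennreal (a m x) * indicator K x + (\<integral>\<^sup>+y. indicator Q y * (ennreal (norm (d m (x + y) - d m x)) * indicator K x) \<partial>lborel) \<partial>lborel)"
   by (intro nn_integral_mono tri)
  also have "... = (\<integral>\<^sup>+x\<in>K. ennreal (a m x) \<partial>lborel) + (\<integral>\<^sup>+x. (\<integral>\<^sup>+y. indicator Q y * (ennreal (norm (d m (x + y) - d m x)) * indicator K x) \<partial>lborel) \<partial>lborel)"
   by (rule nn_integral_add) measurable
  also have "(\<integral>\<^sup>+x. (\<integral>\<^sup>+y. indicator Q y * (ennreal (norm (d m (x + y) - d m x)) * indicator K x) \<partial>lborel) \<partial>lborel) =
    (\<integral>\<^sup>+y. (\<integral>\<^sup>+x. indicator Q y * (ennreal (norm (d m (x + y) - d m x)) * indicator K x) \<partial>lborel) \<partial>lborel)"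
   by (rule lborel_pair.Fubini'[symmetric]) measurable
  also have "... <= (\<integral>\<^sup>+y. indicator Q y * ennreal (eps / 2) \<partial>lborel)"
  proof (rule nn_integral_mono)
   fix y :: "real^'n"
   have "(\<integral>\<^sup>+x. indicator Q y * (ennreal (norm (d m (x + y) - d m x)) * indicator K x) \<partial>lborel) =
     indicator Q y * (\<integral>\<^sup>+x\<in>K. ennreal (norm (d m (x + y) - d m x)) \<partial>lborel)"
    by (rule nn_integral_cmult) measurable
   also have "... <= indicator Q y * ennreal (eps / 2)"
   proof (cases "y \<in> Q")
    case True
    have ysum: "(\<Sum>j\<in>UNIV. y $ j *R axis j 1) = y" using basis_expansion[of y] by (simp add: scalar_mult_eq_scaleR)
    have "(\<integral>\<^sup>+x\<in>K. ennreal (norm (d m (x + (\<Sum>j\<in>UNIV. y $ j *R axis j 1)) - d m x)) \<partial>lborel) <= ennreal (real (card (UNIV :: 'n set)) * delta * C)"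
     by (rule translation_L1_bound_box[OF U wp meas, where K' = K'])
      (use inK' K'U C True in \<open>auto simp: QD\<close>)
    also have "... <= ennreal (eps / 2)" using ndeltaC by (intro ennreal_leI) (simp add: n_def)
    finally show ?thesis using True by (simp add: ysum)
   qed simp
   finally show "(\<integral>\<^sup>+x. indicator Q y * (ennreal (norm (d m (x + y) - d m x)) * indicator K x) \<partial>lborel) <= indicator Q y * ennreal (eps / 2)" .
  qed
  also have "... = ennreal q * ennreal (eps / 2)" by (simp add: nn_integral_multc emQ)
  also have "... = ennreal (q * (eps / 2))" using eps q by (intro ennreal_mult[symmetric]) auto
  finally show ?thesis by (simp add: add_left_mono)
 qed
 have "\<forall>\<^sub>F m in sequentially. (\<integral>\<^sup>+x\<in>K. ennreal (a m x) \<partial>lborel) <= ennreal (q * (eps / 2))"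
  using q eps by (intro ennreal_tendsto_0D[OF alim2]) simp
 then show "\<forall>\<^sub>F m in sequentially. (\<integral>\<^sup>+x\<in>K. ennreal (norm (d m x)) \<partial>lborel) <= ennreal eps"
 proof eventually_elim
  case (elim m)
  have "ennreal q * (\<integral>\<^sup>+x\<in>K. ennreal (norm (d m x)) \<partial>lborel) <= ennreal (q * (eps / 2)) + ennreal (q * (eps / 2))"
   using main[of m] elim by (meson add_right_mono order_trans)
  also have "... = ennreal q * ennreal eps" using q eps by (simp flip: ennreal_plus ennreal_mult)
  finally show ?case using q by (simp add: ennreal_mult_le_mult_iff)
 qed
qed

section \<open>Local boundedness and modes of local convergence\<close>

definition sconv :: "(real^'n) set => (nat => real^'n => 'b::euclidean_space) => (real^'n => 'b) => bool" where
 "sconv U F f \<longleftrightarrow> (\<forall>K. compact K & K \<subseteq> U -->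
  (%m. \<integral>\<^sup>+x\<in>K. ennreal (norm (F m x - f x)) \<partial>lebesgue) \<longlonglongrightarrow> 0)"

text \<open>The bounds are uniform over an arbitrary index type; a single function is treated as a
  family indexed by \<open>unit\<close>. The same holds for the next three notions.\<close>

definition L1_bounded :: "(real^'n) set => ('i => real^'n => 'b::euclidean_space) => bool" where
 "L1_bounded U F \<longleftrightarrow> (\<forall>K. compact K & K \<subseteq> U -->
  (\<exists>C. \<forall>m. (\<integral>\<^sup>+x\<in>K. ennreal (norm (F m x)) \<partial>lebesgue) <= ennreal C))"

definition L2_bounded :: "(real^'n) set => ('i => real^'n => 'b::euclidean_space) => bool" where
 "L2_bounded U F \<longleftrightarrow> (\<forall>K. compact K & K \<subseteq> U -->
  (\<exists>C. \<forall>m. (\<integral>\<^sup>+x\<in>K. ennreal ((norm (F m x))^2) \<partial>lebesgue) <= ennreal C))"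

definition locally_bounded :: "(real^'n) set => ('i => real^'n => 'b::euclidean_space) => bool" where
 "locally_bounded U F \<longleftrightarrow> (\<forall>K. compact K & K \<subseteq> U -->
  (\<exists>B. \<forall>m. AE x in lebesgue. x \<in> K --> norm (F m x) <= B))"

definition Morrey_bounded :: "real => (real^'n) set => ('i => real^'n => 'b::euclidean_space) => bool" where
 "Morrey_bounded p U F \<longleftrightarrow> (\<forall>V. open_compactly_in V U -->
  (\<exists>C. \<forall>m. Morrey_bound p (real CARD('n) - p) V (F m) C))"

text \<open>The working notion of convergence: weak convergence in local L^1 together with Morrey
  bounds uniform along the sequence. By \<open>weak_conv_MorreyI\<close> it implies weak-star
  convergence on every relatively compact open subset, and it is easier to propagate through
  algebraic operations.\<close>

definition mconv :: "real => (real^'n) set => (nat => real^'n => 'b::euclidean_space) => (real^'n => 'b) => bool" where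
 "mconv p U F f \<longleftrightarrow> (\<forall>m. locally_integrable U (F m)) & locally_integrable U f & wconv U F f & Morrey_bounded p U F"

lemma compact_lebesgue:
 assumes "compact (K :: (real^'n) set)"
 shows "K \<in> sets lebesgue" "K \<in> lmeasurable" "emeasure lebesgue K = ennreal (measure lebesgue K)"
proof -
 show "K \<in> lmeasurable" by (rule lmeasurable_compact[OF assms])
 then show "K \<in> sets lebesgue" "emeasure lebesgue K = ennreal (measure lebesgue K)"
  by (auto simp: emeasure_eq_measure2)
qed

lemma indicator_measurable_li:
 assumes "compact K" "K \<subseteq> U" "locally_integrable U f"
 shows "(%x. indicator K x *R f x) \<in> borel_measurable lebesgue"
 using assms by (auto simp: locally_integrable_def set_integrable_def intro!: borel_measurable_integrable)

lemma measurable_norm_li: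
 assumes "compact K" "K \<subseteq> U" "locally_integrable U g"
 shows "(%x. ennreal (norm (g x)) * indicator K x) \<in> borel_measurable lebesgue"
proof -
 have "(%x. ennreal (norm (indicator K x *R g x))) \<in> borel_measurable lebesgue"
  using indicator_measurable_li[OF assms] by measurable
 also have "(%x. ennreal (norm (indicator K x *R g x))) = (%x. ennreal (norm (g x)) * indicator K x)"
  by (auto simp: fun_eq_iff split: split_indicator)
 finally show ?thesis .
qed

lemma locally_integrable_diff:
 "locally_integrable U f ==> locally_integrable U g ==> locally_integrable U (%x. f x - g x)"
 unfolding locally_integrable_def by (blast intro: set_integral_diff(1))

lemma Morrey_bounded_imp_L2:
 fixes F :: "'i => real^'n => 'b::euclidean_space"
 assumes U: "open U" and p: "p > 2" and li: "!!m. locally_integrable U (F m)" and M: "Morrey_bounded p U F"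
 shows "L2_bounded U F"
 unfolding L2_bounded_def
proof (intro allI impI)
 fix K assume K: "compact K & K \<subseteq> U"
 then obtain V where V: "open_compactly_in V U" "K \<subseteq> V" using compact_between[OF U] by metis
 note V' = open_compactly_in_lmeasurable[OF V(1)]
 obtain C where C: "!!m. Morrey_bound p (real CARD('n) - p) V (F m) C" using M V(1) unfolding Morrey_bounded_def by blast
 define c where "c = C * diameter V powr ((real CARD('n) - p) / p)"
 have c: "weak_Lp_bound p V (F m) c" for m
  unfolding c_def by (rule Morrey_bound_imp_weak_Lp_bound[OF V'(1,2) C])
 have meas: "F m \<in> borel_measurable (lebesgue_on V)" for m
  by (rule locally_integrable_measurable_on[OF U li open_compactly_in_subset[OF V(1)] V'(4)])
 have "(\<integral>\<^sup>+x\<in>K. ennreal ((norm (F m x))^2) \<partial>lebesgue) <= ennreal (c^2 * (p / 2 / (p / 2 - 1)) * measure lebesgue V powr (1 - 2 / p))" for m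
 proof -
  have "(\<integral>\<^sup>+x\<in>K. ennreal ((norm (F m x))^2) \<partial>lebesgue) <= (\<integral>\<^sup>+x\<in>V. ennreal ((norm (F m x))^2) \<partial>lebesgue)"
   using V(2) by (intro nn_integral_mono) (auto simp: indicator_def)
  also have "... = (\<integral>\<^sup>+x. ennreal ((norm (F m x))^2) \<partial>lebesgue_on V)"
   using V'(4) by (subst nn_integral_restrict_space) auto
  also have "... <= ennreal (c^2 * (p / 2 / (p / 2 - 1)) * measure lebesgue V powr (1 - 2 / p))"
   by (rule weak_Lp_square_bound[OF c meas V'(3) p])
  finally show ?thesis .
 qed
 then show "\<exists>C. \<forall>m. (\<integral>\<^sup>+x\<in>K. ennreal ((norm (F m x))^2) \<partial>lebesgue) <= ennreal C" by blast
qed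

lemma L2_bounded_imp_L1:
 assumes li: "!!m. locally_integrable U (F m)" and "L2_bounded U F"
 shows "L1_bounded U F"
 unfolding L1_bounded_def
proof (intro allI impI)
 fix K assume K: "compact K & K \<subseteq> U"
 then obtain C where C: "!!m. (\<integral>\<^sup>+x\<in>K. ennreal ((norm (F m x))^2) \<partial>lebesgue) <= ennreal C"
  using assms(2) unfolding L2_bounded_def by blast
 note [measurable] = compact_lebesgue(1)[of K]
 have "(\<integral>\<^sup>+x\<in>K. ennreal (norm (F m x)) \<partial>lebesgue) <= ennreal (measure lebesgue K + max C 0)" for m
 proof -
  have "(\<integral>\<^sup>+x\<in>K. ennreal (norm (F m x)) \<partial>lebesgue) <= (\<integral>\<^sup>+x. indicator K x + ennreal ((norm (F m x))^2) * indicator K x \<partial>lebesgue)"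
  proof (rule nn_integral_mono)
   fix x
   have "norm (F m x) <= 1 + (norm (F m x))^2"
    using sum_squares_bound[of "norm (F m x)" 1] norm_ge_zero[of "F m x"] unfolding power_one mult_1_right by linarith
   then have "ennreal (norm (F m x)) <= 1 + ennreal ((norm (F m x))^2)"
    by (simp add: ennreal_leI ennreal_1[symmetric] del: ennreal_1 flip: ennreal_plus)
   then show "ennreal (norm (F m x)) * indicator K x <= indicator K x + ennreal ((norm (F m x))^2) * indicator K x"
    by (auto simp: indicator_def)
  qed
  also have "... = emeasure lebesgue K + (\<integral>\<^sup>+x\<in>K. ennreal ((norm (F m x))^2) \<partial>lebesgue)"
  proof (subst nn_integral_add)
   have [measurable]: "(%x. indicator K x *R F m x) \<in> borel_measurable lebesgue"
    by (rule indicator_measurable_li[OF _ _ li]) (use K in auto)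
   have "(%x. ennreal ((norm (indicator K x *R F m x))^2)) \<in> borel_measurable lebesgue"
    by measurable
   also have "(%x. ennreal ((norm (indicator K x *R F m x))^2)) = (%x. ennreal ((norm (F m x))^2) * indicator K x)"
    by (auto simp: indicator_def)
   finally show "(%x. ennreal ((norm (F m x))^2) * indicator K x) \<in> borel_measurable lebesgue" .
  qed (use K in auto)
  also have "... <= ennreal (measure lebesgue K) + ennreal (max C 0)"
   using K by (intro add_mono order_trans[OF C] ennreal_leI eq_refl[OF compact_lebesgue(3)]) auto
  finally show ?thesis by (simp flip: ennreal_plus)
 qed
 then show "\<exists>C. \<forall>m. (\<integral>\<^sup>+x\<in>K. ennreal (norm (F m x)) \<partial>lebesgue) <= ennreal C" by blast
qed

lemma locally_integrable_L1: "locally_integrable U f ==> L1_bounded U (%_::'i. f)"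
 unfolding L1_bounded_def
proof (intro allI impI)
 fix K assume "locally_integrable U f" "compact K & K \<subseteq> U"
 then have "integrable lebesgue (%x. indicator K x *R f x)" by (auto simp: locally_integrable_def set_integrable_def)
 then have "(\<integral>\<^sup>+x. ennreal (norm (indicator K x *R f x)) \<partial>lebesgue) < \<infinity>" by (simp add: integrable_iff_bounded)
 also have "(\<integral>\<^sup>+x. ennreal (norm (indicator K x *R f x)) \<partial>lebesgue) = (\<integral>\<^sup>+x\<in>K. ennreal (norm (f x)) \<partial>lebesgue)"
  by (intro nn_integral_cong) (auto simp: indicator_def)
 finally show "\<exists>C. \<forall>m::'i. (\<integral>\<^sup>+x\<in>K. ennreal (norm (f x)) \<partial>lebesgue) <= ennreal C"
  by (intro exI[of _ "enn2real (\<integral>\<^sup>+x\<in>K. ennreal (norm (f x)) \<partial>lebesgue)"]) simp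
qed

lemma L1_bounded_borel_diff:
 fixes F :: "'i => real^'n => 'b::euclidean_space"
 assumes F: "L1_bounded U F" and f: "locally_integrable U f" and li: "!!m. locally_integrable U (F m)"
  and G: "!!m. G m \<in> borel_measurable borel" "!!m. AE x in lebesgue. x \<in> U --> F m x - f x = G m x"
  and K: "compact K" "K \<subseteq> U"
 shows "\<exists>C. \<forall>m. (\<integral>\<^sup>+x\<in>K. ennreal (norm (G m x)) \<partial>lborel) <= ennreal C"
proof -
 obtain C where C: "!!m. (\<integral>\<^sup>+x\<in>K. ennreal (norm (F m x)) \<partial>lebesgue) <= ennreal C" using F K unfolding L1_bounded_def by blast
 obtain C' where C': "(\<integral>\<^sup>+x\<in>K. ennreal (norm (f x)) \<partial>lebesgue) <= ennreal C'"
  using locally_integrable_L1[OF f, where 'i = unit] K unfolding L1_bounded_def by blast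
 have [measurable]: "K \<in> sets borel" using K by (simp add: borel_compact)
 have "(\<integral>\<^sup>+x\<in>K. ennreal (norm (G m x)) \<partial>lborel) <= ennreal (max C 0 + max C' 0)" for m
 proof -
  have "(\<integral>\<^sup>+x\<in>K. ennreal (norm (G m x)) \<partial>lborel) = (\<integral>\<^sup>+x\<in>K. ennreal (norm (G m x)) \<partial>lebesgue)"
   by (rule nn_integral_completion[symmetric])
  also have "... = (\<integral>\<^sup>+x\<in>K. ennreal (norm (F m x - f x)) \<partial>lebesgue)"
   by (rule set_nn_integral_lebesgue_cong[OF AE_imp_sym[OF G(2)] K(2), of "%y x. ennreal (norm y)"])
  also have "... <= (\<integral>\<^sup>+x. ennreal (norm (F m x)) * indicator K x + ennreal (norm (f x)) * indicator K x \<partial>lebesgue)"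
   using norm_triangle_ennreal[of "F m x" "- f x" for x] by (intro nn_integral_mono) (auto simp: indicator_def)
  also have "... = (\<integral>\<^sup>+x\<in>K. ennreal (norm (F m x)) \<partial>lebesgue) + (\<integral>\<^sup>+x\<in>K. ennreal (norm (f x)) \<partial>lebesgue)"
   by (rule nn_integral_add[OF measurable_norm_li[OF K li] measurable_norm_li[OF K f]])
  also have "... <= ennreal (max C 0) + ennreal (max C' 0)"
   by (intro add_mono order_trans[OF C] order_trans[OF C'] ennreal_leI) auto
  finally show ?thesis by (simp flip: ennreal_plus)
 qed
 then show ?thesis by blast
qed

text \<open>Subtracting the limit and choosing Borel representatives of the differences and of the
  differences of derivatives reduces the claim to \<open>Rellich_borel\<close>.\<close>

theorem Rellich:
 fixes F :: "nat => real^'n => 'b::euclidean_space"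
 assumes U: "open U" and wp: "!!m i. has_weak_partial U i (F m) (G i m)" "!!i. has_weak_partial U i f (g i)"
  and conv: "wconv U F f" and b0: "L1_bounded U F" and b1: "!!i. L1_bounded U (G i)"
 shows "sconv U F f"
 unfolding sconv_def
proof (intro allI impI)
 fix K assume K: "compact K & K \<subseteq> U"
 have li: "locally_integrable U (F m)" "locally_integrable U f" "locally_integrable U (G i m)" "locally_integrable U (g i)" for m i
  using wp by (auto simp: has_weak_partial_iff)
 have lid: "locally_integrable U (%x. F m x - f x)" "locally_integrable U (%x. G i m x - g i x)" for m i
  using li by (auto intro: locally_integrable_diff)
 have "\<forall>m. \<exists>g. g \<in> borel_measurable borel & (AE x in lebesgue. x \<in> U --> F m x - f x = g x)"
  using borel_rep_on[OF U lid(1)] by blast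
 from choice[OF this] obtain d where d: "!!m. d m \<in> borel_measurable borel" "!!m. AE x in lebesgue. x \<in> U --> F m x - f x = d m x"
  by blast
 have "\<forall>i. \<exists>h. \<forall>m. h m \<in> borel_measurable borel & (AE x in lebesgue. x \<in> U --> G i m x - g i x = h m x)"
  using borel_rep_on[OF U lid(2)] by (intro allI choice) blast
 from choice[OF this] obtain h where h: "!!i m. h i m \<in> borel_measurable borel" "!!i m. AE x in lebesgue. x \<in> U --> G i m x - g i x = h i m x"
  by blast
 have intd: "(LINT x|lebesgue. psi x *R (a x - b x)) = (LINT x|lebesgue. psi x *R a x) - (LINT x|lebesgue. psi x *R b x)"
  if "wtest U psi" "locally_integrable U a" "locally_integrable U b" for psi and a b :: "real^'n => 'b"
  unfolding scaleR_diff_right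
  by (rule Bochner_Integration.integral_diff[OF wtest_integrable[OF that(1,2)] wtest_integrable[OF that(1,3)]])
 have wpd: "has_weak_partial U i (d m) (h i m)" for m i
 proof (rule has_weak_partial_cong[OF d(2) h(2)])
  show "has_weak_partial U i (%x. F m x - f x) (%x. G i m x - g i x)"
   unfolding has_weak_partial_iff
  proof (intro conjI allI impI lid)
   fix phi assume phi: "test_function U phi"
   then show "(LINT x|lebesgue. partial i phi x *R (F m x - f x)) = - (LINT x|lebesgue. phi x *R (G i m x - g i x))"
    using wp[unfolded has_weak_partial_iff]
    by (simp add: intd[OF test_function_wtest[OF phi] li(3,4)] intd[OF test_function_partial_wtest[OF phi] li(1,2)])
  qed
 qed
 have c0: "wconv U (%m x. F m x - f x) (%x. 0)"
  unfolding wconv_def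
 proof (intro allI impI)
  fix psi assume psi: "wtest U psi"
  have "(%m. (LINT x|lebesgue. psi x *R F m x) - (LINT x|lebesgue. psi x *R f x)) \<longlonglongrightarrow> (LINT x|lebesgue. psi x *R f x) - (LINT x|lebesgue. psi x *R f x)"
   by (intro tendsto_intros wconvD[OF conv psi])
  then show "(%m. LINT x|lebesgue. psi x *R (F m x - f x)) \<longlonglongrightarrow> (LINT x|lebesgue. psi x *R 0)"
   by (simp add: intd[OF psi li(1,2)])
 qed
 have cd: "wconv U d (%x. 0)"
  by (rule wconv_cong[OF d(2) _ lid(1) _ c0]) (auto simp: locally_integrable_def set_integrable_def)
 have "(%m. \<integral>\<^sup>+x\<in>K. ennreal (norm (d m x)) \<partial>lborel) \<longlonglongrightarrow> 0"
 proof (rule Rellich_borel[OF U wpd d(1) h(1) cd])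
  fix K assume K: "compact K" "K \<subseteq> U"
  have "\<forall>i. \<exists>C. \<forall>m. (\<integral>\<^sup>+x\<in>K. ennreal (norm (h i m x)) \<partial>lborel) <= ennreal C"
   using L1_bounded_borel_diff[OF b1 li(4) li(3) h K] by blast
  then obtain C where C: "!!i m. (\<integral>\<^sup>+x\<in>K. ennreal (norm (h i m x)) \<partial>lborel) <= ennreal (C i)" by metis
  have "(\<integral>\<^sup>+x\<in>K. ennreal (norm (h i m x)) \<partial>lborel) <= ennreal (Max (range C))" for m i
   by (rule order_trans[OF C ennreal_leI]) (auto intro: Max_ge)
  then show "\<exists>C. \<forall>m i. (\<integral>\<^sup>+x\<in>K. ennreal (norm (h i m x)) \<partial>lborel) <= ennreal C" by blast
  show "\<exists>C. \<forall>m. (\<integral>\<^sup>+x\<in>K. ennreal (norm (d m x)) \<partial>lborel) <= ennreal C"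
   by (rule L1_bounded_borel_diff[OF b0 li(2) li(1) d K])
 qed (use K in auto)
 moreover have "(\<integral>\<^sup>+x\<in>K. ennreal (norm (d m x)) \<partial>lborel) = (\<integral>\<^sup>+x\<in>K. ennreal (norm (F m x - f x)) \<partial>lebesgue)" for m
 proof -
  have [measurable]: "K \<in> sets borel" using K by (simp add: borel_compact)
  note [measurable] = d(1)
  have "(\<integral>\<^sup>+x\<in>K. ennreal (norm (d m x)) \<partial>lborel) = (\<integral>\<^sup>+x\<in>K. ennreal (norm (d m x)) \<partial>lebesgue)"
   by (rule nn_integral_completion[symmetric])
  also have "... = (\<integral>\<^sup>+x\<in>K. ennreal (norm (F m x - f x)) \<partial>lebesgue)"
   by (rule set_nn_integral_lebesgue_cong[OF AE_imp_sym[OF d(2)], of K "%y x. ennreal (norm y)"]) (use K in auto)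
  finally show ?thesis .
 qed
 ultimately show "(%m. \<integral>\<^sup>+x\<in>K. ennreal (norm (F m x - f x)) \<partial>lebesgue) \<longlonglongrightarrow> 0" by simp
qed

text \<open>The distance from \<open>f x\<close> to \<open>S\<close> is at most |F m x - f x|, whose
  integral over \<open>K\<close> tends to zero. So the integral of the distance vanishes, and
  \<open>S\<close> is closed.\<close>

lemma sconv_mem_closed:
 fixes F :: "nat => real^'n => 'b::euclidean_space"
 assumes conv: "sconv U F f" and li: "locally_integrable U f" and U: "open U" and S: "closed S" "S ~= {}"
  and F: "!!m. AE x in lebesgue. x \<in> K --> F m x \<in> S" and K: "compact K" "K \<subseteq> U"
 shows "AE x in lebesgue. x \<in> K --> f x \<in> S"
proof -
 have "(\<integral>\<^sup>+x\<in>K. ennreal (infdist (f x) S) \<partial>lebesgue) <= (\<integral>\<^sup>+x\<in>K. ennreal (norm (F m x - f x)) \<partial>lebesgue)" for m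
 proof (rule nn_integral_mono_AE)
  show "AE x in lebesgue. ennreal (infdist (f x) S) * indicator K x <= ennreal (norm (F m x - f x)) * indicator K x"
   using F[of m]
  proof eventually_elim
   case (elim x)
   then show ?case
    using infdist_le[of "F m x" S "f x"] by (auto simp: indicator_def dist_norm norm_minus_commute intro!: ennreal_leI)
  qed
 qed
 moreover have "(%m. \<integral>\<^sup>+x\<in>K. ennreal (norm (F m x - f x)) \<partial>lebesgue) \<longlonglongrightarrow> 0"
  using conv K by (simp add: sconv_def)
 ultimately have "(\<integral>\<^sup>+x\<in>K. ennreal (infdist (f x) S) \<partial>lebesgue) <= 0"
  by (intro LIMSEQ_le_const[of _ 0]) auto
 moreover have "(%x. ennreal (infdist (f x) S) * indicator K x) \<in> borel_measurable lebesgue"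
 proof -
  note [measurable] = indicator_measurable_li[OF K li] compact_lebesgue(1)[OF K(1)]
  have "(%y. infdist y S) \<in> borel_measurable borel"
   by (intro borel_measurable_continuous_onI continuous_intros)
  then have "(%x. ennreal (infdist (indicator K x *R f x) S) * indicator K x) \<in> borel_measurable lebesgue"
   by measurable
  also have "(%x. ennreal (infdist (indicator K x *R f x) S) * indicator K x) = (%x. ennreal (infdist (f x) S) * indicator K x)"
   by (auto simp: indicator_def)
  finally show ?thesis .
 qed
 ultimately have "AE x in lebesgue. ennreal (infdist (f x) S) * indicator K x = 0"
  by (subst (asm) le_zero_eq, subst (asm) nn_integral_0_iff_AE) auto
 then show ?thesis
 proof eventually_elim
  case (elim x)
  show ?case
  proof
   assume "x \<in> K"
   then have "infdist (f x) S = 0" using elim infdist_nonneg[of "f x" S] by (simp add: ennreal_eq_0_iff)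
   then show "f x \<in> S" using in_closed_iff_infdist_zero[OF S] by blast
  qed
 qed
qed

lemma sconv_Lipschitz:
 fixes F :: "nat => real^'n => 'b::euclidean_space" and T :: "'b => 'c::euclidean_space"
 assumes conv: "sconv U F f" and li: "!!m. locally_integrable U (F m)" "locally_integrable U f"
  and lip: "!!K. compact K ==> K \<subseteq> U ==> \<exists>L. \<forall>m. AE x in lebesgue. x \<in> K --> norm (T (F m x) - T (f x)) <= L * norm (F m x - f x)"
 shows "sconv U (%m x. T (F m x)) (%x. T (f x))"
 unfolding sconv_def
proof (intro allI impI)
 fix K assume K: "compact K & K \<subseteq> U"
 obtain L where L: "!!m. AE x in lebesgue. x \<in> K --> norm (T (F m x) - T (f x)) <= L * norm (F m x - f x)" using lip K by blast
 define L' where "L' = max L 0 + 1"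
 show "(%m. \<integral>\<^sup>+x\<in>K. ennreal (norm (T (F m x) - T (f x))) \<partial>lebesgue) \<longlonglongrightarrow> 0"
 proof (rule ennreal_tendsto_0I)
  fix e :: real assume e: "e > 0"
  have L': "L' > 0" "L <= L'" by (auto simp: L'_def)
  have "\<forall>\<^sub>F m in sequentially. (\<integral>\<^sup>+x\<in>K. ennreal (norm (F m x - f x)) \<partial>lebesgue) <= ennreal (e / L')"
   using conv K e L' by (intro ennreal_tendsto_0D) (auto simp: sconv_def)
  then show "\<forall>\<^sub>F m in sequentially. (\<integral>\<^sup>+x\<in>K. ennreal (norm (T (F m x) - T (f x))) \<partial>lebesgue) <= ennreal e"
  proof eventually_elim
   case (elim m)
   have "(\<integral>\<^sup>+x\<in>K. ennreal (norm (T (F m x) - T (f x))) \<partial>lebesgue) <= (\<integral>\<^sup>+x. ennreal L' * (ennreal (norm (F m x - f x)) * indicator K x) \<partial>lebesgue)"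
   proof (rule nn_integral_mono_AE)
    show "AE x in lebesgue. ennreal (norm (T (F m x) - T (f x))) * indicator K x <= ennreal L' * (ennreal (norm (F m x - f x)) * indicator K x)"
     using L[of m]
    proof eventually_elim
     case (elim x)
     have "norm (T (F m x) - T (f x)) <= L' * norm (F m x - f x)" if "x \<in> K"
      using elim that mult_right_mono[OF L'(2) norm_ge_zero[of "F m x - f x"]] by simp
     then show ?case using L' by (auto simp: indicator_def ennreal_leI simp flip: ennreal_mult)
    qed
   qed
   also have "... = ennreal L' * (\<integral>\<^sup>+x\<in>K. ennreal (norm (F m x - f x)) \<partial>lebesgue)"
    by (rule nn_integral_cmult, rule measurable_norm_li[OF _ _ locally_integrable_diff[OF li]]) (use K in auto)
   also have "... <= ennreal L' * ennreal (e / L')" using elim by (rule mult_left_mono) simp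
   also have "... = ennreal e" using L' e by (simp flip: ennreal_mult)
   finally show ?case .
  qed
 qed
qed

lemma locally_boundedD:
 assumes "locally_bounded U F" "compact K" "K \<subseteq> U"
 obtains B where "B > 0" "!!m. AE x in lebesgue. x \<in> K --> norm (F m x) <= B"
proof -
 obtain B where B: "!!m. AE x in lebesgue. x \<in> K --> norm (F m x) <= B"
  using assms unfolding locally_bounded_def by blast
 have "AE x in lebesgue. x \<in> K --> norm (F m x) <= max B 1" for m
  using B[of m] by eventually_elim auto
 then show ?thesis by (intro that[of "max B 1"]) auto
qed

section \<open>Products of weakly and strongly convergent sequences\<close>

lemma locally_integrable_product:
 fixes c :: "real^'n => 'b::euclidean_space"
 assumes s: "locally_integrable U s" and c: "locally_integrable U c" "locally_bounded U (%_::unit. c)"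
 shows "locally_integrable U (%x. s x *R c x)"
 unfolding locally_integrable_def set_integrable_def
proof (intro allI impI)
 fix K assume K: "compact K & K \<subseteq> U"
 then obtain B where B: "B > 0" "AE x in lebesgue. x \<in> K --> norm (c x) <= B"
  using locally_boundedD[OF c(2), of K] by metis
 have ms: "(%x. indicator K x *R s x) \<in> borel_measurable lebesgue"
  by (rule indicator_measurable_li[OF _ _ s]) (use K in auto)
 have mc: "(%x. indicator K x *R c x) \<in> borel_measurable lebesgue"
  by (rule indicator_measurable_li[OF _ _ c(1)]) (use K in auto)
 have "integrable lebesgue (%x. indicator K x *R s x)"
  using s K by (auto simp: locally_integrable_def set_integrable_def)
 from integrable_scaleR_right[OF this, of B]
 show "integrable lebesgue (%x. indicator K x *R s x *R c x)"
 proof (rule Bochner_Integration.integrable_bound)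
  have "(%x. (indicator K x *R s x) *R (indicator K x *R c x)) \<in> borel_measurable lebesgue"
   using ms mc by (rule borel_measurable_scaleR)
  also have "(%x. (indicator K x *R s x) *R (indicator K x *R c x)) = (%x. indicator K x *R s x *R c x)"
   by (auto simp: fun_eq_iff split: split_indicator)
  finally show "(%x. indicator K x *R s x *R c x) \<in> borel_measurable lebesgue" .
  show "AE x in lebesgue. norm (indicator K x *R s x *R c x) <= norm (B *R indicator K x *R s x)"
   using B(2)
  proof eventually_elim
   case (elim x)
   then show ?case using B(1) mult_right_mono[of "norm (c x)" B "\<bar>s x\<bar>"] by (cases "x \<in> K") (auto simp: abs_mult mult.commute)
  qed
 qed
qed

text \<open>Split s_m c_m = s_m c_0 + s_m (c_m - c_0). In the first term the bounded
  \<open>c0\<close> is absorbed into the test function. In the second, r = |c_m - c_0| is small only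
  in L^1 but bounded by B0 + B1 = delta R, so Young's inequality gives |s_m| r <= delta |s_m|^2 + R
  r: the square is bounded in L^1, the second part tends to zero.\<close>

lemma wconv_product:
 fixes c :: "nat => real^'n => 'b::euclidean_space"
 assumes s: "!!m. locally_integrable U (s m)" "locally_integrable U s0" "wconv U s s0" "L2_bounded U s"
  and c: "!!m. locally_integrable U (c m)" "locally_integrable U c0" "sconv U c c0"
   "locally_bounded U c" "locally_bounded U (%_::unit. c0)"
 shows "wconv U (%m x. s m x *R c m x) (%x. s0 x *R c0 x)"
 unfolding wconv_def
proof (intro allI impI)
 fix psi assume psi: "wtest U psi"
 then obtain P K where P: "!!x. \<bar>psi x\<bar> <= P" and K: "compact K" "K \<subseteq> U" "!!x. x \<notin> K ==> psi x = 0"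
  and [measurable]: "psi \<in> borel_measurable lebesgue" unfolding wtest_def by blast
 have P0: "0 <= P" using P[of undefined] by linarith
 obtain B0 where B0: "B0 > 0" "AE x in lebesgue. x \<in> K --> norm (c0 x) <= B0" using locally_boundedD[OF c(5) K(1,2)] by metis
 obtain B1 where B1: "B1 > 0" "!!m. AE x in lebesgue. x \<in> K --> norm (c m x) <= B1" using locally_boundedD[OF c(4) K(1,2)] by metis
 have lim: "locally_bounded U (%_::unit. c m)" for m using c(4) unfolding locally_bounded_def by blast
 have lis: "locally_integrable U (%x. s m x *R c m x)" "locally_integrable U (%x. s m x *R c0 x)" "locally_integrable U (%x. s0 x *R c0 x)" for m
  using locally_integrable_product s(1,2) c(1,2,5) lim by blast+
 have Y: "(%m. LINT x|lebesgue. psi x *R (s m x *R c0 x)) \<longlonglongrightarrow> (LINT x|lebesgue. psi x *R (s0 x *R c0 x))"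
 proof (rule tendsto_componentwise_iff[THEN iffD2], intro ballI)
  fix b :: 'b assume b: "b \<in> Basis"
  \<comment> \<open>Clipping at \<open>B0\<close> changes the component of \<open>c0\<close> on a
    null subset of \<open>K\<close> only, and makes the new test function bounded
    everywhere.\<close>
  define psib where "psib x = psi x * max (- B0) (min B0 (indicator K x *R c0 x \<bullet> b))" for x
  have psib: "wtest U psib"
   unfolding wtest_def
  proof (intro conjI)
   show "psib \<in> borel_measurable lebesgue"
    unfolding psib_def[abs_def] using indicator_measurable_li[OF K(1,2) c(2)] by measurable
   have "\<bar>psib x\<bar> <= P * B0" for x
    unfolding psib_def abs_mult using P[of x] B0(1) by (intro mult_mono) auto
   then show "\<exists>B. \<forall>x. \<bar>psib x\<bar> <= B" by blast
   show "\<exists>K. compact K & K \<subseteq> U & (\<forall>x. x \<notin> K --> psib x = 0)"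
    using K by (intro exI[of _ K]) (auto simp: psib_def)
  qed
  have eq: "(LINT x|lebesgue. psi x *R (t x *R c0 x)) \<bullet> b = (LINT x|lebesgue. psib x *R t x)"
   if t: "locally_integrable U t" for t
  proof -
   have I: "integrable lebesgue (%x. psi x *R (t x *R c0 x))"
    by (rule wtest_integrable[OF psi locally_integrable_product[OF t c(2,5)]])
   have "(LINT x|lebesgue. psi x *R (t x *R c0 x)) \<bullet> b = (LINT x|lebesgue. (psi x *R (t x *R c0 x)) \<bullet> b)"
    by (rule integral_inner_left[symmetric]) (rule I)
   also have "... = (LINT x|lebesgue. psib x *R t x)"
   proof (rule integral_cong_AE)
    show "(%x. (psi x *R (t x *R c0 x)) \<bullet> b) \<in> borel_measurable lebesgue"
     by (intro borel_measurable_inner borel_measurable_integrable[OF I]) simp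
    show "(%x. psib x *R t x) \<in> borel_measurable lebesgue"
     by (rule borel_measurable_integrable[OF wtest_integrable[OF psib t]])
    show "AE x in lebesgue. (psi x *R (t x *R c0 x)) \<bullet> b = psib x *R t x"
     using B0(2)
    proof eventually_elim
     case (elim x)
     show ?case
     proof (cases "x \<in> K")
      case True
      then have "\<bar>c0 x \<bullet> b\<bar> <= B0" using elim Basis_le_norm[OF b, of "c0 x"] by simp
      then have "max (- B0) (min B0 (c0 x \<bullet> b)) = c0 x \<bullet> b" by (auto simp: max_def min_def)
      then show ?thesis using True by (simp add: psib_def mult_ac)
     qed (simp add: K(3) psib_def)
    qed
   qed
   finally show ?thesis .
  qed
  show "(%m. (LINT x|lebesgue. psi x *R (s m x *R c0 x)) \<bullet> b) \<longlonglongrightarrow> (LINT x|lebesgue. psi x *R (s0 x *R c0 x)) \<bullet> b"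
   using wconvD[OF s(3) psib] by (simp only: eq[OF s(1)] eq[OF s(2)])
 qed
 have "(%m. (LINT x|lebesgue. psi x *R (s m x *R c m x)) - (LINT x|lebesgue. psi x *R (s m x *R c0 x))) \<longlonglongrightarrow> 0"
 proof (rule LIMSEQ_I)
  fix e :: real assume e: "e > 0"
  obtain C where C: "!!m. (\<integral>\<^sup>+x\<in>K. ennreal ((norm (s m x))^2) \<partial>lebesgue) <= ennreal C"
   using s(4) K unfolding L2_bounded_def by blast
  define C' where "C' = max C 0 + 1"
  have C': "C' > 0" "!!m. (\<integral>\<^sup>+x\<in>K. ennreal ((norm (s m x))^2) \<partial>lebesgue) <= ennreal C'"
   using order_trans[OF C ennreal_leI[of C C']] by (auto simp: C'_def)
  define delta where "delta = e / (3 * (P + 1) * C')"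
  have delta: "delta > 0" using e P0 C' by (simp add: delta_def)
  define R where "R = (B0 + B1) / delta"
  have R: "R > 0" using B0 B1 delta by (simp add: R_def)
  define e' where "e' = e / (3 * (P + 1) * R)"
  have e': "e' > 0" using e P0 R by (simp add: e'_def)
  have "\<forall>\<^sub>F m in sequentially. (\<integral>\<^sup>+x\<in>K. ennreal (norm (c m x - c0 x)) \<partial>lebesgue) <= ennreal e'"
   using c(3) K e' by (intro ennreal_tendsto_0D) (auto simp: sconv_def)
  then obtain N where N: "!!m. m >= N ==> (\<integral>\<^sup>+x\<in>K. ennreal (norm (c m x - c0 x)) \<partial>lebesgue) <= ennreal e'"
   by (auto simp: eventually_sequentially)
  have "norm ((LINT x|lebesgue. psi x *R (s m x *R c m x)) - (LINT x|lebesgue. psi x *R (s m x *R c0 x)) - 0) < e" if m: "m >= N" for m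
  proof -
   let ?h = "%x. psi x *R (s m x *R c m x) - psi x *R (s m x *R c0 x)"
   note I = wtest_integrable[OF psi lis(1)[of m]] wtest_integrable[OF psi lis(2)[of m]]
   have "ennreal (norm (LINT x|lebesgue. ?h x)) <= (\<integral>\<^sup>+x. ennreal (norm (?h x)) \<partial>lebesgue)"
    by (rule norm_integral_le_nn)
   also have "... <= (\<integral>\<^sup>+x. ennreal (P * delta) * (ennreal ((norm (s m x))^2) * indicator K x) + ennreal (P * R) * (ennreal (norm (c m x - c0 x)) * indicator K x) \<partial>lebesgue)"
   proof (rule nn_integral_mono_AE)
    show "AE x in lebesgue. ennreal (norm (?h x)) <= ennreal (P * delta) * (ennreal ((norm (s m x))^2) * indicator K x) + ennreal (P * R) * (ennreal (norm (c m x - c0 x)) * indicator K x)"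
     using B0(2) B1(2)[of m]
    proof eventually_elim
     case (elim x)
     show ?case
     proof (cases "x \<in> K")
      case True
      let ?r = "norm (c m x - c0 x)" and ?s = "norm (s m x)"
      have r: "?r <= B0 + B1" using elim True norm_triangle_ineq4[of "c m x" "c0 x"] by simp
      have "0 <= (delta * ?s - ?r)^2" by simp
      then have "delta * (?s * ?r) * 2 <= (delta * ?s)^2 + ?r^2" by (simp add: power2_diff mult_ac)
      moreover have "0 <= delta * (?s * ?r)" using delta by simp
      ultimately have "delta * (?s * ?r) <= (delta * ?s)^2 + ?r * ?r" unfolding power2_eq_square by linarith
      also have "... <= (delta * ?s)^2 + (B0 + B1) * ?r" by (intro add_left_mono mult_right_mono r) simp
      also have "B0 + B1 = delta * R" using delta by (simp add: R_def)
      also have "(delta * ?s)^2 + delta * R * ?r = delta * (delta * ?s^2 + R * ?r)" by (simp add: power2_eq_square algebra_simps)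
      finally have sr: "?s * ?r <= delta * ?s^2 + R * ?r" using delta by simp
      have "norm (?h x) = \<bar>psi x\<bar> * (?s * ?r)" by (simp add: abs_mult flip: scaleR_diff_right)
      also have "... <= P * (delta * ?s^2 + R * ?r)" using P[of x] P0 sr by (intro mult_mono) auto
      also have "... = P * delta * ?s^2 + P * R * ?r" by (simp add: algebra_simps)
      finally have "ennreal (norm (?h x)) <= ennreal (P * delta * ?s^2 + P * R * ?r)" by (rule ennreal_leI)
      also have "... = ennreal (P * delta) * ennreal (?s^2) + ennreal (P * R) * ennreal ?r"
       using P0 delta R by (simp add: ennreal_plus ennreal_mult)
      finally show ?thesis using True by simp
     qed (simp add: K(3))
    qed
   qed
   also have "... = ennreal (P * delta) * (\<integral>\<^sup>+x\<in>K. ennreal ((norm (s m x))^2) \<partial>lebesgue) + ennreal (P * R) * (\<integral>\<^sup>+x\<in>K. ennreal (norm (c m x - c0 x)) \<partial>lebesgue)"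
   proof -
    note [measurable] = measurable_norm_li[OF K(1,2) s(1)[of m]]
    note m2 = measurable_norm_li[OF K(1,2) locally_integrable_diff[OF c(1)[of m] c(2)]]
    have "(%x. (ennreal (norm (s m x)) * indicator K x)^2) \<in> borel_measurable lebesgue" by measurable
    also have "(%x. (ennreal (norm (s m x)) * indicator K x)^2) = (%x. ennreal ((norm (s m x))^2) * indicator K x)"
     by (auto simp: fun_eq_iff ennreal_power split: split_indicator)
    finally have m1: "(%x. ennreal ((norm (s m x))^2) * indicator K x) \<in> borel_measurable lebesgue" .
    show ?thesis
     by (subst nn_integral_add[OF borel_measurable_times_ennreal[OF borel_measurable_const m1] borel_measurable_times_ennreal[OF borel_measurable_const m2]])
      (simp only: nn_integral_cmult[OF m1] nn_integral_cmult[OF m2])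
   qed
   also have "... <= ennreal (P * delta) * ennreal C' + ennreal (P * R) * ennreal e'"
    using C'(2) N[OF m] by (intro add_mono mult_left_mono) auto
   also have "... = ennreal (P * delta * C' + P * R * e')"
    using P0 delta R C' e' by (simp add: ennreal_plus ennreal_mult)
   finally have le: "ennreal (norm (LINT x|lebesgue. ?h x)) <= ennreal (P * delta * C' + P * R * e')" .
   have "0 <= P * delta * C' + P * R * e'"
    using P0 delta R C'(1) e' by (intro add_nonneg_nonneg mult_nonneg_nonneg) auto
   from le[unfolded ennreal_le_iff[OF this]]
   have "norm (LINT x|lebesgue. ?h x) <= P * delta * C' + P * R * e'" .
   also have "... <= e / 3 + e / 3"
   proof (rule add_mono)
    have *: "P * X * (e / (3 * (P + 1) * X)) <= e / 3" if "X > 0" for X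
    proof -
     have "P * X * (e / (3 * Y * X)) = (P / Y) * (e / 3)" if "Y > 0" for Y
      using that \<open>X > 0\<close> by (simp add: field_simps)
     from this[of "P + 1"] have "P * X * (e / (3 * (P + 1) * X)) = (P / (P + 1)) * (e / 3)" using P0 by simp
     also have "... <= 1 * (e / 3)" using P0 e by (intro mult_right_mono) auto
     finally show ?thesis by simp
    qed
    show "P * delta * C' <= e / 3" using *[OF C'(1)] by (simp add: delta_def mult_ac)
    show "P * R * e' <= e / 3" using *[OF R] by (simp add: e'_def)
   qed
   also have "... < e" using e by simp
   finally show ?thesis unfolding Bochner_Integration.integral_diff[OF I] by simp
  qed
  then show "\<exists>no. \<forall>m\<ge>no. norm ((LINT x|lebesgue. psi x *R (s m x *R c m x)) - (LINT x|lebesgue. psi x *R (s m x *R c0 x)) - 0) < e" by blast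
 qed
 from tendsto_add[OF this Y] show "(%m. LINT x|lebesgue. psi x *R (s m x *R c m x)) \<longlonglongrightarrow> (LINT x|lebesgue. psi x *R (s0 x *R c0 x))" by simp
qed

lemma sconv_imp_wconv:
 fixes c :: "nat => real^'n => 'b::euclidean_space"
 assumes c: "!!m. locally_integrable U (c m)" "locally_integrable U c0" "sconv U c c0"
 shows "wconv U c c0"
 unfolding wconv_def
proof (intro allI impI)
 fix psi assume psi: "wtest U psi"
 then obtain P K where P: "!!x. \<bar>psi x\<bar> <= P" and K: "compact K" "K \<subseteq> U" "!!x. x \<notin> K ==> psi x = 0"
  unfolding wtest_def by blast
 have P0: "0 <= P" using P[of undefined] by linarith
 show "(%m. LINT x|lebesgue. psi x *R c m x) \<longlonglongrightarrow> (LINT x|lebesgue. psi x *R c0 x)"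
 proof (rule LIMSEQ_I)
  fix e :: real assume e: "e > 0"
  define e' where "e' = e / (2 * (P + 1))"
  have e': "e' > 0" using e P0 by (simp add: e'_def)
  have X: "X * (e / (2 * X)) = e / 2" if "X > 0" for X using that by simp
  have "P * e' <= (P + 1) * e'" using e' by (intro mult_right_mono) auto
  also have "... = e / 2" unfolding e'_def by (rule X) (use P0 in simp)
  finally have Pe: "P * e' < e" using e by simp
  have "\<forall>\<^sub>F m in sequentially. (\<integral>\<^sup>+x\<in>K. ennreal (norm (c m x - c0 x)) \<partial>lebesgue) <= ennreal e'"
   using c(3) K e' by (intro ennreal_tendsto_0D) (auto simp: sconv_def)
  then obtain N where N: "!!m. m >= N ==> (\<integral>\<^sup>+x\<in>K. ennreal (norm (c m x - c0 x)) \<partial>lebesgue) <= ennreal e'"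
   by (auto simp: eventually_sequentially)
  have "norm ((LINT x|lebesgue. psi x *R c m x) - (LINT x|lebesgue. psi x *R c0 x)) < e" if m: "m >= N" for m
  proof -
   have "(LINT x|lebesgue. psi x *R c m x) - (LINT x|lebesgue. psi x *R c0 x) = (LINT x|lebesgue. psi x *R c m x - psi x *R c0 x)"
    by (rule Bochner_Integration.integral_diff[symmetric, OF wtest_integrable[OF psi c(1)] wtest_integrable[OF psi c(2)]])
   then have "ennreal (norm ((LINT x|lebesgue. psi x *R c m x) - (LINT x|lebesgue. psi x *R c0 x))) \<le>
     (\<integral>\<^sup>+x. ennreal (norm (psi x *R c m x - psi x *R c0 x)) \<partial>lebesgue)"
    by (simp only: norm_integral_le_nn)
   also have "... <= (\<integral>\<^sup>+x. ennreal P * (ennreal (norm (c m x - c0 x)) * indicator K x) \<partial>lebesgue)"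
   proof (rule nn_integral_mono)
    fix x
    have "norm (psi x *R c m x - psi x *R c0 x) <= P * norm (c m x - c0 x)"
     using P[of x] by (simp add: mult_right_mono flip: scaleR_diff_right)
    then show "ennreal (norm (psi x *R c m x - psi x *R c0 x)) <= ennreal P * (ennreal (norm (c m x - c0 x)) * indicator K x)"
     using P0 K(3)[of x] by (cases "x \<in> K") (auto simp: ennreal_leI simp flip: ennreal_mult)
   qed
   also have "... = ennreal P * (\<integral>\<^sup>+x\<in>K. ennreal (norm (c m x - c0 x)) \<partial>lebesgue)"
    by (rule nn_integral_cmult[OF measurable_norm_li[OF K(1,2) locally_integrable_diff[OF c(1,2)]]])
   also have "... <= ennreal P * ennreal e'" using N[OF m] by (rule mult_left_mono) simp
   also have "... = ennreal (P * e')" using P0 e' by (simp add: ennreal_mult)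
   finally have "norm ((LINT x|lebesgue. psi x *R c m x) - (LINT x|lebesgue. psi x *R c0 x)) <= P * e'"
    using P0 e' by simp
   then show ?thesis using Pe by simp
  qed
  then show "\<exists>no. \<forall>m\<ge>no. norm ((LINT x|lebesgue. psi x *R c m x) - (LINT x|lebesgue. psi x *R c0 x)) < e" by blast
 qed
qed

section \<open>Bounded weak convergence in weak Morrey spaces\<close>

lemma mconvD:
 assumes "mconv p U F f"
 shows "!!m. locally_integrable U (F m)" "locally_integrable U f" "wconv U F f" "Morrey_bounded p U F"
 using assms by (auto simp: mconv_def)

lemma Morrey_bounded_dominated:
 fixes F :: "'i => real^'n => 'b::euclidean_space" and G :: "'k => 'i => real^'n => 'c::euclidean_space"
 assumes U: "open U" and p: "p >= 1" and I: "finite I" "I ~= {}"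
  and li: "!!k m. k \<in> I ==> locally_integrable U (G k m)"
  and G: "!!k. k \<in> I ==> Morrey_bounded p U (G k)"
  and dom: "!!K. compact K ==> K \<subseteq> U ==> \<exists>L. \<forall>m. AE x in lebesgue. x \<in> K --> norm (F m x) <= L * (\<Sum>k\<in>I. norm (G k m x))"
 shows "Morrey_bounded p U F"
 unfolding Morrey_bounded_def
proof (intro allI impI)
 fix V assume V: "open_compactly_in V U"
 note V' = open_compactly_in_lmeasurable[OF V]
 have "\<forall>k\<in>I. \<exists>C. \<forall>m. Morrey_bound p (real CARD('n) - p) V (G k m) C" using G V unfolding Morrey_bounded_def by blast
 from bchoice[OF this] obtain C where C: "!!k m. k \<in> I ==> Morrey_bound p (real CARD('n) - p) V (G k m) (C k)" by blast
 have C2: "Morrey_bound p (real CARD('n) - p) V (G k m) (Max (C ` I))" if "k \<in> I" for k m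
  using that I p by (intro Morrey_bound_mono[OF C]) auto
 obtain L where L: "!!m. AE x in lebesgue. x \<in> closure V --> norm (F m x) <= L * (\<Sum>k\<in>I. norm (G k m x))"
  using dom[OF V'(5,6)] by blast
 have "AE x in lebesgue. x \<in> V --> norm (F m x) <= max L 1 * (\<Sum>k\<in>I. norm (G k m x))" for m
  using L[of m]
 proof eventually_elim
  case (elim x)
  have "L * (\<Sum>k\<in>I. norm (G k m x)) <= max L 1 * (\<Sum>k\<in>I. norm (G k m x))" by (intro mult_right_mono sum_nonneg) auto
  then show ?case using elim closure_subset[of V] by (auto intro: order_trans)
 qed
 then have "Morrey_bound p (real CARD('n) - p) V (F m) (max L 1 * real (card I)^2 * Max (C ` I))" for m
  using locally_integrable_measurable_on[OF U li open_compactly_in_subset[OF V] V'(4)] C2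
  by (intro Morrey_bound_dominated[OF I _ p _ _ V'(1), where g = "%k. G k m"]) auto
 then show "\<exists>C. \<forall>m. Morrey_bound p (real CARD('n) - p) V (F m) C" by blast
qed

lemma Morrey_bounded_locally_bounded:
 fixes F :: "'i => real^'n => 'b::euclidean_space"
 assumes p: "p >= 1" and F: "locally_bounded U F"
 shows "Morrey_bounded p U F"
 unfolding Morrey_bounded_def
proof (intro allI impI)
 fix V assume V: "open_compactly_in V U"
 note V' = open_compactly_in_lmeasurable[OF V]
 obtain B where B: "B > 0" "!!m. AE x in lebesgue. x \<in> closure V --> norm (F m x) <= B"
  using locally_boundedD[OF F V'(5,6)] by metis
 have le: "AE x in lebesgue. x \<in> V --> norm (F m x) <= B" for m
  using B(2)[of m] closure_subset[of V] by (auto elim!: eventually_mono)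
 show "\<exists>C. \<forall>m. Morrey_bound p (real CARD('n) - p) V (F m) C"
  using Morrey_bound_bounded[OF p V'(1,2) less_imp_le[OF B(1)] le] by blast
qed

lemma mconv_cong:
 assumes U: "open U" and p: "p >= 1"
  and ae: "!!m. AE x in lebesgue. x \<in> U --> F m x = G m x" "AE x in lebesgue. x \<in> U --> f x = g x"
  and c: "mconv p U F f"
 shows "mconv p U G g"
 unfolding mconv_def
proof (intro conjI allI)
 note D = mconvD[OF c]
 show "locally_integrable U (G m)" for m by (rule locally_integrable_cong[OF ae(1) D(1)])
 show "locally_integrable U g" by (rule locally_integrable_cong[OF ae(2) D(2)])
 show "wconv U G g" by (rule wconv_cong[OF ae D(1-3)])
 show "Morrey_bounded p U G"
 proof (rule Morrey_bounded_dominated[OF U p, of "{()}" "%_. F"])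
  fix K assume K: "compact K" "K \<subseteq> U"
  have "AE x in lebesgue. x \<in> K --> norm (G m x) <= 1 * (\<Sum>k\<in>{()}. norm (F m x))" for m
   using ae(1)[of m] by eventually_elim (use K in auto)
  then show "\<exists>L. \<forall>m. AE x in lebesgue. x \<in> K --> norm (G m x) <= L * (\<Sum>k\<in>{()}. norm (F m x))" by blast
 qed (use D in auto)
qed

lemma mconv_subseq:
 assumes "strict_mono r" "mconv p U F f"
 shows "mconv p U (%m. F (r m)) f"
 using assms wconv_subseq[OF assms(1)] unfolding mconv_def Morrey_bounded_def by blast

lemma mconv_linear:
 fixes T :: "'b::euclidean_space => 'c::euclidean_space"
 assumes U: "open U" and p: "p >= 1" and T: "bounded_linear T" and c: "mconv p U F f"
 shows "mconv p U (%m x. T (F m x)) (%x. T (f x))"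
 unfolding mconv_def
proof (intro conjI allI)
 note D = mconvD[OF c]
 show "locally_integrable U (%x. T (F m x))" for m by (rule locally_integrable_linear[OF T D(1)])
 show "locally_integrable U (%x. T (f x))" by (rule locally_integrable_linear[OF T D(2)])
 show "wconv U (%m x. T (F m x)) (%x. T (f x))" by (rule wconv_linear[OF T D(1-3)])
 obtain L where L: "!!y. norm (T y) <= norm y * L" using bounded_linear.bounded[OF T] by blast
 show "Morrey_bounded p U (%m x. T (F m x))"
  by (rule Morrey_bounded_dominated[OF U p, of "{()}" "%_. F"])
   (use D L in \<open>auto simp: mult.commute intro!: exI[of _ L]\<close>)
qed

lemma mconv_sum:
 fixes F :: "'k => nat => real^'n => 'b::euclidean_space"
 assumes U: "open U" and p: "p >= 1" and I: "finite I" "I ~= {}" and c: "!!k. k \<in> I ==> mconv p U (F k) (f k)"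
 shows "mconv p U (%m x. \<Sum>k\<in>I. F k m x) (%x. \<Sum>k\<in>I. f k x)"
 unfolding mconv_def
proof (intro conjI allI)
 note D = mconvD[OF c]
 have li: "locally_integrable U (%x. \<Sum>k\<in>I. g k x)" if "!!k. k \<in> I ==> locally_integrable U (g k)" for g :: "'k => real^'n => 'b"
  using that unfolding locally_integrable_def set_integrable_def by (auto simp: scaleR_sum_right intro!: Bochner_Integration.integrable_sum)
 show "locally_integrable U (%x. \<Sum>k\<in>I. F k m x)" for m by (rule li) (rule D)
 show "locally_integrable U (%x. \<Sum>k\<in>I. f k x)" by (rule li) (rule D)
 show "wconv U (%m x. \<Sum>k\<in>I. F k m x) (%x. \<Sum>k\<in>I. f k x)"
  unfolding wconv_def
 proof (intro allI impI)
  fix psi assume psi: "wtest U psi"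
  have eq: "(LINT x|lebesgue. psi x *R (\<Sum>k\<in>I. g k x)) = (\<Sum>k\<in>I. LINT x|lebesgue. psi x *R g k x)"
   if "!!k. k \<in> I ==> locally_integrable U (g k)" for g :: "'k => real^'n => 'b"
   unfolding scaleR_sum_right using wtest_integrable[OF psi that] by (intro Bochner_Integration.integral_sum)
  show "(%m. LINT x|lebesgue. psi x *R (\<Sum>k\<in>I. F k m x)) \<longlonglongrightarrow> (LINT x|lebesgue. psi x *R (\<Sum>k\<in>I. f k x))"
  proof -
   have "(LINT x|lebesgue. psi x *R (\<Sum>k\<in>I. F k m x)) = (\<Sum>k\<in>I. LINT x|lebesgue. psi x *R F k m x)" for m
    by (rule eq) (rule D)
   moreover have "(LINT x|lebesgue. psi x *R (\<Sum>k\<in>I. f k x)) = (\<Sum>k\<in>I. LINT x|lebesgue. psi x *R f k x)"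
    by (rule eq) (rule D)
   ultimately show ?thesis by (simp only:) (intro tendsto_sum wconvD[OF D(3) psi])
  qed
 qed
 show "Morrey_bounded p U (%m x. \<Sum>k\<in>I. F k m x)"
  by (rule Morrey_bounded_dominated[OF U p I, of F]) (use D in \<open>auto intro!: exI[of _ 1] norm_sum\<close>)
qed

lemma mconv_product:
 fixes c :: "nat => real^'n => 'b::euclidean_space"
 assumes U: "open U" and p: "p > 2" and s: "mconv p U s s0"
  and c: "!!m. locally_integrable U (c m)" "locally_integrable U c0" "sconv U c c0"
   "locally_bounded U c" "locally_bounded U (%_::unit. c0)"
 shows "mconv p U (%m x. s m x *R c m x) (%x. s0 x *R c0 x)"
 unfolding mconv_def
proof (intro conjI allI)
 note D = mconvD[OF s]
 have "locally_bounded U (%_::unit. c m)" for m using c(4) unfolding locally_bounded_def by blast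
 then show "locally_integrable U (%x. s m x *R c m x)" for m by (intro locally_integrable_product D c)
 show "locally_integrable U (%x. s0 x *R c0 x)" by (intro locally_integrable_product D c)
 show "wconv U (%m x. s m x *R c m x) (%x. s0 x *R c0 x)"
  by (rule wconv_product[OF D(1-3) Morrey_bounded_imp_L2[OF U p D(1,4)] c])
 show "Morrey_bounded p U (%m x. s m x *R c m x)"
 proof (rule Morrey_bounded_dominated[OF U _, of p "{()}" "%_. s"])
  fix K assume K: "compact K" "K \<subseteq> U"
  obtain B where B: "B > 0" "!!m. AE x in lebesgue. x \<in> K --> norm (c m x) <= B" using locally_boundedD[OF c(4) K] by metis
  have "AE x in lebesgue. x \<in> K --> norm (s m x *R c m x) <= B * (\<Sum>k\<in>{()}. norm (s m x))" for m
   using B(2)[of m]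
  proof eventually_elim
   case (elim x)
   then show ?case using mult_right_mono[of "norm (c m x)" B "\<bar>s m x\<bar>"] by (auto simp: mult.commute)
  qed
  then show "\<exists>L. \<forall>m. AE x in lebesgue. x \<in> K --> norm (s m x *R c m x) <= L * (\<Sum>k\<in>{()}. norm (s m x))" by blast
 qed (use D p in auto)
qed

lemma mconv_bounded:
 fixes c :: "nat => real^'n => 'b::euclidean_space"
 assumes p: "p >= 1" and c: "!!m. locally_integrable U (c m)" "locally_integrable U c0" "sconv U c c0" "locally_bounded U c"
 shows "mconv p U c c0"
 unfolding mconv_def using c sconv_imp_wconv[OF c(1-3)] Morrey_bounded_locally_bounded[OF p c(4)] by auto

text \<open>Expanding \<open>z\<close> in a basis turns the application of a varying linear map into
  a finite sum of products, each of a weakly convergent scalar component of \<open>z\<close> and a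
  bounded, strongly convergent vector \<open>T m x b\<close>.\<close>

lemma mconv_apply:
 fixes z :: "nat => real^'n => 'b::euclidean_space" and T :: "nat => real^'n => 'b => 'c::euclidean_space"
 assumes U: "open U" and p: "p > 2" and z: "mconv p U z z0"
  and T: "!!b m. b \<in> Basis ==> locally_integrable U (%x. T m x b)" "!!b. b \<in> Basis ==> locally_integrable U (%x. T0 x b)"
   "!!b. b \<in> Basis ==> sconv U (%m x. T m x b) (%x. T0 x b)"
   "!!b. b \<in> Basis ==> locally_bounded U (%m x. T m x b)" "!!b. b \<in> Basis ==> locally_bounded U (%(_::unit) x. T0 x b)"
  and lin: "!!m. AE x in lebesgue. x \<in> U --> linear (T m x)" "AE x in lebesgue. x \<in> U --> linear (T0 x)"
 shows "mconv p U (%m x. T m x (z m x)) (%x. T0 x (z0 x))"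
proof -
 have p1: "p >= 1" using p by simp
 have exp: "(\<Sum>b\<in>Basis. (y \<bullet> b) *R L b) = L y" if "linear L" for L :: "'b => 'c" and y
 proof -
  interpret linear L by fact
  have "L y = L (\<Sum>b\<in>Basis. (y \<bullet> b) *R b)" by (simp add: euclidean_representation)
  then show ?thesis by (simp add: sum scale)
 qed
 have "mconv p U (%m x. \<Sum>b\<in>Basis. (z m x \<bullet> b) *R T m x b) (%x. \<Sum>b\<in>Basis. (z0 x \<bullet> b) *R T0 x b)"
  by (intro mconv_sum[OF U p1] mconv_product[OF U p] mconv_linear[OF U p1 bounded_linear_inner_left z] T) auto
 then show ?thesis
 proof (rule mconv_cong[OF U p1, rotated -1])
  show "AE x in lebesgue. x \<in> U --> (\<Sum>b\<in>Basis. (z m x \<bullet> b) *R T m x b) = T m x (z m x)" for m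
   using lin(1)[of m] by (rule eventually_mono) (simp add: exp)
  show "AE x in lebesgue. x \<in> U --> (\<Sum>b\<in>Basis. (z0 x \<bullet> b) *R T0 x b) = T0 x (z0 x)"
   using lin(2) by (rule eventually_mono) (simp add: exp)
 qed
qed

lemma mconv_limit_L2:
 assumes "open U" "p > 2" "mconv p U F f"
 shows "L2_bounded U (%_::unit. f)"
proof (rule Morrey_bounded_imp_L2[OF assms(1,2)])
 note D = mconvD[OF assms(3)]
 show "locally_integrable U f" by (rule D)
 show "Morrey_bounded p U (%_::unit. f)"
  unfolding Morrey_bounded_def
 proof (intro allI impI)
  fix V assume V: "open_compactly_in V U"
  then obtain C where C: "!!m. Morrey_bound p (real CARD('a) - p) V (F m) C" using D(4) unfolding Morrey_bounded_def by blast
  show "\<exists>C. \<forall>m::unit. Morrey_bound p (real CARD('a) - p) V f C"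
   using Morrey_bound_limit[OF assms(1) V D(1-3) C] assms(2) by auto
 qed
qed

section \<open>Passage to weak convergence in the weak Morrey-Sobolev spaces\<close>

lemma measurable_lebesgue_on_cong:
 fixes f :: "real^'n => 'b::euclidean_space"
 assumes "AE x in lebesgue. x \<in> V --> f x = g x" "f \<in> borel_measurable (lebesgue_on V)" "V \<in> sets lebesgue"
 shows "g \<in> borel_measurable (lebesgue_on V)"
proof -
 have "(%x. indicator V x *R f x) \<in> borel_measurable lebesgue"
  using assms(2,3) by (subst (asm) borel_measurable_restrict_space_iff) auto
 moreover have "AE x in lebesgue. indicator V x *R f x = indicator V x *R g x"
  using assms(1) by eventually_elim (auto simp: indicator_def)
 ultimately have "(%x. indicator V x *R g x) \<in> borel_measurable lebesgue" by (rule borel_measurable_AE)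
 then show ?thesis using assms(3) by (subst borel_measurable_restrict_space_iff) auto
qed

lemma weak_conv_Morrey_cong:
 fixes F :: "nat => real^'n => 'b::euclidean_space"
 assumes V: "open V" "bounded V" and p: "p >= 1"
  and ae: "!!m. AE x in lebesgue. x \<in> V --> F m x = G m x" "AE x in lebesgue. x \<in> V --> f x = g x"
  and c: "weak_conv_Morrey p la V F f"
 shows "weak_conv_Morrey p la V G g"
proof -
 have Vs: "V \<in> sets lebesgue" using V(1) by auto
 have bd: "Morrey_bound p la V b (C + 1)"
  if "AE x in lebesgue. x \<in> V --> a x = b x" "a \<in> borel_measurable (lebesgue_on V)" "weak_Morrey_norm p la V a <= ennreal C" "C >= 0"
  for a b :: "real^'n => 'b" and C
 proof -
  have "Morrey_bound p la V b (1 * real (card {()})^2 * (C + 1))"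
   by (rule Morrey_bound_dominated[OF _ _ _ p _ _ V(1), where g = "%_. a"])
    (use that Morrey_bound_of_norm[OF that(3)] p in \<open>auto elim!: eventually_mono\<close>)
  then show ?thesis by simp
 qed
 have mem: "b \<in> weak_Morrey p la V" if "AE x in lebesgue. x \<in> V --> a x = b x" "a \<in> weak_Morrey p la V" for a b :: "real^'n => 'b"
 proof -
  have a: "a \<in> borel_measurable (lebesgue_on V)" "weak_Morrey_norm p la V a < \<infinity>" using that(2) by (auto simp: weak_Morrey_def)
  then obtain C where "weak_Morrey_norm p la V a = ennreal C" "C >= 0" by (cases "weak_Morrey_norm p la V a") auto
  then show ?thesis using weak_MorreyI[OF V bd[OF that(1) a(1)] measurable_lebesgue_on_cong[OF that(1) a(1) Vs]] by auto
 qed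
 have int: "(LINT x:V|lebesgue. phi x *R a x) = (LINT x:V|lebesgue. phi x *R b x)"
  if "AE x in lebesgue. x \<in> V --> a x = b x" "a \<in> weak_Morrey p la V" "phi \<in> Lorentz_dual p V" for a b :: "real^'n => 'b" and phi
 proof -
  have m: "a \<in> borel_measurable (lebesgue_on V)" "phi \<in> borel_measurable (lebesgue_on V)"
   using that by (auto simp: weak_Morrey_def Lorentz_dual_def)
  then have 1: "(%x. indicator V x *R phi x *R a x) \<in> borel_measurable lebesgue"
   using Vs by (subst borel_measurable_restrict_space_iff[symmetric]) auto
  have 2: "AE x in lebesgue. indicator V x *R phi x *R a x = indicator V x *R phi x *R b x"
   using that(1) by eventually_elim (auto simp: indicator_def)
  show ?thesis
   unfolding set_lebesgue_integral_def by (rule integral_cong_AE[OF 1 borel_measurable_AE[OF 1 2] 2])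
 qed
 note c' = c[unfolded weak_conv_Morrey_def]
 obtain C where C: "!!m. weak_Morrey_norm p la V (F m) <= ennreal C" using c' by blast
 have Fm: "F m \<in> weak_Morrey p la V" "f \<in> weak_Morrey p la V" for m using c' by auto
 have "weak_Morrey_norm p la V (G m) <= ennreal (max C 0 + 1)" for m
  by (rule weak_Morrey_norm_le[OF bd[OF ae(1)]])
   (use Fm order_trans[OF C ennreal_leI[of C "max C 0"]] in \<open>auto simp: weak_Morrey_def\<close>)
 then have "\<exists>C. \<forall>m. weak_Morrey_norm p la V (G m) <= ennreal C" by blast
 then show ?thesis
  unfolding weak_conv_Morrey_def
  using mem[OF ae(1) Fm(1)] mem[OF ae(2) Fm(2)] c' int[OF ae(1) Fm(1)] int[OF ae(2) Fm(2)] by auto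
qed

text \<open>Only order zero calls for an argument: functions equal almost everywhere on
  \<open>V\<close> have literally the same \<open>weak_partial V\<close>.\<close>

lemma weak_conv_cong:
 fixes F :: "nat => real^'n => 'b::euclidean_space"
 assumes V: "open V" "bounded V" and p: "p >= 1"
  and ae: "!!m. AE x in lebesgue. x \<in> V --> F m x = G m x" "AE x in lebesgue. x \<in> V --> f x = g x"
  and c: "weak_conv p la l V F f"
 shows "weak_conv p la l V G g"
 using c weak_conv_Morrey_cong[OF assms(1-5)] weak_partial_cong[OF ae(1)] weak_partial_cong[OF ae(2)]
 by (cases l) auto

lemma mconv_weak_conv_loc:
 fixes F :: "nat => real^'n => 'b::euclidean_space"
 assumes U: "open U" and p: "p > 1" and c: "mconv p U F f"
 shows "weak_conv_loc p (real CARD('n) - p) 0 U F f"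
 unfolding weak_conv_loc_def
proof (intro allI impI)
 fix V assume V: "open_compactly_in V U"
 note D = mconvD[OF c]
 obtain C where C: "!!m. Morrey_bound p (real CARD('n) - p) V (F m) C" using D(4) V unfolding Morrey_bounded_def by blast
 show "weak_conv p (real CARD('n) - p) 0 V F f" using weak_conv_MorreyI[OF U V D(1-3) C p] by simp
qed

text \<open>The derivatives are known on \<open>U\<close>, whereas \<open>weak_conv\<close> on
  \<open>V\<close> speaks of \<open>weak_partial V\<close>. By uniqueness both agree almost
  everywhere on \<open>V\<close>.\<close>

lemma mconv_weak_conv_loc_Suc:
 fixes F :: "nat => real^'n => 'b::euclidean_space"
 assumes U: "open U" and p: "p > 1" and c: "mconv p U F f"
  and wp: "!!i m. has_weak_partial U i (F m) (G i m)" "!!i. has_weak_partial U i f (g i)"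
  and G: "!!i. weak_conv_loc p (real CARD('n) - p) l U (G i) (g i)"
 shows "weak_conv_loc p (real CARD('n) - p) (Suc l) U F f"
 unfolding weak_conv_loc_def
proof (intro allI impI)
 fix V assume V: "open_compactly_in V U"
 note V' = open_compactly_in_lmeasurable[OF V] and VU = open_compactly_in_subset[OF V]
 have wpV: "has_weak_partial V i (F m) (G i m)" "has_weak_partial V i f (g i)" for i m
  using wp has_weak_partial_mono[OF VU] by blast+
 have 0: "weak_conv_Morrey p (real CARD('n) - p) V F f"
  using mconv_weak_conv_loc[OF U p c] V by (simp add: weak_conv_loc_def)
 have "weak_conv p (real CARD('n) - p) l V (%m. weak_partial V i (F m)) (weak_partial V i f)" for i
 proof (rule weak_conv_cong[OF V'(1,2)])
  show "AE x in lebesgue. x \<in> V --> G i m x = weak_partial V i (F m) x" for m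
   by (rule AE_imp_sym[OF weak_partial_AE[OF V'(1) wpV(1)]])
  show "AE x in lebesgue. x \<in> V --> g i x = weak_partial V i f x"
   by (rule AE_imp_sym[OF weak_partial_AE[OF V'(1) wpV(2)]])
  show "weak_conv p (real CARD('n) - p) l V (G i) (g i)" using G V by (simp add: weak_conv_loc_def)
 qed (use p in simp)
 then show "weak_conv p (real CARD('n) - p) (Suc l) V F f"
  using 0 wpV unfolding weak_conv.simps weakly_differentiable_def by blast
qed

section \<open>The normal projection\<close>

text \<open>A Jacobian has the direction of differentiation as its outer index: \<open>A $ i\<close>
  is the image of the i-th coordinate vector.\<close>

definition differential :: "real^'m^'n => real^'n => real^'m" where
 "differential A h = (\<Sum>i\<in>UNIV. (h $ i) *R (A $ i))"

lemma linear_differential: "linear (differential A)"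
 by (rule linearI) (auto simp: differential_def scaleR_add_left sum.distrib scaleR_sum_right)

lemma differential_axis: "differential A (axis i 1) = A $ i"
proof -
 have "(\<Sum>j\<in>UNIV. (axis i 1 $ j) *R (A $ j)) = (\<Sum>j\<in>UNIV. if j = i then A $ i else 0)"
  by (rule sum.cong) (auto simp: axis_def)
 then show ?thesis by (simp add: differential_def)
qed

lemma differential_inner: "differential A h \<bullet> y = (\<Sum>i\<in>UNIV. (h $ i) * (A $ i \<bullet> y))"
 by (simp add: differential_def inner_sum_left)

lemma orthogonal_comp_differential:
 "y \<in> orthogonal_comp (range (differential A)) \<longleftrightarrow> (\<forall>i. A $ i \<bullet> y = 0)"
proof
 assume y: "y \<in> orthogonal_comp (range (differential A))"
 show "\<forall>i. A $ i \<bullet> y = 0"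
 proof
  fix i
  have "A $ i \<in> range (differential A)" using differential_axis[of A i] by (metis rangeI)
  then show "A $ i \<bullet> y = 0" using y by (auto simp: orthogonal_comp_def orthogonal_def)
 qed
qed (auto simp: orthogonal_comp_def orthogonal_def differential_inner)

text \<open>The reciprocal basis of the tangent space. For an injective differential it could be
  written with the inverse Gram matrix; the description by biorthogonality avoids inverting that
  matrix.\<close>

definition dual_frame :: "real^'m^'n => 'n => real^'m" where
 "dual_frame A i = (SOME e. e \<in> range (differential A) & (\<forall>j. e \<bullet> A $ j = (if i = j then 1 else 0)))"

text \<open>For an injective differential this is the orthogonal projection onto the normal space.
  As a formula it is linear in \<open>v\<close> for every \<open>A\<close>, in contrast to
  \<open>orth_proj\<close>, which is defined by \<open>THE\<close>.\<close>

definition nproj :: "real^'m^'n => real^'m => real^'m" where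
 "nproj A v = v - (\<Sum>i\<in>UNIV. (dual_frame A i \<bullet> v) *R (A $ i))"

lemma linear_nproj: "linear (nproj A)"
 by (rule linearI) (auto simp: nproj_def inner_add_right scaleR_add_left sum.distrib scaleR_sum_right algebra_simps)

text \<open>Bilinear in \<open>v\<close> and \<open>H\<close>, with two base points. For H = A - B
  it is exactly the difference of the projections at \<open>A\<close> and \<open>B\<close>; for A =
  B it serves as the derivative of the projection in direction \<open>H\<close>. Remainder estimates
  thereby become differences of values of this one expression.\<close>

definition nproj_bilinear :: "real^'m => real^'m^'n => real^'m^'n => real^'m^'n => real^'m" where
 "nproj_bilinear v A B H = - (\<Sum>i\<in>UNIV. (dual_frame B i \<bullet> v) *R nproj A (H $ i))
  - (\<Sum>i\<in>UNIV. (H $ i \<bullet> nproj B v) *R dual_frame A i)"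

definition nproj_deriv :: "real^'m => real^'m^'n => real^'m^'n => real^'m" where
 "nproj_deriv v A H = nproj_bilinear v A A H"

lemma linear_nproj_deriv: "linear (nproj_deriv v A)"
 using linear_nproj[of A]
 by (intro linearI) (auto simp: nproj_deriv_def nproj_bilinear_def linear_add linear_scale inner_add_left
   scaleR_add_right scaleR_add_left sum.distrib scaleR_sum_right mult_ac algebra_simps)

lemma norm_minus_minus: "norm (- a - b) <= norm a + norm (b :: 'a::real_normed_vector)"
 using norm_triangle_ineq4[of "- a" b] by simp

context
 fixes c :: real assumes c: "c > 0"
begin

text \<open>Quantitative injectivity: the smallest singular value of the differential is at least
  \<open>c\<close>. Unlike injectivity itself, this is a closed condition and passes to
  limits.\<close>

definition nondeg :: "real^'m^'n => bool" where
 "nondeg A \<longleftrightarrow> (\<forall>h. c * norm h <= norm (differential A h))"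

lemma range_orthogonal_zero:
 assumes "w \<in> range (differential A)" "!!k. A $ k \<bullet> w = 0"
 shows "w = 0"
proof -
 obtain h where "w = differential A h" using assms(1) by blast
 then have "w \<bullet> w = (\<Sum>i\<in>UNIV. h $ i * (A $ i \<bullet> w))" using differential_inner[of A h w] by simp
 then show ?thesis using assms(2) by simp
qed

text \<open>A vector of the range that is orthogonal to all \<open>A $ k\<close> vanishes, so the
  Gram map \<open>?T\<close> is injective and hence surjective. A preimage of the i-th coordinate
  vector gives the i-th dual vector.\<close>

lemma dual_frame:
 fixes A :: "real^'m^'n"
 assumes "nondeg A"
 shows "dual_frame A i \<in> range (differential A)" "dual_frame A i \<bullet> A $ j = (if i = j then 1 else 0)"
proof -
 let ?T = "%h. (\<chi> j. A $ j \<bullet> differential A h) :: real^'n"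
 have "linear ?T" using linear_differential[of A]
  by (intro linearI) (auto simp: vec_eq_iff linear_add linear_scale inner_add_right)
 moreover have "inj ?T"
  unfolding linear_injective_0[OF \<open>linear ?T\<close>]
 proof (intro allI impI)
  fix h assume "?T h = 0"
  then have "!!k. A $ k \<bullet> differential A h = 0" by (simp add: vec_eq_iff)
  then have "differential A h = 0" by (intro range_orthogonal_zero) auto
  then have "c * norm h <= 0" using assms by (metis nondeg_def norm_zero)
  then show "h = 0" using c by (simp add: mult_le_0_iff)
 qed
 ultimately have "surj ?T" by (rule linear_injective_imp_surjective) (rule refl)
 then have "axis i 1 \<in> range ?T" by simp
 then obtain h where "axis i 1 = ?T h" by (rule imageE)
 note h = this[symmetric]
 have "differential A h \<bullet> A $ j = (if i = j then 1 else 0)" for j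
  using arg_cong[OF h, of "%x. x $ j"] by (auto simp: axis_def inner_commute)
 then have "\<exists>e. e \<in> range (differential A) & (\<forall>j. e \<bullet> A $ j = (if i = j then 1 else 0))" by blast
 from someI_ex[OF this] show "dual_frame A i \<in> range (differential A)" "dual_frame A i \<bullet> A $ j = (if i = j then 1 else 0)"
  unfolding dual_frame_def by auto
qed

text \<open>Writing the dual vector e as the image of h, biorthogonality gives |e|^2 = h_i <= |h|,
  and nondegeneracy gives c |h| <= |e|.\<close>

lemma dual_frame_norm: "nondeg A ==> norm (dual_frame A i) <= 1 / c"
proof -
 assume A: "nondeg A"
 obtain h where h: "dual_frame A i = differential A h" using dual_frame(1)[OF A] by blast
 let ?e = "dual_frame A i"
 have "?e \<bullet> ?e = (\<Sum>j\<in>UNIV. h $ j * (if i = j then 1 else 0))"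
  using differential_inner[of A h ?e] dual_frame(2)[OF A, of i] by (simp add: h[symmetric] inner_commute)
 also have "... = h $ i" by (simp add: if_distrib cong: if_cong)
 finally have "norm ?e * norm ?e = h $ i" by (simp add: dot_square_norm power2_eq_square)
 also have "... <= norm h" using component_le_norm_cart[of h i] by simp
 finally have "c * (norm ?e * norm ?e) <= norm ?e"
  using A c unfolding nondeg_def h by (meson mult_left_mono less_imp_le order_trans)
 then have "(c * norm ?e) * norm ?e <= 1 * norm ?e" by (simp add: mult.assoc)
 then have "norm ?e = 0 \<or> c * norm ?e <= 1" by (metis mult_right_le_imp_le norm_ge_zero order_le_less)
 then show ?thesis using c by (auto simp: pos_le_divide_eq mult.commute)
qed

lemma frame_expand:
 assumes A: "nondeg A"
 shows "w \<in> range (differential A) ==> w = (\<Sum>i\<in>UNIV. (A $ i \<bullet> w) *R dual_frame A i)"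
proof -
 assume w: "w \<in> range (differential A)"
 have sub: "subspace (range (differential A))" using linear_differential linear_subspace_image subspace_UNIV by blast
 have "w - (\<Sum>i\<in>UNIV. (A $ i \<bullet> w) *R dual_frame A i) \<in> range (differential A)"
  by (intro subspace_diff[OF sub] subspace_sum[OF sub] subspace_scale[OF sub] w dual_frame(1)[OF A])
 moreover have "A $ k \<bullet> (w - (\<Sum>i\<in>UNIV. (A $ i \<bullet> w) *R dual_frame A i)) = 0" for k
 proof -
  have "A $ k \<bullet> (\<Sum>i\<in>UNIV. (A $ i \<bullet> w) *R dual_frame A i) = (\<Sum>i\<in>UNIV. (A $ i \<bullet> w) * (if i = k then 1 else 0))"
   by (simp add: inner_sum_right dual_frame(2)[OF A] inner_commute[of "A $ k"])
  then show ?thesis by (simp add: inner_diff_right if_distrib cong: if_cong)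
 qed
 ultimately show ?thesis using range_orthogonal_zero by fastforce
qed

lemma frame_in_range: "A $ j \<in> range (differential A)"
 using differential_axis[of A j] by (metis rangeI)

lemma nproj_orthogonal:
 assumes A: "nondeg A"
 shows "A $ j \<bullet> nproj A v = 0"
proof -
 have "v \<bullet> A $ j = v \<bullet> (\<Sum>i\<in>UNIV. (A $ i \<bullet> A $ j) *R dual_frame A i)"
  using frame_expand[OF A frame_in_range[of A j]] by simp
 then have "v \<bullet> A $ j = (\<Sum>i\<in>UNIV. (A $ i \<bullet> A $ j) * (dual_frame A i \<bullet> v))"
  by (simp add: inner_sum_right inner_commute[of v])
 then show ?thesis
  by (simp add: nproj_def inner_diff_right inner_sum_right inner_commute mult.commute)
qed

text \<open>For the uniqueness behind \<open>THE\<close>: the difference of two candidates lies both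
  in the normal space and in its orthogonal complement.\<close>

lemma orth_proj_eq_nproj:
 assumes A: "nondeg A"
 shows "orth_proj (orthogonal_comp (range (differential A))) v = nproj A v"
 unfolding orth_proj_def
proof (rule the_equality)
 let ?S = "orthogonal_comp (range (differential A))"
 have 1: "nproj A v \<in> ?S" using nproj_orthogonal[OF A] by (simp add: orthogonal_comp_differential)
 have 2: "v - nproj A v \<in> orthogonal_comp ?S"
  unfolding orthogonal_comp_def[of ?S]
 proof (intro CollectI ballI)
  fix y assume "y \<in> ?S"
  then have "!!i. y \<bullet> A $ i = 0" by (simp add: orthogonal_comp_differential inner_commute)
  then show "orthogonal y (v - nproj A v)" by (simp add: orthogonal_def nproj_def inner_sum_right)
 qed
 show "nproj A v \<in> ?S & v - nproj A v \<in> orthogonal_comp ?S" using 1 2 by blast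
 fix w assume w: "w \<in> ?S & v - w \<in> orthogonal_comp ?S"
 have "w - nproj A v = (v - nproj A v) - (v - w)" by simp
 then have "w - nproj A v \<in> orthogonal_comp ?S" using 2 w by (metis subspace_diff subspace_orthogonal_comp)
 moreover have "w - nproj A v \<in> ?S" using 1 w by (simp add: subspace_diff subspace_orthogonal_comp)
 ultimately have "(w - nproj A v) \<bullet> (w - nproj A v) = 0"
  unfolding orthogonal_comp_def[of ?S] orthogonal_def by blast
 then show "w = nproj A v" by simp
qed

lemma nproj_norm:
 assumes A: "nondeg A"
 shows "norm (nproj A v) <= norm v"
proof -
 have "nproj A v \<bullet> nproj A v = v \<bullet> nproj A v"
  using nproj_orthogonal[OF A] unfolding nproj_def[of A v] by (simp add: inner_diff_left inner_sum_left nproj_def)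
 also have "... <= norm v * norm (nproj A v)" by (rule norm_cauchy_schwarz)
 finally have "norm (nproj A v) * norm (nproj A v) <= norm v * norm (nproj A v)" by (simp add: dot_square_norm power2_eq_square)
 then show ?thesis by (metis mult_right_le_imp_le norm_ge_zero order_le_less)
qed

lemma nproj_frame: "nondeg A ==> nproj A (A $ j) = 0"
 by (simp add: nproj_def dual_frame(2) if_distrib[of "%x. x *R _"] cong: if_cong)

lemma nproj_range_zero: "nondeg A ==> w \<in> range (differential A) ==> nproj A w = 0"
 using linear_nproj[of A] nproj_frame[of A] by (auto simp: differential_def linear_sum linear_scale)

lemma tangential_part:
 assumes A: "nondeg A"
 shows "v - nproj A v = (\<Sum>i\<in>UNIV. (A $ i \<bullet> v) *R dual_frame A i)"
proof -
 have sub: "subspace (range (differential A))" using linear_differential linear_subspace_image subspace_UNIV by blast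
 have "v - nproj A v \<in> range (differential A)"
  by (simp add: nproj_def) (intro subspace_sum[OF sub] subspace_scale[OF sub] frame_in_range)
 from frame_expand[OF A this] show ?thesis by (simp add: inner_diff_right nproj_orthogonal[OF A])
qed

text \<open>With P for the projections, P_A - P_B = P_A (1 - P_B) - (1 - P_A) P_B. In the first term
  the tangential part at B is a combination of the B_i, and P_A B_i = - P_A (A - B)_i because P_A
  kills A_i. In the second, the tangential coefficients at A of P_B v are the inner products with
  A_i, where A_i may be replaced by (A - B)_i because P_B v is orthogonal to B_i.\<close>

lemma nproj_difference:
 assumes A: "nondeg A" and B: "nondeg B"
 shows "nproj A v - nproj B v = nproj_bilinear v A B (A - B)"
proof -
 have "nproj A (v - nproj B v) = (\<Sum>i\<in>UNIV. (dual_frame B i \<bullet> v) *R nproj A (B $ i))"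
  using linear_nproj[of A] by (simp add: nproj_def[of B] linear_sum linear_scale)
 also have "... = - (\<Sum>i\<in>UNIV. (dual_frame B i \<bullet> v) *R nproj A ((A - B) $ i))"
  using linear_nproj[of A] nproj_frame[OF A] by (simp add: linear_diff sum_negf)
 finally have 1: "nproj A v - nproj A (nproj B v) = - (\<Sum>i\<in>UNIV. (dual_frame B i \<bullet> v) *R nproj A ((A - B) $ i))"
  using linear_nproj[of A] by (simp add: linear_diff)
 have 2: "- (nproj B v - nproj A (nproj B v)) = - (\<Sum>i\<in>UNIV. ((A - B) $ i \<bullet> nproj B v) *R dual_frame A i)"
  unfolding tangential_part[OF A, of "nproj B v"] using nproj_orthogonal[OF B, of _ v]
  by (simp add: inner_diff_left)
 show ?thesis using arg_cong2[OF 1 2, of "(+)"] by (simp add: nproj_bilinear_def)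
qed

lemma sum_norm_bound:
 fixes f :: "'n::finite => 'c::real_normed_vector"
 assumes "!!i. norm (f i) <= K"
 shows "norm (\<Sum>i\<in>UNIV. f i) <= real CARD('n) * K"
 using sum_norm_le[of UNIV f "%_. K"] assms by simp

lemma nproj_bilinear_norm:
 fixes A B H :: "real^'m^'n"
 assumes A: "nondeg A" and B: "nondeg B"
 shows "norm (nproj_bilinear v A B H) <= 2 * real CARD('n) / c * norm v * norm H"
proof -
 have 1: "norm ((dual_frame B i \<bullet> v) *R nproj A (H $ i)) <= 1 / c * norm v * norm H" for i
 proof -
  have "\<bar>dual_frame B i \<bullet> v\<bar> <= 1 / c * norm v"
   using Cauchy_Schwarz_ineq2[of "dual_frame B i" v] mult_right_mono[OF dual_frame_norm[OF B, of i] norm_ge_zero[of v]] by linarith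
  moreover have "norm (nproj A (H $ i)) <= norm H"
   using nproj_norm[OF A, of "H $ i"] Finite_Cartesian_Product.norm_nth_le[of H i] by linarith
  ultimately show ?thesis unfolding norm_scaleR using c by (intro mult_mono) auto
 qed
 have 2: "norm ((H $ i \<bullet> nproj B v) *R dual_frame A i) <= 1 / c * norm v * norm H" for i
 proof -
  have "\<bar>H $ i \<bullet> nproj B v\<bar> <= norm H * norm v"
   using Cauchy_Schwarz_ineq2[of "H $ i" "nproj B v"] mult_mono[OF Finite_Cartesian_Product.norm_nth_le[of H i] nproj_norm[OF B, of v]] by (auto intro: order_trans)
  then have "norm ((H $ i \<bullet> nproj B v) *R dual_frame A i) <= (norm H * norm v) * (1 / c)"
   unfolding norm_scaleR using dual_frame_norm[OF A, of i] c by (intro mult_mono) auto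
  then show ?thesis by (simp add: mult_ac)
 qed
 have "norm (nproj_bilinear v A B H) <= norm (\<Sum>i\<in>UNIV. (dual_frame B i \<bullet> v) *R nproj A (H $ i)) + norm (\<Sum>i\<in>UNIV. (H $ i \<bullet> nproj B v) *R dual_frame A i)"
  unfolding nproj_bilinear_def by (rule norm_minus_minus)
 also have "... <= real CARD('n) * (1 / c * norm v * norm H) + real CARD('n) * (1 / c * norm v * norm H)"
  using 1 2 by (intro add_mono sum_norm_bound) auto
 finally show ?thesis by (simp add: mult_ac)
qed

lemma nproj_Lipschitz:
 fixes A B :: "real^'m^'n"
 assumes "nondeg A" "nondeg B"
 shows "norm (nproj A v - nproj B v) <= 2 * real CARD('n) / c * norm v * norm (A - B)"
 unfolding nproj_difference[OF assms] by (rule nproj_bilinear_norm[OF assms])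

text \<open>The difference of the dual vectors a and b is split at B. Its normal part is a
  difference of projections of a, giving 2 n / c^2. Its tangential coefficients reduce to inner
  products of (A - B)_j with a, since a and b have the same products with their own frames, giving n
  / c^2.\<close>

lemma dual_frame_Lipschitz:
 fixes A B :: "real^'m^'n"
 assumes A: "nondeg A" and B: "nondeg B"
 shows "norm (dual_frame A i - dual_frame B i) <= 3 * real CARD('n) / c^2 * norm (A - B)"
proof -
 let ?a = "dual_frame A i" and ?b = "dual_frame B i"
 have zero: "nproj A ?a = 0" "nproj B ?b = 0" using nproj_range_zero dual_frame(1) A B by blast+
 have "?a - ?b = nproj B (?a - ?b) + (\<Sum>j\<in>UNIV. (B $ j \<bullet> (?a - ?b)) *R dual_frame B j)"
  using tangential_part[OF B, of "?a - ?b"] by (simp add: algebra_simps)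
 also have "nproj B (?a - ?b) = - (nproj A ?a - nproj B ?a)"
  using linear_nproj[of B] zero by (simp add: linear_diff)
 also have "(\<Sum>j\<in>UNIV. (B $ j \<bullet> (?a - ?b)) *R dual_frame B j) = - (\<Sum>j\<in>UNIV. ((A - B) $ j \<bullet> ?a) *R dual_frame B j)"
  using dual_frame(2)[OF A, of i] dual_frame(2)[OF B, of i]
  by (simp add: inner_diff_left inner_diff_right inner_commute sum_negf[symmetric] scaleR_minus_left[symmetric] del: scaleR_minus_left)
 finally have "norm (?a - ?b) <= norm (nproj A ?a - nproj B ?a) + norm (\<Sum>j\<in>UNIV. ((A - B) $ j \<bullet> ?a) *R dual_frame B j)"
  using norm_minus_minus by (simp only: add_uminus_conv_diff)
 also have "... <= 2 * real CARD('n) / c * (1 / c) * norm (A - B) + real CARD('n) * (norm (A - B) * (1 / c) * (1 / c))"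
 proof (rule add_mono)
  have "2 * real CARD('n) / c * norm ?a <= 2 * real CARD('n) / c * (1 / c)"
   using dual_frame_norm[OF A, of i] c by (intro mult_left_mono) auto
  then show "norm (nproj A ?a - nproj B ?a) <= 2 * real CARD('n) / c * (1 / c) * norm (A - B)"
   by (intro order_trans[OF nproj_Lipschitz[OF A B]] mult_right_mono) auto
  show "norm (\<Sum>j\<in>UNIV. ((A - B) $ j \<bullet> ?a) *R dual_frame B j) <= real CARD('n) * (norm (A - B) * (1 / c) * (1 / c))"
  proof (rule sum_norm_bound)
   fix j
   have "\<bar>(A - B) $ j \<bullet> ?a\<bar> <= norm (A - B) * (1 / c)"
    using Cauchy_Schwarz_ineq2[of "(A - B) $ j" ?a] mult_mono[OF Finite_Cartesian_Product.norm_nth_le[of "A - B" j] dual_frame_norm[OF A, of i]] by auto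
   then show "norm (((A - B) $ j \<bullet> ?a) *R dual_frame B j) <= norm (A - B) * (1 / c) * (1 / c)"
    unfolding norm_scaleR using dual_frame_norm[OF B, of j] c by (intro mult_mono) auto
  qed
 qed
 also have "... = 3 * real CARD('n) / c^2 * norm (A - B)" by (simp add: power2_eq_square field_simps)
 finally show ?thesis .
qed

lemma product_difference:
 "norm (a *R x - b *R y) <= \<bar>a - b\<bar> * norm x + \<bar>b\<bar> * norm (x - (y :: 'c::real_normed_vector))"
proof -
 have "a *R x - b *R y = (a - b) *R x + b *R (x - y)" by (simp add: algebra_simps)
 then show ?thesis using norm_triangle_ineq[of "(a - b) *R x" "b *R (x - y)"] by simp
qed

text \<open>Each summand is a product of bounded factors, one varying through the dual frame (3 n /
  c^2) and one through the projection (2 n / c, paired with a factor 1 / c). The product rule gives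
  5 n / c^2 per summand, and two sums of n terms give 10 n^2 / c^2.\<close>

lemma nproj_bilinear_Lipschitz:
 fixes A B A' B' H :: "real^'m^'n"
 assumes A: "nondeg A" and B: "nondeg B" and A': "nondeg A'" and B': "nondeg B'"
  and d: "norm (A - A') <= d" "norm (B - B') <= d"
 shows "norm (nproj_bilinear v A B H - nproj_bilinear v A' B' H) <= 10 * (real CARD('n))^2 / c^2 * norm v * d * norm H"
proof -
 let ?n = "real CARD('n)"
 have d0: "0 <= d" using d(1) norm_ge_zero order_trans by blast
 have LN: "norm (nproj X w - nproj X' w) <= 2 * ?n / c * norm w * d" if "nondeg X" "nondeg X'" "norm (X - X') <= d" for X X' :: "real^'m^'n" and w
  using nproj_Lipschitz[OF that(1,2), of w] mult_left_mono[OF that(3), of "2 * ?n / c * norm w"] c by simp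
 have LE: "norm (dual_frame X i - dual_frame X' i) <= 3 * ?n / c^2 * d" if "nondeg X" "nondeg X'" "norm (X - X') <= d" for X X' :: "real^'m^'n" and i
  using dual_frame_Lipschitz[OF that(1,2), of i] mult_left_mono[OF that(3), of "3 * ?n / c^2"] c by simp
 define K where "K = 5 * ?n / c^2 * norm v * d * norm H"
 have 1: "norm ((dual_frame B i \<bullet> v) *R nproj A (H $ i) - (dual_frame B' i \<bullet> v) *R nproj A' (H $ i)) <= K" for i
 proof -
  have a: "\<bar>dual_frame B i \<bullet> v - dual_frame B' i \<bullet> v\<bar> <= 3 * ?n / c^2 * d * norm v"
   using Cauchy_Schwarz_ineq2[of "dual_frame B i - dual_frame B' i" v] mult_right_mono[OF LE[OF B B' d(2), of i] norm_ge_zero[of v]]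
   by (simp add: inner_diff_left)
  have b: "\<bar>dual_frame B' i \<bullet> v\<bar> <= 1 / c * norm v"
   using Cauchy_Schwarz_ineq2[of "dual_frame B' i" v] mult_right_mono[OF dual_frame_norm[OF B', of i] norm_ge_zero[of v]] by linarith
  have x: "norm (nproj A (H $ i)) <= norm H" using nproj_norm[OF A, of "H $ i"] Finite_Cartesian_Product.norm_nth_le[of H i] by linarith
  have y: "norm (nproj A (H $ i) - nproj A' (H $ i)) <= 2 * ?n / c * norm H * d"
  proof -
   have "2 * ?n / c * norm (H $ i) * d <= 2 * ?n / c * norm H * d"
    using c d0 Finite_Cartesian_Product.norm_nth_le[of H i] by (intro mult_right_mono mult_left_mono) auto
   then show ?thesis using LN[OF A A' d(1), of "H $ i"] by linarith
  qed
  have "norm ((dual_frame B i \<bullet> v) *R nproj A (H $ i) - (dual_frame B' i \<bullet> v) *R nproj A' (H $ i)) \<le>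
    3 * ?n / c^2 * d * norm v * norm H + 1 / c * norm v * (2 * ?n / c * norm H * d)"
   using c d0 by (intro order_trans[OF product_difference] add_mono mult_mono a b x y) auto
  also have "... = K" using c by (simp add: K_def power2_eq_square field_simps)
  finally show ?thesis .
 qed
 have 2: "norm ((H $ i \<bullet> nproj B v) *R dual_frame A i - (H $ i \<bullet> nproj B' v) *R dual_frame A' i) <= K" for i
 proof -
  have a: "\<bar>H $ i \<bullet> nproj B v - H $ i \<bullet> nproj B' v\<bar> <= norm H * (2 * ?n / c * norm v * d)"
   using Cauchy_Schwarz_ineq2[of "H $ i" "nproj B v - nproj B' v"] mult_mono[OF Finite_Cartesian_Product.norm_nth_le[of H i] LN[OF B B' d(2), of v]]
   by (simp add: inner_diff_right)
  have b: "\<bar>H $ i \<bullet> nproj B' v\<bar> <= norm H * norm v"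
   using Cauchy_Schwarz_ineq2[of "H $ i" "nproj B' v"] mult_mono[OF Finite_Cartesian_Product.norm_nth_le[of H i] nproj_norm[OF B', of v]] by (auto intro: order_trans)
  have "norm ((H $ i \<bullet> nproj B v) *R dual_frame A i - (H $ i \<bullet> nproj B' v) *R dual_frame A' i) \<le>
    norm H * (2 * ?n / c * norm v * d) * (1 / c) + norm H * norm v * (3 * ?n / c^2 * d)"
   using c d0 by (intro order_trans[OF product_difference] add_mono mult_mono a b dual_frame_norm[OF A] LE[OF A A' d(1)]) auto
  also have "... = K" using c by (simp add: K_def power2_eq_square field_simps)
  finally show ?thesis .
 qed
 have "nproj_bilinear v A B H - nproj_bilinear v A' B' H =
   - (\<Sum>i\<in>UNIV. (dual_frame B i \<bullet> v) *R nproj A (H $ i) - (dual_frame B' i \<bullet> v) *R nproj A' (H $ i))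
   - (\<Sum>i\<in>UNIV. (H $ i \<bullet> nproj B v) *R dual_frame A i - (H $ i \<bullet> nproj B' v) *R dual_frame A' i)"
  by (simp add: nproj_bilinear_def sum_subtractf)
 then have "norm (nproj_bilinear v A B H - nproj_bilinear v A' B' H) \<le>
   norm (\<Sum>i\<in>UNIV. (dual_frame B i \<bullet> v) *R nproj A (H $ i) - (dual_frame B' i \<bullet> v) *R nproj A' (H $ i)) +
   norm (\<Sum>i\<in>UNIV. (H $ i \<bullet> nproj B v) *R dual_frame A i - (H $ i \<bullet> nproj B' v) *R dual_frame A' i)"
  using norm_minus_minus by (simp only:)
 also have "... <= ?n * K + ?n * K" using 1 2 by (intro add_mono sum_norm_bound) auto
 also have "... = 10 * ?n^2 / c^2 * norm v * d * norm H" by (simp add: K_def power2_eq_square)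
 finally show ?thesis .
qed

lemma closed_nondeg_ball: "closed {A :: real^'m^'n. nondeg A & norm A <= R}"
proof -
 have "{A :: real^'m^'n. nondeg A & norm A <= R} = {A. \<forall>h. c * norm h <= norm (differential A h)} \<inter> {A. norm A <= R}"
  by (auto simp: nondeg_def)
 moreover have "closed {A :: real^'m^'n. \<forall>h. c * norm h <= norm (differential A h)}"
  unfolding differential_def by (intro closed_Collect_all closed_Collect_le continuous_intros)
 moreover have "closed {A :: real^'m^'n. norm A <= R}" by (intro closed_Collect_le continuous_intros)
 ultimately show ?thesis by auto
qed

text \<open>Both estimates are instances of \<open>nproj_bilinear_Lipschitz\<close>: the remainder
  compares the base points (A, B) and (B, B), the variation of the derivative compares (A, A) and
  (B, B).\<close>

lemma C11_nproj:
 assumes "{A :: real^'m^'n. nondeg A & norm A <= R} ~= {}"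
 shows "C11_on {A :: real^'m^'n. nondeg A & norm A <= R} (%A. nproj A v) (nproj_deriv v) R
  (2 * real CARD('n) / c * norm v) (10 * (real CARD('n))^2 / c^2 * norm v)"
proof (rule C11_on.intro)
 fix A B H :: "real^'m^'n" assume AB: "A \<in> {A. nondeg A & norm A <= R}" "B \<in> {A. nondeg A & norm A <= R}"
 then have A: "nondeg A" and B: "nondeg B" by auto
 have "nproj A v - nproj B v - nproj_deriv v B (A - B) = nproj_bilinear v A B (A - B) - nproj_bilinear v B B (A - B)"
  by (simp add: nproj_difference[OF A B] nproj_deriv_def)
 then show "norm (nproj A v - nproj B v - nproj_deriv v B (A - B)) <= 10 * (real CARD('n))^2 / c^2 * norm v * (norm (A - B))\<^sup>2"
  using nproj_bilinear_Lipschitz[OF A B B B, of "norm (A - B)" v "A - B"] by (simp add: power2_eq_square mult_ac)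
 show "norm (nproj_deriv v A H - nproj_deriv v B H) <= 10 * (real CARD('n))^2 / c^2 * norm v * norm (A - B) * norm H"
  unfolding nproj_deriv_def by (rule nproj_bilinear_Lipschitz[OF A A B B]) auto
qed (use assms c closed_nondeg_ball linear_nproj_deriv nproj_bilinear_norm in \<open>auto simp: nproj_deriv_def\<close>)

end

section \<open>The Gram matrix as a function of the Jacobian\<close>

definition gram :: "real^'m^'n => real^'n^'n" where
 "gram A = (\<chi> i j. A $ i \<bullet> A $ j)"

definition gram_deriv :: "real^'m^'n => real^'m^'n => real^'n^'n" where
 "gram_deriv A H = (\<chi> i j. H $ i \<bullet> A $ j + A $ i \<bullet> H $ j)"

lemma matrix_norm_le:
 fixes X :: "real^'n^'n"
 assumes "!!i j. \<bar>X $ i $ j\<bar> <= K"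
 shows "norm X <= (real CARD('n))^2 * K"
proof -
 have "norm X <= (\<Sum>i\<in>UNIV. norm (X $ i))" unfolding norm_vec_def[of X] by (intro L2_set_le_sum) auto
 also have "... <= (\<Sum>i\<in>(UNIV :: 'n set). real CARD('n) * K)"
 proof (rule sum_mono)
  fix i
  have "norm (X $ i) <= (\<Sum>j\<in>UNIV. \<bar>X $ i $ j\<bar>)" by (rule norm_le_l1_cart)
  also have "... <= (\<Sum>j\<in>(UNIV :: 'n set). K)" using assms by (intro sum_mono)
  finally show "norm (X $ i) <= real CARD('n) * K" by simp
 qed
 finally show ?thesis by (simp add: power2_eq_square mult.assoc)
qed

lemma inner_nth_le: "\<bar>(A :: real^'m^'n) $ i \<bullet> (B :: real^'m^'n) $ j\<bar> <= norm A * norm B"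
 using Cauchy_Schwarz_ineq2[of "A $ i" "B $ j"] mult_mono[OF Finite_Cartesian_Product.norm_nth_le[of A i] Finite_Cartesian_Product.norm_nth_le[of B j]] by (auto intro: order_trans)

text \<open>\<open>gram\<close> is quadratic, so its remainder is exactly the Gram matrix of A - B.
  The 2 in the common constant is dictated by the variation of the derivative.\<close>

lemma C11_gram:
 assumes S: "closed S" "S ~= {}" "!!A. A \<in> S ==> norm (A :: real^'m^'n) <= R"
 shows "C11_on S gram gram_deriv R ((real CARD('n))^2 * (2 * R)) ((real CARD('n))^2 * 2)"
proof (rule C11_on.intro)
 have R0: "0 <= R" using S(2,3) norm_ge_zero order_trans by blast
 then show "0 <= (real CARD('n))^2 * (2 * R)" by simp
 fix A B H :: "real^'m^'n"
 show "linear (gram_deriv A)"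
  by (intro linearI) (auto simp: gram_deriv_def vec_eq_iff inner_add_left inner_add_right algebra_simps)
 assume A: "A \<in> S"
 have "norm (gram_deriv A H) <= (real CARD('n))^2 * (2 * R * norm H)"
 proof (rule matrix_norm_le)
  fix i j
  have "gram_deriv A H $ i $ j = H $ i \<bullet> A $ j + A $ i \<bullet> H $ j" by (simp add: gram_deriv_def)
  then have "\<bar>gram_deriv A H $ i $ j\<bar> <= norm H * norm A + norm A * norm H"
   by (simp only:) (intro order_trans[OF abs_triangle_ineq] add_mono inner_nth_le)
  also have "... = 2 * norm A * norm H" by simp
  also have "... <= 2 * R * norm H" using S(3)[OF A] by (intro mult_right_mono) auto
  finally show "\<bar>gram_deriv A H $ i $ j\<bar> <= 2 * R * norm H" .
 qed
 then show "norm (gram_deriv A H) <= (real CARD('n))^2 * (2 * R) * norm H" by (simp add: mult.assoc)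
 assume B: "B \<in> S"
 have "norm (gram A - gram B - gram_deriv B (A - B)) <= (real CARD('n))^2 * (2 * (norm (A - B))^2)"
 proof (rule matrix_norm_le)
  fix i j
  have "(gram A - gram B - gram_deriv B (A - B)) $ i $ j = (A - B) $ i \<bullet> (A - B) $ j"
   by (simp add: gram_def gram_deriv_def inner_diff_left inner_diff_right)
  then have "\<bar>(gram A - gram B - gram_deriv B (A - B)) $ i $ j\<bar> <= (norm (A - B))^2"
   using inner_nth_le[of "A - B" i "A - B" j] by (simp only: power2_eq_square)
  then show "\<bar>(gram A - gram B - gram_deriv B (A - B)) $ i $ j\<bar> <= 2 * (norm (A - B))^2"
   using zero_le_power2[of "norm (A - B)"] by linarith
 qed
 then show "norm (gram A - gram B - gram_deriv B (A - B)) <= (real CARD('n))^2 * 2 * (norm (A - B))\<^sup>2" by (simp add: mult.assoc)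
 have "norm (gram_deriv A H - gram_deriv B H) <= (real CARD('n))^2 * (2 * norm (A - B) * norm H)"
 proof (rule matrix_norm_le)
  fix i j
  have "(gram_deriv A H - gram_deriv B H) $ i $ j = H $ i \<bullet> (A - B) $ j + (A - B) $ i \<bullet> H $ j"
   by (simp add: gram_deriv_def inner_diff_left inner_diff_right)
  then have "\<bar>(gram_deriv A H - gram_deriv B H) $ i $ j\<bar> <= norm H * norm (A - B) + norm (A - B) * norm H"
   by (simp only:) (intro order_trans[OF abs_triangle_ineq] add_mono inner_nth_le)
  then show "\<bar>(gram_deriv A H - gram_deriv B H) $ i $ j\<bar> <= 2 * norm (A - B) * norm H" by (simp add: mult_ac)
 qed
 then show "norm (gram_deriv A H - gram_deriv B H) <= (real CARD('n))^2 * 2 * norm (A - B) * norm H" by (simp add: mult.assoc)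
qed (use S in auto)

section \<open>Eigenvalue bounds\<close>

text \<open>A parabola that is zero at the origin and nowhere negative has slope zero there;
  otherwise t = - a / d, with d positive and larger than b, would give a negative value.\<close>

lemma linear_coefficient_zero:
 fixes a b :: real
 assumes "!!t. 0 <= 2 * t * a + t^2 * b"
 shows "a = 0"
proof (rule ccontr)
 assume "a ~= 0"
 define d where "d = \<bar>b\<bar> + 1"
 have d: "d > 0" "b < d" by (auto simp: d_def)
 have "2 * (- a / d) * a + (- a / d)^2 * b = (a^2 / d) * (b / d - 2)"
  using d by (simp add: power2_eq_square field_simps)
 moreover have "b / d < 2" using d by (simp add: divide_less_eq)
 then have "(a^2 / d) * (b / d - 2) < 0" using \<open>a ~= 0\<close> d by (intro mult_pos_neg) auto
 ultimately show False using assms[of "- a / d"] by simp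
qed

text \<open>The first variation of the Rayleigh quotient vanishes at an extremum. The sign
  \<open>s\<close> treats the minimum (1) and the maximum (-1) together.\<close>

lemma extremal_eigenvalue:
 fixes A :: "real^'m^'n"
 assumes s: "s ~= 0" and ext: "!!h. 0 <= s * ((norm (differential A h))^2 - mu * (norm h)^2)"
  and h0: "(norm (differential A h0))^2 = mu * (norm h0)^2" "h0 ~= 0"
 shows "mu \<in> eigenvalues (gram A)"
proof -
 let ?d = "differential A"
 have dadd: "?d (h0 + t *R w) = ?d h0 + t *R ?d w" for t w
  using linear_differential[of A] by (simp add: linear_add linear_scale)
 have "?d h0 \<bullet> ?d w = mu * (h0 \<bullet> w)" for w
 proof -
  have "s * (?d h0 \<bullet> ?d w - mu * (h0 \<bullet> w)) = 0"
  proof (rule linear_coefficient_zero)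
   fix t :: real
   have "s * ((norm (?d (h0 + t *R w)))^2 - mu * (norm (h0 + t *R w))^2) =
     s * ((norm (?d h0))^2 - mu * (norm h0)^2) + (2 * t * (s * (?d h0 \<bullet> ?d w - mu * (h0 \<bullet> w))) +
      t^2 * (s * ((norm (?d w))^2 - mu * (norm w)^2)))"
    unfolding dadd power2_norm_eq_inner
    by (simp add: inner_add_left inner_add_right inner_commute[of w h0] inner_commute[of "?d w" "?d h0"] power2_eq_square algebra_simps)
   then show "0 <= 2 * t * (s * (?d h0 \<bullet> ?d w - mu * (h0 \<bullet> w))) + t^2 * (s * ((norm (?d w))^2 - mu * (norm w)^2))"
    using ext[of "h0 + t *R w"] h0(1) by simp
  qed
  then show ?thesis using s by simp
 qed
 from this[of "axis i 1" for i] have "?d h0 \<bullet> A $ i = mu * h0 $ i" for i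
  by (simp add: differential_axis inner_axis)
 moreover have "(gram A *v h0) $ i = ?d h0 \<bullet> A $ i" for i
  by (simp add: gram_def matrix_vector_mult_def differential_inner inner_commute[of "A $ i"] mult.commute)
 ultimately have "gram A *v h0 = mu *R h0" by (simp add: vec_eq_iff)
 then show ?thesis using h0(2) by (auto simp: eigenvalues_def)
qed

text \<open>The minimum and the maximum of the squared length of the differential on the unit sphere
  are eigenvalues of the Gram matrix, so the hypothesis bounds them. The norm bound adds up the n
  entries \<open>A $ i\<close>, each of norm at most sqrt C.\<close>

lemma eigenvalue_bounds:
 fixes A :: "real^'m^'n"
 assumes c: "0 < c" "c <= C" and ev: "!!mu. mu \<in> eigenvalues (gram A) ==> c <= mu & mu <= C"
 shows "nondeg (sqrt c) A" "norm A <= real CARD('n) * sqrt C"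
proof -
 let ?d = "differential A"
 have cont: "continuous_on (sphere 0 1) (%h. (norm (?d h))^2)"
  unfolding differential_def by (intro continuous_intros)
 have ne: "sphere (0 :: real^'n) 1 ~= {}"
 proof -
  have "axis undefined 1 \<in> sphere (0 :: real^'n) 1" by simp
  then show ?thesis by blast
 qed
 have scale: "(norm (?d h))^2 = (norm h)^2 * (norm (?d ((1 / norm h) *R h)))^2" "(1 / norm h) *R h \<in> sphere 0 1" if "h ~= 0" for h
  using that linear_differential[of A] by (auto simp: linear_scale power_mult_distrib power_divide)
 have zero: "?d 0 = 0" using linear_differential by (rule linear_0)
 obtain h0 where h0: "h0 \<in> sphere 0 1" "!!h. h \<in> sphere 0 1 ==> (norm (?d h0))^2 <= (norm (?d h))^2"
  using continuous_attains_inf[OF compact_sphere ne cont] by blast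
 obtain h1 where h1: "h1 \<in> sphere 0 1" "!!h. h \<in> sphere 0 1 ==> (norm (?d h))^2 <= (norm (?d h1))^2"
  using continuous_attains_sup[OF compact_sphere ne cont] by blast
 have lo: "(norm (?d h0))^2 * (norm h)^2 <= (norm (?d h))^2" for h
  using scale[of h] h0(2)[of "(1 / norm h) *R h"] by (cases "h = 0") (auto simp: zero mult.commute intro: mult_left_mono)
 have hi: "(norm (?d h))^2 <= (norm (?d h1))^2 * (norm h)^2" for h
  using scale[of h] h1(2)[of "(1 / norm h) *R h"] by (cases "h = 0") (auto simp: zero mult.commute intro: mult_left_mono)
 have "(norm (?d h0))^2 \<in> eigenvalues (gram A)"
  by (rule extremal_eigenvalue[of 1 _ _ h0]) (use lo h0(1) in auto)
 then have 1: "c <= (norm (?d h0))^2" using ev by blast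
 have "(norm (?d h1))^2 \<in> eigenvalues (gram A)"
  by (rule extremal_eigenvalue[of "-1" _ _ h1]) (use hi h1(1) in auto)
 then have 2: "(norm (?d h1))^2 <= C" using ev by blast
 show "nondeg (sqrt c) A"
  unfolding nondeg_def[OF real_sqrt_gt_zero[OF c(1)]]
 proof
  fix h
  have "c * (norm h)^2 <= (norm (?d h))^2" using lo[of h] mult_right_mono[OF 1, of "(norm h)^2"] by simp
  then have "(sqrt c * norm h)^2 <= (norm (?d h))^2" using c by (simp add: power_mult_distrib)
  then show "sqrt c * norm h <= norm (?d h)" by (rule power2_le_imp_le) simp
 qed
 have "norm (A $ i) <= sqrt C" for i
 proof (rule real_le_rsqrt)
  show "(norm (A $ i))^2 <= C" using order_trans[OF hi[of "axis i 1"]] 2 by (simp add: differential_axis)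
 qed
 moreover have "norm A <= (\<Sum>i\<in>UNIV. norm (A $ i))" unfolding norm_vec_def[of A] by (intro L2_set_le_sum) auto
 ultimately show "norm A <= real CARD('n) * sqrt C"
  using sum_mono[of UNIV "%i. norm (A $ i)" "%_. sqrt C"] by simp
qed

section \<open>Nonlinear functions of weakly convergent sequences\<close>

lemma AE_local:
 assumes U: "open (U :: (real^'n) set)" and P: "!!K. compact K ==> K \<subseteq> U ==> AE x in lebesgue. x \<in> K --> P x"
 shows "AE x in lebesgue. x \<in> U --> P x"
proof -
 obtain V :: "nat => (real^'n) set" where V: "!!n. open_compactly_in (V n) U" "!!n. V n \<subseteq> V (Suc n)" "(\<Union>n. V n) = U"
  "!!K. compact K ==> K \<subseteq> U ==> \<exists>n. K \<subseteq> V n"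
  using open_exhaustion[OF U] by blast
 have "AE x in lebesgue. x \<in> closure (V n) --> P x" for n
  using V(1)[of n] by (intro P) (auto simp: open_compactly_in_def)
 then have "AE x in lebesgue. \<forall>n. x \<in> closure (V n) --> P x" unfolding AE_all_countable by blast
 then show ?thesis
 proof eventually_elim
  fix x assume x: "\<forall>n. x \<in> closure (V n) --> P x"
  show "x \<in> U --> P x"
  proof
   assume "x \<in> U"
   then obtain n where "x \<in> V n" using V(3) by blast
   then have "x \<in> closure (V n)" using closure_subset by blast
   then show "P x" using x by blast
  qed
 qed
qed

lemma locally_integrable_compose:
 fixes u :: "real^'n => 'a::euclidean_space" and f :: "'a => 'c::euclidean_space"
 assumes u: "locally_integrable U u"
  and loc: "!!K. compact K ==> K \<subseteq> U ==> \<exists>S B. (%a. indicator S a *R f a) \<in> borel_measurable borel \<and>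
   (\<forall>a\<in>S. norm (f a) <= B) & (AE x in lebesgue. x \<in> K --> u x \<in> S)"
 shows "locally_integrable U (%x. f (u x))"
 unfolding locally_integrable_def set_integrable_def
proof (intro allI impI)
 fix K assume K: "compact K & K \<subseteq> U"
 then obtain S B where S[measurable]: "(%a. indicator S a *R f a) \<in> borel_measurable borel"
  and B: "!!a. a \<in> S ==> norm (f a) <= B" and uS: "AE x in lebesgue. x \<in> K --> u x \<in> S"
  using loc[of K] by blast
 note [measurable] = compact_lebesgue(1)[of K]
 have Ks: "K \<in> sets lebesgue" using K compact_lebesgue(1) by blast
 let ?w = "%x. indicator K x *R u x"
 have [measurable]: "?w \<in> borel_measurable lebesgue" using K u by (intro indicator_measurable_li) auto
 have "(%x. (indicator S (?w x) *R f (?w x))) \<in> borel_measurable lebesgue"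
  by (rule measurable_compose[OF _ S]) measurable
 then have "(%x. indicator K x *R (indicator S (?w x) *R f (?w x))) \<in> borel_measurable lebesgue"
  by (rule borel_measurable_scaleR[OF borel_measurable_indicator[OF Ks]])
 moreover have "AE x in lebesgue. indicator K x *R (indicator S (?w x) *R f (?w x)) = indicator K x *R f (u x)"
  using uS by eventually_elim (auto simp: indicator_def)
 ultimately have meas: "(%x. indicator K x *R f (u x)) \<in> borel_measurable lebesgue" by (rule borel_measurable_AE)
 show "integrable lebesgue (%x. indicator K x *R f (u x))"
 proof (rule integrableI_bounded_set[of K _ _ B])
  show "emeasure lebesgue K < \<infinity>" using K compact_lebesgue(3)[of K] by simp
  show "AE x in lebesgue. x \<in> K --> norm (indicator K x *R f (u x)) <= B"
   using uS by eventually_elim (auto simp: B)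
 qed (use Ks meas in auto)
qed

lemma finite_mconv_subsequence:
 fixes F :: "'k => nat => real^'n => 'b::euclidean_space"
 assumes U: "open U" and p: "p > 2" and I: "finite I"
  and F: "!!k m. k \<in> I ==> locally_integrable U (F k m)" "!!k. k \<in> I ==> Morrey_bounded p U (F k)"
 shows "\<exists>r f. strict_mono r & (\<forall>k\<in>I. mconv p U (%m. F k (r m)) (f k))"
 using I F
proof (induction I rule: finite_induct)
 case empty
 have "strict_mono (%n::nat. n)" by (simp add: strict_mono_def)
 then show ?case by blast
next
 case (insert k I)
 then obtain r f where r: "strict_mono r" and f: "!!j. j \<in> I ==> mconv p U (%m. F j (r m)) (f j)" by blast
 have li: "locally_integrable U (F k (r m))" for m using insert.prems(1) by blast
 have Mb: "Morrey_bounded p U (%m. F k (r m))" using insert.prems(2)[of k] unfolding Morrey_bounded_def by blast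
 have "\<exists>C. \<forall>m. (\<integral>\<^sup>+x\<in>V. ennreal ((norm (F k (r m) x))^2) \<partial>lebesgue) <= ennreal C" if V: "open_compactly_in V U" for V
 proof -
  note V' = open_compactly_in_lmeasurable[OF V]
  obtain C where C: "!!m. (\<integral>\<^sup>+x\<in>closure V. ennreal ((norm (F k (r m) x))^2) \<partial>lebesgue) <= ennreal C"
   using Morrey_bounded_imp_L2[OF U p li Mb] V'(5,6) unfolding L2_bounded_def by blast
  have "(\<integral>\<^sup>+x\<in>V. ennreal ((norm (F k (r m) x))^2) \<partial>lebesgue) <= (\<integral>\<^sup>+x\<in>closure V. ennreal ((norm (F k (r m) x))^2) \<partial>lebesgue)" for m
   using closure_subset[of V] by (intro nn_integral_mono) (auto simp: indicator_def)
  then show ?thesis using C order_trans by blast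
 qed
 from weak_compactness[OF U li this] obtain s g where
  s: "strict_mono (s :: nat => nat)" "locally_integrable U g" "wconv U (%m. F k (r (s m))) g" by blast
 have "mconv p U (%m. F k (r (s m))) g"
  unfolding mconv_def using s(2,3) li Mb unfolding Morrey_bounded_def by blast
 then have "\<forall>j\<in>insert k I. mconv p U (%m. F j ((r \<circ> s) m)) ((f(k := g)) j)"
  using mconv_subseq[OF s(1) f] insert.hyps(2) by (auto simp del: fun_upd_apply simp: fun_upd_def)
 moreover have "strict_mono (r \<circ> s)" using r s(1) by (rule strict_mono_o)
 ultimately show ?case by blast
qed

text \<open>Weakly convergent derivatives upgrade weak convergence of the functions to strong
  convergence. It is used for Jacobians, for immersions and for normal frames.\<close>

lemma mconv_Rellich:
 fixes u :: "nat => real^'n => 'b::euclidean_space"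
 assumes U: "open U" and p: "p > 2" and u: "mconv p U u u0" and v: "!!i. mconv p U (v i) (v0 i)"
  and wp: "!!i m. has_weak_partial U i (u m) (v i m)"
 shows "sconv U u u0" "has_weak_partial U i u0 (v0 i)"
proof -
 have L1: "L1_bounded U F" if "mconv p U F f" for F :: "nat => real^'n => 'b" and f
  by (rule L2_bounded_imp_L1[OF mconvD(1)[OF that] Morrey_bounded_imp_L2[OF U p mconvD(1)[OF that] mconvD(4)[OF that]]])
 show wp0: "has_weak_partial U i u0 (v0 i)" for i
  by (rule wconv_has_weak_partial[OF wp mconvD(3)[OF u] mconvD(3)[OF v] mconvD(2)[OF u] mconvD(2)[OF v]])
 show "sconv U u u0" by (rule Rellich[OF U wp wp0 mconvD(3)[OF u] L1[OF u] L1[OF v]])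
qed

text \<open>The set \<open>S\<close> and its constants may depend on the compact set, because the
  eigenvalue bounds are local; so each property is proved on compact or relatively compact pieces.
  The last conclusion applies the strongly convergent, bounded linear maps \<open>D (u m x)\<close>
  to the weakly convergent derivatives.\<close>

lemma chain_convergence:
 fixes u :: "nat => real^'n => 'a::euclidean_space" and Phi :: "'a => 'b::euclidean_space"
 assumes U: "open U" and p: "p > 2" and u: "mconv p U u u0" and v: "!!i. mconv p U (v i) (v0 i)"
  and wp: "!!i m. has_weak_partial U i (u m) (v i m)"
  and C: "!!K. compact K ==> K \<subseteq> U ==>
   \<exists>S R B Q. C11_on S Phi D R B Q & (\<forall>m. AE x in lebesgue. x \<in> K --> u m x \<in> S)"
 shows "sconv U (%m x. Phi (u m x)) (%x. Phi (u0 x))"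
  "!!m. locally_integrable U (%x. Phi (u m x))" "locally_integrable U (%x. Phi (u0 x))"
  "locally_bounded U (%m x. Phi (u m x))" "locally_bounded U (%(_::unit) x. Phi (u0 x))"
  "!!i m. has_weak_partial U i (%x. Phi (u m x)) (%x. D (u m x) (v i m x))"
  "!!i. has_weak_partial U i (%x. Phi (u0 x)) (%x. D (u0 x) (v0 i x))"
  "!!i. mconv p U (%m x. D (u m x) (v i m x)) (%x. D (u0 x) (v0 i x))"
proof -
 note Du = mconvD[OF u] and Dv = mconvD[OF v]
 have su: "sconv U u u0" and wp0: "!!i. has_weak_partial U i u0 (v0 i)" by (rule mconv_Rellich[OF U p u v wp])+
 have C': "\<exists>S R B Q. C11_on S Phi D R B Q & (\<forall>m. AE x in lebesgue. x \<in> K --> u m x \<in> S) \<and>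
   (AE x in lebesgue. x \<in> K --> u0 x \<in> S)" if K: "compact K" "K \<subseteq> U" for K
 proof -
  obtain S R B Q where S: "C11_on S Phi D R B Q" "!!m. AE x in lebesgue. x \<in> K --> u m x \<in> S" using C[OF K] by blast
  have "AE x in lebesgue. x \<in> K --> u0 x \<in> S"
   by (rule sconv_mem_closed[OF su Du(2) U C11_on.closed[OF S(1)] C11_on.nonempty[OF S(1)] S(2) K])
  then show ?thesis using S by blast
 qed
 have wps: "has_weak_partial U i (%x. Phi (w x)) (%x. D (w x) (w' x))"
  if w: "has_weak_partial U i w w'" and L2: "L2_bounded U (%_::unit. w')"
   and wS: "!!K. compact K ==> K \<subseteq> U ==> \<exists>S R B Q. C11_on S Phi D R B Q & (AE x in lebesgue. x \<in> K --> w x \<in> S)" for w w' i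
 proof (rule has_weak_partial_local[OF U])
  fix V assume V: "open_compactly_in V U"
  note V' = open_compactly_in_lmeasurable[OF V] and VU = open_compactly_in_subset[OF V]
  obtain S R B Q where S: "C11_on S Phi D R B Q" "AE x in lebesgue. x \<in> closure V --> w x \<in> S" using wS[OF V'(5,6)] by blast
  show "has_weak_partial V i (%x. Phi (w x)) (%x. D (w x) (w' x))"
  proof (rule C11_on.chain_rule[OF S(1) V'(1) has_weak_partial_mono[OF VU w]])
   show "AE x in lebesgue. x \<in> V --> w x \<in> S" using S(2) closure_subset[of V] by (auto elim: eventually_mono)
   fix K assume "compact K" "K \<subseteq> V"
   then obtain c where "(\<integral>\<^sup>+x\<in>K. ennreal ((norm (w' x))^2) \<partial>lebesgue) <= ennreal c"
    using L2 VU unfolding L2_bounded_def by (meson order_trans)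
   then show "(\<integral>\<^sup>+x\<in>K. ennreal ((norm (w' x))^2) \<partial>lebesgue) < \<infinity>" by (rule le_less_trans) simp
  qed
 qed
 have L2v: "L2_bounded U (%_::unit. v i m)" for i m
  using Morrey_bounded_imp_L2[OF U p Dv(1) Dv(4)[of i]] unfolding L2_bounded_def by blast
 show "has_weak_partial U i (%x. Phi (u m x)) (%x. D (u m x) (v i m x))" for i m
  by (rule wps[OF wp L2v]) (use C in blast)
 show "has_weak_partial U i (%x. Phi (u0 x)) (%x. D (u0 x) (v0 i x))" for i
  by (rule wps[OF wp0 mconv_limit_L2[OF U p v]]) (use C' in blast)
 have liPhi: "locally_integrable U (%x. Phi (w x))" if w: "locally_integrable U w"
   and wS: "!!K. compact K ==> K \<subseteq> U ==> \<exists>S R B Q. C11_on S Phi D R B Q & (AE x in lebesgue. x \<in> K --> w x \<in> S)" for w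
 proof (rule locally_integrable_compose[OF w])
  fix K assume "compact K" "K \<subseteq> U"
  then obtain S R B Q where S: "C11_on S Phi D R B Q" "AE x in lebesgue. x \<in> K --> w x \<in> S" using wS by blast
  show "\<exists>S B. (%a. indicator S a *R Phi a) \<in> borel_measurable borel & (\<forall>a\<in>S. norm (Phi a) <= B) & (AE x in lebesgue. x \<in> K --> w x \<in> S)"
   using C11_on.borel_extensions(1)[OF S(1)] C11_on.Phi_bounded[OF S(1)] S(2) by blast
 qed
 show "locally_integrable U (%x. Phi (u m x))" for m by (rule liPhi[OF Du(1)]) (use C in blast)
 show "locally_integrable U (%x. Phi (u0 x))" by (rule liPhi[OF Du(2)]) (use C' in blast)
 have liD: "locally_integrable U (%x. D (w x) b)" if w: "locally_integrable U w"
   and wS: "!!K. compact K ==> K \<subseteq> U ==> \<exists>S R B Q. C11_on S Phi D R B Q & (AE x in lebesgue. x \<in> K --> w x \<in> S)" for w b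
 proof (rule locally_integrable_compose[OF w])
  fix K assume "compact K" "K \<subseteq> U"
  then obtain S R B Q where S: "C11_on S Phi D R B Q" "AE x in lebesgue. x \<in> K --> w x \<in> S" using wS by blast
  show "\<exists>S B. (%a. indicator S a *R D a b) \<in> borel_measurable borel & (\<forall>a\<in>S. norm (D a b) <= B) & (AE x in lebesgue. x \<in> K --> w x \<in> S)"
   using C11_on.borel_extensions(2)[OF S(1)] C11_on.DB[OF S(1)] S(2) by blast
 qed
 have bd: "locally_bounded U (%k x. f (w k x))"
  if w: "!!K. compact K ==> K \<subseteq> U ==> \<exists>S R B Q. C11_on S Phi D R B Q & (\<forall>k. AE x in lebesgue. x \<in> K --> w k x \<in> S)"
   and f: "!!S R B Q. C11_on S Phi D R B Q ==> \<exists>M. \<forall>a\<in>S. norm (f a) <= M"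
  for f :: "'a => 'b" and w :: "'k => real^'n => 'a"
  unfolding locally_bounded_def
 proof (intro allI impI)
  fix K assume "compact K & K \<subseteq> U"
  then have "compact K" "K \<subseteq> U" by auto
  from w[OF this] obtain S R B Q where S: "C11_on S Phi D R B Q" "\<forall>k. AE x in lebesgue. x \<in> K --> w k x \<in> S" by (elim exE conjE)
  obtain M where M: "!!a. a \<in> S ==> norm (f a) <= M" using f[OF S(1)] by blast
  have "AE x in lebesgue. x \<in> K --> norm (f (w k x)) <= M" for k using S(2)[rule_format, of k] by eventually_elim (use M in blast)
  then show "\<exists>M. \<forall>k. AE x in lebesgue. x \<in> K --> norm (f (w k x)) <= M" by blast
 qed
 have DB: "C11_on S Phi D R B Q ==> \<exists>M. \<forall>a\<in>S. norm (D a b) <= M" for S R B Q b using C11_on.DB by blast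
 have C0: "\<exists>S R B Q. C11_on S Phi D R B Q & (\<forall>k::unit. AE x in lebesgue. x \<in> K --> u0 x \<in> S)" if "compact K" "K \<subseteq> U" for K
  using C'[OF that] by blast
 show "locally_bounded U (%m x. Phi (u m x))" by (rule bd[OF C C11_on.Phi_bounded])
 show "locally_bounded U (%(_::unit) x. Phi (u0 x))" by (rule bd[OF C0 C11_on.Phi_bounded])
 have sc: "sconv U (%m x. f (u m x)) (%x. f (u0 x))"
  if f: "!!S R B Q. C11_on S Phi D R B Q ==> \<exists>L. \<forall>a\<in>S. \<forall>b\<in>S. norm (f a - f b) <= L * norm (a - b)" for f :: "'a => 'b"
 proof (rule sconv_Lipschitz[OF su Du(1,2)])
  fix K assume "compact K" "K \<subseteq> U"
  from C'[OF this] obtain S R B Q where S: "C11_on S Phi D R B Q" "\<forall>m. AE x in lebesgue. x \<in> K --> u m x \<in> S" "AE x in lebesgue. x \<in> K --> u0 x \<in> S"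
   by (elim exE conjE)
  obtain L where L: "!!a b. a \<in> S ==> b \<in> S ==> norm (f a - f b) <= L * norm (a - b)" using f[OF S(1)] by blast
  have "AE x in lebesgue. x \<in> K --> norm (f (u m x) - f (u0 x)) <= L * norm (u m x - u0 x)" for m
   using S(2)[rule_format, of m] S(3) by eventually_elim (use L in auto)
  then show "\<exists>L. \<forall>m. AE x in lebesgue. x \<in> K --> norm (f (u m x) - f (u0 x)) <= L * norm (u m x - u0 x)" by blast
 qed
 show "sconv U (%m x. Phi (u m x)) (%x. Phi (u0 x))" using C11_on.Phi_Lipschitz by (intro sc) blast
 have DL: "\<exists>L. \<forall>a\<in>S. \<forall>b\<in>S. norm (D a h - D b h) <= L * norm (a - b)" if "C11_on S Phi D R B Q" for S R B Q h
  using C11_on.DL[OF that, of _ _ h] by (intro exI[of _ "Q * norm h"]) (auto simp: mult_ac)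
 have lin: "AE x in lebesgue. x \<in> U --> linear (D (w x))"
  if wS: "!!K. compact K ==> K \<subseteq> U ==> \<exists>S R B Q. C11_on S Phi D R B Q & (AE x in lebesgue. x \<in> K --> w x \<in> S)" for w
 proof (rule AE_local[OF U])
  fix K assume "compact K" "K \<subseteq> U"
  from wS[OF this] obtain S R B Q where S: "C11_on S Phi D R B Q" "AE x in lebesgue. x \<in> K --> w x \<in> S" by (elim exE conjE)
  from S(2) show "AE x in lebesgue. x \<in> K --> linear (D (w x))" by eventually_elim (use C11_on.lin[OF S(1)] in auto)
 qed
 show "mconv p U (%m x. D (u m x) (v i m x)) (%x. D (u0 x) (v0 i x))" for i
 proof (rule mconv_apply[OF U p v])
  show "locally_integrable U (%x. D (u m x) b)" for m b by (rule liD[OF Du(1)]) (use C in blast)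
  show "locally_integrable U (%x. D (u0 x) b)" for b by (rule liD[OF Du(2)]) (use C' in blast)
  show "sconv U (%m x. D (u m x) b) (%x. D (u0 x) b)" for b by (rule sc[OF DL])
  show "locally_bounded U (%m x. D (u m x) b)" for b by (rule bd[OF C DB])
  show "locally_bounded U (%(_::unit) x. D (u0 x) b)" for b by (rule bd[OF C0 DB])
  show "AE x in lebesgue. x \<in> U --> linear (D (u m x))" for m by (rule lin) (use C in blast)
  show "AE x in lebesgue. x \<in> U --> linear (D (u0 x))" by (rule lin) (use C' in blast)
 qed
qed

section \<open>Limits of Sobolev sequences\<close>

lemma has_weak_partial_sum:
 fixes f :: "'k => real^'n => 'b::euclidean_space"
 assumes f: "!!k. k \<in> I ==> has_weak_partial U i (f k) (g k)"
 shows "has_weak_partial U i (%x. \<Sum>k\<in>I. f k x) (%x. \<Sum>k\<in>I. g k x)"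
 unfolding has_weak_partial_iff
proof (intro conjI allI impI)
 have li: "k \<in> I ==> locally_integrable U (f k)" "k \<in> I ==> locally_integrable U (g k)" for k
  using f by (auto simp: has_weak_partial_iff)
 have sum: "locally_integrable U (%x. \<Sum>k\<in>I. h k x)" if "!!k. k \<in> I ==> locally_integrable U (h k)" for h :: "'k => real^'n => 'b"
  using that unfolding locally_integrable_def set_integrable_def by (auto simp: scaleR_sum_right intro!: Bochner_Integration.integrable_sum)
 show "locally_integrable U (%x. \<Sum>k\<in>I. f k x)" "locally_integrable U (%x. \<Sum>k\<in>I. g k x)" using li by (intro sum; blast)+
 fix phi assume phi: "test_function U phi"
 have eq: "(LINT x|lebesgue. psi x *R (\<Sum>k\<in>I. h k x)) = (\<Sum>k\<in>I. LINT x|lebesgue. psi x *R h k x)"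
  if "wtest U psi" "!!k. k \<in> I ==> locally_integrable U (h k)" for h :: "'k => real^'n => 'b" and psi
  unfolding scaleR_sum_right using wtest_integrable[OF that] by (intro Bochner_Integration.integral_sum)
 have "(\<Sum>k\<in>I. LINT x|lebesgue. partial i phi x *R f k x) = (\<Sum>k\<in>I. - (LINT x|lebesgue. phi x *R g k x))"
  using f phi by (intro sum.cong) (auto simp: has_weak_partial_iff)
 then show "(LINT x|lebesgue. partial i phi x *R (\<Sum>k\<in>I. f k x)) = - (LINT x|lebesgue. phi x *R (\<Sum>k\<in>I. g k x))"
  using eq[of "partial i phi" f] eq[of phi g] test_function_partial_wtest[OF phi] test_function_wtest[OF phi] li by (simp add: sum_negf)
qed

definition unit_vec :: "'k => 'b => 'b::euclidean_space ^ 'k" where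
 "unit_vec i y = (\<chi> j. if j = i then y else 0)"

lemma unit_vec: "bounded_linear (unit_vec i)" "(\<Sum>i\<in>UNIV. unit_vec i (y i)) = (\<chi> i. y i)"
 unfolding linear_conv_bounded_linear[symmetric]
 by (auto intro!: linearI simp: unit_vec_def vec_eq_iff)

lemma mconv_vec:
 fixes F :: "'k::finite => nat => real^'n => 'b::euclidean_space"
 assumes "open U" "p >= 1" "!!i. mconv p U (F i) (f i)"
 shows "mconv p U (%m x. \<chi> i. F i m x) (%x. \<chi> i. f i x)"
proof -
 have m: "mconv p U (%m x. unit_vec i (F i m x)) (%x. unit_vec i (f i x))" for i
  by (rule mconv_linear[OF assms(1,2) unit_vec(1) assms(3)])
 have "mconv p U (%m x. \<Sum>i\<in>UNIV. unit_vec i (F i m x)) (%x. \<Sum>i\<in>UNIV. unit_vec i (f i x))"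
  by (rule mconv_sum[OF assms(1,2) _ _ m]) auto
 then show ?thesis by (simp only: unit_vec)
qed

lemma has_weak_partial_vec:
 fixes f :: "'k::finite => real^'n => 'b::euclidean_space"
 assumes "!!i. has_weak_partial U k (f i) (g i)"
 shows "has_weak_partial U k (%x. \<chi> i. f i x) (%x. \<chi> i. g i x)"
proof -
 have w: "has_weak_partial U k (%x. unit_vec i (f i x)) (%x. unit_vec i (g i x))" for i
  by (rule has_weak_partial_linear[OF unit_vec(1) assms])
 have "has_weak_partial U k (%x. \<Sum>i\<in>UNIV. unit_vec i (f i x)) (%x. \<Sum>i\<in>UNIV. unit_vec i (g i x))"
  by (rule has_weak_partial_sum[OF w])
 then show ?thesis by (simp only: unit_vec)
qed

definition Sobolev_bounded :: "real => nat => (real^'n) set => ('i => real^'n => 'b::euclidean_space) => bool" where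
 "Sobolev_bounded p l U F \<longleftrightarrow> (\<forall>V. open_compactly_in V U -->
  (\<exists>C. \<forall>m. weak_Morrey_Sobolev_norm p (real CARD('n) - p) l V (F m) <= ennreal C))"

lemma weak_Morrey_norm_le_Sobolev: "weak_Morrey_norm p la V f <= weak_Morrey_Sobolev_norm p la l V f"
 by (cases l) auto

lemma Sobolev_bounded_Morrey:
 fixes F :: "'i => real^'n => 'b::euclidean_space"
 assumes "p >= 0" "Sobolev_bounded p l U F"
 shows "Morrey_bounded p U F"
 unfolding Morrey_bounded_def
proof (intro allI impI)
 fix V assume V: "open_compactly_in V U"
 obtain C where C: "!!m. weak_Morrey_Sobolev_norm p (real CARD('n) - p) l V (F m) <= ennreal C"
  using assms(2) V unfolding Sobolev_bounded_def by blast
 have "Morrey_bound p (real CARD('n) - p) V (F m) (max C 0 + 1)" for m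
  by (rule Morrey_bound_of_norm[OF order_trans[OF weak_Morrey_norm_le_Sobolev order_trans[OF C]] assms(1)]) (auto intro: ennreal_leI)
 then show "\<exists>C. \<forall>m. Morrey_bound p (real CARD('n) - p) V (F m) C" by blast
qed

text \<open>The norm on \<open>V\<close> is built from \<open>weak_partial V\<close>, while the
  claim concerns \<open>weak_partial U\<close>. Both agree almost everywhere on \<open>V\<close>, so
  their further derivatives there are literally the same and only the order-zero norm has to be
  estimated again, which costs the additive 1.\<close>

lemma Sobolev_bounded_partial:
 fixes F :: "'i => real^'n => 'b::euclidean_space"
 assumes U: "open U" and p: "p >= 1" and wd: "!!m. weakly_differentiable U (F m)" and F: "Sobolev_bounded p (Suc l) U F"
 shows "Sobolev_bounded p l U (%m. weak_partial U i (F m))"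
 unfolding Sobolev_bounded_def
proof (intro allI impI)
 fix V assume V: "open_compactly_in V U"
 note V' = open_compactly_in_lmeasurable[OF V] and VU = open_compactly_in_subset[OF V]
 let ?la = "real CARD('n) - p"
 obtain C0 where C0: "!!m. weak_Morrey_Sobolev_norm p ?la (Suc l) V (F m) <= ennreal C0"
  using F V unfolding Sobolev_bounded_def by blast
 define C where "C = max C0 0"
 have C: "C >= 0" "ennreal C0 <= ennreal C" by (auto simp: C_def intro: ennreal_leI)
 have "weak_Morrey_Sobolev_norm p ?la l V (weak_partial U i (F m)) <= ennreal (C + 1 + C)" for m
 proof -
  let ?g = "weak_partial V i (F m)" and ?h = "weak_partial U i (F m)"
  have wp: "has_weak_partial V i (F m) ?h" by (rule has_weak_partial_mono[OF VU has_weak_partial_weak_partial[OF wd]])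
  have ae: "AE x in lebesgue. x \<in> V --> ?g x = ?h x" by (rule weak_partial_AE[OF V'(1) wp])
  have "weak_Morrey_Sobolev_norm p ?la l V ?g <= (\<Sum>j\<in>UNIV. weak_Morrey_Sobolev_norm p ?la l V (weak_partial V j (F m)))"
   by (rule member_le_sum) auto
  also have "... <= weak_Morrey_Sobolev_norm p ?la (Suc l) V (F m)" by simp
  finally have gC: "weak_Morrey_Sobolev_norm p ?la l V ?g <= ennreal C" using C0[of m] C(2) by (meson order_trans)
  have gm: "?g \<in> borel_measurable (lebesgue_on V)"
   using locally_integrable_measurable_on[OF V'(1) _ order_refl V'(4)] has_weak_partial_weak_partial_ex[OF wp]
   by (auto simp: has_weak_partial_iff)
  have "Morrey_bound p ?la V ?h (1 * real (card {()})^2 * (C + 1))"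
  proof (rule Morrey_bound_dominated[of "{()}" 1 p "%_. ?g"])
   show "Morrey_bound p ?la V ?g (C + 1)"
    using gC p C(1) by (intro Morrey_bound_of_norm order_trans[OF weak_Morrey_norm_le_Sobolev]) auto
   show "AE x in lebesgue. x \<in> V --> norm (?h x) <= 1 * (\<Sum>i\<in>{()}. norm (?g x))"
    using ae by eventually_elim auto
  qed (use p gm V' in auto)
  then have 1: "weak_Morrey_norm p ?la V ?h <= ennreal (C + 1)" by (intro weak_Morrey_norm_le) simp
  show ?thesis
  proof (cases l)
   case 0
   then show ?thesis using order_trans[OF 1, of "ennreal (C + 1 + C)"] C(1) by (simp add: ennreal_leI)
  next
   case (Suc l')
   have "(\<Sum>j\<in>UNIV. weak_Morrey_Sobolev_norm p ?la l' V (weak_partial V j ?h)) <= weak_Morrey_Sobolev_norm p ?la l V ?g"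
    by (simp add: Suc weak_partial_cong(1)[OF ae])
   then have "(\<Sum>j\<in>UNIV. weak_Morrey_Sobolev_norm p ?la l' V (weak_partial V j ?h)) <= ennreal C" using gC by (rule order_trans)
   from add_mono[OF 1 this] show ?thesis unfolding Suc using C(1) by (subst ennreal_plus) auto
  qed
 qed
 then show "\<exists>C. \<forall>m. weak_Morrey_Sobolev_norm p ?la l V (weak_partial U i (F m)) <= ennreal C" by blast
qed

text \<open>Compactness yields limits \<open>g i\<close> with no reference to the limit function;
  here they are identified with its chosen weak derivatives.\<close>

lemma mconv_weak_partial:
 fixes F :: "nat => real^'n => 'b::euclidean_space"
 assumes U: "open U" and p: "p > 2" and wd: "!!m. weakly_differentiable U (F m)" and F: "mconv p U F f"
  and G: "!!i. mconv p U (%m. weak_partial U i (F m)) (g i)"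
 shows "weakly_differentiable U f" "mconv p U (%m. weak_partial U i (F m)) (weak_partial U i f)" "sconv U F f"
proof -
 have wp: "has_weak_partial U i (F m) (weak_partial U i (F m))" for i m by (rule has_weak_partial_weak_partial[OF wd])
 note R = mconv_Rellich[OF U p F G wp]
 show "sconv U F f" by (rule R(1))
 show "weakly_differentiable U f" using R(2) by (auto simp: weakly_differentiable_def)
 show "mconv p U (%m. weak_partial U i (F m)) (weak_partial U i f)"
  by (rule mconv_cong[OF U _ _ AE_imp_sym[OF weak_partial_AE[OF U R(2)]] G]) (use p in auto)
qed

lemma first_order_subsequence:
 fixes F :: "'k => nat => real^'n => 'b::euclidean_space"
 assumes U: "open U" and p: "p > 2" and I: "finite I"
  and wd: "!!k m. k \<in> I ==> weakly_differentiable U (F k m)"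
  and M0: "!!k. k \<in> I ==> Morrey_bounded p U (F k)"
  and M1: "!!k i. k \<in> I ==> Morrey_bounded p U (%m. weak_partial U i (F k m))"
 obtains r f where "strict_mono (r :: nat => nat)" "!!k. k \<in> I ==> mconv p U (%m. F k (r m)) (f k)"
  "!!k i. k \<in> I ==> mconv p U (%m. weak_partial U i (F k (r m))) (weak_partial U i (f k))"
  "!!k. k \<in> I ==> weakly_differentiable U (f k)" "!!k. k \<in> I ==> sconv U (%m. F k (r m)) (f k)"
proof -
 \<comment> \<open>Functions and their partial derivatives share one finite index set, with
   \<open>None\<close> standing for the function itself, so that a single subsequence serves all of
   them.\<close>
 define G where "G = (%(k, q) m. case q of None => F k m | Some i => weak_partial U i (F k m))"
 have wp: "has_weak_partial U i (F k m) (weak_partial U i (F k m))" if "k \<in> I" for k m i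
  by (rule has_weak_partial_weak_partial[OF wd[OF that]])
 have "\<exists>r f. strict_mono (r :: nat => nat) & (\<forall>q\<in>I \<times> UNIV. mconv p U (%m. G q (r m)) (f q))"
 proof (rule finite_mconv_subsequence[OF U p])
  show "finite (I \<times> (UNIV :: 'n option set))" using I by simp
  fix q :: "'k \<times> 'n option" and m assume "q \<in> I \<times> UNIV"
  then obtain k j where q: "q = (k, j)" "k \<in> I" by auto
  show "locally_integrable U (G q m)" using wp[OF q(2)] by (auto simp: G_def q(1) has_weak_partial_iff split: option.split)
  show "Morrey_bounded p U (G q)"
  proof (cases j)
   case None
   then have "G q = F k" by (simp add: G_def q(1))
   then show ?thesis using M0[OF q(2)] by simp
  next
   case (Some i)
   then have "G q = (%m. weak_partial U i (F k m))" by (simp add: G_def q(1))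
   then show ?thesis using M1[OF q(2)] by simp
  qed
 qed
 then obtain r f where r: "strict_mono (r :: nat => nat)" and f: "!!q. q \<in> I \<times> UNIV ==> mconv p U (%m. G q (r m)) (f q)" by blast
 have c0: "mconv p U (%m. F k (r m)) (f (k, None))" if "k \<in> I" for k
  using f[of "(k, None)"] that by (simp add: G_def)
 have c1: "mconv p U (%m. weak_partial U i (F k (r m))) (f (k, Some i))" if "k \<in> I" for k i
  using f[of "(k, Some i)"] that by (simp add: G_def)
 define g where "g = (%k. f (k, None))"
 have g0: "mconv p U (%m. F k (r m)) (g k)" if "k \<in> I" for k using c0[OF that] by (simp only: g_def)
 have W: "weakly_differentiable U (g k)" "sconv U (%m. F k (r m)) (g k)"
   "mconv p U (%m. weak_partial U i (F k (r m))) (weak_partial U i (g k))" if k: "k \<in> I" for k i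
 proof -
  have wdk: "weakly_differentiable U (F k (r m))" for m by (rule wd[OF k])
  show "weakly_differentiable U (g k)" by (rule mconv_weak_partial(1)[OF U p wdk g0[OF k] c1[OF k]])
  show "sconv U (%m. F k (r m)) (g k)" by (rule mconv_weak_partial(3)[OF U p wdk g0[OF k] c1[OF k]])
  show "mconv p U (%m. weak_partial U i (F k (r m))) (weak_partial U i (g k))"
   by (rule mconv_weak_partial(2)[OF U p wdk g0[OF k] c1[OF k]])
 qed
 show ?thesis by (rule that[OF r g0 W(3) W(1) W(2)])
qed

lemma locally_integrable_add:
 "locally_integrable U f ==> locally_integrable U g ==> locally_integrable U (%x. f x + g x)"
 unfolding locally_integrable_def by (blast intro: set_integral_add(1))

lemma sconv_Pair:
 fixes F :: "nat => real^'n => 'b::euclidean_space" and G :: "nat => real^'n => 'c::euclidean_space"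
 assumes li: "!!m. locally_integrable U (F m)" "locally_integrable U f" "!!m. locally_integrable U (G m)" "locally_integrable U g"
  and c: "sconv U F f" "sconv U G g"
 shows "sconv U (%m x. (F m x, G m x)) (%x. (f x, g x))" "locally_integrable U (%x. (f x, g x))"
proof -
 have l: "bounded_linear (%a::'b. (a, 0::'c))" "bounded_linear (%b::'c. (0::'b, b))"
  by (intro bounded_linear_Pair bounded_linear_ident bounded_linear_zero)+
 have "locally_integrable U (%x. (f x, 0::'c))" "locally_integrable U (%x. (0::'b, g x))"
  using locally_integrable_linear[OF l(1) li(2)] locally_integrable_linear[OF l(2) li(4)] .
 from locally_integrable_add[OF this] show "locally_integrable U (%x. (f x, g x))" by simp
 show "sconv U (%m x. (F m x, G m x)) (%x. (f x, g x))"
  unfolding sconv_def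
 proof (intro allI impI)
  fix K assume K: "compact K & K \<subseteq> U"
  let ?I = "%m. (\<integral>\<^sup>+x\<in>K. ennreal (norm (F m x - f x)) \<partial>lebesgue) + (\<integral>\<^sup>+x\<in>K. ennreal (norm (G m x - g x)) \<partial>lebesgue)"
  have le: "(\<integral>\<^sup>+x\<in>K. ennreal (norm ((F m x, G m x) - (f x, g x))) \<partial>lebesgue) <= ?I m" for m
  proof -
   have "(\<integral>\<^sup>+x\<in>K. ennreal (norm ((F m x, G m x) - (f x, g x))) \<partial>lebesgue) \<le>
     (\<integral>\<^sup>+x. ennreal (norm (F m x - f x)) * indicator K x + ennreal (norm (G m x - g x)) * indicator K x \<partial>lebesgue)"
    by (intro nn_integral_mono)
     (auto simp: ennreal_plus[symmetric] norm_Pair_le simp del: ennreal_plus intro!: ennreal_leI split: split_indicator)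
   also have "... = ?I m"
    using K by (intro nn_integral_add measurable_norm_li[of K U] locally_integrable_diff li) auto
   finally show ?thesis .
  qed
  have "(%m. \<integral>\<^sup>+x\<in>K. ennreal (norm (F m x - f x)) \<partial>lebesgue) \<longlonglongrightarrow> 0"
    "(%m. \<integral>\<^sup>+x\<in>K. ennreal (norm (G m x - g x)) \<partial>lebesgue) \<longlonglongrightarrow> 0"
   using c K by (simp_all add: sconv_def)
  from tendsto_add[OF this] have lim: "?I \<longlonglongrightarrow> 0" by (simp only: add_0_right)
  show "(%m. \<integral>\<^sup>+x\<in>K. ennreal (norm ((F m x, G m x) - (f x, g x))) \<partial>lebesgue) \<longlonglongrightarrow> 0"
   by (rule tendsto_sandwich[OF always_eventually always_eventually tendsto_const lim]; rule allI; (rule le | rule zero_le))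
 qed
qed

lemma weak_conv_loc_cong:
 fixes F :: "nat => real^'n => 'b::euclidean_space"
 assumes p: "p >= 1"
  and ae: "!!m. AE x in lebesgue. x \<in> U --> F m x = G m x" "AE x in lebesgue. x \<in> U --> f x = g x"
  and c: "weak_conv_loc p la l U F f"
 shows "weak_conv_loc p la l U G g"
 unfolding weak_conv_loc_def
proof (intro allI impI)
 fix V assume V: "open_compactly_in V U"
 note V' = open_compactly_in_lmeasurable[OF V] and VU = open_compactly_in_subset[OF V]
 show "weak_conv p la l V G g"
 proof (rule weak_conv_cong[OF V'(1,2) p])
  show "AE x in lebesgue. x \<in> V --> F m x = G m x" for m using ae(1)[of m] by eventually_elim (use VU in auto)
  show "AE x in lebesgue. x \<in> V --> f x = g x" using ae(2) by eventually_elim (use VU in auto)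
  show "weak_conv p la l V F f" using c V by (simp add: weak_conv_loc_def)
 qed
qed

lemma mconv_mono: "V \<subseteq> U ==> mconv p U F f ==> mconv p V F f"
 unfolding mconv_def Morrey_bounded_def using locally_integrable_mono wconv_mono open_compactly_in_mono by metis

lemma mconv_inner:
 fixes z :: "nat => real^'n => 'b::euclidean_space"
 assumes U: "open U" and p: "p > 2" and z: "mconv p U z z0"
  and h: "!!m. locally_integrable U (h m)" "locally_integrable U h0" "sconv U h h0"
   "locally_bounded U h" "locally_bounded U (%_::unit. h0)"
 shows "mconv p U (%m x. z m x \<bullet> h m x) (%x. z0 x \<bullet> h0 x)"
proof (rule mconv_apply[OF U p z])
 fix b :: 'b
 have bl: "bounded_linear (%y. b \<bullet> y)" by (rule bounded_linear_inner_right)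
 show "locally_integrable U (%x. b \<bullet> h m x)" for m by (rule locally_integrable_linear[OF bl h(1)])
 show "locally_integrable U (%x. b \<bullet> h0 x)" by (rule locally_integrable_linear[OF bl h(2)])
 have le: "norm (b \<bullet> y) <= norm b * norm y" for y using Cauchy_Schwarz_ineq2[of b y] by simp
 show "sconv U (%m x. b \<bullet> h m x) (%x. b \<bullet> h0 x)"
  by (rule sconv_Lipschitz[OF h(3,1,2)]) (use le in \<open>auto simp: inner_diff_right[symmetric]\<close>)
 have bd: "locally_bounded U (%k x. b \<bullet> w k x)" if w: "locally_bounded U w" for w :: "'k => real^'n => 'b"
  unfolding locally_bounded_def
 proof (intro allI impI)
  fix K assume "compact K & K \<subseteq> U"
  then obtain B where B: "\<forall>k. AE x in lebesgue. x \<in> K --> norm (w k x) <= B" using w unfolding locally_bounded_def by blast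
  have "AE x in lebesgue. x \<in> K --> norm (b \<bullet> w k x) <= norm b * B" for k
   using B[rule_format, of k] by eventually_elim (use order_trans[OF le mult_left_mono] in auto)
  then show "\<exists>B. \<forall>k. AE x in lebesgue. x \<in> K --> norm (b \<bullet> w k x) <= B" by blast
 qed
 show "locally_bounded U (%m x. b \<bullet> h m x)" "locally_bounded U (%(_::unit) x. b \<bullet> h0 x)" by (rule bd, rule h)+
 show "AE x in lebesgue. x \<in> U --> linear (%y. y \<bullet> h m x)" "AE x in lebesgue. x \<in> U --> linear (%y. y \<bullet> h0 x)" for m
  using bounded_linear.linear[OF bounded_linear_inner_left] by auto
qed

section \<open>Limits of immersions\<close>

definition jacobian :: "(real^'n) set => (real^'n => real^'m) => real^'n => real^'m^'n" where
 "jacobian U f x = (\<chi> i. weak_partial U i f x)"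

lemma weak_differential_eq: "weak_differential U f x = differential (jacobian U f x)"
 by (simp add: fun_eq_iff weak_differential_def differential_def jacobian_def)

lemma induced_metric_eq: "induced_metric U f x = gram (jacobian U f x)"
 by (simp add: induced_metric_def gram_def jacobian_def)

lemma normal_space_eq: "normal_space U f x = orthogonal_comp (range (differential (jacobian U f x)))"
 by (simp add: normal_space_def weak_differential_eq)

lemma nproj_inner_normal: "\<forall>i. A $ i \<bullet> y = 0 ==> nproj A z \<bullet> y = z \<bullet> y"
 by (simp add: nproj_def inner_diff_left inner_sum_left)

abbreviation frames :: "real => real => (real^'m^'n) set" where
 "frames c R \<equiv> {A. nondeg c A & norm A <= R}"

lemma AE_lebesgue_on_open: "open U ==> (AE x in lebesgue_on U. P x) \<longleftrightarrow> (AE x in lebesgue. x \<in> U --> P x)"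
 by (rule AE_restrict_space_iff) auto

lemma frame_AE:
 assumes "open U" "orthonormal_normal_frame k U g h"
 shows "AE x in lebesgue. x \<in> U --> (\<forall>alpha<k. h alpha x \<in> normal_space U g x) \<and>
  (\<forall>alpha<k. \<forall>beta<k. h alpha x \<bullet> h beta x = (if alpha = beta then 1 else 0))"
 using assms(2) unfolding orthonormal_normal_frame_def AE_lebesgue_on_open[OF assms(1)] .

text \<open>The state after the subsequence has been extracted. Stating it for an arbitrary open set
  lets the geometric conclusions be used on the whole domain and, through \<open>restrict\<close>,
  on the subdomains that carry normal frames. Nonemptiness of the set of matrices is a requirement
  of \<open>C11_on\<close>.\<close>

locale immersion_limit =
 fixes U :: "(real^'n) set" and p :: real and F :: "nat => real^'n => real^'m" and f :: "real^'n => real^'m"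
 assumes U: "open U" and p: "p > 2"
  and wd: "!!m. weakly_differentiable U (F m)" "!!m i. weakly_differentiable U (weak_partial U i (F m))"
  and c0: "mconv p U F f"
  and c1: "!!i. mconv p U (%m. weak_partial U i (F m)) (weak_partial U i f)"
  and c2: "!!i j. mconv p U (%m. weak_partial U j (weak_partial U i (F m))) (weak_partial U j (weak_partial U i f))"
  and nd: "!!K. compact K ==> K \<subseteq> U ==> \<exists>c R. 0 < c & (frames c R :: (real^'m^'n) set) ~= {} \<and>
   (\<forall>m. AE x in lebesgue. x \<in> K --> jacobian U (F m) x \<in> frames c R)"
begin

definition "v = (%k m x. \<chi> i. weak_partial U k (weak_partial U i (F m)) x)"
definition "v0 = (%k x. \<chi> i. weak_partial U k (weak_partial U i f) x)"

lemma p1: "p >= 1" "p > 1" using p by auto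

lemma wd_limit: "weakly_differentiable U f" "weakly_differentiable U (weak_partial U i f)"
 by (rule mconv_weak_partial(1)[OF U p wd(1) c0 c1], rule mconv_weak_partial(1)[OF U p wd(2) c1 c2])

lemma cu: "mconv p U (%m. jacobian U (F m)) (jacobian U f)"
 using mconv_vec[OF U p1(1) c1] by (simp add: jacobian_def[abs_def])

lemma cv: "mconv p U (v k) (v0 k)"
 unfolding v_def v0_def by (rule mconv_vec[OF U p1(1) c2])

lemma wpu: "has_weak_partial U k (jacobian U (F m)) (v k m)"
 using has_weak_partial_vec[OF has_weak_partial_weak_partial[OF wd(2)]] by (simp add: jacobian_def[abs_def] v_def)

lemma su: "sconv U (%m. jacobian U (F m)) (jacobian U f)"
 by (rule mconv_Rellich(1)[OF U p cu cv wpu])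

lemma nondeg_ae:
 "AE x in lebesgue. x \<in> U --> (\<exists>c>0. nondeg c (jacobian U (F m) x))"
 "AE x in lebesgue. x \<in> U --> (\<exists>c>0. nondeg c (jacobian U f x))"
proof -
 show "AE x in lebesgue. x \<in> U --> (\<exists>c>0. nondeg c (jacobian U (F m) x))"
 proof (rule AE_local[OF U])
  fix K assume "compact K" "K \<subseteq> U"
  from nd[OF this] obtain c R where c: "0 < c" "\<forall>m. AE x in lebesgue. x \<in> K --> jacobian U (F m) x \<in> frames c R"
   by (elim exE conjE)
  show "AE x in lebesgue. x \<in> K --> (\<exists>c>0. nondeg c (jacobian U (F m) x))"
   using c(2)[rule_format, of m] by eventually_elim (use c(1) in blast)
 qed
 show "AE x in lebesgue. x \<in> U --> (\<exists>c>0. nondeg c (jacobian U f x))"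
 proof (rule AE_local[OF U])
  fix K assume K: "compact K" "K \<subseteq> U"
  from nd[OF this] obtain c R where c: "0 < c" "(frames c R :: (real^'m^'n) set) ~= {}"
    "\<forall>m. AE x in lebesgue. x \<in> K --> jacobian U (F m) x \<in> frames c R"
   by (elim exE conjE)
  have "AE x in lebesgue. x \<in> K --> jacobian U f x \<in> frames c R"
   by (rule sconv_mem_closed[OF su mconvD(2)[OF cu] U closed_nondeg_ball[OF c(1)] c(2) c(3)[rule_format] K])
  then show "AE x in lebesgue. x \<in> K --> (\<exists>c>0. nondeg c (jacobian U f x))"
   by eventually_elim (use c(1) in blast)
 qed
qed

lemma nproj_local: "\<exists>S R B Q. C11_on S (%A. nproj A y) (nproj_deriv y) R B Q \<and>
  (\<forall>m. AE x in lebesgue. x \<in> K --> jacobian U (F m) x \<in> S)" if "compact K" "K \<subseteq> U"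
proof -
 from nd[OF that] obtain c R where c: "0 < c" "(frames c R :: (real^'m^'n) set) ~= {}"
   "\<forall>m. AE x in lebesgue. x \<in> K --> jacobian U (F m) x \<in> frames c R"
  by (elim exE conjE)
 show ?thesis using C11_nproj[OF c(1,2)] c(3) by blast
qed

lemma gram_local: "\<exists>S R B Q. C11_on S gram gram_deriv R B Q \<and>
  (\<forall>m. AE x in lebesgue. x \<in> K --> jacobian U (F m) x \<in> S)" if "compact K" "K \<subseteq> U"
proof -
 from nd[OF that] obtain c R where c: "0 < c" "(frames c R :: (real^'m^'n) set) ~= {}"
   "\<forall>m. AE x in lebesgue. x \<in> K --> jacobian U (F m) x \<in> frames c R"
  by (elim exE conjE)
 have "C11_on (frames c R :: (real^'m^'n) set) gram gram_deriv R ((real CARD('n))^2 * (2 * R)) ((real CARD('n))^2 * 2)"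
  by (rule C11_gram[OF closed_nondeg_ball[OF c(1)] c(2)]) blast
 then show ?thesis using c(3) by blast
qed

text \<open>At order zero the Morrey bound comes from boundedness of \<open>Phi\<close> on the
  admissible set alone, owing to the exponent n - p; at order one it comes from the chain
  rule.\<close>

lemma chain_weak_conv:
 fixes Phi :: "real^'m^'n => 'b::euclidean_space"
 assumes "!!K. compact K ==> K \<subseteq> U ==> \<exists>S R B Q. C11_on S Phi D R B Q \<and>
  (\<forall>m. AE x in lebesgue. x \<in> K --> jacobian U (F m) x \<in> S)"
 shows "weak_conv_loc p (real CARD('n) - p) 1 U (%m x. Phi (jacobian U (F m) x)) (%x. Phi (jacobian U f x))"
proof -
 note C = chain_convergence[OF U p cu cv wpu assms]
 have m: "mconv p U (%m x. Phi (jacobian U (F m) x)) (%x. Phi (jacobian U f x))"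
  by (rule mconv_bounded[OF p1(1) C(2,3,1,4)])
 show ?thesis
  unfolding One_nat_def by (rule mconv_weak_conv_loc_Suc[OF U p1(2) m C(6,7) mconv_weak_conv_loc[OF U p1(2) C(8)]])
qed

text \<open>Applied with \<open>z\<close> the second derivatives it gives the second fundamental
  form, and with \<open>z\<close> the derivatives of the projected constant vectors it gives the
  normal connection.\<close>

lemma nproj_conv:
 assumes z: "mconv p U z z0"
 shows "weak_conv_loc p (real CARD('n) - p) 0 U (%m x. nproj (jacobian U (F m) x) (z m x)) (%x. nproj (jacobian U f x) (z0 x))"
proof (rule mconv_weak_conv_loc[OF U p1(2)], rule mconv_apply[OF U p z])
 fix b :: "real^'m"
 note C = chain_convergence[OF U p cu cv wpu nproj_local[of _ b]]
 show "locally_integrable U (%x. nproj (jacobian U (F m) x) b)" for m by (rule C)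
 show "locally_integrable U (%x. nproj (jacobian U f x) b)" by (rule C)
 show "sconv U (%m x. nproj (jacobian U (F m) x) b) (%x. nproj (jacobian U f x) b)" by (rule C)
 show "locally_bounded U (%m x. nproj (jacobian U (F m) x) b)" by (rule C)
 show "locally_bounded U (%(_::unit) x. nproj (jacobian U f x) b)" by (rule C)
qed (simp_all add: linear_nproj)

lemma immersion: "ae_immersion U f"
proof -
 have "AE x in lebesgue. x \<in> U --> inj (weak_differential U f x)"
  using nondeg_ae(2)
 proof eventually_elim
  fix x assume x: "x \<in> U --> (\<exists>c>0. nondeg c (jacobian U f x))"
  show "x \<in> U --> inj (weak_differential U f x)"
  proof
   assume "x \<in> U"
   then obtain c where c: "c > 0" "nondeg c (jacobian U f x)" using x by blast
   show "inj (weak_differential U f x)"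
    unfolding weak_differential_eq linear_injective_0[OF linear_differential]
   proof (intro allI impI)
    fix h assume "differential (jacobian U f x) h = 0"
    then have "c * norm h <= 0" using c(2) unfolding nondeg_def[OF c(1)] by (metis norm_zero)
    then show "h = 0" using c(1) by (simp add: mult_le_0_iff)
   qed
  qed
 qed
 then show ?thesis using wd_limit(1) U by (simp add: ae_immersion_def AE_restrict_space_iff)
qed

lemma second_order: "weak_conv_loc p (real CARD('n) - p) 2 U F f"
 unfolding numeral_2_eq_2
 by (rule mconv_weak_conv_loc_Suc[OF U p1(2) c0 has_weak_partial_weak_partial[OF wd(1)] has_weak_partial_weak_partial[OF wd_limit(1)]],
   rule mconv_weak_conv_loc_Suc[OF U p1(2) c1 has_weak_partial_weak_partial[OF wd(2)] has_weak_partial_weak_partial[OF wd_limit(2)]],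
   rule mconv_weak_conv_loc[OF U p1(2) c2])

lemma metric: "weak_conv_loc p (real CARD('n) - p) 1 U (%m. induced_metric U (F m)) (induced_metric U f)"
 using chain_weak_conv[OF gram_local] by (simp add: induced_metric_eq[abs_def])

lemma orth_proj_ae:
 "AE x in lebesgue. x \<in> U --> nproj (jacobian U (F m) x) (z x) = orth_proj (normal_space U (F m) x) (z x)"
 "AE x in lebesgue. x \<in> U --> nproj (jacobian U f x) (z x) = orth_proj (normal_space U f x) (z x)"
proof -
 have "AE x in lebesgue. x \<in> U --> nproj (jacobian U g x) (z x) = orth_proj (normal_space U g x) (z x)"
  if "AE x in lebesgue. x \<in> U --> (\<exists>c>0. nondeg c (jacobian U g x))" for g
  using that by eventually_elim (auto simp: normal_space_eq orth_proj_eq_nproj)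
 then show "AE x in lebesgue. x \<in> U --> nproj (jacobian U (F m) x) (z x) = orth_proj (normal_space U (F m) x) (z x)"
  "AE x in lebesgue. x \<in> U --> nproj (jacobian U f x) (z x) = orth_proj (normal_space U f x) (z x)"
  using nondeg_ae by blast+
qed

lemma generator: "weak_conv_loc p (real CARD('n) - p) 1 U (%m. normal_generator U (F m) a) (normal_generator U f a)"
 unfolding normal_generator_def[abs_def]
 by (rule weak_conv_loc_cong[OF p1(1) orth_proj_ae chain_weak_conv[OF nproj_local]])

text \<open>The projected constant vector and \<open>normal_generator\<close> agree almost
  everywhere, so they have the same \<open>weak_partial\<close>; the chain rule expresses it by the
  derivative of the projection, and projecting once more gives the normal connection.\<close>

lemma connection_ae:
 "AE x in lebesgue. x \<in> U --> nproj (jacobian U (F m) x) (nproj_deriv (axis a 1) (jacobian U (F m) x) (v j m x)) =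
  normal_connection U (F m) j (normal_generator U (F m) a) x"
 "AE x in lebesgue. x \<in> U --> nproj (jacobian U f x) (nproj_deriv (axis a 1) (jacobian U f x) (v0 j x)) =
  normal_connection U f j (normal_generator U f a) x"
proof -
 note C = chain_convergence[OF U p cu cv wpu nproj_local[of _ "axis a 1"]]
 have eq: "AE x in lebesgue. x \<in> U --> nproj (jacobian U g x) (w x) = normal_connection U g j (normal_generator U g a) x"
  if wp: "has_weak_partial U j (%x. nproj (jacobian U g x) (axis a 1)) w"
   and o: "!!z. AE x in lebesgue. x \<in> U --> nproj (jacobian U g x) (z x) = orth_proj (normal_space U g x) (z x)" for g w
 proof -
  have e: "weak_partial U j (%x. nproj (jacobian U g x) (axis a 1)) = weak_partial U j (normal_generator U g a)"
   by (rule weak_partial_cong(1)) (use o[of "%_. axis a 1"] in \<open>simp add: normal_generator_def\<close>)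
  have "AE x in lebesgue. x \<in> U --> weak_partial U j (normal_generator U g a) x = w x"
   using weak_partial_AE[OF U wp] by (simp only: e)
  then show ?thesis
   using o[of "weak_partial U j (normal_generator U g a)"] by eventually_elim (simp add: normal_connection_def)
 qed
 show "AE x in lebesgue. x \<in> U --> nproj (jacobian U (F m) x) (nproj_deriv (axis a 1) (jacobian U (F m) x) (v j m x)) =
   normal_connection U (F m) j (normal_generator U (F m) a) x" by (rule eq[OF C(6) orth_proj_ae(1)])
 show "AE x in lebesgue. x \<in> U --> nproj (jacobian U f x) (nproj_deriv (axis a 1) (jacobian U f x) (v0 j x)) =
   normal_connection U f j (normal_generator U f a) x" by (rule eq[OF C(7) orth_proj_ae(2)])
qed

lemma extrinsic: "extrinsic_conv p (real CARD('n) - p) U F f"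
 unfolding extrinsic_conv_def
proof (intro conjI allI)
 show "weak_conv_loc p (real CARD('n) - p) 0 U (%m. second_fundamental_form U (F m) i j) (second_fundamental_form U f i j)" for i j
  unfolding second_fundamental_form_def[abs_def]
  by (rule weak_conv_loc_cong[OF p1(1) orth_proj_ae nproj_conv[OF c2]])
 show "weak_conv_loc p (real CARD('n) - p) 1 U (%m. normal_generator U (F m) a) (normal_generator U f a)" for a
  by (rule generator)
 show "weak_conv_loc p (real CARD('n) - p) 0 U (%m. normal_connection U (F m) j (normal_generator U (F m) a))
   (normal_connection U f j (normal_generator U f a))" for j a
  by (rule weak_conv_loc_cong[OF p1(1) connection_ae
    nproj_conv[OF chain_convergence(8)[OF U p cu cv wpu nproj_local[of _ "axis a 1"]]]])
qed

lemma subsequence: "strict_mono s ==> immersion_limit U p (%m. F (s m)) f"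
 by (rule immersion_limit.intro[OF U p wd(1) wd(2) mconv_subseq[OF _ c0] mconv_subseq[OF _ c1] mconv_subseq[OF _ c2]])
  (use nd in \<open>fastforce\<close>)+

section \<open>Normal frames along the sequence\<close>

text \<open>Pairing with a normal vector removes the projections, so the components are inner
  products of weakly convergent derivatives, either of the immersions or of the frames, with frame
  vectors that have unit length and converge strongly.\<close>

lemma frame_components:
 assumes H: "!!m. orthonormal_normal_frame k U (F m) (H m)" and eta: "orthonormal_normal_frame k U f eta"
  and h: "!!alpha m. alpha < k ==> weakly_differentiable U (H m alpha)" "!!alpha. alpha < k ==> mconv p U (%m. H m alpha) (eta alpha)"
   "!!alpha j. alpha < k ==> mconv p U (%m. weak_partial U j (H m alpha)) (weak_partial U j (eta alpha))"
   "!!alpha. alpha < k ==> sconv U (%m. H m alpha) (eta alpha)"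
 shows "extrinsic_conv_in_frames p (real CARD('n) - p) k U F H f eta"
proof -
 have ip: "AE x in lebesgue. x \<in> U --> z x \<bullet> h alpha x = orth_proj (normal_space U g x) (z x) \<bullet> h alpha x"
  if h: "orthonormal_normal_frame k U g h" "alpha < k"
   and o: "AE x in lebesgue. x \<in> U --> nproj (jacobian U g x) (z x) = orth_proj (normal_space U g x) (z x)" for g h alpha z
 proof -
  have "AE x in lebesgue. x \<in> U --> h alpha x \<in> normal_space U g x"
   using frame_AE[OF U h(1)] by eventually_elim (use h(2) in auto)
  then show ?thesis
   using o
  proof eventually_elim
   fix x assume x: "x \<in> U --> h alpha x \<in> normal_space U g x" "x \<in> U --> nproj (jacobian U g x) (z x) = orth_proj (normal_space U g x) (z x)"
   show "x \<in> U --> z x \<bullet> h alpha x = orth_proj (normal_space U g x) (z x) \<bullet> h alpha x"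
   proof
    assume "x \<in> U"
    then show "z x \<bullet> h alpha x = orth_proj (normal_space U g x) (z x) \<bullet> h alpha x"
     using x nproj_inner_normal[of "jacobian U g x" "h alpha x" "z x"] by (simp add: normal_space_eq orthogonal_comp_differential)
   qed
  qed
 qed
 have bd: "locally_bounded U (%m. h m alpha)" if "!!m. orthonormal_normal_frame k U (g m) (h m)" "alpha < k"
  for g and h :: "'i => nat => real^'n => real^'m" and alpha
  unfolding locally_bounded_def
 proof (intro allI impI)
  fix K assume K: "compact K & K \<subseteq> U"
  have one: "AE x in lebesgue. x \<in> U --> h m alpha x \<bullet> h m alpha x = 1" for m
   using frame_AE[OF U that(1)[of m]] by eventually_elim (use that(2) in auto)
  have "AE x in lebesgue. x \<in> K --> norm (h m alpha x) <= 1" for m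
   using one[of m] by eventually_elim (use K in \<open>auto simp: norm_eq_sqrt_inner\<close>)
  then show "\<exists>B. \<forall>m. AE x in lebesgue. x \<in> K --> norm (h m alpha x) <= B" by blast
 qed
 have inner: "weak_conv_loc p (real CARD('n) - p) 0 U (%m x. z m x \<bullet> H m alpha x) (%x. z0 x \<bullet> eta alpha x)"
  if z: "mconv p U z z0" and alpha: "alpha < k" for z z0 alpha
  by (rule mconv_weak_conv_loc[OF U p1(2) mconv_inner[OF U p z mconvD(1)[OF h(2)[OF alpha]] mconvD(2)[OF h(2)[OF alpha]] h(4)[OF alpha] bd[OF H alpha] bd[OF eta alpha]]])
 show ?thesis
  unfolding extrinsic_conv_in_frames_def
 proof (intro conjI allI impI)
  show "weak_conv_loc p (real CARD('n) - p) 0 U (%m x. second_fundamental_form U (F m) i j x \<bullet> H m alpha x)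
    (%x. second_fundamental_form U f i j x \<bullet> eta alpha x)" if "alpha < k" for i j alpha
   unfolding second_fundamental_form_def
   by (rule weak_conv_loc_cong[OF p1(1) ip[OF H that orth_proj_ae(1)] ip[OF eta that orth_proj_ae(2)] inner[OF c2 that]])
  show "weak_conv_loc p (real CARD('n) - p) 0 U (%m x. normal_connection U (F m) j (H m alpha) x \<bullet> H m beta x)
    (%x. normal_connection U f j (eta alpha) x \<bullet> eta beta x)" if "alpha < k" "beta < k" for j alpha beta
   unfolding normal_connection_def
   by (rule weak_conv_loc_cong[OF p1(1) ip[OF H that(2) orth_proj_ae(1)] ip[OF eta that(2) orth_proj_ae(2)] inner[OF h(3)[OF that(1)] that(2)]])
 qed
qed

text \<open>Normality and orthonormality form a closed condition on the Jacobian together with two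
  frame vectors, and the triple converges strongly.\<close>

lemma frame_limit:
 assumes H: "!!m. orthonormal_normal_frame k U (F m) (H m)"
  and h: "!!alpha. alpha < k ==> mconv p U (%m. H m alpha) (eta alpha)" "!!alpha. alpha < k ==> sconv U (%m. H m alpha) (eta alpha)"
 shows "orthonormal_normal_frame k U f eta"
proof -
 have "AE x in lebesgue. x \<in> U --> (\<forall>i. jacobian U f x $ i \<bullet> eta alpha x = 0) & eta alpha x \<bullet> eta beta x = (if alpha = beta then 1 else 0)"
  if alpha: "alpha < k" and beta: "beta < k" for alpha beta
 proof (rule AE_local[OF U])
  fix K assume K: "compact K" "K \<subseteq> U"
  define d where "d = (if alpha = beta then 1 else 0 :: real)"
  define S where "S = {q :: (real^'m^'n) \<times> (real^'m) \<times> (real^'m). (\<forall>i. fst q $ i \<bullet> fst (snd q) = 0) & fst (snd q) \<bullet> snd (snd q) = d}"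
  have cl: "closed S"
   unfolding S_def by (intro closed_Collect_conj closed_Collect_all closed_Collect_eq continuous_intros)
  have ne: "S ~= {}"
  proof -
   \<comment> \<open>With the zero Jacobian the normality condition is void, so only the prescribed
     inner product \<open>d\<close> has to be realised.\<close>
   have "(0, d *R axis undefined 1, axis undefined 1) \<in> S" by (simp add: S_def inner_axis_axis)
   then show ?thesis by blast
  qed
  note P = sconv_Pair[OF mconvD(1)[OF h(1)[OF alpha]] mconvD(2)[OF h(1)[OF alpha]] mconvD(1)[OF h(1)[OF beta]] mconvD(2)[OF h(1)[OF beta]] h(2)[OF alpha] h(2)[OF beta]]
  \<comment> \<open>Integrability of the pair for fixed m is read off from \<open>sconv_Pair\<close>
    applied to constant sequences.\<close>
  have liP: "locally_integrable U (%x. (H m alpha x, H m beta x))" for m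
   by (rule sconv_Pair(2)[OF mconvD(1)[OF h(1)[OF alpha]] mconvD(1)[OF h(1)[OF alpha], of m] mconvD(1)[OF h(1)[OF beta]] mconvD(1)[OF h(1)[OF beta], of m], of "%_. m" "%_. m"])
    (simp_all add: sconv_def)
  note Q = sconv_Pair[OF mconvD(1,2)[OF cu] liP P(2) su P(1)]
  have mem: "AE x in lebesgue. x \<in> K --> (jacobian U (F m) x, H m alpha x, H m beta x) \<in> S" for m
  proof -
   have "AE x in lebesgue. x \<in> U --> H m alpha x \<in> normal_space U (F m) x & H m alpha x \<bullet> H m beta x = d"
    using frame_AE[OF U H[of m]] by eventually_elim (use alpha beta in \<open>auto simp: d_def\<close>)
   then show ?thesis
    by eventually_elim (use K(2) in \<open>auto simp: S_def normal_space_eq orthogonal_comp_differential\<close>)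
  qed
  have "AE x in lebesgue. x \<in> K --> (jacobian U f x, eta alpha x, eta beta x) \<in> S"
   by (rule sconv_mem_closed[OF Q(1) Q(2) U cl ne mem K])
  then show "AE x in lebesgue. x \<in> K --> (\<forall>i. jacobian U f x $ i \<bullet> eta alpha x = 0) & eta alpha x \<bullet> eta beta x = (if alpha = beta then 1 else 0)"
   by (simp add: S_def d_def)
 qed
 then have "AE x in lebesgue. \<forall>alpha beta. alpha < k --> beta < k --> x \<in> U -->
   (\<forall>i. jacobian U f x $ i \<bullet> eta alpha x = 0) & eta alpha x \<bullet> eta beta x = (if alpha = beta then 1 else 0)"
  unfolding AE_all_countable by (intro allI) (auto simp del: if_split)
 then have "AE x in lebesgue. x \<in> U --> (\<forall>alpha<k. eta alpha x \<in> normal_space U f x) \<and>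
   (\<forall>alpha<k. \<forall>beta<k. eta alpha x \<bullet> eta beta x = (if alpha = beta then 1 else 0))"
  unfolding normal_space_eq orthogonal_comp_differential by eventually_elim blast
 then show ?thesis unfolding orthonormal_normal_frame_def AE_lebesgue_on_open[OF U] .
qed

text \<open>The immersions do not determine the frames, so these converge only after passing to a
  further subsequence; the limit immersion stays the same.\<close>

lemma frame_subsequence:
 assumes H: "!!m. orthonormal_normal_frame k U (F m) (H m)"
  and b: "!!alpha. alpha < k ==> unif_bounded_loc p (real CARD('n) - p) 1 U UNIV (%m. H m alpha)"
 shows "\<exists>s eta. strict_mono s & orthonormal_normal_frame k U f eta \<and>
  (\<forall>alpha<k. weak_conv_loc p (real CARD('n) - p) 1 U (%m. H (s m) alpha) (eta alpha)) \<and>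
  extrinsic_conv_in_frames p (real CARD('n) - p) k U (%m. F (s m)) (%m. H (s m)) f eta"
proof -
 have wdH: "weakly_differentiable U (H m alpha)" if "alpha < k" for alpha m
 proof (rule weakly_differentiable_local[OF U])
  fix V assume "open_compactly_in V U"
  then have "weak_Morrey_Sobolev p (real CARD('n) - p) 1 V (H m alpha)" using b[OF that] unfolding unif_bounded_loc_def by blast
  then show "weakly_differentiable V (H m alpha)" by (simp add: One_nat_def del: One_nat_def[symmetric])
 qed
 have S: "Sobolev_bounded p (Suc 0) U (%m. H m alpha)" if "alpha < k" for alpha
  using b[OF that] unfolding unif_bounded_loc_def Sobolev_bounded_def One_nat_def by blast
 have p0: "p >= 0" using p by simp
 obtain s eta where s: "strict_mono (s :: nat => nat)"
  and eta: "!!alpha. alpha \<in> {..<k} ==> mconv p U (%m. H (s m) alpha) (eta alpha)"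
  "!!alpha i. alpha \<in> {..<k} ==> mconv p U (%m. weak_partial U i (H (s m) alpha)) (weak_partial U i (eta alpha))"
  "!!alpha. alpha \<in> {..<k} ==> weakly_differentiable U (eta alpha)" "!!alpha. alpha \<in> {..<k} ==> sconv U (%m. H (s m) alpha) (eta alpha)"
 proof (rule first_order_subsequence[OF U p, of "{..<k}" "%alpha m. H m alpha"])
  show "weakly_differentiable U (H m alpha)" if "alpha \<in> {..<k}" for alpha m using that by (intro wdH) simp
  show "Morrey_bounded p U (%m. H m alpha)" if "alpha \<in> {..<k}" for alpha using that by (intro Sobolev_bounded_Morrey[OF p0 S]) simp
  show "Morrey_bounded p U (%m. weak_partial U i (H m alpha))" if "alpha \<in> {..<k}" for alpha i
   using that by (intro Sobolev_bounded_Morrey[OF p0 Sobolev_bounded_partial[OF U p1(1) wdH S]]) simp_all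
 qed (simp, (rule that; assumption))
 note eta' = eta[unfolded lessThan_iff]
 interpret S: immersion_limit U p "%m. F (s m)" f by (rule subsequence[OF s])
 have on: "orthonormal_normal_frame k U f eta" by (rule S.frame_limit[OF H eta'(1,4)])
 have wc: "weak_conv_loc p (real CARD('n) - p) 1 U (%m. H (s m) alpha) (eta alpha)" if "alpha < k" for alpha
  unfolding One_nat_def
  by (rule mconv_weak_conv_loc_Suc[OF U p1(2) eta'(1)[OF that] has_weak_partial_weak_partial[OF wdH[OF that]]
    has_weak_partial_weak_partial[OF eta'(3)[OF that]] mconv_weak_conv_loc[OF U p1(2) eta'(2)[OF that]]])
 have "extrinsic_conv_in_frames p (real CARD('n) - p) k U (%m. F (s m)) (%m. H (s m)) f eta"
  by (rule S.frame_components[OF H on wdH eta'(1,2,4)])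
 then show ?thesis using s on wc by blast
qed

text \<open>\<open>weak_partial U\<close> and \<open>weak_partial W\<close> are different choices
  that agree almost everywhere on \<open>W\<close>. First derivatives are exchanged by
  \<open>mconv_cong\<close>; second ones also use that functions equal almost everywhere on
  \<open>W\<close> have the same \<open>weak_partial W\<close>.\<close>

lemma restrict:
 assumes W: "open W" "W \<subseteq> U"
 shows "immersion_limit W p F f"
proof -
 have wp: "has_weak_partial W i g (weak_partial U i g)" if "weakly_differentiable U g" for g :: "real^'n => real^'m" and i
  by (rule has_weak_partial_mono[OF W(2) has_weak_partial_weak_partial[OF that]])
 have ae: "AE x in lebesgue. x \<in> W --> weak_partial U i g x = weak_partial W i g x" if "weakly_differentiable U g" for g :: "real^'n => real^'m" and i
  by (rule AE_imp_sym[OF weak_partial_AE[OF W(1) wp[OF that]]])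
 have wdW: "weakly_differentiable W g" if "weakly_differentiable U g" for g :: "real^'n => real^'m"
  unfolding weakly_differentiable_def using wp[OF that] by blast
 have wp2: "weak_partial W j (weak_partial U i g) = weak_partial W j (weak_partial W i g)"
  "weakly_differentiable W (weak_partial U i g) = weakly_differentiable W (weak_partial W i g)"
  if "weakly_differentiable U g" for g :: "real^'n => real^'m" and i j
  by (rule weak_partial_cong[OF ae[OF that]])+
 show ?thesis
 proof
  show "open W" "p > 2" by fact+ (rule p)
  show "weakly_differentiable W (F m)" for m by (rule wdW[OF wd(1)])
  show "weakly_differentiable W (weak_partial W i (F m))" for m i using wdW[OF wd(2)] wp2(2)[OF wd(1)] by blast
  show "mconv p W F f" by (rule mconv_mono[OF W(2) c0])
  show "mconv p W (%m. weak_partial W i (F m)) (weak_partial W i f)" for i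
   by (rule mconv_cong[OF W(1) p1(1) ae[OF wd(1)] ae[OF wd_limit(1)] mconv_mono[OF W(2) c1]])
  have "mconv p W (%m. weak_partial W j (weak_partial U i (F m))) (weak_partial W j (weak_partial U i f))" for i j
   by (rule mconv_cong[OF W(1) p1(1) ae[OF wd(2)] ae[OF wd_limit(2)] mconv_mono[OF W(2) c2]])
  then show "mconv p W (%m. weak_partial W j (weak_partial W i (F m))) (weak_partial W j (weak_partial W i f))" for i j
   by (simp only: wp2(1)[OF wd(1)] wp2(1)[OF wd_limit(1)])
  fix K assume K: "compact K" "K \<subseteq> W"
  then have "compact K" "K \<subseteq> U" using W(2) by auto
  from nd[OF this] obtain c R where c: "0 < c" "(frames c R :: (real^'m^'n) set) ~= {}"
    "\<forall>m. AE x in lebesgue. x \<in> K --> jacobian U (F m) x \<in> frames c R"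
   by (elim exE conjE)
  have "AE x in lebesgue. x \<in> K --> jacobian W (F m) x \<in> frames c R" for m
  proof -
   have "AE x in lebesgue. \<forall>i. x \<in> W --> weak_partial U i (F m) x = weak_partial W i (F m) x"
    by (intro eventually_all_finite ae wd)
   then have "AE x in lebesgue. x \<in> W --> jacobian U (F m) x = jacobian W (F m) x"
    by eventually_elim (simp add: jacobian_def)
   then show ?thesis using c(3)[rule_format, of m] by eventually_elim (use K(2) in auto)
  qed
  then show "\<exists>c R. 0 < c & (frames c R :: (real^'m^'n) set) ~= {} \<and>
   (\<forall>m. AE x in lebesgue. x \<in> K --> jacobian W (F m) x \<in> frames c R)" using c(1,2) by blast
 qed
qed

end

section \<open>Extraction of the subsequence and conclusion\<close>

theorem theorem5p1:
  fixes M :: "(real^'n) set"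
    and \<iota> :: "real \<Rightarrow> real^'n \<Rightarrow> real^'m"
    and k :: nat
    and p :: real
  assumes codim: "CARD('m) = CARD('n) + k"
    and p: "2 < p" "p \<le> real CARD('n)"
    and domain: "open M" "connected M" "M \<noteq> {}"
    and immersion: "\<And>\<epsilon>. \<epsilon> > 0 \<Longrightarrow> ae_immersion M (\<iota> \<epsilon>)"
    and bounded: "unif_bounded_loc p (real CARD('n) - p) 2 M {0<..} \<iota>"
    and eigen: "\<And>K. compact K \<Longrightarrow> K \<subseteq> M \<Longrightarrow>
      \<exists>c C. 0 < c \<and> c \<le> C \<and>
        (\<forall>\<epsilon>>0. AE x in lebesgue_on K. \<forall>\<mu>\<in>eigenvalues (induced_metric M (\<iota> \<epsilon>) x). c \<le> \<mu> \<and> \<mu> \<le> C)"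
    and deriv: "\<And>j \<epsilon>. \<epsilon> > 0 \<Longrightarrow>
      weak_Morrey_Sobolev_loc p (real CARD('n) - p) 1 M (weak_partial M j (\<iota> \<epsilon>)) \<and>
      Linfty_loc M (weak_partial M j (\<iota> \<epsilon>))"
  shows "\<forall>e. (\<forall>m. e m > 0) \<and> e \<longlonglongrightarrow> 0 \<longrightarrow>
    (\<exists>r \<iota>'. strict_mono r \<and>
      weak_conv_loc p (real CARD('n) - p) 2 M (\<lambda>m. \<iota> (e (r m))) \<iota>' \<and>
      ae_immersion M \<iota>' \<and>
      weak_conv_loc p (real CARD('n) - p) 1 M
        (\<lambda>m. induced_metric M (\<iota> (e (r m)))) (induced_metric M \<iota>') \<and>
      extrinsic_conv p (real CARD('n) - p) M (\<lambda>m. \<iota> (e (r m))) \<iota>' \<and>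
      (\<forall>W H. open W \<and> W \<subseteq> M \<and>
          (\<forall>m. orthonormal_normal_frame k W (\<iota> (e (r m))) (H m)) \<and>
          (\<forall>\<alpha><k. unif_bounded_loc p (real CARD('n) - p) 1 W UNIV (\<lambda>m. H m \<alpha>)) \<longrightarrow>
        (\<exists>s \<eta>. strict_mono s \<and>
          orthonormal_normal_frame k W \<iota>' \<eta> \<and>
          (\<forall>\<alpha><k. weak_conv_loc p (real CARD('n) - p) 1 W (\<lambda>m. H (s m) \<alpha>) (\<eta> \<alpha>)) \<and>
          extrinsic_conv_in_frames p (real CARD('n) - p) k W
            (\<lambda>m. \<iota> (e (r (s m)))) (\<lambda>m. H (s m)) \<iota>' \<eta>)))"
proof (intro allI impI, elim conjE)
 fix e :: "nat => real" assume e: "\<forall>m. e m > 0" "e \<longlonglongrightarrow> 0"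
 define F where "F = (%m. \<iota> (e m))"
 have p1: "p >= 1" "p >= 0" using p by auto
 have wd: "weakly_differentiable M (F m)" for m
  using immersion[of "e m"] e(1) by (simp add: F_def ae_immersion_def)
 have wd2: "weakly_differentiable M (weak_partial M i (F m))" for m i
 proof (rule weakly_differentiable_local[OF domain(1)])
  fix V assume "open_compactly_in V M"
  then have "weak_Morrey_Sobolev p (real CARD('n) - p) 1 V (weak_partial M i (F m))"
   using deriv[of "e m" i] e(1) unfolding weak_Morrey_Sobolev_loc_def F_def by blast
  then show "weakly_differentiable V (weak_partial M i (F m))" by simp
 qed
 have S2: "Sobolev_bounded p (Suc (Suc 0)) M F"
  unfolding Sobolev_bounded_def
 proof (intro allI impI)
  fix V assume "open_compactly_in V M"
  then obtain C where "\<forall>eps\<in>{0<..}. weak_Morrey_Sobolev_norm p (real CARD('n) - p) 2 V (\<iota> eps) <= ennreal C"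
   using bounded unfolding unif_bounded_loc_def by blast
  then show "\<exists>C. \<forall>m. weak_Morrey_Sobolev_norm p (real CARD('n) - p) (Suc (Suc 0)) V (F m) <= ennreal C"
   using e(1) by (auto simp: F_def numeral_2_eq_2 simp del: weak_Morrey_Sobolev_norm.simps intro!: exI[of _ C])
 qed
 have S1: "Sobolev_bounded p (Suc 0) M (%m. weak_partial M i (F m))" for i
  by (rule Sobolev_bounded_partial[OF domain(1) p1(1) wd S2])
 have S0: "Sobolev_bounded p 0 M (%m. weak_partial M j (weak_partial M i (F m)))" for i j
  by (rule Sobolev_bounded_partial[OF domain(1) p1(1) wd2 S1])
 \<comment> \<open>With the immersions under \<open>None\<close> and their first derivatives under
   \<open>Some i\<close>, a first-order extraction for this family provides limits of all
   derivatives up to second order.\<close>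
 define G where "G = (%q m. case q of None => F m | Some i => weak_partial M i (F m))"
 have G: "G None = F" "G (Some i) = (%m. weak_partial M i (F m))" for i by (simp_all add: G_def)
 have G0: "weakly_differentiable M (G q m)" "Morrey_bounded p M (G q)" "Morrey_bounded p M (%m. weak_partial M j (G q m))" for q m j
 proof -
  show "weakly_differentiable M (G q m)" by (cases q) (simp_all add: G wd wd2)
  show "Morrey_bounded p M (G q)"
   by (cases q) (simp_all add: G Sobolev_bounded_Morrey[OF p1(2) S2] Sobolev_bounded_Morrey[OF p1(2) S1])
  show "Morrey_bounded p M (%m. weak_partial M j (G q m))"
   by (cases q) (simp_all add: G Sobolev_bounded_Morrey[OF p1(2) S1] Sobolev_bounded_Morrey[OF p1(2) S0])
 qed
 obtain r g where r: "strict_mono (r :: nat => nat)"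
  and g: "!!q. q \<in> UNIV ==> mconv p M (%m. G q (r m)) (g q)"
  "!!q i. q \<in> UNIV ==> mconv p M (%m. weak_partial M i (G q (r m))) (weak_partial M i (g q))"
  by (rule first_order_subsequence[where F = G and I = UNIV, OF domain(1) p(1) finite G0]) (rule that; assumption)
 note g = g[OF UNIV_I]
 define f where "f = g None"
 have c0: "mconv p M (%m. F (r m)) f" using g(1)[of None] by (simp add: G f_def)
 have c1: "mconv p M (%m. weak_partial M i (F (r m))) (weak_partial M i f)" for i using g(2)[of i None] by (simp add: G f_def)
 have c2': "mconv p M (%m. weak_partial M j (weak_partial M i (F (r m)))) (weak_partial M j (g (Some i)))" for i j
  using g(2)[of j "Some i"] by (simp add: G)
 \<comment> \<open>The limits in \<open>c2'\<close> are derivatives of \<open>g (Some i)\<close>.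
   Since \<open>c1\<close> identifies the limit of the first derivatives as
   \<open>weak_partial M i f\<close>, they can be rewritten as second derivatives of
   \<open>f\<close>.\<close>
 have c2: "mconv p M (%m. weak_partial M j (weak_partial M i (F (r m)))) (weak_partial M j (weak_partial M i f))" for i j
  by (rule mconv_weak_partial(2)[OF domain(1) p(1) wd2 c1 c2'])
 have nd: "\<exists>c R. 0 < c & (frames c R :: (real^'m^'n) set) ~= {} \<and>
   (\<forall>m. AE x in lebesgue. x \<in> K --> jacobian M (F (r m)) x \<in> frames c R)" if K: "compact K" "K \<subseteq> M" for K
 proof -
  \<comment> \<open>The added ball has positive measure, so the eigenvalue bounds hold at some point
    and the set of admissible matrices is nonempty, even if \<open>K\<close> is empty or a null
    set.\<close>
  obtain x0 d where d: "0 < d" "cball x0 d \<subseteq> M" using domain(1,3) open_contains_cball by blast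
  let ?K = "K \<union> cball x0 d"
  have K': "compact ?K" "?K \<subseteq> M" using K d(2) by auto
  obtain c C where c: "0 < c" "c <= C"
   and ev: "!!eps. eps > 0 ==> AE x in lebesgue_on ?K. \<forall>mu\<in>eigenvalues (induced_metric M (\<iota> eps) x). c <= mu & mu <= C"
   using eigen[OF K'] by blast
  let ?S = "frames (sqrt c) (real CARD('n) * sqrt C) :: (real^'m^'n) set"
  have ae: "AE x in lebesgue. x \<in> ?K --> jacobian M (F (r m)) x \<in> ?S" for m
  proof -
   have "AE x in lebesgue. x \<in> ?K --> (\<forall>mu\<in>eigenvalues (gram (jacobian M (F (r m)) x)). c <= mu & mu <= C)"
    using ev[of "e (r m)"] e(1) AE_restrict_space_iff[of ?K lebesgue] compact_lebesgue(1)[OF K'(1)]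
    by (simp add: F_def induced_metric_eq)
   then show ?thesis by eventually_elim (use eigenvalue_bounds[OF c] in blast)
  qed
  have "?S ~= {}"
  proof
   assume "?S = {}"
   then have no: "!!A. A \<notin> ?S" by blast
   have "AE x in lebesgue. x \<notin> ball x0 d"
    using ae[of 0]
   proof eventually_elim
    fix x assume x: "x \<in> ?K --> jacobian M (F (r 0)) x \<in> ?S"
    show "x \<notin> ball x0 d"
    proof
     assume "x \<in> ball x0 d"
     then have "x \<in> ?K" using ball_subset_cball by blast
     then show False using x no by (rule_tac notE[OF no]) (rule mp)
    qed
   qed
   then have "negligible (ball x0 d)" by (simp add: negligible_iff_null_sets AE_iff_null_sets)
   then show False using open_not_negligible[of "ball x0 d"] d(1) by simp
  qed
  moreover have "AE x in lebesgue. x \<in> K --> jacobian M (F (r m)) x \<in> ?S" for m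
   using ae[of m] by eventually_elim blast
  ultimately show ?thesis using c(1) real_sqrt_gt_zero by blast
 qed
 interpret L: immersion_limit M p "%m. F (r m)" f
  by (rule immersion_limit.intro[OF domain(1) p(1) wd wd2 c0 c1 c2 nd])
 show "\<exists>r \<iota>'. strict_mono r \<and>
   weak_conv_loc p (real CARD('n) - p) 2 M (%m. \<iota> (e (r m))) \<iota>' \<and>
   ae_immersion M \<iota>' \<and>
   weak_conv_loc p (real CARD('n) - p) 1 M
    (%m. induced_metric M (\<iota> (e (r m)))) (induced_metric M \<iota>') \<and>
   extrinsic_conv p (real CARD('n) - p) M (%m. \<iota> (e (r m))) \<iota>' \<and>
   (\<forall>W H. open W & W \<subseteq> M \<and>
     (\<forall>m. orthonormal_normal_frame k W (\<iota> (e (r m))) (H m)) \<and>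
     (\<forall>alpha<k. unif_bounded_loc p (real CARD('n) - p) 1 W UNIV (%m. H m alpha)) -->
    (\<exists>s eta. strict_mono s \<and>
     orthonormal_normal_frame k W \<iota>' eta \<and>
     (\<forall>alpha<k. weak_conv_loc p (real CARD('n) - p) 1 W (%m. H (s m) alpha) (eta alpha)) \<and>
     extrinsic_conv_in_frames p (real CARD('n) - p) k W
      (%m. \<iota> (e (r (s m)))) (%m. H (s m)) \<iota>' eta))"
 proof (rule exI[of _ r], rule exI[of _ f], intro conjI allI impI; (elim conjE)?)
  fix W H
  assume W: "open W" "W \<subseteq> M" and H: "\<forall>m. orthonormal_normal_frame k W (\<iota> (e (r m))) (H m)"
   "\<forall>alpha<k. unif_bounded_loc p (real CARD('n) - p) 1 W UNIV (%m. H m alpha)"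
  interpret W: immersion_limit W p "%m. F (r m)" f by (rule L.restrict[OF W])
  show "\<exists>s eta. strict_mono s & orthonormal_normal_frame k W f eta \<and>
    (\<forall>alpha<k. weak_conv_loc p (real CARD('n) - p) 1 W (%m. H (s m) alpha) (eta alpha)) \<and>
    extrinsic_conv_in_frames p (real CARD('n) - p) k W (%m. \<iota> (e (r (s m)))) (%m. H (s m)) f eta"
   using W.frame_subsequence[of k H] H by (simp only: F_def)
 qed (use r L.second_order L.immersion L.metric L.extrinsic in \<open>simp_all only: F_def\<close>)
qed

end
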